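(* Let $k$ be a field of characteristic $\neq 2$, let $\Gamma_k=\mathrm{Gal}(k_s/k)$, let $G$ be the Weyl group of type $\mathsf{E}_6$, and let $\varphi:\Gamma_k\to G$ be a continuous homomorphism. Let $q_{27,\varphi}$ be the twist by $\varphi$ of the $G$-quadratic form $q_{27}$, and let $q_{5,\varphi}$ be the rank $5$ quadratic form over $k$ characterized by $q_{7,\varphi}=\langle -2\rangle q_{5,\varphi}+\langle 1,-1\rangle$. Then $$q_{27,\varphi}=\lambda^2 q_{5,\varphi}+\langle 1,2\rangle q_{5,\varphi}+6+\langle 2\rangle .$$
   Context: Quadratic forms. Over a field $k$ of characteristic $\ne 2$ quadratic forms are identified with symmetric bilinear forms ($q(x)=q(x,x)$); "$=$" means isomorphism, "$+$" means orthogonal sum, juxtaposition means tensor product, $\langle a_1,\dots,a_n\rangle$ is the diagonal form $\sum a_iX_i^2$, an integer $n\ge 0$ denotes the form $\langle 1,\dots,1\rangle$ ($n$ times), and $\lambda^2q$ is the second exterior power of $q$, with $\lambda^2q(x\wedge y,x'\wedge y')=q(x,x')q(y,y')-q(x,y')q(y,x')$. Lattices. $R$ is a root system of type $\mathsf{E}_6$ with simple roots $\alpha_1,\dots,\alpha_6$ in Bourbaki's numbering (the Dynkin diagram is the chain $\alpha_1-\alpha_3-\alpha_4-\alpha_5-\alpha_6$ with $\alpha_2$ attached to $\alpha_4$), with scalar product normalized by $\alpha\cdot\alpha=2$ for every root $\alpha$. $Q$ is the root lattice, $P$ its dual (the weight lattice), with basis the fundamental weights $\omega_1,\dots,\omega_6$;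 $(P:Q)=3$, and $\mathrm{e}:P\to\mathbf{Z}/3\mathbf{Z}$ is the homomorphism with kernel $Q$ and $\mathrm{e}(\omega_1)=1$. $L$ is the lattice of pairs $(n,p)\in\mathbf{Z}\oplus P$ with $n\equiv \mathrm{e}(p)\pmod 3$, with the unimodular integral form $q_L(n,p;n',p')=nn'/3-p\cdot p'$ of signature $(1,6)$. Put $h=(3,0)\in L$. $G$ is the Weyl group of $R$, acting on $P$, $Q$, and on $L$ (trivially on the factor $\mathbf{Z}$), and preserving $q_L$. $Y$ is the set of $y\in L$ with $q_L(h,y)=1$ and $q_L(y,y)=-1$; it has 27 elements, namely the pairs $(1,\omega)$ with $\omega$ in the $G$-orbit of $\omega_1$. $G$-quadratic forms (quadratic forms with an action of $G$ preserving them). $q_7$ is the form $q_L$ on $L\otimes k$; $q_{27}$ is the form on $k^Y$ for which the natural basis $(e_y)_{y\in Y}$ is orthonormal. Twists. If $q$ is a $G$-quadratic form on a $k$-vector space $V$ and $\varphi:\Gamma_k\to G$ is a continuous homomorphism, let $V_\varphi$ be the set of $x\in k_s\otimes_k V$ such that $\gamma(\varphi(\gamma)x)=x$ for all $\gamma\in\Gamma_k$ (where $G$ acts $k_s$-linearly through $V$, and $\Gamma_k$ acts semilinearly through $k_s$). It is a $k$-form of $V$, and the restriction to $V_\varphi$ of the $k_s$-extension of $q$ is a $k$-valued quadratic form, denoted $q_\varphi$. Thus $q_{7,\varphi}$ and $q_{27,\varphi}$ are defined. The form $q_{7,\varphi}$ is non-degenerate and isotropic, so there is, up to isomorphism, a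 unique rank $5$ quadratic form $q_{5,\varphi}$ over $k$ with $q_{7,\varphi}=\langle -2\rangle q_{5,\varphi}+\langle 1,-1\rangle$. Equivalently to the twist description, $q_{27,\varphi}$ is the trace form of the étale $k$-algebra of rank 27 associated with the $\Gamma_k$-set $Y$. *)

theory Defs
  imports
    "HOL-Analysis.Analysis"
    "HOL-Computational_Algebra.Computational_Algebra"
    "HOL-Library.Function_Algebras"
    "HOL-Library.Numeral_Type"
begin

section \<open>Modules with a bilinear form\<close>

text \<open>
  A module over a commutative ring \<open>'r\<close>, sitting as a submodule \<open>carr\<close> inside a type, together
  with a bilinear form. Over a field of characteristic different from 2, a quadratic form is
  identified with its symmetric bilinear form, \<open>q(x) = form x x\<close>.
\<close>

record ('r, 'm) form_module =
  carr :: "'m set"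
  scal :: "'r \<Rightarrow> 'm \<Rightarrow> 'm"
  form :: "'m \<Rightarrow> 'm \<Rightarrow> 'r"

definition quadratic_space :: "('k::field, 'm::ab_group_add) form_module \<Rightarrow> bool" where
  "quadratic_space q \<longleftrightarrow>
     vector_space (scal q) \<and> module.subspace (scal q) (carr q) \<and>
     (\<forall>x\<in>carr q. \<forall>y\<in>carr q. form q x y = form q y x) \<and>
     (\<forall>x\<in>carr q. \<forall>y\<in>carr q. \<forall>z\<in>carr q. form q (x + y) z = form q x z + form q y z) \<and>
     (\<forall>c. \<forall>x\<in>carr q. \<forall>z\<in>carr q. form q (scal q c x) z = c * form q x z)"

definition form_rank :: "('k::field, 'm::ab_group_add) form_module \<Rightarrow> nat" where
  "form_rank q = vector_space.dim (scal q) (carr q)"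

definition isometric ::
    "('k::field, 'a::ab_group_add) form_module \<Rightarrow> ('k, 'b::ab_group_add) form_module \<Rightarrow> bool"
    (infix "\<simeq>" 50) where
  "q \<simeq> r \<longleftrightarrow> (\<exists>f. bij_betw f (carr q) (carr r) \<and>
     (\<forall>x\<in>carr q. \<forall>y\<in>carr q. f (x + y) = f x + f y) \<and>
     (\<forall>c. \<forall>x\<in>carr q. f (scal q c x) = scal r c (f x)) \<and>
     (\<forall>x\<in>carr q. \<forall>y\<in>carr q. form r (f x) (f y) = form q x y))"

definition diag :: "'k::field list \<Rightarrow> ('k, nat \<Rightarrow> 'k) form_module" where
  "diag as = \<lparr>carr = {x. \<forall>i\<ge>length as. x i = 0},
              scal = (\<lambda>c x i. c * x i),
              form = (\<lambda>x y. \<Sum>i<length as. as ! i * x i * y i)\<rparr>"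

definition osum ::
    "('k::field, 'a::ab_group_add) form_module \<Rightarrow> ('k, 'b::ab_group_add) form_module
      \<Rightarrow> ('k, 'a \<times> 'b) form_module" (infixl "\<oplus>\<^sub>q" 65) where
  "q \<oplus>\<^sub>q r = \<lparr>carr = carr q \<times> carr r,
               scal = (\<lambda>c (x, y). (scal q c x, scal r c y)),
               form = (\<lambda>(x, y) (x', y'). form q x x' + form r y y')\<rparr>"

text \<open>Maps from the carrier of \<open>M\<close> that are linear along the ring homomorphism \<open>\<iota>\<close>; values outside
  the carrier are irrelevant.\<close>

definition linear_along ::
    "('r::comm_ring_1 \<Rightarrow> 's::comm_ring_1) \<Rightarrow> ('r, 'm::ab_group_add) form_module \<Rightarrow> ('m \<Rightarrow> 's) \<Rightarrow> bool"
  where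
  "linear_along \<iota> M f \<longleftrightarrow>
     (\<forall>x\<in>carr M. \<forall>y\<in>carr M. f (x + y) = f x + f y) \<and>
     (\<forall>c. \<forall>x\<in>carr M. f (scal M c x) = \<iota> c * f x)"

definition fscale :: "'s::comm_ring_1 \<Rightarrow> ('t \<Rightarrow> 's) \<Rightarrow> ('t \<Rightarrow> 's)" where
  "fscale c u = (\<lambda>f. c * u f)"

text \<open>
  Tensor products are realised inside duals. For free \<open>M\<close> the canonical map from \<open>S \<otimes>\<^sub>R M\<close> to the
  functions on the set of \<open>\<iota>\<close>-linear maps \<open>f : M \<rightarrow> S\<close>, sending \<open>c \<otimes> x\<close> to \<open>f \<mapsto> c f(x)\<close>, is
  injective, so \<open>S \<otimes>\<^sub>R M\<close> is the \<open>S\<close>-span of the evaluations \<open>1 \<otimes> x\<close>. Likewise \<open>V \<otimes> W\<close> (resp. the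
  exterior square of \<open>V\<close>) over a field is the span of the evaluations of bilinear forms on
  \<open>V \<times> W\<close> (resp. of alternating bilinear forms on \<open>V \<times> V\<close>) at pairs of vectors. Evaluations are set
  to 0 at functions that are not (bi)linear. In each case \<open>form\<close> is the bilinear form with the
  prescribed values on the generators, obtained by applying both elements to those values.
\<close>

definition unit_tensor ::
    "('r::comm_ring_1 \<Rightarrow> 's::comm_ring_1) \<Rightarrow> ('r, 'm::ab_group_add) form_module \<Rightarrow> 'm \<Rightarrow> ('m \<Rightarrow> 's) \<Rightarrow> 's"
  where
  "unit_tensor \<iota> M x = (\<lambda>f. if linear_along \<iota> M f then f x else 0)"

definition base_change ::
    "('r::comm_ring_1 \<Rightarrow> 's::comm_ring_1) \<Rightarrow> ('r, 'm::ab_group_add) form_module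
      \<Rightarrow> ('s, ('m \<Rightarrow> 's) \<Rightarrow> 's) form_module" where
  "base_change \<iota> M = \<lparr>carr = module.span fscale (unit_tensor \<iota> M ` carr M),
                     scal = fscale,
                     form = (\<lambda>u v. u (\<lambda>x. v (\<lambda>y. \<iota> (form M x y))))\<rparr>"

text \<open>The \<open>S\<close>-linear extension of \<open>g : M \<rightarrow> M\<close> sends \<open>c \<otimes> x\<close> to \<open>c \<otimes> g x\<close>.\<close>

definition base_change_map :: "('m \<Rightarrow> 'm) \<Rightarrow> (('m \<Rightarrow> 's) \<Rightarrow> 's) \<Rightarrow> (('m \<Rightarrow> 's) \<Rightarrow> 's)" where
  "base_change_map g u = (\<lambda>f. u (f \<circ> g))"

definition bilinear_map ::
    "('k::field, 'a::ab_group_add) form_module \<Rightarrow> ('k, 'b::ab_group_add) form_module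
      \<Rightarrow> ('a \<Rightarrow> 'b \<Rightarrow> 'k) \<Rightarrow> bool" where
  "bilinear_map q r \<beta> \<longleftrightarrow>
     (\<forall>x\<in>carr q. linear_along id r (\<beta> x)) \<and> (\<forall>y\<in>carr r. linear_along id q (\<lambda>x. \<beta> x y))"

definition pure_tensor ::
    "('k::field, 'a::ab_group_add) form_module \<Rightarrow> ('k, 'b::ab_group_add) form_module
      \<Rightarrow> 'a \<Rightarrow> 'b \<Rightarrow> ('a \<Rightarrow> 'b \<Rightarrow> 'k) \<Rightarrow> 'k" where
  "pure_tensor q r x y = (\<lambda>\<beta>. if bilinear_map q r \<beta> then \<beta> x y else 0)"

definition tensor ::
    "('k::field, 'a::ab_group_add) form_module \<Rightarrow> ('k, 'b::ab_group_add) form_module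
      \<Rightarrow> ('k, ('a \<Rightarrow> 'b \<Rightarrow> 'k) \<Rightarrow> 'k) form_module" (infixl "\<otimes>\<^sub>q" 70) where
  "q \<otimes>\<^sub>q r =
     \<lparr>carr = module.span fscale {pure_tensor q r x y | x y. x \<in> carr q \<and> y \<in> carr r},
      scal = fscale,
      form = (\<lambda>u v. u (\<lambda>x y. v (\<lambda>x' y'. form q x x' * form r y y')))\<rparr>"

definition wedge ::
    "('k::field, 'a::ab_group_add) form_module \<Rightarrow> 'a \<Rightarrow> 'a \<Rightarrow> ('a \<Rightarrow> 'a \<Rightarrow> 'k) \<Rightarrow> 'k" where
  "wedge q x y = (\<lambda>\<beta>. if bilinear_map q q \<beta> \<and> (\<forall>z\<in>carr q. \<beta> z z = 0) then \<beta> x y else 0)"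

definition ext_square ::
    "('k::field, 'a::ab_group_add) form_module \<Rightarrow> ('k, ('a \<Rightarrow> 'a \<Rightarrow> 'k) \<Rightarrow> 'k) form_module" where
  "ext_square q =
     \<lparr>carr = module.span fscale {wedge q x y | x y. x \<in> carr q \<and> y \<in> carr q},
      scal = fscale,
      form = (\<lambda>u v. u (\<lambda>x y. v (\<lambda>x' y'. form q x x' * form q y y' - form q x y' * form q y x')))\<rparr>"


text \<open>The values on generators that characterise these constructions.\<close>

lemma qs_closed:
  assumes "quadratic_space q" "x \<in> carr q" "y \<in> carr q"
  shows "x + y \<in> carr q" "scal q c x \<in> carr q"
proof -
  have m: "module (scal q)" using assms(1)
    by (simp add: quadratic_space_def vector_space_def module_def)
  show "x + y \<in> carr q" "scal q c x \<in> carr q"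
    using assms module.subspace_def[OF m] by (auto simp: quadratic_space_def)
qed

lemma qs_right:
  assumes "quadratic_space q" "x \<in> carr q" "y \<in> carr q" "z \<in> carr q"
  shows "form q z (x + y) = form q z x + form q z y" "form q z (scal q c x) = c * form q z x"
   "form q (x + y) z = form q x z + form q y z" "form q (scal q c x) z = c * form q x z"
    using assms qs_closed[OF assms(1-3)] by (auto simp: quadratic_space_def)

lemma form_pure_tensor:
  assumes q: "quadratic_space q" and r: "quadratic_space r"
    and xy: "x \<in> carr q" "x' \<in> carr q" "y \<in> carr r" "y' \<in> carr r"
  shows "form (q \<otimes>\<^sub>q r) (pure_tensor q r x y) (pure_tensor q r x' y') = form q x x' * form r y y'"
proof -
  have 1: "bilinear_map q r (\<lambda>x' y'. form q x x' * form r y y')" if "x \<in> carr q" "y \<in> carr r" for x y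
    using that by (auto simp: bilinear_map_def linear_along_def qs_right[OF q] qs_right[OF r] algebra_simps)
  have v: "pure_tensor q r x' y' (\<lambda>x' y'. form q x x' * form r y y') = form q x x' * form r y y'"
    if "x \<in> carr q" "y \<in> carr r" for x y
    using 1[OF that] by (simp add: pure_tensor_def)
  have 2: "bilinear_map q r (\<lambda>x y. pure_tensor q r x' y' (\<lambda>x' y'. form q x x' * form r y y'))"
    using xy unfolding bilinear_map_def linear_along_def
    by (simp add: v qs_closed[OF q] qs_closed[OF r]) (simp add: qs_right[OF q] qs_right[OF r] algebra_simps)
  show ?thesis unfolding tensor_def using 2 v xy by (simp add: pure_tensor_def[of q r x y])
qed

lemma form_wedge:
  assumes q: "quadratic_space q" 
    and xy: "x \<in> carr q" "x' \<in> carr q" "y \<in> carr q" "y' \<in> carr q"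
  shows "form (ext_square q) (wedge q x y) (wedge q x' y') = form q x x' * form q y y' - form q x y' * form q y x'"
proof -
  let ?F = "\<lambda>x y x' y'. form q x x' * form q y y' - form q x y' * form q y x'"
  have 1: "bilinear_map q q (?F x y)" if "x \<in> carr q" "y \<in> carr q" for x y
    using that by (auto simp: bilinear_map_def linear_along_def qs_right[OF q] algebra_simps)
  have v: "wedge q x' y' (?F x y) = ?F x y x' y'"
    if "x \<in> carr q" "y \<in> carr q" for x y
    using 1[OF that] by (simp add: wedge_def)
  have 2: "bilinear_map q q (\<lambda>x y. wedge q x' y' (?F x y))"
    using xy unfolding bilinear_map_def linear_along_def
    by (simp add: v qs_closed[OF q]) (simp add: qs_right[OF q] algebra_simps)
  show ?thesis unfolding ext_square_def using 2 v xy
    by (simp add: wedge_def[of q x y]) (simp add: wedge_def)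
qed

lemma form_base_change:
  assumes add: "\<And>x y. x \<in> carr M \<Longrightarrow> y \<in> carr M \<Longrightarrow> x + y \<in> carr M"
    and scal: "\<And>c x. x \<in> carr M \<Longrightarrow> scal M c x \<in> carr M"
    and l: "\<And>y. y \<in> carr M \<Longrightarrow> linear_along \<iota> M (\<lambda>x. \<iota> (form M x y))"
    and r: "\<And>x. x \<in> carr M \<Longrightarrow> linear_along \<iota> M (\<lambda>y. \<iota> (form M x y))"
    and xy: "x \<in> carr M" "y \<in> carr M"
  shows "form (base_change \<iota> M) (unit_tensor \<iota> M x) (unit_tensor \<iota> M y) = \<iota> (form M x y)"
proof -
  have v: "unit_tensor \<iota> M y (\<lambda>y. \<iota> (form M x y)) = \<iota> (form M x y)" if "x \<in> carr M" for x
    using r[OF that] by (simp add: unit_tensor_def)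
  have "linear_along \<iota> M (\<lambda>x. unit_tensor \<iota> M y (\<lambda>y. \<iota> (form M x y)))"
    using l[OF xy(2)] unfolding linear_along_def by (simp add: v add scal)
  then show ?thesis
    unfolding base_change_def using v xy by (simp add: unit_tensor_def[of \<iota> M x])
qed

lemma base_change_map_unit_tensor:
  assumes "\<And>f. linear_along \<iota> M (f \<circ> g) \<longleftrightarrow> linear_along \<iota> M f"
  shows "base_change_map g (fscale c (unit_tensor \<iota> M x)) = fscale c (unit_tensor \<iota> M (g x))"
  using assms by (auto simp: base_change_map_def fscale_def unit_tensor_def)


section \<open>Absolute Galois group and twists\<close>

definition separable_poly :: "'k::field poly \<Rightarrow> bool" where
  "separable_poly p \<longleftrightarrow> coprime p (pderiv p)"

text \<open>\<open>\<iota>\<close> embeds \<open>k\<close> into a separable closure of \<open>k\<close>: \<open>'s\<close> is separable algebraic over \<open>\<iota>(k)\<close> and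
  separably closed. The zero polynomial is not separable in the sense above.\<close>

definition separable_closure :: "('k::field \<Rightarrow> 's::field) \<Rightarrow> bool" where
  "separable_closure \<iota> \<longleftrightarrow>
     (\<forall>x y. \<iota> (x + y) = \<iota> x + \<iota> y) \<and> (\<forall>x y. \<iota> (x * y) = \<iota> x * \<iota> y) \<and> \<iota> 1 = 1 \<and>
     (\<forall>x. \<exists>p. separable_poly p \<and> poly (map_poly \<iota> p) x = 0) \<and>
     (\<forall>p::'s poly. degree p > 0 \<and> separable_poly p \<longrightarrow> (\<exists>x. poly p x = 0))"

definition galois_group :: "('k::field \<Rightarrow> 's::field) \<Rightarrow> ('s \<Rightarrow> 's) set" where
  "galois_group \<iota> = {\<sigma>. bij \<sigma> \<and> (\<forall>x y. \<sigma> (x + y) = \<sigma> x + \<sigma> y) \<and> (\<forall>x y. \<sigma> (x * y) = \<sigma> x * \<sigma> y) \<and>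
                        (\<forall>a. \<sigma> (\<iota> a) = \<iota> a)}"

text \<open>The Krull topology is the topology of pointwise convergence with \<open>k\<^sub>s\<close> discrete: a neighbourhood
  basis of \<open>\<sigma>\<close> is given by the automorphisms agreeing with \<open>\<sigma>\<close> on a finite set \<open>S\<close>, equivalently
  on the finite extension \<open>k(S)\<close>.\<close>

definition krull_topology :: "('k::field \<Rightarrow> 's::field) \<Rightarrow> ('s \<Rightarrow> 's) topology" where
  "krull_topology \<iota> =
     subtopology (product_topology (\<lambda>_. discrete_topology UNIV) UNIV) (galois_group \<iota>)"

definition continuous_hom :: "('k::field \<Rightarrow> 's::field) \<Rightarrow> ('v \<Rightarrow> 'v) set \<Rightarrow> (('s \<Rightarrow> 's) \<Rightarrow> 'v \<Rightarrow> 'v) \<Rightarrow> bool"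
  where
  "continuous_hom \<iota> G \<phi> \<longleftrightarrow>
     continuous_map (krull_topology \<iota>) (discrete_topology G) \<phi> \<and>
     (\<forall>\<sigma>\<in>galois_group \<iota>. \<forall>\<tau>\<in>galois_group \<iota>. \<phi> (\<sigma> \<circ> \<tau>) = \<phi> \<sigma> \<circ> \<phi> \<tau>)"

text \<open>The semilinear action on \<open>k\<^sub>s \<otimes> V\<close>: \<open>c \<otimes> x\<close> is sent to \<open>\<gamma>(c) \<otimes> x\<close>.\<close>

definition galois_act :: "('s \<Rightarrow> 's) \<Rightarrow> (('m \<Rightarrow> 's) \<Rightarrow> 's) \<Rightarrow> (('m \<Rightarrow> 's) \<Rightarrow> 's)" where
  "galois_act \<gamma> u = (\<lambda>f. \<gamma> (u (inv \<gamma> \<circ> f)))"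

lemma galois_act_unit_tensor:
  assumes "\<gamma> \<in> galois_group \<iota>"
  shows "galois_act \<gamma> (fscale c (unit_tensor \<iota> M x)) = fscale (\<gamma> c) (unit_tensor \<iota> M x)"
proof -
  have g: "bij \<gamma>" "\<And>x y. \<gamma> (x + y) = \<gamma> x + \<gamma> y" "\<And>x y. \<gamma> (x * y) = \<gamma> x * \<gamma> y" "\<And>a. \<gamma> (\<iota> a) = \<iota> a"
    using assms by (auto simp: galois_group_def)
  have gi: "\<gamma> (inv \<gamma> x) = x" "inv \<gamma> (\<gamma> x) = x" for x
    using g(1) by (simp_all add: bij_is_surj surj_f_inv_f bij_is_inj)
  have z: "\<gamma> 0 = 0" using g(2)[of 0 0] by (metis add_0 add_cancel_right_right)
  have "linear_along \<iota> M (inv \<gamma> \<circ> f) \<longleftrightarrow> linear_along \<iota> M f" for f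
    unfolding linear_along_def o_def by (metis g(2-4) gi)
  then show ?thesis
    by (auto simp: galois_act_def fscale_def unit_tensor_def g gi z)
qed

text \<open>\<open>\<rho>\<close> is the action of \<open>G\<close> on the form \<open>q\<close>. On the twist the extended form takes values in
  \<open>\<iota>(k)\<close>, whence the use of \<open>inv \<iota>\<close>.\<close>

definition twist ::
    "('k::field \<Rightarrow> 's::field) \<Rightarrow> (('s \<Rightarrow> 's) \<Rightarrow> 'g) \<Rightarrow> ('g \<Rightarrow> 'm \<Rightarrow> 'm)
      \<Rightarrow> ('k, 'm::ab_group_add) form_module \<Rightarrow> ('k, ('m \<Rightarrow> 's) \<Rightarrow> 's) form_module" where
  "twist \<iota> \<phi> \<rho> q =
     \<lparr>carr = {u \<in> carr (base_change \<iota> q).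
               \<forall>\<gamma>\<in>galois_group \<iota>. galois_act \<gamma> (base_change_map (\<rho> (\<phi> \<gamma>)) u) = u},
      scal = (\<lambda>c. fscale (\<iota> c)),
      form = (\<lambda>u v. inv \<iota> (form (base_change \<iota> q) u v))\<rparr>"


section \<open>The root system and its lattices\<close>

definition root_reflection :: "'v::euclidean_space \<Rightarrow> 'v \<Rightarrow> 'v" where
  "root_reflection \<beta> x = x - (2 * (x \<bullet> \<beta>) / (\<beta> \<bullet> \<beta>)) *\<^sub>R \<beta>"

definition root_system :: "'v::euclidean_space set \<Rightarrow> bool" where
  "root_system R \<longleftrightarrow> finite R \<and> 0 \<notin> R \<and> span R = UNIV \<and>
     (\<forall>\<beta>\<in>R. root_reflection \<beta> ` R = R) \<and>
     (\<forall>\<alpha>\<in>R. \<forall>\<beta>\<in>R. 2 * (\<alpha> \<bullet> \<beta>) / (\<beta> \<bullet> \<beta>) \<in> \<int>) \<and>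
     (\<forall>\<beta>\<in>R. \<forall>c. c *\<^sub>R \<beta> \<in> R \<longrightarrow> c = 1 \<or> c = -1)"

definition simple_roots :: "'v::euclidean_space set \<Rightarrow> nat \<Rightarrow> (nat \<Rightarrow> 'v) \<Rightarrow> bool" where
  "simple_roots R n \<alpha> \<longleftrightarrow>
     inj_on \<alpha> {1..n} \<and> independent (\<alpha> ` {1..n}) \<and> \<alpha> ` {1..n} \<subseteq> R \<and>
     (\<forall>\<beta>\<in>R. \<exists>c::nat \<Rightarrow> nat. \<beta> = (\<Sum>i=1..n. of_nat (c i) *\<^sub>R \<alpha> i) \<or>
                              \<beta> = - (\<Sum>i=1..n. of_nat (c i) *\<^sub>R \<alpha> i))"

text \<open>Bourbaki's numbering of the Dynkin diagram.\<close>

definition E6_edges :: "nat set set" where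
  "E6_edges = {{1,3}, {3,4}, {4,5}, {5,6}, {2,4}}"

definition E6_root_system :: "'v::euclidean_space set \<Rightarrow> (nat \<Rightarrow> 'v) \<Rightarrow> bool" where
  "E6_root_system R \<alpha> \<longleftrightarrow> root_system R \<and> simple_roots R 6 \<alpha> \<and> (\<forall>\<beta>\<in>R. \<beta> \<bullet> \<beta> = 2) \<and>
     (\<forall>i\<in>{1..6}. \<forall>j\<in>{1..6}. i \<noteq> j \<longrightarrow> \<alpha> i \<bullet> \<alpha> j = (if {i, j} \<in> E6_edges then -1 else 0))"

text \<open>Reflections are involutions, so products of reflections form a group.\<close>

inductive_set weyl_group :: "'v::euclidean_space set \<Rightarrow> ('v \<Rightarrow> 'v) set" for R where
  one: "id \<in> weyl_group R"
| refl: "\<beta> \<in> R \<Longrightarrow> w \<in> weyl_group R \<Longrightarrow> root_reflection \<beta> \<circ> w \<in> weyl_group R"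

definition root_lattice :: "'v::euclidean_space set \<Rightarrow> 'v set" where
  "root_lattice R = module.span (\<lambda>m::int. (*\<^sub>R) (of_int m)) R"

definition weight_lattice :: "'v::euclidean_space set \<Rightarrow> 'v set" where
  "weight_lattice R = {p. \<forall>x\<in>root_lattice R. p \<bullet> x \<in> \<int>}"

definition fund_weight :: "(nat \<Rightarrow> 'v::euclidean_space) \<Rightarrow> nat \<Rightarrow> 'v" where
  "fund_weight \<alpha> i = (THE w. \<forall>j\<in>{1..6}. w \<bullet> \<alpha> j = (if i = j then 1 else 0))"

text \<open>The type \<open>3\<close> is \<open>\<int>/3\<int>\<close>.\<close>

definition weight_class :: "'v::euclidean_space set \<Rightarrow> (nat \<Rightarrow> 'v) \<Rightarrow> ('v \<Rightarrow> 3) \<Rightarrow> bool" where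
  "weight_class R \<alpha> e \<longleftrightarrow>
     (\<forall>x\<in>weight_lattice R. \<forall>y\<in>weight_lattice R. e (x + y) = e x + e y) \<and>
     {x \<in> weight_lattice R. e x = 0} = root_lattice R \<and>
     e (fund_weight \<alpha> 1) = 1"

text \<open>The form \<open>nn'/3 - p \<cdot> p'\<close> takes integral values on the lattice, where taking the floor is
  merely the conversion from real to int.\<close>

definition lattice_L :: "'v::euclidean_space set \<Rightarrow> ('v \<Rightarrow> 3) \<Rightarrow> (int, int \<times> 'v) form_module" where
  "lattice_L R e =
     \<lparr>carr = {(n, p). p \<in> weight_lattice R \<and> of_int n = e p},
      scal = (\<lambda>m (n, p). (m * n, of_int m *\<^sub>R p)),
      form = (\<lambda>(n, p) (n', p'). \<lfloor>of_int (n * n') / 3 - p \<bullet> p'\<rfloor>)\<rparr>"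

definition lattice_act :: "('v \<Rightarrow> 'v) \<Rightarrow> int \<times> 'v \<Rightarrow> int \<times> 'v" where
  "lattice_act g = (\<lambda>(n, p). (n, g p))"

definition set_Y :: "'v::euclidean_space set \<Rightarrow> ('v \<Rightarrow> 3) \<Rightarrow> (int \<times> 'v) set" where
  "set_Y R e = {y \<in> carr (lattice_L R e).
                  form (lattice_L R e) (3, 0) y = 1 \<and> form (lattice_L R e) y y = -1}"


section \<open>The forms of rank 7 and 27\<close>

definition q7 :: "'v::euclidean_space set \<Rightarrow> ('v \<Rightarrow> 3)
    \<Rightarrow> ('k::field, (int \<times> 'v \<Rightarrow> 'k) \<Rightarrow> 'k) form_module" where
  "q7 R e = base_change of_int (lattice_L R e)"

definition q27 :: "'v::euclidean_space set \<Rightarrow> ('v \<Rightarrow> 3)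
    \<Rightarrow> ('k::field, int \<times> 'v \<Rightarrow> 'k) form_module" where
  "q27 R e = \<lparr>carr = {x. \<forall>y. y \<notin> set_Y R e \<longrightarrow> x y = 0},
              scal = fscale,
              form = (\<lambda>x x'. \<Sum>y\<in>set_Y R e. x y * x' y)\<rparr>"

text \<open>The permutation action \<open>e\<^sub>y \<mapsto> e\<^sub>g\<^sub>y\<close>.\<close>

definition perm_act :: "('v \<Rightarrow> 'v) \<Rightarrow> (int \<times> 'v \<Rightarrow> 'k) \<Rightarrow> (int \<times> 'v \<Rightarrow> 'k)" where
  "perm_act g x = (\<lambda>y. x (lattice_act (inv g) y))"

definition q7_twist ::
    "('k::field \<Rightarrow> 's::field) \<Rightarrow> 'v::euclidean_space set \<Rightarrow> ('v \<Rightarrow> 3) \<Rightarrow> (('s \<Rightarrow> 's) \<Rightarrow> 'v \<Rightarrow> 'v)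
      \<Rightarrow> ('k, (((int \<times> 'v \<Rightarrow> 'k) \<Rightarrow> 'k) \<Rightarrow> 's) \<Rightarrow> 's) form_module" where
  "q7_twist \<iota> R e \<phi> = twist \<iota> \<phi> (\<lambda>g. base_change_map (lattice_act g)) (q7 R e)"

definition q27_twist ::
    "('k::field \<Rightarrow> 's::field) \<Rightarrow> 'v::euclidean_space set \<Rightarrow> ('v \<Rightarrow> 3) \<Rightarrow> (('s \<Rightarrow> 's) \<Rightarrow> 'v \<Rightarrow> 'v)
      \<Rightarrow> ('k, ((int \<times> 'v \<Rightarrow> 'k) \<Rightarrow> 's) \<Rightarrow> 's) form_module" where
  "q27_twist \<iota> R e \<phi> = twist \<iota> \<phi> perm_act (q27 R e)"

end

theory Submission
  imports Defs "HOL-Library.Multiset"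
begin

text \<open>
  The weight lattice picture is that of a cubic surface: \<open>L\<close> is its Picard lattice and \<open>Y\<close> the set of its
  27 lines. By Springer's theorem on odd degree extensions (in the form that Witt chain equivalence of
  diagonal forms descends along an orbit of odd length) one may replace \<open>\<Gamma>\<close> by the stabiliser of a line, of one of the
  five conic pairs meeting it, and of one of the three partitions of the other four pairs into blocks of two. Then the 27 lines split as
  \<open>1 + 10 + 16\<close>, the forms on the 10 and the 16 are computed with the five vectors \<open>u\<^sub>i\<close> and their
  pairwise products, the form on the \<open>u\<^sub>i\<close> is \<open>q\<^sub>5\<close> up to scaling, and the remaining identity concerns only
  forms permuted by a 2-group, where it is checked by hand. Additivity of the form on the given twist
  shows that the fixed field of \<open>\<Gamma>\<close> is \<open>\<iota>(k)\<close>.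
\<close>

section \<open>Diagonal quadratic forms over a subfield\<close>

text \<open>All fields that occur are fixed fields of groups of automorphisms of one separable
  closure. They are therefore subsets of a single type, diagonal forms over them are multisets of
  its elements, and passing to a stabiliser only enlarges the fixed field: no extension field is
  ever constructed. The three descents work because 27, 5 and 3 are odd, so that some orbit is odd.
  What is left is a group of signed permutations of the \<open>u i\<close> whose action on the
  indices lies in a dihedral group of order 8. Functions on the lines are polynomials of degree at
  most two in the products \<open>B x (u i)\<close>: squares and linear ones on the ten lines (5 +
  5), and 1, linear ones and products of two on the sixteen (1 + 5 + 10). Comparison with the other
  side leaves <2> m + p = w + 4 + <2>, with m the permutation form of the five indices, p the form
  on pairs with the product of the two signs, and w the exterior square. The obstacle is that p and
  w differ by the orientation sign of a pair. That sign is removed by a rotation on the two blocks,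
  and on the four pairs between the blocks by a similarity whose factor is the discriminant of the
  block swap.\<close>

locale subfld =
 fixes K :: "'f::field set"
 assumes zero [simp]: "0 \<in> K" and one [simp]: "1 \<in> K"
 and add [simp]: "a \<in> K ==> b \<in> K ==> a + b \<in> K"
 and neg [simp]: "a \<in> K ==> - a \<in> K"
 and mult [simp]: "a \<in> K ==> b \<in> K ==> a * b \<in> K"
 and inv [simp]: "a \<in> K ==> inverse a \<in> K"
 and two: "(2::'f) ~= 0"
begin

lemma diff [simp]: "a \<in> K ==> b \<in> K ==> a - b \<in> K"
 using add[of a "- b"] by simp

lemma divide [simp]: "a \<in> K ==> b \<in> K ==> a / b \<in> K"
 by (simp add: field_class.field_divide_inverse)

lemma power [simp]: "a \<in> K ==> a ^ n \<in> K"
 by (induction n) auto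

lemma of_nat [simp]: "of_nat n \<in> K"
 by (induction n) auto

lemma numeral [simp]: "numeral n \<in> K"
 using of_nat[of "numeral n"] by simp

lemma of_int [simp]: "of_int n \<in> K"
 by (cases n) (simp_all del: of_nat_Suc)

lemma sum [simp]: "(!!i. i \<in> I ==> f i \<in> K) ==> sum f I \<in> K"
 by (induction I rule: infinite_finite_induct) auto

lemma prod [simp]: "(!!i. i \<in> I ==> f i \<in> K) ==> prod f I \<in> K"
 by (induction I rule: infinite_finite_induct) auto

end

text \<open>Witt's chain equivalence: a binary form \<open>\<langle>a, b\<rangle>\<close> representing \<open>e \<noteq> 0\<close> is \<open>\<langle>e, a b e\<rangle>\<close>.
  Multisets stand for diagonal forms.\<close>

inductive dstep :: "'f::field set => 'f multiset => 'f multiset => bool" for K where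
 square: "[|a \<in> K; a ~= 0; x \<in> K; x ~= 0|] ==> dstep K (add_mset a M) (add_mset (a * x^2) M)"
| binary: "[|a \<in> K; a ~= 0; b \<in> K; b ~= 0; x \<in> K; y \<in> K; e = a * x^2 + b * y^2; e ~= 0|]
 ==> dstep K (add_mset a (add_mset b M)) (add_mset e (add_mset (a * b * e) M))"

definition deq :: "'f::field set => 'f multiset => 'f multiset => bool" where
 "deq K = (dstep K)\<^sup>*\<^sup>*"

lemma image_mset_mult_1 [simp]: "image_mset ((*) (1::'f::field)) M = M"
 by (induction M) auto

lemma deq_refl [simp]: "deq K M M"
 by (simp add: deq_def)

lemma deq_trans [trans]: "deq K L M ==> deq K M N ==> deq K L N"
 by (simp add: deq_def)

lemma deq_step: "dstep K M N ==> deq K M N"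
 by (simp add: deq_def r_into_rtranclp)

lemma deq_square:
 "[|a \<in> K; a ~= 0; x \<in> K; x ~= 0; b = a * x^2|] ==> deq K (add_mset a M) (add_mset b M)"
 by (simp add: deq_step dstep.square)

lemma deq_binary:
 "[|a \<in> K; a ~= 0; b \<in> K; b ~= 0; x \<in> K; y \<in> K; e = a * x^2 + b * y^2; e ~= 0; f = a * b * e|]
 ==> deq K (add_mset a (add_mset b M)) (add_mset e (add_mset f M))"
 using dstep.binary[of a K b x y e M] by (simp add: deq_step)

lemma deq_mono: "deq K M N ==> K <= K' ==> deq K' M N"
proof -
 assume "K <= K'"
 have "dstep K' M N" if "dstep K M N" for M N
 using that
 proof cases
 case (square a x L)
 thus ?thesis using \<open>K <= K'\<close> dstep.square[of a K' x L] by auto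
 next
 case (binary a b x y e L)
 thus ?thesis using \<open>K <= K'\<close> dstep.binary[of a K' b x y e L] by auto
 qed
 hence "dstep K \<le> dstep K'" by auto
 thus "deq K M N ==> deq K' M N"
 unfolding deq_def using rtranclp_mono by blast
qed

lemma deq_add: "deq K M N ==> deq K (M + P) (N + P)"
 unfolding deq_def
proof (induction rule: rtranclp_induct)
 case (step N N')
 from step(2) have "dstep K (N + P) (N' + P)"
 by cases (simp_all add: dstep.intros)
 with step show ?case by simp
qed simp

lemma deq_add2: "deq K M N ==> deq K M' N' ==> deq K (M + M') (N + N')"
 by (metis deq_add deq_trans union_commute)

lemma deq_add_mset: "deq K M N ==> deq K (add_mset a M) (add_mset a N)"
 using deq_add[of K M N "{#a#}"] by simp

context subfld begin

text \<open>Each step can be undone. A square is undone by the inverse square. A binary step is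
  undone by a binary step that represents \<open>a\<close> with coordinates \<open>a x / e\<close>
  and \<open>y / e\<close>; its second entry is \<open>b\<close> times the square of
  \<open>a e\<close>.\<close>

lemma deq_sym: "deq K M N ==> deq K N M"
 unfolding deq_def
proof (induction rule: rtranclp_induct)
 case (step N N')
 have "deq K N' N" using step(2)
 proof cases
 case (square a x M)
 thus ?thesis
 by (intro deq_step) (use dstep.square[of "a * x^2" K "inverse x" M] in \<open>simp add: field_simps\<close>)
 next
 case (binary a b x y e M)
 have "e * (x / (e/a))^2 + (a*b*e) * (y/e)^2 = a * (a * x^2 + b*y^2) / e"
 using binary(4,6,10) by (simp add: field_simps power2_eq_square)
 also have "\<dots> = a" using binary by simp
 finally have "deq K N' (add_mset a (add_mset (e * (a*b*e) * a) M))"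
 unfolding binary using binary
 by (intro deq_binary[where x="x / (e/a)" and y="y/e"]) simp_all
 also have "deq K \<dots> (add_mset a (add_mset b M))"
 proof -
 have "e * (a*b*e) * a * (inverse (a*e))^2 = b"
 using \<open>a ~= 0\<close> \<open>e ~= 0\<close> by (simp add: field_simps power2_eq_square)
 moreover have "e \<in> K" using binary by simp
 ultimately show ?thesis unfolding add_mset_commute[of a] using binary(3-6) \<open>e ~= 0\<close>
 by (intro deq_square[where x="inverse (a*e)"]) simp_all
 qed
 finally show ?thesis using binary by simp
 qed
 with step show ?case by (simp add: deq_def)
qed simp

lemma deq_units: "deq K M N ==> set_mset M <= K - {0} ==> set_mset N <= K - {0}"
 unfolding deq_def
proof (induction rule: rtranclp_induct)
 case (step N N')
 thus ?case by (auto elim!: dstep.cases)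
qed

lemma deq_scale:
 assumes "deq K M N" "c \<in> K" "c ~= 0"
 shows "deq K (image_mset ((*) c) M) (image_mset ((*) c) N)"
 using assms(1) unfolding deq_def
proof (induction rule: rtranclp_induct)
 case (step N N')
 have "deq K (image_mset ((*) c) N) (image_mset ((*) c) N')" using step(2)
 proof cases
 case (square a x M)
 thus ?thesis using assms by (auto intro!: deq_square[where x=x])
 next
 case (binary a b x y e M)
 have eK: "e \<in> K" and ce: "c * e = c * a * x^2 + c * b * y^2" using binary by (simp_all add: algebra_simps)
 have "deq K (add_mset (c*a) (add_mset (c*b) (image_mset ((*) c) M)))
 (add_mset (c*e) (add_mset (c*a*(c*b)*(c*e)) (image_mset ((*) c) M)))"
 using binary(3-8,10) assms by (intro deq_binary[OF _ _ _ _ _ _ ce]) simp_all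
 hence "deq K (image_mset ((*) c) N) (add_mset (c*e) (add_mset (c*a*(c*b)*(c*e)) (image_mset ((*) c) M)))"
 by (simp add: binary(1))
 also have "deq K \<dots> (add_mset (c*e) (add_mset (c*(a*b*e)) (image_mset ((*) c) M)))"
 unfolding add_mset_commute[of "c*e"] using binary(3-6,10) assms eK
 by (intro deq_square[where x="inverse c"]) (simp_all add: power2_eq_square field_simps)
 finally show ?thesis using binary by simp
 qed
 with step show ?case by (simp add: deq_def)
qed simp

lemma deq_image_square:
 assumes "!!x. x \<in># A ==> g x \<in> K & g x ~= 0 & (\<exists>r\<in>K. r ~= 0 & f x = g x * r^2)"
 shows "deq K (image_mset f A) (image_mset g A)"
 using assms
proof (induction A)
 case (add a A)
 obtain r where r: "r \<in> K" "r ~= 0" "f a = g a * r^2" "g a \<in> K" "g a ~= 0" using add(2)[of a] by auto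
 have "deq K (add_mset (g a) (image_mset g A)) (add_mset (f a) (image_mset g A))"
 using r by (intro deq_square) auto
 moreover have "deq K (add_mset (f a) (image_mset f A)) (add_mset (f a) (image_mset g A))"
 using add by (intro deq_add_mset) auto
 ultimately have "deq K (add_mset (f a) (image_mset f A)) (add_mset (g a) (image_mset g A))"
 by (metis deq_sym deq_trans)
 thus ?case by simp
qed simp

lemma deq_square_scale:
 assumes "set_mset M <= K - {0}" "r \<in> K" "r ~= 0" "c = r^2"
 shows "deq K (image_mset ((*) c) M) M"
proof -
 have "deq K (image_mset ((*) c) M) (image_mset (%x. x) M)"
 using assms by (intro deq_image_square) (auto simp: mult.commute)
 thus ?thesis by simp
qed

lemma deq_hyperbolic:
 assumes "a \<in> K" "a ~= 0"
 shows "deq K (add_mset a (add_mset (- a) M)) (add_mset 1 (add_mset (-1) M))"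
proof -
 \<comment> \<open>The solution of \<open>x - y = 1\<close> and \<open>x + y = inverse a\<close>, so
   that \<open>a (x - y) (x + y) = 1\<close>.\<close>
 let ?x = "(inverse a + 1) / 2" and ?y = "(inverse a - 1) / 2"
 have "?x - ?y = 1" "?x + ?y = inverse a"
 using two by (simp_all add: add_divide_distrib[symmetric] diff_divide_distrib[symmetric])
 hence "a * ((?x - ?y) * (?x + ?y)) = 1" using assms by simp
 moreover have "a * X^2 + (- a) * Y^2 = a * ((X - Y) * (X + Y))" for X Y
 by (simp add: algebra_simps power2_eq_square)
 ultimately have "a * ?x^2 + (- a) * ?y^2 = 1" by metis
 hence "deq K (add_mset a (add_mset (- a) M)) (add_mset 1 (add_mset (- (a*a)) M))"
 using assms by (intro deq_binary[where x="?x" and y="?y"]) simp_all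
 also have "deq K \<dots> (add_mset 1 (add_mset (-1) M))"
 unfolding add_mset_commute[of 1] using assms
 by (intro deq_square[where x="inverse a"]) (simp_all add: power2_eq_square field_simps)
 finally show ?thesis .
qed

end

section \<open>Orthogonal bases\<close>

definition orth :: "'x set => ('x => 'x => 'f::field) => 'x set => bool" where
 "orth V \<beta> C \<longleftrightarrow> finite C & C <= V & (\<forall>c\<in>C. \<beta> c c ~= 0) & (\<forall>c\<in>C. \<forall>d\<in>C. c ~= d --> \<beta> c d = 0)"

text \<open>Completeness is the absence of a nonzero vector orthogonal to \<open>B\<close>. By
  projection this makes \<open>B\<close> an orthogonal basis, without any mention of span or
  dimension.\<close>

definition obas :: "'x::zero set => ('x => 'x => 'f::field) => 'x set => bool" where
 "obas V \<beta> B \<longleftrightarrow> orth V \<beta> B & (\<forall>x\<in>V. (\<forall>b\<in>B. \<beta> x b = 0) --> x = 0)"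

definition norms :: "('x => 'x => 'f::field) => 'x set => 'f multiset" where
 "norms \<beta> B = image_mset (%b. \<beta> b b) (mset_set B)"

lemma orth_finite: "orth V \<beta> C ==> finite C"
 by (simp add: orth_def)

lemma norms_insert: "finite B ==> b \<notin> B ==> norms \<beta> (insert b B) = add_mset (\<beta> b b) (norms \<beta> B)"
 by (simp add: norms_def)

lemma norms_remove: "finite B ==> b \<in> B ==> norms \<beta> B = add_mset (\<beta> b b) (norms \<beta> (B - {b}))"
 using norms_insert[of "B - {b}" b \<beta>] by (simp add: insert_absorb)

lemma norms_Un: "finite A ==> finite B ==> A \<inter> B = {} ==> norms \<beta> (A \<union> B) = norms \<beta> A + norms \<beta> B"
 by (simp add: norms_def mset_set_Union)

lemma norms_size: "size (norms \<beta> B) = card B"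
 by (simp add: norms_def)

lemma orth_Un:
 assumes "orth V \<beta> A" "orth V \<beta> B" and z: "!!a b. a \<in> A ==> b \<in> B ==> \<beta> a b = 0 & \<beta> b a = 0"
 shows "orth V \<beta> (A \<union> B)" "A \<inter> B = {}" "norms \<beta> (A \<union> B) = norms \<beta> A + norms \<beta> B"
proof -
 show d: "A \<inter> B = {}"
 proof (rule ccontr)
 assume "A \<inter> B ~= {}"
 then obtain x where "x \<in> A" "x \<in> B" by blast
 thus False using z[of x x] assms(1) by (simp add: orth_def)
 qed
 show "orth V \<beta> (A \<union> B)" using assms by (auto simp: orth_def)
 show "norms \<beta> (A \<union> B) = norms \<beta> A + norms \<beta> B"
 using assms d by (simp add: orth_def norms_Un)
qed

lemma orth_image:
 assumes "orth V \<beta> C" "c ~= 0" and T: "!!x. x \<in> C ==> T x \<in> V'"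
 and iso: "!!x y. x \<in> C ==> y \<in> C ==> \<beta>' (T x) (T y) = c * \<beta> x y"
 shows "orth V' \<beta>' (T ` C)" "card (T ` C) = card C" "norms \<beta>' (T ` C) = image_mset ((*) c) (norms \<beta> C)"
proof -
 have inj: "inj_on T C"
 proof (rule inj_onI)
 fix x y assume xy: "x \<in> C" "y \<in> C" "T x = T y"
 hence "c * \<beta> x y = c * \<beta> x x" by (metis iso)
 thus "x = y" using assms xy unfolding orth_def by (metis mult_cancel_left)
 qed
 show "orth V' \<beta>' (T ` C)" using assms unfolding orth_def by (auto simp: iso)
 show "card (T ` C) = card C" using inj by (rule card_image)
 have "norms \<beta>' (T ` C) = image_mset (%b. \<beta>' (T b) (T b)) (mset_set C)"
 unfolding norms_def by (subst image_mset_mset_set[OF inj, symmetric]) (simp add: multiset.map_comp o_def)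
 also have "\<dots> = image_mset (%b. c * \<beta> b b) (mset_set C)"
 using assms by (intro image_mset_cong) (auto simp: orth_def)
 finally show "norms \<beta>' (T ` C) = image_mset ((*) c) (norms \<beta> C)"
 by (simp add: norms_def multiset.map_comp o_def)
qed

lemma orth_family:
 assumes "finite I" and v: "!!i. i \<in> I ==> v i \<in> V"
 and d: "!!i. i \<in> I ==> \<beta> (v i) (v i) = n i & n i ~= 0"
 and o: "!!i j. i \<in> I ==> j \<in> I ==> i ~= j ==> \<beta> (v i) (v j) = 0"
 shows "orth V \<beta> (v ` I)" "card (v ` I) = card I" "norms \<beta> (v ` I) = image_mset n (mset_set I)"
proof -
 have inj: "inj_on v I" using d o unfolding inj_on_def by metis
 show "orth V \<beta> (v ` I)" using assms unfolding orth_def by auto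
 show "card (v ` I) = card I" using inj by (rule card_image)
 have "norms \<beta> (v ` I) = image_mset (%b. \<beta> (v b) (v b)) (mset_set I)"
 unfolding norms_def by (subst image_mset_mset_set[OF inj, symmetric]) (simp add: multiset.map_comp o_def)
 also have "\<dots> = image_mset n (mset_set I)"
 using assms by (intro image_mset_cong) auto
 finally show "norms \<beta> (v ` I) = image_mset n (mset_set I)" .
qed

text \<open>Scalars are restricted to \<open>K\<close> and vectors to \<open>V\<close>, so that a
  twist inside a function space over the separable closure is an instance over the fixed field, and
  an extension field is an instance over a smaller field.\<close>

locale qsp = subfld K for K :: "'f::field set" +
 fixes V :: "'x::ab_group_add set" and sc :: "'f => 'x => 'x" and \<beta> :: "'x => 'x => 'f"
 assumes V0 [simp]: "0 \<in> V" and Vadd [simp]: "x \<in> V ==> y \<in> V ==> x + y \<in> V"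
 and Vsc [simp]: "a \<in> K ==> x \<in> V ==> sc a x \<in> V"
 and sc_one: "x \<in> V ==> sc 1 x = x"
 and sc_sc: "a \<in> K ==> b \<in> K ==> x \<in> V ==> sc a (sc b x) = sc (a * b) x"
 and sc_add: "a \<in> K ==> b \<in> K ==> x \<in> V ==> sc (a + b) x = sc a x + sc b x"
 and \<beta>_in [simp]: "x \<in> V ==> y \<in> V ==> \<beta> x y \<in> K"
 and \<beta>_sym: "x \<in> V ==> y \<in> V ==> \<beta> x y = \<beta> y x"
 and \<beta>_add [simp]: "x \<in> V ==> y \<in> V ==> z \<in> V ==> \<beta> (x + y) z = \<beta> x z + \<beta> y z"
 and \<beta>_sc [simp]: "a \<in> K ==> x \<in> V ==> z \<in> V ==> \<beta> (sc a x) z = a * \<beta> x z"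
begin

lemma \<beta>_addR [simp]: "x \<in> V ==> y \<in> V ==> z \<in> V ==> \<beta> z (x + y) = \<beta> z x + \<beta> z y"
 using \<beta>_sym[of z] by simp

lemma \<beta>_scR [simp]: "a \<in> K ==> x \<in> V ==> z \<in> V ==> \<beta> z (sc a x) = a * \<beta> z x"
 using \<beta>_sym[of z] by simp

lemma sc_zero: "x \<in> V ==> sc 0 x = 0"
 using sc_add[of 0 0 x] by simp

lemma sc_minus: assumes "x \<in> V" shows "sc (-1) x = - x"
proof -
 have "sc (-1) x + sc 1 x = 0" using assms sc_add[of "-1" 1 x] by (simp add: sc_zero)
 thus ?thesis using assms by (simp add: sc_one eq_neg_iff_add_eq_0)
qed

lemma Vneg [simp]: "x \<in> V ==> - x \<in> V"
 by (metis neg one Vsc sc_minus)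

lemma Vdiff [simp]: "x \<in> V ==> y \<in> V ==> x - y \<in> V"
 using Vadd[of x "- y"] by simp

lemma \<beta>_neg [simp]: "x \<in> V ==> z \<in> V ==> \<beta> (- x) z = - \<beta> x z"
 by (metis neg one \<beta>_sc sc_minus mult_minus1)

lemma \<beta>_negR [simp]: "x \<in> V ==> z \<in> V ==> \<beta> z (- x) = - \<beta> z x"
 using \<beta>_sym[of z] by simp

lemma \<beta>_diff [simp]: "x \<in> V ==> y \<in> V ==> z \<in> V ==> \<beta> (x - y) z = \<beta> x z - \<beta> y z"
 using \<beta>_add[of x "- y" z] by simp

lemma \<beta>_diffR [simp]: "x \<in> V ==> y \<in> V ==> z \<in> V ==> \<beta> z (x - y) = \<beta> z x - \<beta> z y"
 using \<beta>_sym[of z] by simp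

lemma \<beta>_zero [simp]: "x \<in> V ==> \<beta> 0 x = 0" "x \<in> V ==> \<beta> x 0 = 0"
 using \<beta>_diff[of x x x] \<beta>_diffR[of x x x] by simp_all

lemma V_sum [simp]: "(!!i. i \<in> I ==> f i \<in> V) ==> sum f I \<in> V"
 by (induction I rule: infinite_finite_induct) auto

lemma \<beta>_sum: "(!!i. i \<in> I ==> f i \<in> V) ==> z \<in> V ==> \<beta> (sum f I) z = (\<Sum>i\<in>I. \<beta> (f i) z)"
 by (induction I rule: infinite_finite_induct) auto

lemma orth_norms_units: "orth V \<beta> C ==> set_mset (norms \<beta> C) <= K - {0}"
 by (auto simp: orth_def norms_def)

lemma qsp_perp: "v \<in> V ==> qsp K {x \<in> V. \<beta> x v = 0} sc \<beta>"
 by unfold_locales (auto simp: sc_one sc_sc sc_add \<beta>_sym)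

lemma orth_proj:
 assumes "orth V \<beta> C" "y \<in> V"
 obtains y' where "y' \<in> V" "!!c. c \<in> C ==> \<beta> y' c = 0"
 "!!x. x \<in> V ==> (!!c. c \<in> C ==> \<beta> x c = 0) ==> \<beta> x y' = \<beta> x y"
 "y' = y - (\<Sum>c\<in>C. sc (\<beta> y c / \<beta> c c) c)"
proof
 let ?s = "\<Sum>c\<in>C. sc (\<beta> y c / \<beta> c c) c"
 have C: "finite C" "C <= V" using assms by (auto simp: orth_def)
 have cV: "sc (\<beta> y c / \<beta> c c) c \<in> V" if "c \<in> C" for c using that C assms(2) by (intro Vsc divide \<beta>_in) auto
 hence s: "?s \<in> V" by (intro V_sum)
 show "y - ?s \<in> V" using s assms by simp
 have bs: "\<beta> ?s z = (\<Sum>c\<in>C. \<beta> y c / \<beta> c c * \<beta> c z)" if "z \<in> V" for z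
 using that C assms(2) cV by (subst \<beta>_sum) (auto intro!: sum.cong \<beta>_sc divide \<beta>_in)
 show "\<beta> (y - ?s) c = 0" if c: "c \<in> C" for c
 proof -
 have "\<beta> ?s c = (\<Sum>d\<in>C. if d = c then \<beta> y c else 0)"
 using c C assms(1) by (subst bs, force) (intro sum.cong refl, auto simp: orth_def)
 hence "\<beta> ?s c = \<beta> y c" using c C by simp
 thus ?thesis using c C s assms(2) by (simp add: subset_iff)
 qed
 show "\<beta> x (y - ?s) = \<beta> x y" if x: "x \<in> V" "!!c. c \<in> C ==> \<beta> x c = 0" for x
 proof -
 have "\<beta> ?s x = 0" using x C by (subst bs) (auto intro!: sum.neutral simp: \<beta>_sym[of _ x] subset_iff)
 thus ?thesis using x(1) s assms(2) by (simp add: \<beta>_sym[of x ?s])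
 qed
qed simp

lemma obas_expand:
 assumes "obas V \<beta> B" "x \<in> V"
 shows "x = (\<Sum>b\<in>B. sc (\<beta> x b / \<beta> b b) b)"
proof -
 obtain y' where "y' \<in> V" "!!c. c \<in> B ==> \<beta> y' c = 0" "y' = x - (\<Sum>b\<in>B. sc (\<beta> x b / \<beta> b b) b)"
 using orth_proj[of B x] assms by (auto simp: obas_def)
 thus ?thesis using assms unfolding obas_def by auto
qed

text \<open>A sum of three or more nonzero terms has a two-term subsum that does not vanish, because
  \<open>2 \<noteq> 0\<close>; combining two such basis vectors shortens the expansion of \<open>v\<close>.\<close>

lemma obas_exchange:
 assumes "obas V \<beta> B" "v \<in> V" "\<beta> v v ~= 0"
 shows "\<exists>B'. obas V \<beta> B' & v \<in> B' & card B' = card B & deq K (norms \<beta> B) (norms \<beta> B')"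
 using assms(1)
proof (induction "card {b \<in> B. \<beta> v b ~= 0}" arbitrary: B rule: less_induct)
 case less
 let ?S = "{b \<in> B. \<beta> v b ~= 0}"
 have fin: "finite B" and BV: "!!b. b \<in> B ==> b \<in> V" and an: "!!b. b \<in> B ==> \<beta> b b ~= 0"
 and or: "!!b c. b \<in> B ==> c \<in> B ==> b ~= c ==> \<beta> b c = 0"
 and co: "!!x. x \<in> V ==> (!!b. b \<in> B ==> \<beta> x b = 0) ==> x = 0"
 using less(2) by (auto simp: obas_def orth_def)
 define x where "x b = \<beta> v b / \<beta> b b" for b
 have xK: "x b \<in> K" if "b \<in> B" for b using that BV assms(2) by (simp add: x_def)
 have vexp: "\<beta> v z = (\<Sum>b\<in>?S. x b * \<beta> b z)" if "z \<in> V" for z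
 proof -
 have "\<beta> v z = \<beta> (\<Sum>b\<in>B. sc (x b) b) z" using obas_expand[OF less(2) assms(2)] by (simp add: x_def)
 also have "\<dots> = (\<Sum>b\<in>B. x b * \<beta> b z)" using that BV xK by (subst \<beta>_sum) auto
 also have "\<dots> = (\<Sum>b\<in>?S. x b * \<beta> b z)" using fin by (intro sum.mono_neutral_right) (auto simp: x_def)
 finally show ?thesis .
 qed
 have vv: "\<beta> v v = (\<Sum>b\<in>?S. \<beta> b b * (x b)^2)"
 unfolding vexp[OF assms(2)] using an BV assms(2)
 by (intro sum.cong) (auto simp: x_def power2_eq_square \<beta>_sym[of _ v])
 have S0: "?S ~= {}" using vv assms(3) by force
 show ?case
 proof (cases "\<exists>b\<in>?S. \<exists>c\<in>?S. b ~= c & \<beta> b b * (x b)^2 + \<beta> c c * (x c)^2 ~= 0")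
 case True
 then obtain b c where bc: "b \<in> B" "c \<in> B" "b ~= c" "\<beta> v b ~= 0" "\<beta> v c ~= 0"
 and e: "\<beta> b b * (x b)^2 + \<beta> c c * (x c)^2 ~= 0" by auto
 let ?e = "\<beta> b b * (x b)^2 + \<beta> c c * (x c)^2"
 have [simp]: "b \<in> V" "c \<in> V" "x b \<in> K" "x c \<in> K" "\<beta> b b \<in> K" "\<beta> c c \<in> K" "\<beta> b c = 0" "\<beta> c b = 0"
 using bc BV xK or by auto
 have [simp]: "x c * \<beta> c c \<in> K" "x b * \<beta> b b \<in> K" by auto
 \<comment> \<open>In the plane of \<open>b\<close> and \<open>c\<close>: the component
   \<open>b'\<close> of \<open>v\<close>, and a vector \<open>c'\<close> orthogonal to it. As
   \<open>c'\<close> is then orthogonal to \<open>v\<close>, the expansion of \<open>v\<close> loses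
   a term.\<close>
 define b' where "b' = sc (x b) b + sc (x c) c"
 define c' where "c' = sc (x c * \<beta> c c) b - sc (x b * \<beta> b b) c"
 have [simp]: "b' \<in> V" "c' \<in> V" by (auto simp: b'_def c'_def)
 have nb: "\<beta> b' b' = ?e" by (simp add: b'_def power2_eq_square algebra_simps)
 have nc: "\<beta> c' c' = \<beta> b b * \<beta> c c * ?e" by (simp add: c'_def power2_eq_square algebra_simps)
 have n0: "\<beta> b' c' = 0" "\<beta> c' b' = 0" by (auto simp: b'_def c'_def algebra_simps)
 let ?R = "B - {b, c}"
 have R: "\<beta> d b' = 0" "\<beta> d c' = 0" "\<beta> b' d = 0" "\<beta> c' d = 0" if "d \<in> ?R" for d
 using that bc or[of d b] or[of d c] or[of b d] or[of c d] BV[of d] by (auto simp: b'_def c'_def)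
 have abc: "\<beta> b b ~= 0" "\<beta> c c ~= 0" using an bc by auto
 have nc0: "\<beta> c' c' ~= 0" using nc e abc by simp
 have ne: "b' ~= c'" "b' \<notin> ?R" "c' \<notin> ?R" using n0 nc0 R nb e an by (metis Diff_iff)+
 let ?B = "insert b' (insert c' ?R)"
 have ob: "obas V \<beta> ?B" unfolding obas_def orth_def
 proof (intro conjI ballI impI)
 show "finite ?B" "?B <= V" using fin BV by auto
 show "\<beta> d d ~= 0" if "d \<in> ?B" for d using that nb nc0 e an by auto
 show "\<beta> d f = 0" if "d \<in> ?B" "f \<in> ?B" "d ~= f" for d f using that n0 R or by auto
 fix z assume z: "z \<in> V" "\<forall>d\<in>?B. \<beta> z d = 0"
 have "\<beta> z b' = 0" "\<beta> z c' = 0" using z by auto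
 hence 1: "x b * \<beta> z b + x c * \<beta> z c = 0" "x c * \<beta> c c * \<beta> z b - x b * \<beta> b b * \<beta> z c = 0"
 using z(1) by (auto simp: b'_def c'_def)
 have "?e * \<beta> z b = x b * \<beta> b b * (x b * \<beta> z b + x c * \<beta> z c) + x c * (x c * \<beta> c c * \<beta> z b - x b * \<beta> b b * \<beta> z c)"
 "?e * \<beta> z c = x c * \<beta> c c * (x b * \<beta> z b + x c * \<beta> z c) - x b * (x c * \<beta> c c * \<beta> z b - x b * \<beta> b b * \<beta> z c)"
 by (simp_all add: power2_eq_square algebra_simps)
 hence "?e * \<beta> z b = 0" "?e * \<beta> z c = 0" unfolding 1 by simp_all
 hence "\<beta> z b = 0" "\<beta> z c = 0" using e by auto
 thus "z = 0" using z by (intro co) auto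
 qed
 have "\<beta> v c' = 0"
 using assms(2) abc by (simp add: c'_def x_def)
 hence "{d \<in> ?B. \<beta> v d ~= 0} <= insert b' (?S - {b, c})" by auto
 hence "card {d \<in> ?B. \<beta> v d ~= 0} \<le> card (insert b' (?S - {b, c}))" using fin by (intro card_mono) auto
 also have "\<dots> \<le> Suc (card (?S - {b, c}))" using fin by (simp add: card_insert_if)
 also have "\<dots> < card ?S"
 proof -
 have "card ?S = card (insert b (insert c (?S - {b, c})))" using bc by (intro arg_cong[where f=card]) auto
 also have "\<dots> = Suc (Suc (card (?S - {b, c})))" using fin bc by simp
 finally show ?thesis by simp
 qed
 finally obtain B' where B': "obas V \<beta> B'" "v \<in> B'" "card B' = card ?B" "deq K (norms \<beta> ?B) (norms \<beta> B')"
 using less(1)[OF _ ob] by blast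
 have "norms \<beta> B = add_mset (\<beta> b b) (add_mset (\<beta> c c) (norms \<beta> ?R))"
 proof -
 have "?R = B - {b} - {c}" by auto
 thus ?thesis using norms_remove[of B b \<beta>] norms_remove[of "B - {b}" c \<beta>] fin bc by simp
 qed
 also have "deq K \<dots> (add_mset ?e (add_mset (\<beta> b b * \<beta> c c * ?e) (norms \<beta> ?R)))"
 using abc e by (intro deq_binary[where x="x b" and y="x c"]) auto
 also have "\<dots> = norms \<beta> ?B" using fin ne by (simp add: norms_insert nb nc)
 finally have "deq K (norms \<beta> B) (norms \<beta> B')" using B'(4) deq_trans by blast
 moreover have "card B' = card B"
 proof -
 have "card B = card (insert b (insert c ?R))" using bc by (intro arg_cong[where f=card]) auto
 thus ?thesis using B'(3) fin bc ne by simp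
 qed
 ultimately show ?thesis using B' by blast
 next
 case False
 \<comment> \<open>A support of exactly two elements is excluded too: the two terms would cancel and
   give \<open>\<beta> v v = 0\<close>.\<close>
 have "\<exists>b. ?S = {b}"
 proof (rule ccontr)
 assume n1: "\<nexists>b. ?S = {b}"
 obtain b where b: "b \<in> ?S" using S0 by blast
 then obtain c where c: "c \<in> ?S" "c ~= b" using n1 by blast
 let ?g = "%b. \<beta> b b * (x b)^2"
 have g0: "?g d ~= 0" if "d \<in> ?S" for d using that an by (auto simp: x_def)
 have F: "?g d = - ?g f" if "d \<in> ?S" "f \<in> ?S" "d ~= f" for d f
 using False that by (metis (no_types, lifting) eq_neg_iff_add_eq_0)
 have "?S = {b, c}"
 proof (rule ccontr)
 assume "?S ~= {b, c}"
 then obtain d where d: "d \<in> ?S" "d ~= b" "d ~= c" using b c by blast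
 have "?g b = - ?g c" "?g b = - ?g d" "?g c = - ?g d" using F b c d by blast+
 hence "?g d = - ?g d" by simp
 hence "2 * ?g d = 0" by (simp add: eq_neg_iff_add_eq_0)
 thus False using g0[OF d(1)] two by simp
 qed
 hence "\<beta> v v = ?g b + ?g c" using vv c by simp
 thus False using F[OF b c(1)] c assms(3) by simp
 qed
 then obtain b where b: "?S = {b}" by blast
 hence bB: "b \<in> B" "\<beta> v b ~= 0" by auto
 have x0: "x b ~= 0" using bB an by (simp add: x_def)
 have vb: "v = sc (x b) b"
 proof -
 have "v - sc (x b) b = 0"
 proof (rule co)
 show "v - sc (x b) b \<in> V" using assms(2) BV bB xK by simp
 show "\<beta> (v - sc (x b) b) d = 0" if "d \<in> B" for d
 using that assms(2) BV bB xK vexp[of d] b by simp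
 qed
 thus ?thesis by simp
 qed
 let ?B = "insert v (B - {b})"
 have vd: "\<beta> v d = x b * \<beta> b d" "\<beta> d v = x b * \<beta> d b" if "d \<in> V" for d
 using that BV bB xK by (simp_all add: vb)
 have vn: "v \<notin> B - {b}" using b assms(3) by auto
 have "obas V \<beta> ?B" unfolding obas_def orth_def
 proof (intro conjI ballI impI)
 show "finite ?B" "?B <= V" using fin BV assms by auto
 show "\<beta> d d ~= 0" if "d \<in> ?B" for d using that an assms by auto
 show "\<beta> d f = 0" if "d \<in> ?B" "f \<in> ?B" "d ~= f" for d f using that or vd BV bB by auto
 fix z assume z: "z \<in> V" "\<forall>d\<in>?B. \<beta> z d = 0"
 hence "\<beta> z b = 0" using vd x0 by auto
 with z show "z = 0" by (intro co) auto
 qed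
 moreover have "card ?B = card B" using fin vn card_Suc_Diff1[OF fin bB(1)] by simp
 moreover have "norms \<beta> B = add_mset (\<beta> b b) (norms \<beta> (B - {b}))"
 using fin bB by (simp add: norms_remove)
 moreover have "norms \<beta> ?B = add_mset (\<beta> b b * (x b)^2) (norms \<beta> (B - {b}))"
 using fin vn vd assms BV bB by (simp add: norms_insert power2_eq_square)
 ultimately show ?thesis using x0 an bB BV xK by (intro exI[of _ ?B]) (auto intro!: deq_square[where x="x b"])
 qed
qed

end

text \<open>Witt's chain equivalence theorem. One vector of \<open>C\<close> is exchanged into the
  basis, and the rest happens in its orthogonal complement; hence the induction quantifies over the
  space \<open>V\<close>.\<close>

lemma (in qsp) obas_extend:
 assumes "orth V \<beta> C" "obas V \<beta> B"
 shows "\<exists>B'. C <= B' & obas V \<beta> B' & card B' = card B & deq K (norms \<beta> B) (norms \<beta> B')"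
proof -
 have "\<forall>V B C. card C = n --> qsp K V sc \<beta> --> orth V \<beta> C --> obas V \<beta> B -->
 (\<exists>B'. C <= B' & obas V \<beta> B' & card B' = card B & deq K (norms \<beta> B) (norms \<beta> B'))" for n
 proof (induction n)
 case 0
 show ?case by (intro allI impI) (auto simp: orth_def)
 next
 case (Suc n)
 show ?case
 proof (intro allI impI)
 fix V B C assume a: "card C = Suc n" "qsp K V sc \<beta>" "orth V \<beta> C" "obas V \<beta> B"
 interpret W: qsp K V sc \<beta> by fact
 obtain v where v: "v \<in> C" using a(1) by fastforce
 have vV: "v \<in> V" "\<beta> v v ~= 0" and fC: "finite C" using v a(3) by (auto simp: orth_def)
 obtain B1 where B1: "obas V \<beta> B1" "v \<in> B1" "card B1 = card B" "deq K (norms \<beta> B) (norms \<beta> B1)"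
 using W.obas_exchange[OF a(4) vV] by blast
 let ?V = "{x \<in> V. \<beta> x v = 0}"
 have f1: "finite B1" using B1 by (simp add: obas_def orth_def)
 have "orth ?V \<beta> (C - {v})" using a(3) v by (auto simp: orth_def)
 moreover have "obas ?V \<beta> (B1 - {v})" using B1 by (auto simp: orth_def obas_def)
 moreover have "card (C - {v}) = n" using a(1) v by simp
 ultimately obtain B' where B': "C - {v} <= B'" "obas ?V \<beta> B'" "card B' = card (B1 - {v})"
 "deq K (norms \<beta> (B1 - {v})) (norms \<beta> B')"
 using Suc W.qsp_perp[OF vV(1)] by blast
 have f': "finite B'" "v \<notin> B'" "B' <= V" "!!b. b \<in> B' ==> \<beta> b v = 0"
 using B'(2) vV by (auto simp: obas_def orth_def)
 have vb: "\<beta> v b = 0" if "b \<in> B'" for b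
 using that f' vV(1) W.\<beta>_sym[of v b] by auto
 have "obas V \<beta> (insert v B')" unfolding obas_def orth_def
 proof (intro conjI ballI impI)
 show "finite (insert v B')" "insert v B' <= V" using f' vV by auto
 show "\<beta> d d ~= 0" if "d \<in> insert v B'" for d using that vV B'(2) by (auto simp: obas_def orth_def)
 show "\<beta> d f = 0" if "d \<in> insert v B'" "f \<in> insert v B'" "d ~= f" for d f
 using that f'(4) vb B'(2) by (auto simp: obas_def orth_def)
 show "z = 0" if "z \<in> V" "\<forall>d\<in>insert v B'. \<beta> z d = 0" for z
 using that B'(2) by (auto simp: obas_def)
 qed
 moreover have "deq K (norms \<beta> B1) (norms \<beta> (insert v B'))"
 unfolding norms_remove[OF f1 B1(2)] norms_insert[OF f'(1,2)] by (rule deq_add_mset[OF B'(4)])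
 moreover have "card (insert v B') = card B" using f' B' B1 f1 by (metis card.insert card_Suc_Diff1)
 ultimately show "\<exists>B'. C <= B' & obas V \<beta> B' & card B' = card B & deq K (norms \<beta> B) (norms \<beta> B')"
 using B'(1) B1(4) deq_trans by (intro exI[of _ "insert v B'"]) blast
 qed
 qed
 thus ?thesis using assms qsp_axioms by blast
qed

context qsp begin

lemma orth_card_le: "orth V \<beta> C ==> obas V \<beta> B ==> card C \<le> card B"
 using obas_extend[of C B] by (metis card_mono obas_def orth_finite)

lemma orth_card_obas: "orth V \<beta> C ==> obas V \<beta> B ==> card B \<le> card C ==> obas V \<beta> C"
 using obas_extend[of C B] by (metis card_seteq obas_def orth_finite)

text \<open>A basis containing \<open>C\<close> and chain equivalent to \<open>B\<close> has no room
  for further vectors, because \<open>C\<close> is already complete.\<close>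

lemma obas_unique: assumes "obas V \<beta> B" "obas V \<beta> C"
 shows "deq K (norms \<beta> B) (norms \<beta> C)" "card B = card C"
proof -
 obtain B' where B': "C <= B'" "obas V \<beta> B'" "card B' = card B" "deq K (norms \<beta> B) (norms \<beta> B')"
 using obas_extend[of C B] assms by (auto simp: obas_def)
 have "B' <= C"
 proof
 fix b assume b: "b \<in> B'"
 show "b \<in> C"
 proof (rule ccontr)
 assume "b \<notin> C"
 moreover have "\<forall>c\<in>B'. \<forall>d\<in>B'. c ~= d --> \<beta> c d = 0" using B'(2) by (simp add: obas_def orth_def)
 ultimately have "\<forall>c\<in>C. \<beta> b c = 0" using b B'(1) by (metis subsetD)
 hence "b = 0" using assms(2) b B' by (auto simp: obas_def orth_def)
 thus False using b B'(2) by (auto simp: obas_def orth_def)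
 qed
 qed
 hence "B' = C" using B' by auto
 thus "deq K (norms \<beta> B) (norms \<beta> C)" "card B = card C" using B' by auto
qed

lemma norms_split:
 assumes "orth V \<beta> B" "norms \<beta> B = add_mset a M"
 obtains b where "b \<in> B" "\<beta> b b = a" "norms \<beta> (B - {b}) = M"
proof -
 have fin: "finite B" using assms by (rule_tac orth_finite)
 have "a \<in># norms \<beta> B" using assms by simp
 then obtain b where b: "b \<in> B" "\<beta> b b = a" using fin by (auto simp: norms_def)
 hence "norms \<beta> (B - {b}) = M" using norms_remove[OF fin b(1), of \<beta>] assms by simp
 with b show ?thesis using that by blast
qed

text \<open>The converse of uniqueness: each elementary step is performed on one or two vectors of
  an actual basis, the binary one by the vectors with coordinates \<open>(x, y)\<close> and
  \<open>(y b, - x a)\<close>.\<close>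

lemma obas_transport:
 assumes "obas V \<beta> B" "deq K (norms \<beta> B) N"
 shows "\<exists>B'. obas V \<beta> B' & norms \<beta> B' = N"
 using assms(2) unfolding deq_def
proof (induction rule: rtranclp_induct)
 case base
 thus ?case using assms by blast
next
 case (step N N')
 then obtain C where C: "obas V \<beta> C" "norms \<beta> C = N" by blast
 hence o: "orth V \<beta> C" and fin: "finite C" and CV: "C <= V" by (auto simp: obas_def orth_def)
 show ?case using step(2)
 proof cases
 case (square a x M)
 then obtain c where c: "c \<in> C" "\<beta> c c = a" "norms \<beta> (C - {c}) = M"
 using norms_split[OF o] C by metis
 let ?c = "sc x c"
 have [simp]: "c \<in> V" using c CV by auto
 have cc: "\<beta> ?c z = x * \<beta> c z" "\<beta> z ?c = x * \<beta> z c" if "z \<in> V" for z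
 using that square by auto
 have cn: "\<beta> ?c ?c = a * x^2" using cc square c by (simp add: power2_eq_square)
 have "orth V \<beta> (insert ?c (C - {c}))"
 using o square c cc cn unfolding orth_def by (auto simp: subset_iff)
 moreover have "?c \<notin> C - {c}" using o square c cc cn CV unfolding orth_def
 by (metis DiffD1 DiffD2 insertI1 mult_zero_right subsetD)
 ultimately have "orth V \<beta> (insert ?c (C - {c}))" "card (insert ?c (C - {c})) = card C"
 "norms \<beta> (insert ?c (C - {c})) = N'"
 using fin c square cn card_Suc_Diff1[OF fin c(1)] by (auto simp: norms_insert)
 thus ?thesis using orth_card_obas[OF _ C(1)] by (metis order_refl)
 next
 case (binary a b x y e M)
 obtain c where c: "c \<in> C" "\<beta> c c = a" "norms \<beta> (C - {c}) = add_mset b M"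
 using norms_split[OF o, of a "add_mset b M"] C binary by metis
 have "orth V \<beta> (C - {c})" using o by (auto simp: orth_def)
 then obtain d where d: "d \<in> C - {c}" "\<beta> d d = b" "norms \<beta> (C - {c} - {d}) = M"
 using norms_split[of "C - {c}" b M] c by metis
 have [simp]: "c \<in> V" "d \<in> V" using c d CV by auto
 have [simp]: "\<beta> c d = 0" "\<beta> d c = 0" using o c d by (auto simp: orth_def)
 have [simp]: "a \<in> K" "b \<in> K" "x \<in> K" "y \<in> K" "\<beta> c c = a" "\<beta> d d = b" "y * b \<in> K" "x * a \<in> K"
 using binary c d by auto
 define c' where "c' = sc x c + sc y d"
 define d' where "d' = sc (y * b) c - sc (x * a) d"
 have [simp]: "c' \<in> V" "d' \<in> V" by (auto simp: c'_def d'_def)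
 have n: "\<beta> c' c' = e" "\<beta> d' d' = a * b * e" "\<beta> c' d' = 0" "\<beta> d' c' = 0"
 by (simp_all add: c'_def d'_def binary power2_eq_square algebra_simps)
 let ?R = "C - {c} - {d}"
 have R: "\<beta> r c' = 0" "\<beta> r d' = 0" "\<beta> c' r = 0" "\<beta> d' r = 0" if "r \<in> ?R" for r
 using that o c d CV by (auto simp: c'_def d'_def orth_def subset_iff)
 have e0: "e ~= 0" "a * b * e ~= 0" using binary by auto
 have or: "orth V \<beta> (insert c' (insert d' ?R))" unfolding orth_def
 proof (intro conjI ballI impI)
 show "finite (insert c' (insert d' ?R))" "insert c' (insert d' ?R) <= V" using fin CV by auto
 show "\<beta> r r ~= 0" if "r \<in> insert c' (insert d' ?R)" for r using that n e0 o by (auto simp: orth_def)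
 show "\<beta> r s = 0" if "r \<in> insert c' (insert d' ?R)" "s \<in> insert c' (insert d' ?R)" "r ~= s" for r s
 using that n R o by (auto simp: orth_def)
 qed
 have ne: "c' ~= d'" "c' \<notin> ?R" "d' \<notin> ?R" using n e0 R by metis+
 have "card (insert c' (insert d' ?R)) = card C"
 using ne fin c d card_Suc_Diff1[of C c] card_Suc_Diff1[of "C - {c}" d] by simp
 hence "obas V \<beta> (insert c' (insert d' ?R))" using orth_card_obas[OF or C(1)] by simp
 moreover have "norms \<beta> (insert c' (insert d' ?R)) = N'"
 using ne fin d n binary by (simp add: norms_insert)
 ultimately show ?thesis by blast
 qed
qed

text \<open>The bound \<open>n\<close> replaces finite dimension: a largest orthogonal family is
  complete. Otherwise some \<open>x \<noteq> 0\<close> is orthogonal to it, and for a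
  \<open>y'\<close> orthogonal to it with \<open>\<beta> x y' \<noteq> 0\<close> one of
  \<open>x\<close>, \<open>y'\<close>, \<open>x + y'\<close> is anisotropic, since their norms
  differ by \<open>2 \<beta> x y'\<close>.\<close>

lemma obas_exists:
 assumes nd: "!!x. x \<in> V ==> x ~= 0 ==> \<exists>y\<in>V. \<beta> x y ~= 0"
 and bd: "!!C. orth V \<beta> C ==> card C \<le> n"
 shows "\<exists>B. obas V \<beta> B"
proof -
 have "orth V \<beta> {}" by (simp add: orth_def)
 then obtain C where C: "orth V \<beta> C" "!!D. orth V \<beta> D ==> card D \<le> card C"
 using ex_has_greatest_nat[of "orth V \<beta>" "{}" card "Suc n"] bd by (metis less_Suc_eq_le)
 have "x = 0" if x: "x \<in> V" "\<forall>c\<in>C. \<beta> x c = 0" for x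
 proof (rule ccontr)
 assume "x ~= 0"
 then obtain y where y: "y \<in> V" "\<beta> x y ~= 0" using nd x by blast
 obtain y' where y': "y' \<in> V" "!!c. c \<in> C ==> \<beta> y' c = 0" "\<beta> x y' = \<beta> x y"
 using orth_proj[OF C(1) y(1)] x by metis
 have CV: "C <= V" using C(1) by (simp add: orth_def)
 have "\<exists>z\<in>V. \<beta> z z ~= 0 & (\<forall>c\<in>C. \<beta> z c = 0)"
 proof (rule ccontr)
 assume n: "~ ?thesis"
 have "\<forall>c\<in>C. \<beta> (x + y') c = 0" using x y' CV by auto
 hence "\<beta> (x + y') (x + y') = 0" "\<beta> x x = 0" "\<beta> y' y' = 0" using n x y' Vadd by blast+
 hence "2 * \<beta> x y' = 0" using x y' \<beta>_sym[of y' x] by simp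
 thus False using y y' two by simp
 qed
 then obtain z where z: "z \<in> V" "\<beta> z z ~= 0" "\<forall>c\<in>C. \<beta> z c = 0" by blast
 moreover have "\<forall>c\<in>C. \<beta> c z = 0" using z CV by (metis \<beta>_sym subsetD)
 ultimately have "orth V \<beta> (insert z C)" "z \<notin> C" using C(1) by (auto simp: orth_def)
 thus False using C(2)[of "insert z C"] orth_finite[OF C(1)] by simp
 qed
 thus ?thesis using C by (auto simp: obas_def)
qed

lemma obas_perp:
 assumes "obas V \<beta> B" "b \<in> B"
 shows "obas {x \<in> V. \<beta> x b = 0} \<beta> (B - {b})"
 using assms by (auto simp: obas_def orth_def)

end

section \<open>Witt cancellation for diagonal forms\<close>

context subfld begin

lemma standard_space:
 assumes "set as <= K - {0}"
 defines "V \<equiv> {x::nat => 'f. (\<forall>i. x i \<in> K) & (\<forall>i\<ge>length as. x i = 0)}"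
 and "\<beta> \<equiv> %x y. \<Sum>i<length as. as ! i * x i * y i"
 and "B \<equiv> (%i j. if j = i then 1 else 0) ` {..<length as}"
 shows "qsp K V fscale \<beta>" "obas V \<beta> B" "norms \<beta> B = mset as"
proof -
 have asK: "as ! i \<in> K" "as ! i ~= 0" if "i < length as" for i
 using that assms(1) nth_mem[OF that] by blast+
 show "qsp K V fscale \<beta>"
 by unfold_locales
 (auto simp: V_def \<beta>_def fscale_def algebra_simps sum.distrib sum_distrib_left asK two intro!: sum ext)
 define u :: "nat => nat => 'f" where "u = (%i j. if j = i then 1 else 0)"
 have \<beta>u: "\<beta> x (u i) = as ! i * x i" if "i < length as" for x i
 unfolding \<beta>_def using that by (subst sum.remove[of _ i]) (auto simp: u_def intro!: sum.neutral)
 have f: "orth V \<beta> (u ` {..<length as})" "norms \<beta> (u ` {..<length as}) = image_mset ((!) as) (mset_set {..<length as})"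
 proof -
 have 1: "u i \<in> V" if "i \<in> {..<length as}" for i using that by (auto simp: u_def V_def)
 have 2: "\<beta> (u i) (u i) = as ! i & as ! i ~= 0" if "i \<in> {..<length as}" for i
 using that asK by (auto simp: \<beta>u) (auto simp: u_def)
 have 3: "\<beta> (u i) (u j) = 0" if "i \<in> {..<length as}" "j \<in> {..<length as}" "i ~= j" for i j
 using that by (auto simp: \<beta>u) (auto simp: u_def)
 show "orth V \<beta> (u ` {..<length as})"
 "norms \<beta> (u ` {..<length as}) = image_mset ((!) as) (mset_set {..<length as})"
 using orth_family[of "{..<length as}" u V \<beta> "(!) as", OF _ 1 2 3] by auto
 qed
 have Bu: "B = u ` {..<length as}" by (simp add: B_def u_def)
 show "norms \<beta> B = mset as" unfolding Bu f(2)
 by (metis map_nth mset_map mset_upt lessThan_atLeast0)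
 have "x = 0" if "x \<in> V" "\<forall>b\<in>B. \<beta> x b = 0" for x
 proof
 fix i show "x i = 0 i"
 using that asK[of i] \<beta>u[of i x] by (cases "i < length as") (auto simp: Bu V_def)
 qed
 thus "obas V \<beta> B" using f(1) Bu by (simp add: obas_def)
qed

text \<open>Both multisets are realised by bases of one space, with vectors \<open>u\<close> and
  \<open>v\<close> of the same norm \<open>a\<close>. The norms of \<open>u - v\<close> and
  \<open>u + v\<close> add up to \<open>4 a \<noteq> 0\<close>, so for some sign \<epsilon> the
  reflection in \<open>u - \<epsilon> v\<close> exists. It takes \<open>\<epsilon> v\<close> to
  \<open>u\<close>, and vectors orthogonal to \<open>v\<close> to vectors orthogonal to
  \<open>u\<close>.\<close>

lemma deq_cancel1:
 assumes "deq K (add_mset a M) (add_mset a N)" and aM: "set_mset (add_mset a M) <= K - {0}"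
 shows "deq K M N"
proof -
 obtain as where as: "mset as = add_mset a M" by (meson ex_mset)
 have "set as = set_mset (add_mset a M)" using as by (metis set_mset_mset)
 hence s: "set as <= K - {0}" using aM by simp
 obtain V :: "(nat => 'f) set" and \<beta> B where q: "qsp K V fscale \<beta>" and B: "obas V \<beta> B" "norms \<beta> B = add_mset a M"
 using standard_space[OF s] unfolding as by blast
 interpret q: qsp K V fscale \<beta> by fact
 obtain C where C: "obas V \<beta> C" "norms \<beta> C = add_mset a N" using q.obas_transport B assms(1) by metis
 obtain u where u: "u \<in> B" "\<beta> u u = a" "norms \<beta> (B - {u}) = M"
 using q.norms_split B by (metis obas_def)
 obtain v where v: "v \<in> C" "\<beta> v v = a" "norms \<beta> (C - {v}) = N"
 using q.norms_split C by (metis obas_def)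
 have [simp]: "u \<in> V" "v \<in> V" using u v B C by (auto simp: obas_def orth_def)
 have a: "a \<in> K" "a ~= 0" using aM by auto
 obtain \<epsilon> :: 'f where eps: "\<epsilon> = 1 | \<epsilon> = -1" and e0: "\<beta> (u - fscale \<epsilon> v) (u - fscale \<epsilon> v) ~= 0"
 proof -
 have "\<beta> (u - fscale 1 v) (u - fscale 1 v) + \<beta> (u - fscale (-1) v) (u - fscale (-1) v) = 2 * 2 * a"
 using u v by (simp add: algebra_simps)
 moreover have "2 * 2 * a ~= 0" using a two by (simp only: mult_eq_0_iff) simp
 ultimately have "\<beta> (u - fscale 1 v) (u - fscale 1 v) ~= 0 | \<beta> (u - fscale (-1) v) (u - fscale (-1) v) ~= 0"
 by (metis add_0)
 thus ?thesis using that by blast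
 qed
 have [simp]: "\<epsilon> \<in> K" "\<epsilon> * \<epsilon> = 1" using eps by auto
 define d where "d = u - fscale \<epsilon> v"
 define \<tau> where "\<tau> x = x - fscale (2 * \<beta> x d / \<beta> d d) d" for x
 have [simp]: "d \<in> V" by (simp add: d_def)
 have dd: "\<beta> d d ~= 0" using e0 by (simp add: d_def)
 have cK [simp]: "2 * \<beta> x d / \<beta> d d \<in> K" if "x \<in> V" for x using that by simp
 have \<tau>V: "\<tau> x \<in> V" if "x \<in> V" for x using that by (simp add: \<tau>_def del: divide)
 have \<tau>iso: "\<beta> (\<tau> x) (\<tau> y) = \<beta> x y" if "x \<in> V" "y \<in> V" for x y
 proof -
 have "\<beta> (\<tau> x) (\<tau> y) = \<beta> x y - 2 * \<beta> y d / \<beta> d d * \<beta> x d - 2 * \<beta> x d / \<beta> d d * (\<beta> d y - 2 * \<beta> y d / \<beta> d d * \<beta> d d)"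
 proof -
 have "\<beta> (x - fscale s d) (y - fscale t d) = \<beta> x y - t * \<beta> x d - s * (\<beta> d y - t * \<beta> d d)"
 if "s \<in> K" "t \<in> K" for s t using that \<open>x \<in> V\<close> \<open>y \<in> V\<close> by (simp add: algebra_simps)
 thus ?thesis unfolding \<tau>_def using cK that by blast
 qed
 also have "\<dots> = \<beta> x y"
 proof -
 have sy: "\<beta> d y = \<beta> y d" using that by (intro q.\<beta>_sym) auto
 have "c - 2 * q / D * p - 2 * p / D * (q - 2 * q / D * D) = c" if "D ~= 0" for c p q D :: 'f
 proof -
 have "q - 2 * q / D * D = - q" using that by simp
 thus ?thesis by simp
 qed
 thus ?thesis unfolding sy using dd by blast
 qed
 finally show ?thesis .
 qed
 have \<tau>v: "\<tau> (fscale \<epsilon> v) = u"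
 proof -
 have "2 * \<beta> (fscale \<epsilon> v) d = - \<beta> d d"
 using u v q.\<beta>_sym[of v u] by (simp add: d_def algebra_simps)
 hence "2 * \<beta> (fscale \<epsilon> v) d / \<beta> d d = -1" using dd by (simp add: field_simps)
 thus ?thesis unfolding \<tau>_def by (simp add: q.sc_minus) (simp add: d_def)
 qed
 have u\<tau>: "\<beta> (\<tau> x) u = \<epsilon> * \<beta> x v" if "x \<in> V" for x
 using \<tau>iso[OF that, of "fscale \<epsilon> v"] that by (simp add: \<tau>v)
 let ?W = "{x \<in> V. \<beta> x u = 0}"
 have oC: "orth V \<beta> (C - {v})" using C(1) by (auto simp: obas_def orth_def)
 have uw: "orth ?W \<beta> (\<tau> ` (C - {v}))" "card (\<tau> ` (C - {v})) = card (C - {v})"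
 "norms \<beta> (\<tau> ` (C - {v})) = image_mset ((*) 1) (norms \<beta> (C - {v}))"
 proof -
 have 1: "\<tau> x \<in> ?W" if "x \<in> C - {v}" for x
 using that u\<tau>[of x] \<tau>V[of x] C(1) v(1) by (auto simp: obas_def orth_def)
 have 2: "\<beta> (\<tau> x) (\<tau> y) = 1 * \<beta> x y" if "x \<in> C - {v}" "y \<in> C - {v}" for x y
 using that \<tau>iso[of x y] C(1) by (auto simp: obas_def orth_def)
 show "orth ?W \<beta> (\<tau> ` (C - {v}))" "card (\<tau> ` (C - {v})) = card (C - {v})"
 "norms \<beta> (\<tau> ` (C - {v})) = image_mset ((*) 1) (norms \<beta> (C - {v}))"
 using orth_image[where T=\<tau> and c=1 and \<beta>'=\<beta> and V'="?W", OF oC _ 1 2] by auto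
 qed
 interpret W: qsp K ?W fscale \<beta> by (rule q.qsp_perp) simp
 have bB: "obas ?W \<beta> (B - {u})" using q.obas_perp[OF B(1) u(1)] .
 have "card B = card C" using q.obas_unique B C by blast
 hence "card (B - {u}) = card (\<tau> ` (C - {v}))" using u v uw by simp
 hence "obas ?W \<beta> (\<tau> ` (C - {v}))" using W.orth_card_obas[OF uw(1) bB] by simp
 from W.obas_unique[OF bB this] show ?thesis using uw u v by simp
qed

lemma deq_cancel:
 assumes "deq K (P + M) (P + N)" "set_mset (P + M) <= K - {0}"
 shows "deq K M N"
 using assms
proof (induction P)
 case (add a P)
 thus ?case using deq_cancel1[of a "P + M" "P + N"] by simp
qed simp

end

section \<open>Groups of field automorphisms and descent\<close>

definition fixf :: "('s => 's) set => 's set" where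
 "fixf H = {x. \<forall>\<mu>\<in>H. \<mu> x = x}"

locale aut_group =
 fixes H :: "('s::field => 's) set"
 assumes id_in [simp]: "id \<in> H" and comp_in [simp]: "\<mu> \<in> H ==> \<delta> \<in> H ==> \<mu> \<circ> \<delta> \<in> H"
 and inv_ex: "\<mu> \<in> H ==> \<exists>\<delta>\<in>H. \<delta> \<circ> \<mu> = id & \<mu> \<circ> \<delta> = id"
 and hom_add: "\<mu> \<in> H ==> \<mu> (x + y) = \<mu> x + \<mu> y"
 and hom_mult: "\<mu> \<in> H ==> \<mu> (x * y) = \<mu> x * \<mu> y"
 and two_neq: "(2::'s) ~= 0"
begin

lemma invE:
 assumes "\<mu> \<in> H"
 obtains \<delta> where "\<delta> \<in> H" "\<delta> \<circ> \<mu> = id" "\<mu> \<circ> \<delta> = id" "!!x. \<delta> (\<mu> x) = x" "!!x. \<mu> (\<delta> x) = x"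
 using inv_ex[OF assms] by (metis comp_apply id_apply)

lemma hom_inj: "\<mu> \<in> H ==> \<mu> x = \<mu> y \<longleftrightarrow> x = y"
 by (metis invE)

lemma hom_zero: "\<mu> \<in> H ==> \<mu> 0 = 0"
 using hom_add[of \<mu> 0 0] by (metis add_0 add_cancel_right_right)

lemma hom_one: "\<mu> \<in> H ==> \<mu> 1 = 1"
 using hom_mult[of \<mu> 1 1] hom_inj[of \<mu> 1 0] hom_zero[of \<mu>] by simp

lemma hom_neg: "\<mu> \<in> H ==> \<mu> (- x) = - \<mu> x"
 using hom_add[of \<mu> x "- x"] by (simp add: hom_zero eq_neg_iff_add_eq_0 add.commute)

lemma hom_diff: "\<mu> \<in> H ==> \<mu> (x - y) = \<mu> x - \<mu> y"
 using hom_add[of \<mu> x "- y"] by (simp add: hom_neg)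

lemma hom_inverse: "\<mu> \<in> H ==> \<mu> (inverse x) = inverse (\<mu> x)"
 using hom_mult[of \<mu> x "inverse x"]
 by (cases "x = 0") (auto simp: hom_zero hom_one intro!: inverse_unique[symmetric])

lemma hom_divide: "\<mu> \<in> H ==> \<mu> (x / y) = \<mu> x / \<mu> y"
 by (simp add: divide_inverse hom_mult hom_inverse)

lemma hom_sum: "\<mu> \<in> H ==> \<mu> (sum f I) = (\<Sum>i\<in>I. \<mu> (f i))"
 by (induction I rule: infinite_finite_induct) (auto simp: hom_zero hom_add)

lemma hom_prod: "\<mu> \<in> H ==> \<mu> (prod f I) = (\<Prod>i\<in>I. \<mu> (f i))"
 by (induction I rule: infinite_finite_induct) (auto simp: hom_one hom_mult)

lemma hom_power: "\<mu> \<in> H ==> \<mu> (x ^ n) = \<mu> x ^ n"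
 by (induction n) (auto simp: hom_one hom_mult)

lemma hom_of_nat: "\<mu> \<in> H ==> \<mu> (of_nat n) = of_nat n"
 by (induction n) (auto simp: hom_one hom_add hom_zero)

lemma hom_of_int: "\<mu> \<in> H ==> \<mu> (of_int n) = of_int n"
 by (cases n) (simp_all add: hom_neg hom_of_nat del: of_nat_Suc)

lemma hom_numeral: "\<mu> \<in> H ==> \<mu> (numeral n) = numeral n"
 using hom_of_nat[of \<mu> "numeral n"] by simp

lemmas hom_simps = hom_zero hom_one hom_add hom_mult hom_neg hom_diff hom_inverse hom_divide
 hom_power hom_of_int hom_numeral

sublocale fx: subfld "fixf H"
 by unfold_locales (auto simp: fixf_def hom_simps two_neq)

text \<open>The action \<pi> is arbitrary because stabilisers of a field element, of a line, of an
  index and of a partition are all needed.\<close>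

lemma stab_group:
 assumes "!!\<mu> \<delta>. \<mu> \<in> H ==> \<delta> \<in> H ==> \<pi> (\<mu> \<circ> \<delta>) x = \<pi> \<mu> (\<pi> \<delta> x)" "\<pi> id x = x"
 shows "aut_group {\<mu> \<in> H. \<pi> \<mu> x = x}"
proof unfold_locales
 show "\<exists>\<delta>\<in>{\<mu> \<in> H. \<pi> \<mu> x = x}. \<delta> \<circ> \<mu> = id & \<mu> \<circ> \<delta> = id" if g: "\<mu> \<in> {\<mu> \<in> H. \<pi> \<mu> x = x}" for \<mu>
 proof -
 obtain \<delta> where d: "\<delta> \<in> H" "\<delta> \<circ> \<mu> = id" "\<mu> \<circ> \<delta> = id" using g inv_ex by blast
 hence "\<pi> \<delta> x = x" using assms(1)[of \<delta> \<mu>] assms(2) g by simp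
 thus ?thesis using d by auto
 qed
qed (use assms in \<open>auto simp: hom_simps two_neq\<close>)

end

section \<open>Functions twisted by a signed permutation action, and Galois descent for them\<close>

definition wbil :: "'i set => ('i => 's) => ('i => 's::field) => ('i => 's) => 's" where
 "wbil X w f g = (\<Sum>x\<in>X. w x * f x * g x)"

abbreviation bil :: "'i set => ('i => 's::field) => ('i => 's) => 's" where
 "bil X \<equiv> wbil X (%_. 1)"

definition fset :: "'i set => ('i => 's::zero) set" where
 "fset X = {f. \<forall>x. x \<notin> X --> f x = 0}"

definition udelta :: "'i => 'i => 's::zero_neq_one" where
 "udelta x = (%y. if y = x then 1 else 0)"

lemma wbil_udelta: "finite X ==> x \<in> X ==> wbil X w f (udelta x) = w x * f x"
 unfolding wbil_def udelta_def by (subst sum.remove[of _ x]) (auto intro!: sum.neutral)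

lemma wbil_sym: "wbil X w f g = wbil X w g f"
 by (auto simp: wbil_def algebra_simps intro!: sum.cong)

text \<open>The weights are \<open>inverse (D t)\<close> for the transfer form in
  \<open>odd_transfer\<close> and 1 elsewhere. Comparison with this space bounds the orthogonal
  families of a twist.\<close>

lemma full_space:
 assumes "finite X" "!!x. x \<in> X ==> w x ~= 0" "(2::'s::field) ~= 0"
 shows "qsp UNIV (fset X :: ('i => 's) set) fscale (wbil X w)"
 "obas (fset X) (wbil X w) ((udelta :: 'i => 'i => 's) ` X)"
 "card ((udelta :: 'i => 'i => 's) ` X) = card X"
proof -
 show "qsp UNIV (fset X :: ('i => 's) set) fscale (wbil X w)"
 using assms(3) by unfold_locales
 (auto simp: fset_def wbil_def fscale_def algebra_simps sum.distrib sum_distrib_left)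
 note ud = wbil_udelta[OF assms(1)]
 have o: "orth (fset X) (wbil X w) ((udelta :: 'i => 'i => 's) ` X)"
 "card ((udelta :: 'i => 'i => 's) ` X) = card X"
 proof -
 have 1: "udelta x \<in> fset X" if "x \<in> X" for x using that by (auto simp: udelta_def fset_def)
 have 2: "wbil X w (udelta x) (udelta x) = w x & w x ~= 0" if "x \<in> X" for x
 using that assms(2) by (simp add: ud) (simp add: udelta_def)
 have 3: "wbil X w (udelta x) (udelta y) = 0" if "x \<in> X" "y \<in> X" "x ~= y" for x y
 using that by (simp add: ud) (simp add: udelta_def)
 show "orth (fset X) (wbil X w) ((udelta :: 'i => 'i => 's) ` X)"
 "card ((udelta :: 'i => 'i => 's) ` X) = card X"
 using orth_family[of X udelta "fset X" "wbil X w" w, OF assms(1) 1 2 3] by auto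
 qed
 thus "card ((udelta :: 'i => 'i => 's) ` X) = card X" by simp
 have "f = 0" if "f \<in> fset X" "\<forall>b\<in>udelta ` X. wbil X w f b = 0" for f :: "'i => 's"
 using that assms(2) by (auto simp: ud fset_def fun_eq_iff)
 thus "obas (fset X) (wbil X w) ((udelta :: 'i => 'i => 's) ` X)"
 using o by (simp add: obas_def)
qed

text \<open>Dedekind's independence of characters, on a multiplicative monoid \<open>M\<close> only:
  in the descent \<open>c\<close> is restricted to elements on which automorphisms that agree on
  \<open>S\<close> agree.\<close>

lemma characters_independent:
 fixes \<sigma> :: "'t => 's::field => 's"
 assumes "finite R" "1 \<in> M" "!!c d. c \<in> M ==> d \<in> M ==> c * d \<in> M"
 and "!!\<tau> c d. \<tau> \<in> R ==> c \<in> M ==> d \<in> M ==> \<sigma> \<tau> (c * d) = \<sigma> \<tau> c * \<sigma> \<tau> d"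
 and "!!\<tau>. \<tau> \<in> R ==> \<sigma> \<tau> 1 = 1"
 and "!!\<tau> \<tau>'. \<tau> \<in> R ==> \<tau>' \<in> R ==> \<tau> ~= \<tau>' ==> \<exists>c\<in>M. \<sigma> \<tau> c ~= \<sigma> \<tau>' c"
 and "!!c. c \<in> M ==> (\<Sum>\<tau>\<in>R. a \<tau> * \<sigma> \<tau> c) = 0"
 shows "\<forall>\<tau>\<in>R. a \<tau> = 0"
 using assms(1,4-)
proof (induction R arbitrary: a rule: finite_induct)
 case (insert t R)
 have "\<forall>\<tau>\<in>R. a \<tau> * (\<sigma> \<tau> d - \<sigma> t d) = 0" if d: "d \<in> M" for d
 proof (rule insert.IH)
 fix c assume c: "c \<in> M"
 have "(\<Sum>\<tau>\<in>insert t R. a \<tau> * \<sigma> \<tau> (c * d)) - \<sigma> t d * (\<Sum>\<tau>\<in>insert t R. a \<tau> * \<sigma> \<tau> c) = 0"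
 using insert.prems(4)[OF c] insert.prems(4)[OF assms(3)[OF c d]] by simp
 moreover have "(\<Sum>\<tau>\<in>R. a \<tau> * \<sigma> \<tau> (c * d)) = (\<Sum>\<tau>\<in>R. a \<tau> * (\<sigma> \<tau> c * \<sigma> \<tau> d))"
 using insert.prems(1)[OF _ c d] by (intro sum.cong) auto
 ultimately show "(\<Sum>\<tau>\<in>R. a \<tau> * (\<sigma> \<tau> d - \<sigma> t d) * \<sigma> \<tau> c) = 0"
 using insert.hyps insert.prems(1)[of t c d] c d
 by (simp add: algebra_simps sum_subtractf sum_distrib_left)
 qed (use insert.prems in auto)
 moreover have "\<exists>c\<in>M. \<sigma> \<tau> c ~= \<sigma> t c" if "\<tau> \<in> R" for \<tau>
 using insert.prems(3)[of \<tau> t] that insert.hyps by auto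
 ultimately have 0: "\<forall>\<tau>\<in>R. a \<tau> = 0"
 by (metis eq_iff_diff_eq_0 mult_eq_0_iff)
 have "a t * \<sigma> t 1 = 0" using insert.prems(4)[OF assms(2)] insert.hyps 0 by simp
 thus ?case using 0 insert.prems(2)[of t] by simp
qed simp

text \<open>The fixed points of the semilinear action on a signed permutation module. For \<epsilon>
  = 1 this is the etale algebra belonging to the set \<open>X\<close> with its action, and
  \<open>bil X\<close> is its trace form.\<close>

definition tw :: "('s => 's) set => 'i set => (('s => 's) => 'i => 'i) => (('s => 's) => 'i => 's) => ('i => 's::field) set"
 where "tw H X \<rho> \<epsilon> = {f \<in> fset X. \<forall>\<mu>\<in>H. \<forall>x\<in>X. f (\<rho> \<mu> x) = \<epsilon> \<mu> x * \<mu> (f x)}"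

text \<open>The finite set \<open>S\<close> expresses continuity: an automorphism fixing \<open>S\<close> pointwise acts trivially.\<close>

locale gal = aut_group H for H :: "('s::field => 's) set" +
 fixes S :: "'s set"
 assumes finS: "finite S" and S_in: "\<mu> \<in> H ==> s \<in> S ==> \<mu> s \<in> S"

text \<open>The signs \<epsilon> form a cocycle over the permutation action \<rho>. The axiom
  \<open>triv\<close> makes the action depend only on the restriction of an automorphism to
  \<open>S\<close>.\<close>

locale sact = gal H S for H :: "('s::field => 's) set" and S +
 fixes X :: "'i set" and \<rho> :: "('s => 's) => 'i => 'i" and \<epsilon> :: "('s => 's) => 'i => 's"
 assumes finX: "finite X" and \<rho>_in: "\<mu> \<in> H ==> x \<in> X ==> \<rho> \<mu> x \<in> X"
 and \<rho>_comp: "\<mu> \<in> H ==> \<delta> \<in> H ==> x \<in> X ==> \<rho> (\<mu> \<circ> \<delta>) x = \<rho> \<mu> (\<rho> \<delta> x)"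
 and \<epsilon>_comp: "\<mu> \<in> H ==> \<delta> \<in> H ==> x \<in> X ==> \<epsilon> (\<mu> \<circ> \<delta>) x = \<epsilon> \<mu> (\<rho> \<delta> x) * \<epsilon> \<delta> x"
 and \<epsilon>_sign: "\<mu> \<in> H ==> x \<in> X ==> \<epsilon> \<mu> x = 1 | \<epsilon> \<mu> x = -1"
 and triv: "\<mu> \<in> H ==> (!!s. s \<in> S ==> \<mu> s = s) ==> x \<in> X ==> \<rho> \<mu> x = x & \<epsilon> \<mu> x = 1"
begin

abbreviation T where "T \<equiv> tw H X \<rho> \<epsilon>"

lemma \<rho>_id: "x \<in> X ==> \<rho> id x = x" "x \<in> X ==> \<epsilon> id x = 1"
 using triv[of id x] by auto

lemma \<rho>_bij: assumes "\<mu> \<in> H" shows "bij_betw (\<rho> \<mu>) X X"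
proof -
 obtain \<delta> where d: "\<delta> \<in> H" "\<delta> \<circ> \<mu> = id" "\<mu> \<circ> \<delta> = id" using inv_ex assms by blast
 have "\<rho> \<delta> (\<rho> \<mu> x) = x" "\<rho> \<mu> (\<rho> \<delta> x) = x" if "x \<in> X" for x
 using \<rho>_comp[of \<delta> \<mu> x] \<rho>_comp[of \<mu> \<delta> x] d assms that \<rho>_id by auto
 thus ?thesis using assms d by (intro bij_betw_byWitness[where f' = "\<rho> \<delta>"]) (auto simp: \<rho>_in)
qed

lemma \<epsilon>_sq: "\<mu> \<in> H ==> x \<in> X ==> \<epsilon> \<mu> x * \<epsilon> \<mu> x = 1"
 using \<epsilon>_sign by fastforce

lemma \<epsilon>_hom: "\<mu> \<in> H ==> \<delta> \<in> H ==> x \<in> X ==> \<delta> (\<epsilon> \<mu> x) = \<epsilon> \<mu> x"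
 using \<epsilon>_sign[of \<mu> x] by (auto simp: hom_simps)

lemma bil_fixed:
 assumes "f \<in> T" "g \<in> T" shows "bil X f g \<in> fixf H"
proof -
 have "\<mu> (bil X f g) = bil X f g" if g: "\<mu> \<in> H" for \<mu>
 proof -
 have "bil X f g = (\<Sum>x\<in>X. f (\<rho> \<mu> x) * g (\<rho> \<mu> x))"
 unfolding wbil_def using sum.reindex_bij_betw[OF \<rho>_bij[OF g], of "%x. f x * g x"] by simp
 also have "\<dots> = (\<Sum>x\<in>X. (\<epsilon> \<mu> x * \<epsilon> \<mu> x) * (\<mu> (f x) * \<mu> (g x)))"
 using assms g by (intro sum.cong) (auto simp: tw_def)
 also have "\<dots> = \<mu> (bil X f g)"
 unfolding wbil_def using g by (auto simp: hom_sum hom_simps \<epsilon>_sq intro!: sum.cong)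
 finally show ?thesis by simp
 qed
 thus ?thesis by (simp add: fixf_def)
qed

sublocale q: qsp "fixf H" T fscale "bil X"
 by unfold_locales
 (auto simp: wbil_sym bil_fixed,
 auto simp: tw_def fset_def fscale_def hom_simps fixf_def wbil_def algebra_simps sum.distrib sum_distrib_left)

lemmas full = full_space[OF finX, of "%_. 1", simplified, OF two_neq]

lemma tw_sub: "T <= fset X" by (auto simp: tw_def)

text \<open>\<open>H\<close> may be infinite. Averages over it are replaced by sums over the
  finitely many restrictions to \<open>S\<close>, each represented by one automorphism.\<close>

definition rep :: "('s => 's) => 's => 's" where
 "rep \<tau> = (SOME \<mu>. \<mu> \<in> H & restrict \<mu> S = \<tau>)"

abbreviation reps where "reps \<equiv> (%\<mu>. restrict \<mu> S) ` H"

lemma rep: "\<tau> \<in> reps ==> rep \<tau> \<in> H & restrict (rep \<tau>) S = \<tau>"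
 unfolding rep_def using someI_ex[of "%\<mu>. \<mu> \<in> H & restrict \<mu> S = \<tau>"] by blast

lemma fin_reps: "finite reps"
proof (rule finite_subset)
 show "reps <= S \<rightarrow>\<^sub>E S" using S_in by auto
 show "finite (S \<rightarrow>\<^sub>E S)" using finS by (simp add: finite_PiE)
qed

lemma respects:
 assumes "\<mu> \<in> H" "\<delta> \<in> H" "!!s. s \<in> S ==> \<mu> s = \<delta> s"
 shows "x \<in> X ==> \<rho> \<mu> x = \<rho> \<delta> x" "x \<in> X ==> \<epsilon> \<mu> x = \<epsilon> \<delta> x"
 "(!!\<sigma>. \<sigma> \<in> H ==> (!!s. s \<in> S ==> \<sigma> s = s) ==> \<sigma> c = c) ==> \<mu> c = \<delta> c"
proof -
 obtain \<eta> where e: "\<eta> \<in> H" "\<delta> \<circ> \<eta> = id" "!!x. \<eta> (\<delta> x) = x" "!!x. \<delta> (\<eta> x) = x" using invE[OF assms(2)] by metis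
 define \<sigma> where "\<sigma> = \<eta> \<circ> \<mu>"
 have g: "\<mu> = \<delta> \<circ> \<sigma>" using e by (simp add: \<sigma>_def fun_eq_iff)
 have t: "\<sigma> \<in> H" "!!s. s \<in> S ==> \<sigma> s = s" using e assms by (auto simp: \<sigma>_def)
 show "\<rho> \<mu> x = \<rho> \<delta> x" if "x \<in> X" using triv[OF t that] \<rho>_comp[OF assms(2) t(1) that] g by simp
 show "\<epsilon> \<mu> x = \<epsilon> \<delta> x" if "x \<in> X" using triv[OF t that] \<epsilon>_comp[OF assms(2) t(1) that] g by simp
 show "\<mu> c = \<delta> c" if "!!\<sigma>. \<sigma> \<in> H ==> (!!s. s \<in> S ==> \<sigma> s = s) ==> \<sigma> c = c"
 using that[OF t] g by (metis comp_apply)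
qed

text \<open>The average is invariant because left translation by \<mu> is a well defined permutation
  of the restrictions to \<open>S\<close>.\<close>

lemma sum_reps:
 assumes g: "\<mu> \<in> H" and \<Phi>: "!!\<mu> \<delta>. \<mu> \<in> H ==> \<delta> \<in> H ==> (!!s. s \<in> S ==> \<mu> s = \<delta> s) ==> \<Phi> \<mu> = \<Phi> \<delta>"
 shows "(\<Sum>\<tau>\<in>reps. \<Phi> (\<mu> \<circ> rep \<tau>)) = (\<Sum>\<tau>\<in>reps. \<Phi> (rep \<tau>) :: 'a::comm_monoid_add)"
proof -
 obtain \<delta> where d: "\<delta> \<in> H" "!!x. \<delta> (\<mu> x) = x" "!!x. \<mu> (\<delta> x) = x" using invE[OF g] by metis
 define m where "m \<mu> \<tau> = restrict (\<mu> \<circ> rep \<tau>) S" for \<mu> :: "'s => 's" and \<tau>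
 have repS: "rep \<tau> s = \<tau> s" if "\<tau> \<in> reps" "s \<in> S" for \<tau> s
 using rep[OF that(1)] that(2) by (metis restrict_apply')
 have mr: "m \<mu> \<tau> \<in> reps" if "\<mu> \<in> H" "\<tau> \<in> reps" for \<mu> \<tau>
 using that rep[of \<tau>] by (auto simp: m_def intro!: imageI)
 have mm: "m \<delta> (m \<mu> \<tau>) = \<tau>" if "\<tau> \<in> reps" "\<mu> \<in> H" "!!x. \<delta> (\<mu> x) = x" for \<mu> \<delta> \<tau>
 proof
 fix s
 show "m \<delta> (m \<mu> \<tau>) s = \<tau> s"
 proof (cases "s \<in> S")
 case True
 thus ?thesis using repS[OF mr[OF that(2,1)] True] repS[OF that(1) True] that(3)
 by (simp add: m_def)
 next
 case False
 thus ?thesis using that(1) by (auto simp: m_def)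
 qed
 qed
 have "bij_betw (m \<mu>) reps reps"
 using mm[of _ \<mu> \<delta>] mm[of _ \<delta> \<mu>] mr[of \<mu>] mr[of \<delta>] g d
 by (intro bij_betw_byWitness[where f' = "m \<delta>"]) auto
 hence "(\<Sum>\<tau>\<in>reps. \<Phi> (rep \<tau>)) = (\<Sum>\<tau>\<in>reps. \<Phi> (rep (m \<mu> \<tau>)))"
 by (rule sum.reindex_bij_betw[symmetric])
 also have "\<dots> = (\<Sum>\<tau>\<in>reps. \<Phi> (\<mu> \<circ> rep \<tau>))"
 using g rep mr[OF g] repS by (intro sum.cong \<Phi>) (auto simp: m_def)
 finally show ?thesis by simp
qed

text \<open>Averages \<open>\<Sum> \<mu>(c) \<mu>(e\<^sub>x)\<close> lie in the twist, and they separate coordinates because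
  distinct automorphisms are linearly independent.\<close>

lemma descent_nondegenerate:
 assumes "f \<in> fset X" and 0: "!!g. g \<in> T ==> bil X f g = 0"
 shows "f = 0"
proof -
 define M where "M = {c. \<forall>\<mu>\<in>H. (\<forall>s\<in>S. \<mu> s = s) --> \<mu> c = c}"
 have M: "\<mu> c = c" if "c \<in> M" "\<mu> \<in> H" "!!s. s \<in> S ==> \<mu> s = s" for \<mu> c using that by (auto simp: M_def)
 have "f x0 = 0" if x0: "x0 \<in> X" for x0
 proof -
 have rX: "\<rho> (rep \<tau>) x0 \<in> X" if "\<tau> \<in> reps" for \<tau> using rep that x0 \<rho>_in by blast
 have "\<forall>\<tau>\<in>reps. f (\<rho> (rep \<tau>) x0) * \<epsilon> (rep \<tau>) x0 = 0"
 proof (rule characters_independent[where \<sigma> = rep and M = M])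
 show "1 \<in> M" by (auto simp: M_def hom_simps)
 show "c * d \<in> M" if "c \<in> M" "d \<in> M" for c d using that by (auto simp: M_def hom_simps)
 fix \<tau> assume t: "\<tau> \<in> reps"
 show "rep \<tau> (c * d) = rep \<tau> c * rep \<tau> d" "rep \<tau> 1 = 1" for c d using rep[OF t] by (auto simp: hom_simps)
 fix \<tau>' assume "\<tau>' \<in> reps" "\<tau> ~= \<tau>'"
 hence "restrict (rep \<tau>) S ~= restrict (rep \<tau>') S" using rep[OF t] rep[of \<tau>'] by simp
 hence "\<exists>s\<in>S. rep \<tau> s ~= rep \<tau>' s" by (meson restrict_ext)
 thus "\<exists>c\<in>M. rep \<tau> c ~= rep \<tau>' c" by (auto simp: M_def)
 next
 fix c assume c: "c \<in> M"
 \<comment> \<open>\<open>g\<close> is the average of \<open>c\<close> times the unit vector at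
   \<open>x0\<close>. Hence \<open>bil X f g\<close> is a linear combination of automorphisms
   evaluated at \<open>c\<close>, to which independence applies.\<close>
 define \<Phi> where "\<Phi> y \<mu> = (if \<rho> \<mu> x0 = y then \<epsilon> \<mu> x0 * \<mu> c else 0)" for y \<mu>
 define g where "g y = (\<Sum>\<tau>\<in>reps. \<Phi> y (rep \<tau>))" for y
 have "g \<in> T" unfolding tw_def fset_def
 proof (intro CollectI conjI allI impI ballI)
 show "g y = 0" if "y \<notin> X" for y
 unfolding g_def using that rX by (intro sum.neutral) (auto simp: \<Phi>_def)
 fix \<mu> y assume gy: "\<mu> \<in> H" "y \<in> X"
 have resp: "\<Phi> (\<rho> \<mu> y) \<sigma> = \<Phi> (\<rho> \<mu> y) \<delta>" if "\<sigma> \<in> H" "\<delta> \<in> H" "!!s. s \<in> S ==> \<sigma> s = \<delta> s" for \<sigma> \<delta>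
 unfolding \<Phi>_def using respects(1,2)[OF that x0] respects(3)[OF that, of c] M[OF c] by simp
 have "g (\<rho> \<mu> y) = (\<Sum>\<tau>\<in>reps. \<Phi> (\<rho> \<mu> y) (\<mu> \<circ> rep \<tau>))"
 unfolding g_def by (rule sum_reps[OF gy(1) resp, symmetric])
 also have "\<dots> = (\<Sum>\<tau>\<in>reps. \<epsilon> \<mu> y * \<mu> (\<Phi> y (rep \<tau>)))"
 proof (rule sum.cong[OF HOL.refl])
 fix \<tau> assume t: "\<tau> \<in> reps"
 have "\<rho> \<mu> (\<rho> (rep \<tau>) x0) = \<rho> \<mu> y \<longleftrightarrow> \<rho> (rep \<tau>) x0 = y"
 using \<rho>_bij[OF gy(1)] rX[OF t] gy(2) by (metis bij_betw_def inj_onD)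
 thus "\<Phi> (\<rho> \<mu> y) (\<mu> \<circ> rep \<tau>) = \<epsilon> \<mu> y * \<mu> (\<Phi> y (rep \<tau>))"
 using rep[OF t] gy x0 by (auto simp: \<Phi>_def \<rho>_comp \<epsilon>_comp hom_simps \<epsilon>_hom)
 qed
 also have "\<dots> = \<epsilon> \<mu> y * \<mu> (g y)" using gy by (simp add: g_def hom_sum sum_distrib_left)
 finally show "g (\<rho> \<mu> y) = \<epsilon> \<mu> y * \<mu> (g y)" .
 qed
 hence "0 = bil X f g" using 0 by simp
 also have "\<dots> = (\<Sum>y\<in>X. \<Sum>\<tau>\<in>reps. if \<rho> (rep \<tau>) x0 = y then f y * (\<epsilon> (rep \<tau>) x0 * rep \<tau> c) else 0)"
 unfolding wbil_def g_def \<Phi>_def sum_distrib_left by (intro sum.cong) auto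
 also have "\<dots> = (\<Sum>\<tau>\<in>reps. \<Sum>y\<in>X. if \<rho> (rep \<tau>) x0 = y then f y * (\<epsilon> (rep \<tau>) x0 * rep \<tau> c) else 0)"
 by (rule sum.swap)
 also have "\<dots> = (\<Sum>\<tau>\<in>reps. f (\<rho> (rep \<tau>) x0) * \<epsilon> (rep \<tau>) x0 * rep \<tau> c)"
 using rX finX by (intro sum.cong) (auto simp: mult.assoc)
 finally show "(\<Sum>\<tau>\<in>reps. f (\<rho> (rep \<tau>) x0) * \<epsilon> (rep \<tau>) x0 * rep \<tau> c) = 0" by simp
 qed (use fin_reps in auto)
 \<comment> \<open>The coefficient that belongs to the identity is \<open>f x0\<close>.\<close>
 moreover have t: "restrict id S \<in> reps" by (intro imageI id_in)
 moreover have "\<rho> (rep (restrict id S)) x0 = x0 & \<epsilon> (rep (restrict id S)) x0 = 1"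
 using rep[OF t] x0 by (intro triv) (auto dest: fun_cong, metis restrict_apply' id_apply)
 ultimately show ?thesis by force
 qed
 thus ?thesis using assms(1) by (auto simp: fset_def fun_eq_iff)
qed

lemma tw_orth_full: "orth T (bil X) C ==> orth (fset X) (bil X) C"
 using tw_sub by (auto simp: orth_def)

text \<open>Descent preserves the dimension. A basis \<open>B\<close> of the twist is extended to
  one of the full function space; an added vector would be orthogonal to \<open>B\<close>, hence to
  the twist, hence 0 by \<open>descent_nondegenerate\<close>.\<close>

lemma tw_obas_exists: "\<exists>B. obas T (bil X) B & card B = card X"
proof -
 interpret F: qsp UNIV "fset X :: ('i => 's) set" fscale "bil X" using full by blast
 have "\<exists>B. obas T (bil X) B"
 proof (rule q.obas_exists[where n = "card X"])
 show "\<exists>y\<in>T. bil X x y ~= 0" if "x \<in> T" "x ~= 0" for x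
 using descent_nondegenerate[of x] that tw_sub by blast
 show "card C \<le> card X" if "orth T (bil X) C" for C
 using F.orth_card_le[OF tw_orth_full[OF that] full(2)] full(3) by simp
 qed
 then obtain B where B: "obas T (bil X) B" by blast
 hence oB: "orth (fset X) (bil X) B" using tw_orth_full by (auto simp: obas_def)
 obtain B' where B': "B <= B'" "obas (fset X) (bil X) B'" "card B' = card X"
 using F.obas_extend[OF oB full(2)] full(3) by auto
 have "B' <= B"
 proof
 fix v assume v: "v \<in> B'"
 show "v \<in> B"
 proof (rule ccontr)
 assume nv: "v \<notin> B"
 have vF: "v \<in> fset X" "bil X v v ~= 0" using v B' by (auto simp: obas_def orth_def)
 have vb: "bil X b v = 0" if "b \<in> B" for b
 using that v nv B' unfolding obas_def orth_def by (metis subsetD)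
 have "bil X v g = 0" if g: "g \<in> T" for g
 proof -
 have BF: "b \<in> fset X" if "b \<in> B" for b using oB that by (auto simp: orth_def)
 hence scF: "fscale c b \<in> fset X" if "b \<in> B" for c b using that F.Vsc[of c b] by auto
 have "bil X g v = (\<Sum>b\<in>B. bil X (fscale (bil X g b / bil X b b) b) v)"
 by (subst q.obas_expand[OF B g], subst F.\<beta>_sum) (auto simp: scF vF)
 also have "\<dots> = 0" using vF BF vb by (intro sum.neutral) auto
 finally show ?thesis by (simp add: wbil_sym)
 qed
 hence "v = 0" using descent_nondegenerate vF by blast
 thus False using vF by (simp add: wbil_def)
 qed
 qed
 hence "B' = B" using B' by auto
 thus ?thesis using B B' by auto
qed

lemma tw_orth_obas:
 assumes "orth T (bil X) C" "card C = card X"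
 shows "obas T (bil X) C"
proof -
 interpret F: qsp UNIV "fset X :: ('i => 's) set" fscale "bil X" using full by blast
 have "obas (fset X) (bil X) C"
 using F.orth_card_obas[OF tw_orth_full[OF assms(1)] full(2)] assms(2) full(3) by simp
 thus ?thesis using assms(1) tw_sub by (auto simp: obas_def)
qed

lemma tw_obas_deq:
 assumes "orth T (bil X) C" "card C = card X" "orth T (bil X) D" "card D = card X"
 shows "deq (fixf H) (norms (bil X) C) (norms (bil X) D)"
 using q.obas_unique tw_orth_obas assms by blast

lemma tw_value_exists: "x \<in> X ==> \<exists>f\<in>T. f x ~= 0"
proof (rule ccontr)
 assume x: "x \<in> X" and "~ (\<exists>f\<in>T. f x ~= 0)"
 hence "bil X (udelta x) g = 0" if "g \<in> T" for g
 using that wbil_udelta[OF finX x, of "%_. 1" g] by (simp add: wbil_sym)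
 hence "(udelta x :: 'i => 's) = 0"
 using x by (intro descent_nondegenerate) (auto simp: udelta_def fset_def)
 thus False by (metis udelta_def zero_fun_apply zero_neq_one)
qed

end

section \<open>Extensions of odd degree\<close>

text \<open>Euler's formula for the sums of \<open>t^i / p'(t)\<close> over the roots of a separable
  monic \<open>p\<close>. Removing a root \<open>a\<close> gives
  \<open>E (i+1) X = a E i X + E i (X - {a})\<close>; comparing this for two roots yields
  \<open>E 0 X = 0\<close>, and the recursion gives the rest.\<close>

lemma euler_identity:
 fixes X :: "'s::field set"
 assumes "finite X" "card X = Suc m" "i \<le> m"
 shows "(\<Sum>t\<in>X. t ^ i / (\<Prod>u\<in>X - {t}. t - u)) = (if i = m then 1 else 0)"
proof -
 define E where "E i X = (\<Sum>t\<in>X. t ^ i / (\<Prod>u\<in>X - {t}. t - u))" for i and X :: "'s set"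
 have rec: "E (Suc i) X = a * E i X + E i (X - {a})" if "finite X" "a \<in> X" for i X a
 proof -
 have "E (Suc i) X - a * E i X = (\<Sum>t\<in>X. (t - a) * t ^ i / (\<Prod>u\<in>X - {t}. t - u))"
 by (simp add: E_def sum_distrib_left sum_subtractf[symmetric] diff_divide_distrib[symmetric] algebra_simps)
 also have "\<dots> = (\<Sum>t\<in>X - {a}. (t - a) * t ^ i / (\<Prod>u\<in>X - {t}. t - u))"
 using that by (subst sum.remove[of X a]) auto
 also have "\<dots> = E i (X - {a})" unfolding E_def
 proof (rule sum.cong[OF HOL.refl])
 fix t assume t: "t \<in> X - {a}"
 have "(\<Prod>u\<in>X - {t}. t - u) = (t - a) * (\<Prod>u\<in>X - {t} - {a}. t - u)"
 using that t by (intro prod.remove) auto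
 moreover have "X - {t} - {a} = X - {a} - {t}" by auto
 ultimately show "(t - a) * t ^ i / (\<Prod>u\<in>X - {t}. t - u) = t ^ i / (\<Prod>u\<in>X - {a} - {t}. t - u)"
 using t by simp
 qed
 finally show ?thesis by (simp add: algebra_simps)
 qed
 have "\<forall>X. finite X --> card X = Suc m --> (\<forall>i\<le>m. E i X = (if i = m then 1 else 0))"
 proof (induction m)
 case 0
 show ?case
 proof (intro allI impI)
 fix X :: "'s set" and i :: nat assume a: "finite X" "card X = Suc 0" "i \<le> 0"
 then obtain x where "X = {x}" by (auto simp: card_Suc_eq)
 thus "E i X = (if i = 0 then 1 else 0)" using a by (simp add: E_def)
 qed
 next
 case (Suc m)
 show ?case
 proof (intro allI impI)
 fix X :: "'s set" and i :: nat assume a: "finite X" "card X = Suc (Suc m)" "i \<le> Suc m"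
 have IH: "E j (X - {x}) = (if j = m then 1 else 0)" if "x \<in> X" "j \<le> m" for x j
 using Suc a that by simp
 obtain x y where xy: "x \<in> X" "y \<in> X" "x ~= y"
 using a by (metis card_Suc_eq insertI1 insertI2)
 have "x * E 0 X + E 0 (X - {x}) = y * E 0 X + E 0 (X - {y})" using rec[OF a(1)] xy by metis
 hence "(x - y) * E 0 X = 0" using IH[OF xy(1)] IH[OF xy(2)] by (simp add: algebra_simps)
 hence E0: "E 0 X = 0" using xy by simp
 have "j \<le> Suc m ==> E j X = (if j = Suc m then 1 else 0)" for j
 proof (induction j)
 case (Suc j)
 hence "E j X = 0" "E j (X - {x}) = (if j = m then 1 else 0)" using IH[OF xy(1)] by auto
 thus ?case using rec[OF a(1) xy(1), of j] by simp
 qed (simp add: E0)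
 thus "E i X = (if i = Suc m then 1 else 0)" using a(3) .
 qed
 qed
 thus ?thesis using assms by (auto simp: E_def)
qed

text \<open>A unitriangular Gram matrix is inverted by downward recursion: \<open>h j\<close> is
  corrected by the dual vectors with larger index.\<close>

lemma (in qsp) dual_family:
 fixes r :: nat
 assumes e: "!!i. i < r ==> e i \<in> V" and h: "!!j. j < r ==> h j \<in> V"
 and tri: "!!i j. i \<le> j ==> j < r ==> \<beta> (e i) (h j) = (if i = j then 1 else 0)"
 shows "j < r ==> \<exists>f\<in>V. \<forall>i<r. \<beta> (e i) f = (if i = j then 1 else 0)"
proof (induction "r - j" arbitrary: j rule: less_induct)
 case less
 have "\<forall>l\<in>{j<..<r}. \<exists>f\<in>V. \<forall>i<r. \<beta> (e i) f = (if i = l then 1 else 0)"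
 proof
 fix l assume "l \<in> {j<..<r}"
 thus "\<exists>f\<in>V. \<forall>i<r. \<beta> (e i) f = (if i = l then 1 else 0)"
 using less(1)[of l] less(2) by (metis diff_less_mono2 greaterThanLessThan_iff)
 qed
 then obtain F where F: "!!l. l \<in> {j<..<r} ==> F l \<in> V"
 "!!l i. l \<in> {j<..<r} ==> i < r ==> \<beta> (e i) (F l) = (if i = l then 1 else 0)" by metis
 let ?s = "\<Sum>l\<in>{j<..<r}. sc (\<beta> (e l) (h j)) (F l)"
 have cV: "sc (\<beta> (e l) (h j)) (F l) \<in> V" if "l \<in> {j<..<r}" for l using that F e h less(2) by auto
 hence sV: "?s \<in> V" by (intro V_sum)
 have "\<beta> (e i) (h j - ?s) = (if i = j then 1 else 0)" if i: "i < r" for i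
 proof -
 have "\<beta> (e i) ?s = (\<Sum>l\<in>{j<..<r}. \<beta> (sc (\<beta> (e l) (h j)) (F l)) (e i))"
 using sV e[OF i] cV by (subst \<beta>_sym) (auto intro!: \<beta>_sum)
 also have "\<dots> = (\<Sum>l\<in>{j<..<r}. if i = l then \<beta> (e l) (h j) else 0)"
 using F e h i less(2) by (intro sum.cong) (auto simp: \<beta>_sym[of "F _"])
 also have "\<dots> = (if j < i then \<beta> (e i) (h j) else 0)" using i by simp
 finally show ?thesis using i e h sV less(2) tri[of i j] by (auto simp: not_less)
 qed
 thus ?case using sV h less(2) by (intro bexI[of _ "h j - ?s"]) auto
qed

lemma (in qsp) \<beta>_lin:
 assumes "!!i. i \<in> I ==> c i \<in> K" "!!i. i \<in> I ==> v i \<in> V" "z \<in> V"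
 shows "(\<Sum>i\<in>I. sc (c i) (v i)) \<in> V" "\<beta> (\<Sum>i\<in>I. sc (c i) (v i)) z = (\<Sum>i\<in>I. c i * \<beta> (v i) z)"
 using assms by (auto intro!: V_sum simp: \<beta>_sum)

text \<open>An isotropic family of length \<open>r\<close> orthogonal to a vector of norm 1 splits off
  \<open>r\<close> hyperbolic planes.\<close>

lemma (in qsp) hyperbolic_split:
 fixes r :: nat
 assumes e: "!!i. i < r ==> e i \<in> V" and f: "!!j. j < r ==> f j \<in> V" and g: "g \<in> V"
 and ee: "!!i j. i < r ==> j < r ==> \<beta> (e i) (e j) = 0"
 and eg: "!!i. i < r ==> \<beta> (e i) g = 0" and gg: "\<beta> g g = 1"
 and ef: "!!i j. i < r ==> j < r ==> \<beta> (e i) (f j) = (if i = j then 1 else 0)"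
 shows "\<exists>C. orth V \<beta> C & card C = 2 * r + 1 & norms \<beta> C = add_mset 1 (replicate_mset r 1 + replicate_mset r (-1))"
proof -
 have h2: "1 / 2 \<in> K" "c / 2 \<in> K" if "c \<in> K" for c using that divide numeral one by blast+
 \<comment> \<open>Subtracting half of the Gram matrix makes the dual family totally isotropic and
   leaves its products with the \<open>e i\<close> unchanged.\<close>
 define F where "F j = f j - (\<Sum>i<r. sc (\<beta> (f i) (f j) / 2) (e i))" for j
 have sF: "(\<Sum>i<r. sc (\<beta> (f i) (f j) / 2) (e i)) \<in> V"
 "z \<in> V ==> \<beta> (\<Sum>i<r. sc (\<beta> (f i) (f j) / 2) (e i)) z = (\<Sum>i<r. \<beta> (f i) (f j) / 2 * \<beta> (e i) z)"
 if "j < r" for j z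
 using \<beta>_lin[of "{..<r}" "%i. \<beta> (f i) (f j) / 2" e] that e f h2(2) V0 by auto
 have FV: "F j \<in> V" if "j < r" for j using sF that f by (simp add: F_def)
 have Fz: "\<beta> (F j) z = \<beta> (f j) z - (\<Sum>i<r. \<beta> (f i) (f j) / 2 * \<beta> (e i) z)" if "j < r" "z \<in> V" for j z
 using that sF f by (simp add: F_def)
 have eF: "\<beta> (F j) (e i) = (if i = j then 1 else 0)" "\<beta> (e i) (F j) = (if i = j then 1 else 0)" if "i < r" "j < r" for i j
 proof -
 have "\<beta> (F j) (e i) = \<beta> (f j) (e i)" using that e ee by (subst Fz) (auto intro!: sum.neutral)
 thus "\<beta> (F j) (e i) = (if i = j then 1 else 0)" using ef[OF that] \<beta>_sym[of "e i" "f j"] that e f by simp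
 thus "\<beta> (e i) (F j) = (if i = j then 1 else 0)" using \<beta>_sym[of "e i" "F j"] that e FV by simp
 qed
 have FF: "\<beta> (F i) (F j) = 0" if "i < r" "j < r" for i j
 proof -
 have "\<beta> (f i) (F j) = \<beta> (F j) (f i)" using that FV f \<beta>_sym by blast
 also have "\<dots> = \<beta> (f j) (f i) - (\<Sum>l<r. \<beta> (f l) (f j) / 2 * \<beta> (e l) (f i))" using that f Fz by blast
 also have "\<beta> (f j) (f i) = \<beta> (f i) (f j)" using that f \<beta>_sym by blast
 also have "(\<Sum>l<r. \<beta> (f l) (f j) / 2 * \<beta> (e l) (f i)) = (\<Sum>l<r. if l = i then \<beta> (f l) (f j) / 2 else 0)"
 using that ef by (intro sum.cong) auto
 also have "(\<Sum>l<r. if l = i then \<beta> (f l) (f j) / 2 else 0) = \<beta> (f i) (f j) / 2" using that by simp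
 finally have 1: "\<beta> (f i) (F j) = \<beta> (f i) (f j) - \<beta> (f i) (f j) / 2" .
 have "\<beta> (F i) (F j) = \<beta> (f i) (F j) - (\<Sum>l<r. if l = j then \<beta> (f l) (f i) / 2 else 0)"
 proof -
 have "(\<Sum>l<r. \<beta> (f l) (f i) / 2 * \<beta> (e l) (F j)) = (\<Sum>l<r. if l = j then \<beta> (f l) (f i) / 2 else 0)"
 using that by (intro sum.cong) (auto simp: eF)
 thus ?thesis using that FV by (simp add: Fz del: times_divide_eq_left)
 qed
 also have "\<dots> = \<beta> (f i) (F j) - \<beta> (f j) (f i) / 2" using that by simp
 moreover have "x - x / 2 - x / 2 = 0" for x :: 'f using two by (simp add: field_simps)
 ultimately show ?thesis using 1 that f \<beta>_sym[of "f j" "f i"] by simp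
 qed
 define G where "G = g - (\<Sum>i<r. sc (\<beta> g (F i)) (e i))"
 have sG: "(\<Sum>i<r. sc (\<beta> g (F i)) (e i)) \<in> V"
 "z \<in> V ==> \<beta> (\<Sum>i<r. sc (\<beta> g (F i)) (e i)) z = (\<Sum>i<r. \<beta> g (F i) * \<beta> (e i) z)" for z
 using \<beta>_lin[of "{..<r}" "%i. \<beta> g (F i)" e] e FV g V0 by auto
 have GV: "G \<in> V" using sG g by (simp add: G_def)
 have Gz: "\<beta> G z = \<beta> g z - (\<Sum>i<r. \<beta> g (F i) * \<beta> (e i) z)" if "z \<in> V" for z
 using that sG g by (simp add: G_def)
 have Ge: "\<beta> G (e i) = 0" "\<beta> (e i) G = 0" if "i < r" for i
 proof -
 show "\<beta> G (e i) = 0" using that e ee eg[OF that] g \<beta>_sym[of g "e i"]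
 by (subst Gz) (auto intro!: sum.neutral)
 thus "\<beta> (e i) G = 0" using \<beta>_sym[of "e i" G] that e GV by simp
 qed
 have GF: "\<beta> G (F j) = 0" "\<beta> (F j) G = 0" if "j < r" for j
 proof -
 have "(\<Sum>i<r. \<beta> g (F i) * \<beta> (e i) (F j)) = (\<Sum>i<r. if i = j then \<beta> g (F i) else 0)"
 using that by (intro sum.cong) (auto simp: eF)
 hence "\<beta> G (F j) = \<beta> g (F j) - (\<Sum>i<r. if i = j then \<beta> g (F i) else 0)"
 using that FV by (simp add: Gz)
 thus "\<beta> G (F j) = 0" using that by simp
 thus "\<beta> (F j) G = 0" using \<beta>_sym[of "F j" G] that FV GV by simp
 qed
 have GG: "\<beta> G G = 1"
 proof -
 have "\<beta> G G = \<beta> g G" using GV Ge by (subst Gz) auto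
 also have "\<dots> = \<beta> G g" using \<beta>_sym g GV by blast
 also have "\<dots> = 1" using g eg gg by (subst Gz) auto
 finally show ?thesis .
 qed
 \<comment> \<open>In the hyperbolic plane of \<open>e i\<close> and \<open>F i\<close>, for
   \<sigma> = 1 and \<sigma> = -1, the two orthogonal vectors of norm \<sigma>.\<close>
 define u where "u \<sigma> i = e i + sc (\<sigma> * (1/2)) (F i)" for \<sigma> i
 have uV: "u \<sigma> i \<in> V" if "i < r" "\<sigma> \<in> K" for \<sigma> i using that e FV h2 by (auto simp: u_def)
 have uu: "\<beta> (u \<sigma> i) (u \<tau> j) = (if i = j then (\<sigma> + \<tau>) * (1/2) else 0)" if "i < r" "j < r" "\<sigma> \<in> K" "\<tau> \<in> K" for \<sigma> \<tau> i j
 proof -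
 have "\<sigma> * (1/2) \<in> K" "\<tau> * (1/2) \<in> K" using that h2 by auto
 thus ?thesis using that e FV by (auto simp: u_def ee eF FF algebra_simps)
 qed
 have uG: "\<beta> (u \<sigma> i) G = 0" "\<beta> G (u \<sigma> i) = 0" if "i < r" "\<sigma> \<in> K" for \<sigma> i
 proof -
 have "\<sigma> * (1/2) \<in> K" using that h2 by auto
 thus "\<beta> (u \<sigma> i) G = 0" "\<beta> G (u \<sigma> i) = 0" using that e FV GV Ge GF by (simp_all add: u_def)
 qed
 have o: "orth V \<beta> (u \<sigma> ` {..<r})" "card (u \<sigma> ` {..<r}) = r" "norms \<beta> (u \<sigma> ` {..<r}) = replicate_mset r \<sigma>"
 if "\<sigma> = 1 | \<sigma> = -1" for \<sigma>
 proof -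
 have [simp]: "\<sigma> \<in> K" "\<sigma> ~= 0" and h: "(\<sigma> + \<sigma>) * (1/2) = \<sigma>" using that two by (auto simp: field_simps)
 have 1: "u \<sigma> i \<in> V" if "i \<in> {..<r}" for i using that uV by auto
 have 2: "\<beta> (u \<sigma> i) (u \<sigma> i) = \<sigma> & \<sigma> ~= 0" if "i \<in> {..<r}" for i
 using uu[of i i \<sigma> \<sigma>] that h by (metis \<open>\<sigma> \<in> K\<close> \<open>\<sigma> ~= 0\<close> lessThan_iff)
 have 3: "\<beta> (u \<sigma> i) (u \<sigma> j) = 0" if "i \<in> {..<r}" "j \<in> {..<r}" "i ~= j" for i j using that by (simp add: uu)
 show "orth V \<beta> (u \<sigma> ` {..<r})" "card (u \<sigma> ` {..<r}) = r" "norms \<beta> (u \<sigma> ` {..<r}) = replicate_mset r \<sigma>"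
 using orth_family[of "{..<r}" "u \<sigma>" V \<beta> "%_. \<sigma>", OF _ 1 2 3] by (auto simp: image_mset_const_eq)
 qed
 have o2: "orth V \<beta> (u 1 ` {..<r} \<union> u (-1) ` {..<r})" "u 1 ` {..<r} \<inter> u (-1) ` {..<r} = {}"
 "norms \<beta> (u 1 ` {..<r} \<union> u (-1) ` {..<r}) = replicate_mset r 1 + replicate_mset r (-1)"
 proof -
 have z: "\<beta> a b = 0 & \<beta> b a = 0" if "a \<in> u 1 ` {..<r}" "b \<in> u (-1) ` {..<r}" for a b
 using that by (auto simp: uu)
 show "orth V \<beta> (u 1 ` {..<r} \<union> u (-1) ` {..<r})" "u 1 ` {..<r} \<inter> u (-1) ` {..<r} = {}"
 "norms \<beta> (u 1 ` {..<r} \<union> u (-1) ` {..<r}) = replicate_mset r 1 + replicate_mset r (-1)"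
 using orth_Un[OF o(1)[of 1] o(1)[of "-1"] z] o(3) by simp_all
 qed
 have oG: "orth V \<beta> {G}" "norms \<beta> {G} = {#1#}" using GV GG by (auto simp: orth_def norms_def)
 have o3: "orth V \<beta> ({G} \<union> (u 1 ` {..<r} \<union> u (-1) ` {..<r}))" "{G} \<inter> (u 1 ` {..<r} \<union> u (-1) ` {..<r}) = {}"
 "norms \<beta> ({G} \<union> (u 1 ` {..<r} \<union> u (-1) ` {..<r})) = {#1#} + (replicate_mset r 1 + replicate_mset r (-1))"
 proof -
 have z: "\<beta> a b = 0 & \<beta> b a = 0" if "a \<in> {G}" "b \<in> u 1 ` {..<r} \<union> u (-1) ` {..<r}" for a b
 using that by (auto simp: uG)
 show "orth V \<beta> ({G} \<union> (u 1 ` {..<r} \<union> u (-1) ` {..<r}))" "{G} \<inter> (u 1 ` {..<r} \<union> u (-1) ` {..<r}) = {}"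
 "norms \<beta> ({G} \<union> (u 1 ` {..<r} \<union> u (-1) ` {..<r})) = {#1#} + (replicate_mset r 1 + replicate_mset r (-1))"
 using orth_Un[OF oG(1) o2(1) z] o2(3) oG(2) by simp_all
 qed
 have "card ({G} \<union> (u 1 ` {..<r} \<union> u (-1) ` {..<r})) = 2 * r + 1"
 using norms_size[of \<beta> "{G} \<union> (u 1 ` {..<r} \<union> u (-1) ` {..<r})"] unfolding o3 by simp
 thus ?thesis using o3 by (intro exI[of _ "{G} \<union> (u 1 ` {..<r} \<union> u (-1) ` {..<r})"]) simp
qed

text \<open>The transfer functional of an odd simple extension \<open>k(\<theta>)\<close> is
  \<open>s(z) = \<Sum> z\<^sub>t / p'(t)\<close> over the conjugates \<open>t\<close> of \<open>\<theta>\<close>; powers of \<open>\<theta>\<close> below the middle one are isotropic.\<close>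

lemma (in aut_group) odd_transfer:
 assumes fin: "finite ((%\<mu>. \<mu> \<theta>) ` H)" and odd: "odd (card ((%\<mu>. \<mu> \<theta>) ` H))"
 defines "L \<equiv> fixf {\<mu> \<in> H. \<mu> \<theta> = \<theta>}"
 obtains s r C where "qsp (fixf H) L (*) (%x y. s (x * y))" "obas L (%x y. s (x * y)) C"
 "norms (%x y. s (x * y)) C = add_mset 1 (replicate_mset r 1 + replicate_mset r (-1))"
proof -
 define \<Theta> where "\<Theta> = (%\<mu>. \<mu> \<theta>) ` H"
 obtain r where r: "card \<Theta> = 2 * r + 1" using odd by (auto simp: \<Theta>_def elim: oddE)
 define g where "g t = (SOME \<mu>. \<mu> \<in> H & \<mu> \<theta> = t)" for t
 have g: "g t \<in> H" "g t \<theta> = t" if "t \<in> \<Theta>" for t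
 using someI_ex[of "%\<mu>. \<mu> \<in> H & \<mu> \<theta> = t"] that unfolding g_def \<Theta>_def by blast+
 interpret l: aut_group "{\<mu> \<in> H. \<mu> \<theta> = \<theta>}" using stab_group[of "%\<mu> x. \<mu> x" \<theta>] by simp
 interpret L: subfld L unfolding L_def by (rule l.fx.subfld_axioms)
 have fin\<Theta>: "finite \<Theta>" using fin by (simp add: \<Theta>_def)
 have \<Theta>_in: "\<mu> t \<in> \<Theta>" if "\<mu> \<in> H" "t \<in> \<Theta>" for \<mu> t
 proof -
 have "\<mu> t = (\<mu> \<circ> g t) \<theta>" using g[OF that(2)] by simp
 thus ?thesis unfolding \<Theta>_def using that g comp_in by blast
 qed
 have bij: "bij_betw \<mu> \<Theta> \<Theta>" if "\<mu> \<in> H" for \<mu>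
 using that \<Theta>_in inv_ex[OF that]
 by (metis (no_types, lifting) bij_betw_byWitness comp_apply id_apply image_subsetI)
 have conj: "\<mu> (g t z) = g (\<mu> t) z" if a: "\<mu> \<in> H" "t \<in> \<Theta>" "z \<in> L" for \<mu> t z
 proof -
 obtain \<delta> where d: "\<delta> \<in> H" "!!x. \<delta> (g (\<mu> t) x) = x" "!!x. g (\<mu> t) (\<delta> x) = x"
 using invE[OF g(1)[OF \<Theta>_in[OF a(1,2)]]] by metis
 have "\<delta> \<circ> (\<mu> \<circ> g t) \<in> H" using d that g by simp
 moreover have "(\<delta> \<circ> (\<mu> \<circ> g t)) \<theta> = \<theta>" using d(2)[of \<theta>] g \<Theta>_in that by simp
 ultimately have "(\<delta> \<circ> (\<mu> \<circ> g t)) z = z" using that(3) unfolding L_def fixf_def by blast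
 thus ?thesis using d(3) by (metis comp_apply)
 qed
 define D where "D t = (\<Prod>u\<in>\<Theta> - {t}. t - u)" for t
 have D0: "D t ~= 0" for t using fin\<Theta> by (auto simp: D_def)
 have D\<mu>: "\<mu> (D t) = D (\<mu> t)" if "\<mu> \<in> H" "t \<in> \<Theta>" for \<mu> t
 proof -
 have b: "bij_betw \<mu> (\<Theta> - {t}) (\<Theta> - {\<mu> t})"
 using bij[OF that(1)] that(2) by (metis bij_betw_DiffI bij_betw_singletonI empty_subsetI insert_subset \<Theta>_in that(1))
 have "\<mu> (D t) = (\<Prod>u\<in>\<Theta> - {t}. \<mu> t - \<mu> u)" using that by (simp add: D_def hom_prod hom_simps)
 also have "\<dots> = D (\<mu> t)" unfolding D_def by (rule prod.reindex_bij_betw[OF b])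
 finally show ?thesis .
 qed
 define s where "s z = (\<Sum>t\<in>\<Theta>. g t z / D t)" for z
 have sK: "s z \<in> fixf H" if "z \<in> L" for z
 proof -
 have "\<mu> (s z) = s z" if gm: "\<mu> \<in> H" for \<mu>
 proof -
 have "\<mu> (s z) = (\<Sum>t\<in>\<Theta>. g (\<mu> t) z / D (\<mu> t))"
 using gm \<open>z \<in> L\<close> by (simp add: s_def hom_sum hom_simps conj D\<mu>)
 also have "\<dots> = s z" unfolding s_def by (rule sum.reindex_bij_betw[OF bij[OF gm]])
 finally show ?thesis .
 qed
 thus ?thesis by (simp add: fixf_def)
 qed
 have KL: "fixf H <= L" by (auto simp: L_def fixf_def)
 interpret q: qsp "fixf H" L "(*)" "%x y. s (x * y)"
 proof unfold_locales
 show "s (x * y) \<in> fixf H" if "x \<in> L" "y \<in> L" for x y using that sK by simp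
 show "s (x * y) = s (y * x)" for x y by (simp add: mult.commute)
 show "s ((x + y) * z) = s (x * z) + s (y * z)" for x y z
 using g by (simp add: s_def distrib_right hom_simps add_divide_distrib sum.distrib)
 show "s (a * x * z) = a * s (x * z)" if "a \<in> fixf H" for a x z
 proof -
 have "g t a = a" if "t \<in> \<Theta>" for t using g[OF that] \<open>a \<in> fixf H\<close> by (auto simp: fixf_def)
 thus ?thesis using g by (simp add: s_def hom_simps sum_distrib_left mult.assoc)
 qed
 qed (use KL in \<open>auto simp: algebra_simps\<close>)
 have s\<theta>: "s (\<theta> ^ i) = (if i = 2 * r then 1 else 0)" if "i \<le> 2 * r" for i
 proof -
 have "s (\<theta> ^ i) = (\<Sum>t\<in>\<Theta>. t ^ i / D t)" using g by (simp add: s_def hom_simps)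
 thus ?thesis using euler_identity[OF fin\<Theta> _ that] r by (simp add: D_def)
 qed
 have \<theta>L: "\<theta> ^ i \<in> L" for i
 proof -
 have "\<theta> \<in> L" by (auto simp: L_def fixf_def)
 thus ?thesis by simp
 qed
 \<comment> \<open>The powers with exponent \<open>2 r - j\<close> give a triangular matrix: for
   \<open>i \<le> j\<close> the exponent \<open>i + 2 r - j\<close> is at most \<open>2 r\<close>,
   and there the functional is nonzero on the top power only.\<close>
 have "\<exists>f\<in>L. \<forall>i<r. s (\<theta> ^ i * f) = (if i = j then 1 else 0)" if "j < r" for j
 proof (rule q.dual_family[where h = "%j. \<theta> ^ (2 * r - j)" and r = r])
 show "s (\<theta> ^ i * \<theta> ^ (2 * r - j)) = (if i = j then 1 else 0)" if "i \<le> j" "j < r" for i j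
 using that by (auto simp: s\<theta> power_add[symmetric])
 qed (use \<theta>L that in auto)
 then obtain f where f: "!!j. j < r ==> f j \<in> L"
 "!!i j. i < r ==> j < r ==> s (\<theta> ^ i * f j) = (if i = j then 1 else 0)" by metis
 \<comment> \<open>The middle power is the vector of norm 1: its square has exponent
   \<open>2 r\<close>, its products with lower powers have a smaller one.\<close>
 have "\<exists>C. orth L (%x y. s (x * y)) C & card C = 2 * r + 1 &
 norms (%x y. s (x * y)) C = add_mset 1 (replicate_mset r 1 + replicate_mset r (-1))"
 by (rule q.hyperbolic_split[where e = "%i. \<theta> ^ i" and g = "\<theta> ^ r" and f = f])
 (use f \<theta>L in \<open>auto simp: power_add[symmetric] s\<theta>\<close>)
 then obtain C where C: "orth L (%x y. s (x * y)) C" "card C = 2 * r + 1"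
 "norms (%x y. s (x * y)) C = add_mset 1 (replicate_mset r 1 + replicate_mset r (-1))" by blast
 have w: "inverse (D t) ~= 0" for t using D0 by simp
 note F = full_space[of \<Theta> "%t. inverse (D t)", OF fin\<Theta> w two_neq]
 interpret F: qsp UNIV "fset \<Theta> :: ('s => 's) set" fscale "wbil \<Theta> (%t. inverse (D t))" by (rule F)
 \<comment> \<open>Completeness of \<open>C\<close> is checked after embedding \<open>L\<close> into
   the functions on the conjugates, where \<open>2 r + 1\<close> orthogonal vectors form a
   basis.\<close>
 define cj where "cj z = (%t. if t \<in> \<Theta> then g t z else 0)" for z
 have cjF: "cj z \<in> fset \<Theta>" for z by (simp add: cj_def fset_def)
 have cj: "wbil \<Theta> (%t. inverse (D t)) (cj x) (cj y) = s (x * y)" for x y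
 using g by (auto simp: wbil_def cj_def s_def hom_simps field_simps intro!: sum.cong)
 have oF: "orth (fset \<Theta>) (wbil \<Theta> (%t. inverse (D t))) (cj ` C)" "card (cj ` C) = card C"
 using orth_image[where T = cj and c = 1 and \<beta>' = "wbil \<Theta> (%t. inverse (D t))" and V' = "fset \<Theta>", OF C(1)]
 by (simp_all add: cj cjF)
 hence bF: "obas (fset \<Theta>) (wbil \<Theta> (%t. inverse (D t))) (cj ` C)"
 using F.orth_card_obas[OF _ F(2)] F(3) C(2) r by simp
 have "z = 0" if z: "z \<in> L" "\<forall>c\<in>C. s (z * c) = 0" for z
 proof -
 have "cj z = 0" using bF cjF[of z] z(2) unfolding obas_def by (auto simp: cj)
 moreover have \<theta>: "\<theta> \<in> \<Theta>" unfolding \<Theta>_def using imageI[OF id_in, of "%\<mu>. \<mu> \<theta>"] by simp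
 ultimately have "g \<theta> z = 0" by (metis cj_def zero_fun_apply)
 thus ?thesis using g[OF \<theta>] hom_inj[of "g \<theta>" z 0] hom_zero by metis
 qed
 hence "obas L (%x y. s (x * y)) C" using C(1) by (simp add: obas_def)
 thus ?thesis using that q.qsp_axioms C(3) by blast
qed

lemma mset_set_Times:
 fixes n :: "'d => 'f::field"
 assumes "finite C" "finite D"
 shows "image_mset (%(c, d). n d * \<nu> c) (mset_set (C \<times> D)) =
 (\<Sum>a\<in>#image_mset \<nu> (mset_set C). image_mset ((*) a) (image_mset n (mset_set D)))"
 using assms(1)
proof (induction C rule: finite_induct)
 case (insert c C)
 have inj: "inj_on (Pair c) D" by (auto simp: inj_on_def)
 have "mset_set (insert c C \<times> D) = mset_set (Pair c ` D \<union> C \<times> D)"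
 by (intro arg_cong[where f = mset_set]) auto
 also have "\<dots> = image_mset (Pair c) (mset_set D) + mset_set (C \<times> D)"
 using insert assms(2) image_mset_mset_set[OF inj] by (subst mset_set_Union) auto
 finally show ?case using insert by (simp add: multiset.map_comp o_def mult.commute)
qed simp

lemma (in subfld) deq_hyperbolic_sum:
 assumes "set_mset M <= K - {0}"
 shows "deq K (M + image_mset uminus M) (replicate_mset (size M) 1 + replicate_mset (size M) (-1))"
 using assms
proof (induction M)
 case (add a M)
 have "deq K (add_mset a (add_mset (- a) (M + image_mset uminus M))) (add_mset 1 (add_mset (-1) (M + image_mset uminus M)))"
 using add by (intro deq_hyperbolic) auto
 also have "deq K \<dots> (add_mset 1 (add_mset (-1) (replicate_mset (size M) 1 + replicate_mset (size M) (-1))))"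
 using add by (intro deq_add_mset) auto
 finally show ?case by (simp add: add_mset_commute)
qed simp

lemma deq_size: "deq K M N ==> size M = size N"
 unfolding deq_def by (induction rule: rtranclp_induct) (auto elim!: dstep.cases)

lemma set_mset_repeat_subset: "set_mset (repeat_mset r P) <= set_mset P"
 by (induction r) auto

text \<open>Frobenius reciprocity: \<open>s\<^sub>*(q\<^sub>L) = q \<otimes> s\<^sub>*\<langle>1\<rangle> = q + r q \<langle>1, -1\<rangle>\<close>, and the hyperbolic part depends on
  the rank of \<open>q\<close> only.\<close>

lemma deq_descend:
 assumes q: "qsp K L (*) (%x y. s (x * y))" and C: "obas L (%x y. s (x * y)) C"
 and nC: "norms (%x y. s (x * y)) C = add_mset 1 (replicate_mset r 1 + replicate_mset r (-1))"
 and L: "subfld L" and MN: "set_mset M <= K - {0}" "set_mset N <= K - {0}" and KL: "K <= L"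
 and eq: "deq L M N"
 shows "deq K M N"
proof -
 interpret q: qsp K L "(*)" "%x y. s (x * y)" by fact
 interpret L: subfld L by fact
 have s1: "x \<in> L ==> y \<in> L ==> s (x + y) = s x + s y" "c \<in> K ==> x \<in> L ==> s (c * x) = c * s x"
 "x \<in> L ==> s x \<in> K" for x y c
 using q.\<beta>_add[of x y 1] q.\<beta>_sc[of c x 1] q.\<beta>_in[of x 1] by simp_all
 have "s 0 = 0" using s1(2)[of 0 0] by simp
 obtain as where as: "mset as = M" by (meson ex_mset)
 have "set as <= L - {0}" using as MN KL by (metis set_mset_mset Diff_mono order_refl order_trans)
 from L.standard_space[OF this] obtain V :: "(nat => 'a) set" and \<beta> B
 where W: "qsp L V fscale \<beta>" and B: "obas V \<beta> B" "norms \<beta> B = M" unfolding as by blast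
 interpret W: qsp L V fscale \<beta> by fact
 \<comment> \<open>The transfer: the same space, regarded over the smaller field with the form
   composed with \<open>s\<close>.\<close>
 interpret R: qsp K V fscale "%x y. s (\<beta> x y)"
 using KL by unfold_locales (auto simp: s1 W.sc_one W.sc_sc W.sc_add W.\<beta>_sym subset_iff)
 obtain B' where B': "obas V \<beta> B'" "norms \<beta> B' = N" using W.obas_transport[OF B(1)] B(2) eq by blast
 define tot where "tot M = M + (\<Sum>a\<in>#replicate_mset r 1 + replicate_mset r (-1). image_mset ((*) a) M)" for M :: "'a multiset"
 have bas: "\<exists>E. obas V (%x y. s (\<beta> x y)) E & norms (%x y. s (\<beta> x y)) E = tot M"
 if D: "obas V \<beta> D" "norms \<beta> D = M" "set_mset M <= K - {0}" for D M
 proof -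
 have Dp: "finite D" "!!d. d \<in> D ==> d \<in> V" "!!d f. d \<in> D ==> f \<in> D ==> d ~= f ==> \<beta> d f = 0"
 using D by (auto simp: obas_def orth_def)
 have Dn: "\<beta> d d \<in> K - {0}" if "d \<in> D" for d
 proof -
 have "\<beta> d d \<in># norms \<beta> D" using that Dp(1) by (simp add: norms_def)
 thus ?thesis using D(2,3) by blast
 qed
 have Cp: "finite C" "!!d. d \<in> C ==> d \<in> L" "!!d f. d \<in> C ==> f \<in> C ==> d ~= f ==> s (d * f) = 0"
 "!!d. d \<in> C ==> s (d * d) ~= 0"
 using C by (auto simp: obas_def orth_def)
 \<comment> \<open>A basis over the small field consists of the products of a basis of
   \<open>L\<close> over \<open>K\<close> with a basis of \<open>V\<close> over
   \<open>L\<close>.\<close>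
 define v where "v = (%(c, d). fscale c d :: nat => 'a)"
 have ip: "s (\<beta> (v (c, d)) (v (c', d'))) = (if d = d' then \<beta> d d * s (c * c') else 0)"
 if "c \<in> C" "c' \<in> C" "d \<in> D" "d' \<in> D" for c c' d d'
 proof -
 have "\<beta> (v (c, d)) (v (c', d')) = (if d = d' then \<beta> d d * (c * c') else 0)"
 using that Cp Dp by (simp add: v_def)
 moreover have "s (\<beta> d d * (c * c')) = \<beta> d d * s (c * c')"
 using that Cp(2) Dn by (intro s1(2)) auto
 ultimately show ?thesis using \<open>s 0 = 0\<close> by (cases "d = d'") simp_all
 qed
 have 1: "v p \<in> V" if "p \<in> C \<times> D" for p using that Cp Dp by (auto simp: v_def)
 have 2: "s (\<beta> (v p) (v p)) = (case p of (c, d) => \<beta> d d * s (c * c)) & (case p of (c, d) => \<beta> d d * s (c * c)) ~= 0"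
 if "p \<in> C \<times> D" for p using that Cp Dn by (auto simp: ip)
 have 3: "s (\<beta> (v p) (v p')) = 0" if "p \<in> C \<times> D" "p' \<in> C \<times> D" "p ~= p'" for p p'
 proof -
 obtain c d c' d' where p: "p = (c, d)" "p' = (c', d')" by (metis surj_pair)
 thus ?thesis using that Cp(3)[of c c'] by (cases "c = c'") (auto simp: ip)
 qed
 note fam = orth_family[of "C \<times> D" v V "%x y. s (\<beta> x y)", OF _ 1 2 3]
 have "x = 0" if x: "x \<in> V" "\<forall>p\<in>v ` (C \<times> D). s (\<beta> x p) = 0" for x
 proof -
 have "\<beta> x d = 0" if d: "d \<in> D" for d
 proof -
 have "s (\<beta> x d * c) = 0" if "c \<in> C" for c
 proof -
 have "s (\<beta> x (v (c, d))) = 0" using x(2) that d by blast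
 thus ?thesis using that d Cp Dp x(1) by (simp add: v_def mult.commute)
 qed
 moreover have "\<forall>z\<in>L. (\<forall>c\<in>C. s (z * c) = 0) --> z = 0" using C by (simp add: obas_def)
 ultimately show ?thesis using Dp(2)[OF d] x(1) W.\<beta>_in by metis
 qed
 thus ?thesis using D(1) x(1) by (auto simp: obas_def)
 qed
 hence "obas V (%x y. s (\<beta> x y)) (v ` (C \<times> D))" using fam Cp Dp by (auto simp: obas_def)
 moreover have "norms (%x y. s (\<beta> x y)) (v ` (C \<times> D)) =
 (\<Sum>a\<in>#norms (%x y. s (x * y)) C. image_mset ((*) a) M)"
 using fam(3) Cp Dp mset_set_Times[of C D "%d. \<beta> d d" "%c. s (c * c)"] D(2) by (simp add: norms_def)
 ultimately show ?thesis unfolding nC tot_def by auto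
 qed
 have t: "deq K (tot M) (tot N)"
 using bas[OF B MN(1)] bas[OF B' MN(2)] R.obas_unique by metis
 have hyp: "deq K (\<Sum>a\<in>#replicate_mset r 1 + replicate_mset r (-1). image_mset ((*) a) P)
 (repeat_mset r (replicate_mset (size P) 1 + replicate_mset (size P) (-1)))"
 if "set_mset P <= K - {0}" for P
 proof -
 have u: "image_mset ((*) (-1)) P = image_mset uminus P" by (rule image_mset_cong) simp
 have "(\<Sum>a\<in>#replicate_mset r 1 + replicate_mset r (-1). image_mset ((*) a) P) = repeat_mset r (P + image_mset uminus P)"
 by (induction r) (simp_all add: u)
 moreover have "deq K (repeat_mset r (P + image_mset uminus P)) (repeat_mset r (replicate_mset (size P) 1 + replicate_mset (size P) (-1)))"
 proof (induction r)
 case (Suc r)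
 thus ?case unfolding repeat_mset_Suc by (rule deq_add2[OF q.deq_hyperbolic_sum[OF that]])
 qed simp
 ultimately show ?thesis by simp
 qed
 let ?R = "repeat_mset r (replicate_mset (size M) 1 + replicate_mset (size M) (-1))"
 have "deq K (M + ?R) (tot M)" unfolding tot_def by (rule deq_add2[OF deq_refl q.deq_sym[OF hyp[OF MN(1)]]])
 also note t
 also have "deq K (tot N) (N + ?R)" unfolding tot_def deq_size[OF eq]
 by (rule deq_add2[OF deq_refl hyp[OF MN(2)]])
 finally have "deq K (?R + M) (?R + N)" by (simp add: add.commute)
 moreover have "set_mset (?R + M) <= K - {0}"
 proof -
 have "set_mset ?R <= set_mset (replicate_mset (size M) 1 + replicate_mset (size M) (-1))"
 by (rule set_mset_repeat_subset)
 also have "\<dots> <= K - {0}" by (auto simp: in_replicate_mset)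
 finally show ?thesis using MN by auto
 qed
 ultimately show ?thesis by (rule q.deq_cancel)
qed

lemma (in aut_group) deq_descend_simple:
 assumes "finite ((%\<mu>. \<mu> \<theta>) ` H)" "odd (card ((%\<mu>. \<mu> \<theta>) ` H))"
 and "deq (fixf {\<mu> \<in> H. \<mu> \<theta> = \<theta>}) M N" "set_mset M <= fixf H - {0}" "set_mset N <= fixf H - {0}"
 shows "deq (fixf H) M N"
proof -
 interpret l: aut_group "{\<mu> \<in> H. \<mu> \<theta> = \<theta>}" using stab_group[of "%\<mu> x. \<mu> x" \<theta>] by simp
 obtain s r C where "qsp (fixf H) (fixf {\<mu> \<in> H. \<mu> \<theta> = \<theta>}) (*) (%x y. s (x * y))"
 "obas (fixf {\<mu> \<in> H. \<mu> \<theta> = \<theta>}) (%x y. s (x * y)) C"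
 "norms (%x y. s (x * y)) C = add_mset 1 (replicate_mset r 1 + replicate_mset r (-1))"
 using odd_transfer[OF assms(1,2)] by blast
 from deq_descend[OF this l.fx.subfld_axioms assms(4,5) _ assms(3)] show ?thesis
 by (auto simp: fixf_def)
qed

section \<open>Descent along orbits of odd length\<close>

locale gact = aut_group H for H :: "('s::field => 's) set" +
 fixes X :: "'i set" and \<pi> :: "('s => 's) => 'i => 'i"
 assumes finite_X: "finite X" and \<pi>_in: "\<mu> \<in> H ==> x \<in> X ==> \<pi> \<mu> x \<in> X"
 and \<pi>_comp: "\<mu> \<in> H ==> \<delta> \<in> H ==> x \<in> X ==> \<pi> (\<mu> \<circ> \<delta>) x = \<pi> \<mu> (\<pi> \<delta> x)"
 and \<pi>_id: "x \<in> X ==> \<pi> id x = x"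
begin

abbreviation orbit where "orbit x \<equiv> (%\<mu>. \<pi> \<mu> x) ` H"

lemma odd_orbit: assumes "odd (card X)" shows "\<exists>x\<in>X. odd (card (orbit x))"
proof (rule ccontr)
 assume n: "~ ?thesis"
 have eq: "orbit y = orbit x" if "x \<in> X" "y \<in> orbit x" for x y
 proof -
 obtain \<mu> where \<mu>: "\<mu> \<in> H" "y = \<pi> \<mu> x" using \<open>y \<in> orbit x\<close> by blast
 obtain \<delta> where \<delta>: "\<delta> \<in> H" "\<delta> \<circ> \<mu> = id" "\<mu> \<circ> \<delta> = id" using inv_ex \<mu> by blast
 have 1: "x = \<pi> \<delta> y" using \<mu> \<delta> \<pi>_comp[of \<delta> \<mu> x] \<pi>_id \<open>x \<in> X\<close> by simp
 have yX: "y \<in> X" using \<mu> \<open>x \<in> X\<close> \<pi>_in by simp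
 have tr: "\<pi> \<sigma> y = \<pi> (\<sigma> \<circ> \<mu>) x" "\<pi> \<sigma> x = \<pi> (\<sigma> \<circ> \<delta>) y" if "\<sigma> \<in> H" for \<sigma>
 using \<pi>_comp[OF that \<mu>(1) \<open>x \<in> X\<close>] \<pi>_comp[OF that \<delta>(1) yX] by (simp_all only: \<mu>(2)[symmetric] 1[symmetric])
 show ?thesis
 proof (intro subset_antisym image_subsetI)
 show "\<pi> \<sigma> y \<in> orbit x" if "\<sigma> \<in> H" for \<sigma> unfolding tr(1)[OF that] by (intro imageI comp_in that \<mu>(1))
 show "\<pi> \<sigma> x \<in> orbit y" if "\<sigma> \<in> H" for \<sigma> unfolding tr(2)[OF that] by (intro imageI comp_in that \<delta>(1))
 qed
 qed
 have self: "x \<in> orbit x" if "x \<in> X" for x using \<pi>_id[OF that] id_in by (metis image_eqI)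
 have un: "\<Union> (orbit ` X) = X" using \<pi>_in self by auto
 have "2 dvd card (\<Union> (orbit ` X))"
 proof (rule dvd_partition)
 show "finite (\<Union> (orbit ` X))" unfolding un by (rule finite_X)
 show "\<forall>c\<in>orbit ` X. 2 dvd card c" using n by auto
 show "\<forall>c1\<in>orbit ` X. \<forall>c2\<in>orbit ` X. c1 ~= c2 --> c1 \<inter> c2 = {}"
 proof (intro ballI impI, elim imageE)
 fix c1 c2 x y assume c: "c1 ~= c2" "c1 = orbit x" "x \<in> X" "c2 = orbit y" "y \<in> X"
 have "z \<notin> c1 | z \<notin> c2" for z using eq[of x z] eq[of y z] c by blast
 thus "c1 \<inter> c2 = {}" by blast
 qed
 qed
 thus False using assms un by simp
qed

end

text \<open>The transfer handles only a field generated by one element, so a tower is climbed. If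
  the stabiliser has a larger fixed field than \<open>H\<close>, some \<theta> in it is moved by
  \<open>H\<close>. The orbit length is the number of conjugates of \<theta> times the length of the
  orbit under the stabiliser of \<theta>; both factors are odd, and the second is smaller.\<close>

lemma deq_descend_orbit:
 assumes "gact H X \<pi>" "x \<in> X" "X = (%\<mu>. \<pi> \<mu> x) ` H" "odd (card X)"
 and "deq (fixf {\<mu> \<in> H. \<pi> \<mu> x = x}) M N" "set_mset M <= fixf H - {0}" "set_mset N <= fixf H - {0}"
 shows "deq (fixf H) M N"
 using assms
proof (induction "card X" arbitrary: H X rule: less_induct)
 case less
 interpret gact H X \<pi> by fact
 let ?Hx = "{\<mu> \<in> H. \<pi> \<mu> x = x}"
 show ?case
 proof (cases "fixf ?Hx <= fixf H")
 case True
 thus ?thesis using less.prems deq_mono by blast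
 next
 case False
 then obtain \<theta> where \<theta>: "\<theta> \<in> fixf ?Hx" "\<theta> \<notin> fixf H" by blast
 have \<theta>x: "\<mu> \<theta> = \<theta>" if "\<mu> \<in> H" "\<pi> \<mu> x = x" for \<mu> using \<theta>(1) that by (auto simp: fixf_def)
 let ?T = "(%\<mu>. \<mu> \<theta>) ` H" and ?H = "{\<mu> \<in> H. \<mu> \<theta> = \<theta>}"
 let ?X = "(%\<mu>. \<pi> \<mu> x) ` ?H"
 interpret h: aut_group ?H using stab_group[of "%\<mu> x. \<mu> x" \<theta>] by simp
 have xX: "\<pi> \<mu> x \<in> X" if "\<mu> \<in> H" for \<mu> using that less.prems(2) \<pi>_in by blast
 have sub: "?X <= X" using xX by auto
 have val: "\<mu> \<theta> = \<delta> \<theta>" if gd: "\<mu> \<in> H" "\<delta> \<in> H" "\<pi> \<mu> x = \<pi> \<delta> x" for \<mu> \<delta>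
 proof -
 obtain \<eta> where e: "\<eta> \<in> H" "\<eta> \<circ> \<delta> = id" "\<delta> \<circ> \<eta> = id" using inv_ex gd by blast
 have "\<pi> (\<eta> \<circ> \<mu>) x = \<pi> (\<eta> \<circ> \<delta>) x" using gd e(1) \<pi>_comp less.prems(2) by simp
 hence "\<pi> (\<eta> \<circ> \<mu>) x = x" using e less.prems(2) by (simp add: \<pi>_id)
 hence "(\<eta> \<circ> \<mu>) \<theta> = \<theta>" by (rule \<theta>x[OF comp_in[OF e(1) gd(1)]])
 hence "\<delta> (\<eta> (\<mu> \<theta>)) = \<delta> \<theta>" by simp
 thus ?thesis using e by (metis comp_apply id_apply)
 qed
 define g where "g t = (SOME \<mu>. \<mu> \<in> H & \<mu> \<theta> = t)" for t
 have g: "g t \<in> H" "g t \<theta> = t" if "t \<in> ?T" for t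
 using someI_ex[of "%\<mu>. \<mu> \<in> H & \<mu> \<theta> = t"] that unfolding g_def by blast+
 have inj\<pi>: "y = z" if "\<mu> \<in> H" "y \<in> X" "z \<in> X" "\<pi> \<mu> y = \<pi> \<mu> z" for \<mu> y z
 using that inv_ex[of \<mu>] \<pi>_comp \<pi>_id by metis
 \<comment> \<open>By \<open>val\<close> the orbit is fibred over the conjugates of \<theta>; the
   fibre over \<theta> is \<open>?X\<close>, and \<open>g t\<close> carries it to the fibre over
   \<open>t\<close>.\<close>
 have "bij_betw (%(t, y). \<pi> (g t) y) (?T \<times> ?X) X" unfolding bij_betw_def
 proof (intro conjI inj_onI)
 fix p p' assume a: "p \<in> ?T \<times> ?X" "p' \<in> ?T \<times> ?X" "(%(t, y). \<pi> (g t) y) p = (%(t, y). \<pi> (g t) y) p'"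
 then obtain t y t' y' where p: "p = (t, y)" "p' = (t', y')" "t \<in> ?T" "t' \<in> ?T" "y \<in> ?X" "y' \<in> ?X"
 "\<pi> (g t) y = \<pi> (g t') y'" by auto
 obtain \<delta> \<delta>' where d: "\<delta> \<in> H" "\<delta> \<theta> = \<theta>" "y = \<pi> \<delta> x" "\<delta>' \<in> H" "\<delta>' \<theta> = \<theta>" "y' = \<pi> \<delta>' x" using p(5,6) by auto
 have "\<pi> (g t \<circ> \<delta>) x = \<pi> (g t' \<circ> \<delta>') x" using p(7) d g[OF p(3)] g[OF p(4)] \<pi>_comp less.prems(2) by simp
 hence "(g t \<circ> \<delta>) \<theta> = (g t' \<circ> \<delta>') \<theta>"
 by (rule val[OF comp_in[OF g(1)[OF p(3)] d(1)] comp_in[OF g(1)[OF p(4)] d(4)]])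
 hence "t = t'" using d g[OF p(3)] g[OF p(4)] by simp
 moreover from this have "y = y'" using inj\<pi>[OF g(1)[OF p(3)], of y y'] p(5-7) sub by blast
 ultimately show "p = p'" using p by simp
 next
 have "y \<in> (%(t, y). \<pi> (g t) y) ` (?T \<times> ?X)" if "y \<in> X" for y
 proof -
 obtain \<mu> where \<mu>: "\<mu> \<in> H" "y = \<pi> \<mu> x" using \<open>y \<in> X\<close> less.prems(3) by blast
 have tT: "\<mu> \<theta> \<in> ?T" using \<mu> by blast
 obtain \<eta> where e: "\<eta> \<in> H" "\<eta> \<circ> g (\<mu> \<theta>) = id" "g (\<mu> \<theta>) \<circ> \<eta> = id" using inv_ex g[OF tT] by blast
 have "(\<eta> \<circ> \<mu>) \<theta> = (\<eta> \<circ> g (\<mu> \<theta>)) \<theta>" using g[OF tT] by simp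
 hence "\<eta> \<circ> \<mu> \<in> ?H" using e \<mu> by simp
 moreover have "\<pi> (g (\<mu> \<theta>)) (\<pi> (\<eta> \<circ> \<mu>) x) = y"
 using \<mu> e g[OF tT] \<pi>_comp[of "g (\<mu> \<theta>)" "\<eta> \<circ> \<mu>" x] less.prems(2) by (simp add: comp_assoc[symmetric])
 ultimately have "(\<mu> \<theta>, \<pi> (\<eta> \<circ> \<mu>) x) \<in> ?T \<times> ?X" "y = (%(t, y). \<pi> (g t) y) (\<mu> \<theta>, \<pi> (\<eta> \<circ> \<mu>) x)"
 using tT by auto
 thus ?thesis by (rule rev_image_eqI)
 qed
 moreover have "(%(t, y). \<pi> (g t) y) ` (?T \<times> ?X) <= X" using g sub \<pi>_in by auto
 ultimately show "(%(t, y). \<pi> (g t) y) ` (?T \<times> ?X) = X" by blast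
 qed
 from bij_betw_same_card[OF this] have cX: "card X = card ?T * card ?X"
 by (simp only: card_cartesian_product)
 hence odd: "odd (card ?T)" "odd (card ?X)" using less.prems(4) by auto
 hence fin: "finite ?T" by (metis card.infinite even_zero)
 have "card ?T ~= 1"
 proof
 assume "card ?T = 1"
 then obtain t where t: "?T = {t}" by (auto simp: card_Suc_eq)
 have "\<mu> \<theta> = t" if "\<mu> \<in> H" for \<mu> using that t by blast
 hence "\<mu> \<theta> = id \<theta>" if "\<mu> \<in> H" for \<mu> using that id_in by blast
 thus False using \<theta>(2) by (simp add: fixf_def)
 qed
 hence "card ?T > 1" using odd by (cases "card ?T") auto
 moreover have "card ?X > 0" using odd by (cases "card ?X") auto
 ultimately have lt: "card ?X < card X" unfolding cX using n_less_m_mult_n[of "card ?X" "card ?T"] by simp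
 have ga: "gact ?H ?X \<pi>"
 proof unfold_locales
 show "finite ?X" using sub finite_X finite_subset by blast
 show "\<pi> \<mu> y \<in> ?X" if \<mu>: "\<mu> \<in> ?H" and y: "y \<in> ?X" for \<mu> y
 proof -
 obtain \<delta> where d: "\<delta> \<in> ?H" "y = \<pi> \<delta> x" using y by blast
 hence "\<mu> \<circ> \<delta> \<in> ?H" "\<pi> \<mu> y = \<pi> (\<mu> \<circ> \<delta>) x" using \<mu> \<pi>_comp less.prems(2) by auto
 thus ?thesis by blast
 qed
 qed (use sub \<pi>_comp \<pi>_id in auto)
 have xx: "x \<in> ?X" using \<pi>_id[OF less.prems(2)] h.id_in by (metis (no_types, lifting) image_eqI)
 have "{\<mu> \<in> ?H. \<pi> \<mu> x = x} = ?Hx" using \<theta>x by auto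
 moreover have "fixf H <= fixf ?H" by (auto simp: fixf_def)
 ultimately have "deq (fixf ?H) M N"
 using less.hyps[OF lt ga xx HOL.refl odd(2)] less.prems(5-7) by auto
 thus ?thesis using deq_descend_simple[OF fin odd(1)] less.prems(6,7) by blast
 qed
qed

text \<open>The equivalence is required over every stabiliser, since it is not known which orbit is
  odd.\<close>

theorem deq_descend_odd:
 assumes "gact H X \<pi>" "odd (card X)" "set_mset M <= fixf H - {0}" "set_mset N <= fixf H - {0}"
 and "!!x. x \<in> X ==> deq (fixf {\<mu> \<in> H. \<pi> \<mu> x = x}) M N"
 shows "deq (fixf H) M N"
proof -
 interpret gact H X \<pi> by fact
 obtain x where x: "x \<in> X" "odd (card (orbit x))" using odd_orbit assms(2) by blast
 have sub: "orbit x <= X" using x \<pi>_in by auto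
 have "gact H (orbit x) \<pi>"
 proof unfold_locales
 show "finite (orbit x)" using sub finite_X finite_subset by blast
 show "\<pi> \<mu> y \<in> orbit x" if \<mu>: "\<mu> \<in> H" and y: "y \<in> orbit x" for \<mu> y
 proof -
 obtain \<delta> where d: "\<delta> \<in> H" "y = \<pi> \<delta> x" using y by blast
 hence "\<pi> \<mu> y = \<pi> (\<mu> \<circ> \<delta>) x" using \<mu> \<pi>_comp x by simp
 thus ?thesis using \<mu> d by auto
 qed
 qed (use sub \<pi>_comp \<pi>_id in auto)
 moreover have "x \<in> orbit x" using \<pi>_id[OF x(1)] id_in by (metis image_eqI)
 ultimately show ?thesis
 using deq_descend_orbit[of H "orbit x" \<pi> x M N] x assms(3,4) assms(5)[OF x(1)] by blast
qed

section \<open>Signed permutation modules\<close>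

text \<open>\<open>M\<close> is a diagonalisation of the unit form on the twist. The condition on
  the cardinality replaces completeness, by \<open>tw_orth_obas\<close>.\<close>

definition hd_tw :: "('s => 's) set => 'i set => (('s => 's) => 'i => 'i) => (('s => 's) => 'i => 's)
 => 's::field multiset => bool" where
 "hd_tw H X \<rho> \<epsilon> M \<longleftrightarrow> (\<exists>C. orth (tw H X \<rho> \<epsilon>) (bil X) C & card C = card X & norms (bil X) C = M)"

lemma twI:
 assumes "!!x. x \<notin> X ==> f x = 0" "!!\<mu> x. \<mu> \<in> H ==> x \<in> X ==> f (\<rho> \<mu> x) = \<epsilon> \<mu> x * \<mu> (f x)"
 shows "f \<in> tw H X \<rho> \<epsilon>"
 using assms by (simp add: tw_def fset_def)

lemma twD:
 assumes "f \<in> tw H X \<rho> \<epsilon>"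
 shows "x \<notin> X ==> f x = 0" "\<mu> \<in> H ==> x \<in> X ==> f (\<rho> \<mu> x) = \<epsilon> \<mu> x * \<mu> (f x)"
 using assms by (simp_all add: tw_def fset_def)

context sact begin

lemma hd_exists: "\<exists>M. hd_tw H X \<rho> \<epsilon> M"
 using tw_obas_exists by (auto simp: hd_tw_def obas_def)

lemma hd_deq: "hd_tw H X \<rho> \<epsilon> M ==> hd_tw H X \<rho> \<epsilon> N ==> deq (fixf H) M N"
 using tw_obas_deq by (auto simp: hd_tw_def)

lemma hd_transport:
 assumes "hd_tw H X \<rho> \<epsilon> M" "deq (fixf H) M N" shows "hd_tw H X \<rho> \<epsilon> N"
proof -
 obtain C where C: "orth T (bil X) C" "card C = card X" "norms (bil X) C = M"
 using assms by (auto simp: hd_tw_def)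
 then obtain B where B: "obas T (bil X) B" "norms (bil X) B = N"
 using q.obas_transport tw_orth_obas assms(2) by metis
 moreover have "card B = card X" using q.obas_unique(2)[OF B(1) tw_orth_obas[OF C(1,2)]] C by simp
 ultimately show ?thesis by (auto simp: hd_tw_def obas_def)
qed

lemma hd_units: "hd_tw H X \<rho> \<epsilon> M ==> set_mset M <= fixf H - {0}"
 using q.orth_norms_units by (auto simp: hd_tw_def)

lemma sact_one: "sact H S X \<rho> (%_ _. 1)"
 by unfold_locales (auto simp: finX \<rho>_in \<rho>_comp triv)

lemma sact_mult: assumes "sact H S X \<rho> \<epsilon>'" shows "sact H S X \<rho> (%\<mu> x. \<epsilon> \<mu> x * \<epsilon>' \<mu> x)"
proof -
 interpret e: sact H S X \<rho> \<epsilon>' by fact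
 show ?thesis
 proof unfold_locales
 show "\<epsilon> \<mu> x * \<epsilon>' \<mu> x = 1 | \<epsilon> \<mu> x * \<epsilon>' \<mu> x = -1" if "\<mu> \<in> H" "x \<in> X" for \<mu> x
 using \<epsilon>_sign[OF that] e.\<epsilon>_sign[OF that] by auto
 qed (auto simp: finX \<rho>_in \<rho>_comp triv e.triv \<epsilon>_comp e.\<epsilon>_comp algebra_simps)
qed

lemma sact_subset:
 assumes "X' <= X" "!!\<mu> x. \<mu> \<in> H ==> x \<in> X' ==> \<rho> \<mu> x \<in> X'"
 shows "sact H S X' \<rho> \<epsilon>"
proof unfold_locales
 show "finite X'" using finX assms(1) finite_subset by blast
qed (use assms in \<open>auto simp: \<rho>_comp \<epsilon>_comp triv \<epsilon>_sign subset_iff\<close>)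

lemma tw_eps_sq: "f \<in> T ==> \<mu> \<in> H ==> x \<in> X ==> \<mu> (f x) = \<epsilon> \<mu> x * f (\<rho> \<mu> x)"
 using \<epsilon>_sq[of \<mu> x] by (simp add: twD(2) mult.assoc[symmetric])

end

lemma hd_Un:
 fixes M N :: "'s::field multiset" and X Y :: "'i set"
 assumes "hd_tw H X \<rho> \<epsilon> M" "hd_tw H Y \<rho> \<epsilon> N" "X \<inter> Y = {}" "finite X" "finite Y"
 and XY: "!!\<mu> x. \<mu> \<in> H ==> x \<in> X ==> \<rho> \<mu> x \<in> X" "!!\<mu> x. \<mu> \<in> H ==> x \<in> Y ==> \<rho> \<mu> x \<in> Y"
 and z: "!!\<mu>. \<mu> \<in> H ==> \<mu> 0 = 0"
 shows "hd_tw H (X \<union> Y) \<rho> \<epsilon> (M + N)"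
proof -
 have dj: "x \<notin> Y" if "x \<in> X" for x using that assms(3) by blast
 have sub: "f \<in> tw H (X \<union> Y) \<rho> \<epsilon>" if "f \<in> tw H X \<rho> \<epsilon> | f \<in> tw H Y \<rho> \<epsilon>" for f
 using that
 proof
 assume f: "f \<in> tw H X \<rho> \<epsilon>"
 have "f x = 0 & f (\<rho> \<mu> x) = 0" if "x \<in> Y" "\<mu> \<in> H" for x \<mu>
 using twD(1)[OF f] XY(2)[OF that(2,1)] that(1) dj by blast
 thus ?thesis using twD[OF f] z by (intro twI) auto
 next
 assume f: "f \<in> tw H Y \<rho> \<epsilon>"
 have "f x = 0 & f (\<rho> \<mu> x) = 0" if "x \<in> X" "\<mu> \<in> H" for x \<mu>
 using twD(1)[OF f] XY(1)[OF that(2,1)] that(1) dj by blast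
 thus ?thesis using twD[OF f] z by (intro twI) auto
 qed
 have b: "bil (X \<union> Y) f g = bil X f g + bil Y f g" for f g :: "'i => 's"
 using assms(3-5) by (simp add: wbil_def sum.union_disjoint)
 have b0: "bil Y f g = 0" "bil Y g f = 0" if "f \<in> tw H X \<rho> \<epsilon>" for f g
 proof -
 have "f x = 0" if "x \<in> Y" for x using twD(1)[OF \<open>f \<in> tw H X \<rho> \<epsilon>\<close>] dj that by blast
 thus "bil Y f g = 0" "bil Y g f = 0" unfolding wbil_def by (auto intro!: sum.neutral)
 qed
 have b0': "bil X f g = 0" "bil X g f = 0" if "f \<in> tw H Y \<rho> \<epsilon>" for f g
 proof -
 have "f x = 0" if "x \<in> X" for x using twD(1)[OF \<open>f \<in> tw H Y \<rho> \<epsilon>\<close>] dj that by blast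
 thus "bil X f g = 0" "bil X g f = 0" unfolding wbil_def by (auto intro!: sum.neutral)
 qed
 obtain C where C: "orth (tw H X \<rho> \<epsilon>) (bil X) C" "card C = card X" "norms (bil X) C = M"
 using assms(1) by (auto simp: hd_tw_def)
 obtain D where D: "orth (tw H Y \<rho> \<epsilon>) (bil Y) D" "card D = card Y" "norms (bil Y) D = N"
 using assms(2) by (auto simp: hd_tw_def)
 have Ci: "f \<in> tw H X \<rho> \<epsilon>" if "f \<in> C" for f using C(1) that by (auto simp: orth_def)
 have Di: "f \<in> tw H Y \<rho> \<epsilon>" if "f \<in> D" for f using D(1) that by (auto simp: orth_def)
 have C': "orth (tw H (X \<union> Y) \<rho> \<epsilon>) (bil (X \<union> Y)) C" "norms (bil (X \<union> Y)) C = M"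
 using orth_image[where T = "%x. x" and c = 1 and V' = "tw H (X \<union> Y) \<rho> \<epsilon>" and \<beta>' = "bil (X \<union> Y)", OF C(1)]
 Ci sub b b0 C(3) by simp_all
 have D': "orth (tw H (X \<union> Y) \<rho> \<epsilon>) (bil (X \<union> Y)) D" "norms (bil (X \<union> Y)) D = N"
 using orth_image[where T = "%x. x" and c = 1 and V' = "tw H (X \<union> Y) \<rho> \<epsilon>" and \<beta>' = "bil (X \<union> Y)", OF D(1)]
 Di sub b b0' D(3) by simp_all
 have z: "bil (X \<union> Y) f g = 0 & bil (X \<union> Y) g f = 0" if "f \<in> C" "g \<in> D" for f g
 using b b0[OF Ci[OF that(1)]] b0'[OF Di[OF that(2)]] by simp
 note U = orth_Un[OF C'(1) D'(1) z]
 have "card (C \<union> D) = card (X \<union> Y)"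
 using U(2) C D assms(3-5) orth_finite by (metis card_Un_disjoint)
 thus ?thesis unfolding hd_tw_def using U C' D' by auto
qed

lemma hd_similar:
 assumes "hd_tw H X \<rho> \<epsilon> M" "c ~= 0" "card X' = card X"
 and "!!f. f \<in> tw H X \<rho> \<epsilon> ==> \<Phi> f \<in> tw H X' \<rho>' \<epsilon>'"
 and "!!f g. f \<in> tw H X \<rho> \<epsilon> ==> g \<in> tw H X \<rho> \<epsilon> ==> bil X' (\<Phi> f) (\<Phi> g) = c * bil X f g"
 shows "hd_tw H X' \<rho>' \<epsilon>' (image_mset ((*) c) M)"
proof -
 obtain C where C: "orth (tw H X \<rho> \<epsilon>) (bil X) C" "card C = card X" "norms (bil X) C = M"
 using assms(1) by (auto simp: hd_tw_def)
 have Ci: "f \<in> tw H X \<rho> \<epsilon>" if "f \<in> C" for f using C(1) that by (auto simp: orth_def)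
 show ?thesis unfolding hd_tw_def
 using orth_image[where T = \<Phi> and V' = "tw H X' \<rho>' \<epsilon>'" and \<beta>' = "bil X'", OF C(1) assms(2)] C Ci assms(3-5)
 by (intro exI[of _ "\<Phi> ` C"]) auto
qed

lemma hd_cong:
 assumes "hd_tw H X \<rho> \<epsilon> M" "!!\<mu> x. \<mu> \<in> H ==> x \<in> X ==> \<epsilon> \<mu> x = \<epsilon>' \<mu> x"
 shows "hd_tw H X \<rho> \<epsilon>' M"
proof -
 have "tw H X \<rho> \<epsilon> = tw H X \<rho> \<epsilon>'" unfolding tw_def using assms(2) by force
 thus ?thesis using assms(1) by (simp add: hd_tw_def)
qed

text \<open>The orthogonal sum of two modules on \<open>X\<close>, realised on \<open>X \<times> {0, 1}\<close>.\<close>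

lemma hd_pair:
 fixes M N :: "'s::field multiset" and X :: "'i set"
 assumes M: "hd_tw H X \<rho> \<epsilon> M" and N: "hd_tw H X \<rho> \<epsilon>' N" and fin: "finite X"
 and X: "!!\<mu> x. \<mu> \<in> H ==> x \<in> X ==> \<rho> \<mu> x \<in> X" and z: "!!\<mu>. \<mu> \<in> H ==> \<mu> 0 = 0"
 shows "hd_tw H (X \<times> {0, 1::nat}) (%\<mu> (x, n). (\<rho> \<mu> x, n)) (%\<mu> (x, n). if n = 0 then \<epsilon> \<mu> x else \<epsilon>' \<mu> x) (M + N)"
proof -
 define \<Phi> where "\<Phi> m f = (%(x, n). if n = m then f x else 0)" for m :: nat and f :: "'i => 's"
 have b: "bil (X \<times> {m}) (\<Phi> m f) (\<Phi> m g) = bil X f g" for m f g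
 proof -
 have "X \<times> {m} = (%x. (x, m)) ` X" by auto
 thus ?thesis by (simp add: wbil_def \<Phi>_def sum.reindex inj_on_def)
 qed
 have P: "hd_tw H (X \<times> {m}) (%\<mu> (x, n). (\<rho> \<mu> x, n)) (%\<mu> (x, n). if n = 0 then \<epsilon> \<mu> x else \<epsilon>' \<mu> x) L"
 if L: "hd_tw H X \<rho> \<eta> L" and \<eta>: "\<eta> = (if m = 0 then \<epsilon> else \<epsilon>')" for m :: nat and L \<eta>
 proof -
 have "hd_tw H (X \<times> {m}) (%\<mu> (x, n). (\<rho> \<mu> x, n)) (%\<mu> (x, n). if n = 0 then \<epsilon> \<mu> x else \<epsilon>' \<mu> x) (image_mset ((*) 1) L)"
 proof (rule hd_similar[OF L, where \<Phi> = "\<Phi> m"])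
 show "card (X \<times> {m}) = card X" by (simp add: card_cartesian_product)
 show "\<Phi> m f \<in> tw H (X \<times> {m}) (%\<mu> (x, n). (\<rho> \<mu> x, n)) (%\<mu> (x, n). if n = 0 then \<epsilon> \<mu> x else \<epsilon>' \<mu> x)"
 if "f \<in> tw H X \<rho> \<eta>" for f
 proof (rule twI)
 show "\<Phi> m f x = 0" if "x \<notin> X \<times> {m}" for x
 using twD(1)[OF \<open>f \<in> tw H X \<rho> \<eta>\<close>] that by (cases x) (auto simp: \<Phi>_def)
 qed (use twD(2)[OF that] \<eta> in \<open>auto simp: \<Phi>_def\<close>)
 qed (simp_all add: b)
 thus ?thesis by simp
 qed
 have "X \<times> {0, 1::nat} = X \<times> {0} \<union> X \<times> {1}" by auto
 thus ?thesis
 using hd_Un[OF P[OF M, of 0] P[OF N, of 1]] fin X z by auto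
qed

text \<open>Up to the square 4, \<open>N\<close> is a norm from the extension by a square root of
  \<open>c\<close>. The equation says that <c, N> represents \<open>A^2\<close>, hence 1 if
  \<open>A \<noteq> 0\<close>. If \<open>A = 0\<close>, both sides are hyperbolic planes.\<close>

lemma (in subfld) deq_norm_form:
 assumes "c \<in> K" "c ~= 0" "N \<in> K" "N ~= 0" "A \<in> K" "B \<in> K" and eq: "A^2 = c * B^2 + 4 * N"
 shows "deq K {#c, N#} {#1, c * N#}"
proof (cases "A = 0")
 case False
 have "c * (B / A)^2 + N * (2 / A)^2 = (c * B^2 + 4 * N) / A^2"
 by (simp add: power_divide add_divide_distrib)
 also have "\<dots> = 1" unfolding eq[symmetric] using False by simp
 finally show ?thesis using assms False
 by (intro deq_binary[where x = "B / A" and y = "2 / A"]) simp_all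
next
 case True
 have four: "(4::'f) ~= 0" using two by (metis mult_eq_0_iff numeral_Bit0_eq_double)
 have N: "N = - c * (B / 2)^2"
 proof -
 have "4 * N = - c * B^2" using eq True by (simp add: add_eq_0_iff)
 thus ?thesis using four by (simp add: field_simps power2_eq_square)
 qed
 have B: "B / 2 ~= 0" using assms(4) N by auto
 have "deq K {#c, - c#} {#c, N#}"
 unfolding add_mset_commute[of c] using assms B by (intro deq_square[where x = "B / 2"]) (simp_all add: N)
 moreover have "deq K {#1, -1#} {#1, c * N#}"
 unfolding add_mset_commute[of 1] using assms B
 by (intro deq_square[where x = "c * (B / 2)"]) (simp_all add: N power2_eq_square)
 moreover have "deq K {#c, - c#} {#1, -1#}" using assms by (intro deq_hyperbolic)
 ultimately show ?thesis by (metis deq_sym deq_trans)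
qed

lemma orth_insert:
 assumes "orth V \<beta> C" "v \<in> V" "\<beta> v v ~= 0" "!!c. c \<in> C ==> \<beta> v c = 0 & \<beta> c v = 0"
 shows "orth V \<beta> (insert v C) & card (insert v C) = Suc (card C) & norms \<beta> (insert v C) = add_mset (\<beta> v v) (norms \<beta> C)"
proof -
 have "v \<notin> C" using assms(3,4) by auto
 thus ?thesis using assms by (auto simp: orth_def norms_insert)
qed

lemma sact_pair:
 assumes "sact H S X \<rho> \<epsilon>" "sact H S X \<rho> \<epsilon>'"
 shows "sact H S (X \<times> {0, 1::nat}) (%\<mu> (x, n). (\<rho> \<mu> x, n)) (%\<mu> (x, n). if n = 0 then \<epsilon> \<mu> x else \<epsilon>' \<mu> x)"
proof -
 interpret a: sact H S X \<rho> \<epsilon> by fact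
 interpret b: sact H S X \<rho> \<epsilon>' by fact
 show ?thesis
 by unfold_locales (auto simp: a.finX a.\<rho>_in a.\<rho>_comp a.\<epsilon>_comp b.\<epsilon>_comp a.triv b.triv dest: a.\<epsilon>_sign b.\<epsilon>_sign)
qed

lemma bil_pair: "finite X ==> bil (X \<times> {0, 1::nat}) f g = (\<Sum>x\<in>X. f (x, 0) * g (x, 0) + f (x, 1) * g (x, 1))"
proof -
 assume "finite X"
 have "bil (X \<times> {0, 1::nat}) f g = (\<Sum>(x, n)\<in>X \<times> {0, 1::nat}. f (x, n) * g (x, n))"
 unfolding wbil_def by (rule sum.cong) auto
 also have "\<dots> = (\<Sum>x\<in>X. \<Sum>n\<in>{0, 1::nat}. f (x, n) * g (x, n))"
 by (rule sum.cartesian_product[symmetric])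
 finally show ?thesis by simp
qed

section \<open>Signed permutations of five points\<close>

definition pairs5 :: "(nat \<times> nat) set" where
 "pairs5 = {(i, j). i \<in> {1..5} & j \<in> {1..5} & i < j}"

lemma pairs5_eq: "pairs5 = {(1,2), (3,4)} \<union> ({(1,3), (1,4), (2,3), (2,4)} \<union> {(1,5), (2,5), (3,5), (4,5)})"
 (is "_ = ?R")
proof
 show "?R <= pairs5" by (auto simp: pairs5_def)
 show "pairs5 <= ?R"
 proof
 fix p assume "p \<in> pairs5"
 then obtain i j where p: "p = (i, j)" "1 \<le> i" "i < j" "j \<le> 5" by (auto simp: pairs5_def)
 hence "i = 1 | i = 2 | i = 3 | i = 4" "j = 2 | j = 3 | j = 4 | j = 5" by linarith+
 thus "p \<in> ?R" unfolding p(1) using p(3) by (elim disjE) simp_all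
 qed
qed

lemma card_pairs5: "finite pairs5" "card pairs5 = 10"
 by (simp_all add: pairs5_eq)

locale five = sact H S "{1..5::nat}" \<rho> \<sigma> for H :: "('s::field => 's) set" and S \<rho> \<sigma>
begin

definition \<rho>2 :: "('s => 's) => nat \<times> nat => nat \<times> nat" where
 "\<rho>2 \<mu> = (%(i, j). (min (\<rho> \<mu> i) (\<rho> \<mu> j), max (\<rho> \<mu> i) (\<rho> \<mu> j)))"

definition \<sigma>2 :: "('s => 's) => nat \<times> nat => 's" where
 "\<sigma>2 \<mu> = (%(i, j). \<sigma> \<mu> i * \<sigma> \<mu> j)"

text \<open>The sign by which \<open>e\<^sub>i \<and> e\<^sub>j\<close> differs from the basis vector with sorted indices.\<close>

definition ori :: "('s => 's) => nat \<times> nat => 's" where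
 "ori \<mu> = (%(i, j). if \<rho> \<mu> i < \<rho> \<mu> j then 1 else -1)"

lemma \<rho>_neq: "\<mu> \<in> H ==> i \<in> {1..5} ==> j \<in> {1..5} ==> i ~= j ==> \<rho> \<mu> i ~= \<rho> \<mu> j"
 using \<rho>_bij[of \<mu>] by (auto simp: bij_betw_def inj_on_def)

lemma sact_pairs: "sact H S pairs5 \<rho>2 \<sigma>2" "sact H S pairs5 \<rho>2 ori"
proof -
 have 1: "\<rho>2 \<mu> x \<in> pairs5" if g: "\<mu> \<in> H" and x: "x \<in> pairs5" for \<mu> x
 proof -
 obtain i j where ij: "x = (i, j)" "i \<in> {1..5}" "j \<in> {1..5}" "i < j" using x by (auto simp: pairs5_def)
 have "\<rho> \<mu> i \<in> {1..5}" "\<rho> \<mu> j \<in> {1..5}" "\<rho> \<mu> i ~= \<rho> \<mu> j" using \<rho>_in[OF g] \<rho>_neq[OF g] ij by auto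
 thus ?thesis by (auto simp: ij \<rho>2_def pairs5_def)
 qed
 have c: "\<rho>2 (\<mu> \<circ> \<delta>) x = \<rho>2 \<mu> (\<rho>2 \<delta> x) & \<sigma>2 (\<mu> \<circ> \<delta>) x = \<sigma>2 \<mu> (\<rho>2 \<delta> x) * \<sigma>2 \<delta> x &
 ori (\<mu> \<circ> \<delta>) x = ori \<mu> (\<rho>2 \<delta> x) * ori \<delta> x" if g: "\<mu> \<in> H" "\<delta> \<in> H" and x: "x \<in> pairs5" for \<mu> \<delta> x
 proof -
 obtain i j where ij: "x = (i, j)" "i \<in> {1..5}" "j \<in> {1..5}" "i < j" using x by (auto simp: pairs5_def)
 have e: "\<rho> (\<mu> \<circ> \<delta>) i = \<rho> \<mu> (\<rho> \<delta> i)" "\<rho> (\<mu> \<circ> \<delta>) j = \<rho> \<mu> (\<rho> \<delta> j)"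
 "\<sigma> (\<mu> \<circ> \<delta>) i = \<sigma> \<mu> (\<rho> \<delta> i) * \<sigma> \<delta> i" "\<sigma> (\<mu> \<circ> \<delta>) j = \<sigma> \<mu> (\<rho> \<delta> j) * \<sigma> \<delta> j"
 using \<rho>_comp[OF g] \<epsilon>_comp[OF g] ij by auto
 have "\<rho> \<delta> i ~= \<rho> \<delta> j" "\<rho> \<mu> (\<rho> \<delta> i) ~= \<rho> \<mu> (\<rho> \<delta> j)" using \<rho>_neq[OF g(2)] \<rho>_neq[OF g(1)] \<rho>_in[OF g(2)] ij by auto
 thus ?thesis unfolding ij \<rho>2_def \<sigma>2_def ori_def split_conv e
 by (cases "\<rho> \<delta> i < \<rho> \<delta> j"; cases "\<rho> \<mu> (\<rho> \<delta> i) < \<rho> \<mu> (\<rho> \<delta> j)")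
 (auto simp: min_def max_def mult.commute mult.left_commute)
 qed
 have sg: "\<sigma>2 \<mu> x = 1 | \<sigma>2 \<mu> x = -1" if g: "\<mu> \<in> H" and x: "x \<in> pairs5" for \<mu> x
 proof -
 obtain i j where ij: "x = (i, j)" "i \<in> {1..5}" "j \<in> {1..5}" "i < j" using x by (auto simp: pairs5_def)
 show ?thesis using \<epsilon>_sign[OF g ij(2)] \<epsilon>_sign[OF g ij(3)] by (auto simp: ij \<sigma>2_def)
 qed
 have t: "\<rho>2 \<mu> x = x & \<sigma>2 \<mu> x = 1 & ori \<mu> x = 1"
 if g: "\<mu> \<in> H" "!!s. s \<in> S ==> \<mu> s = s" and x: "x \<in> pairs5" for \<mu> x
 proof -
 obtain i j where ij: "x = (i, j)" "i \<in> {1..5}" "j \<in> {1..5}" "i < j" using x by (auto simp: pairs5_def)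
 show ?thesis using triv[OF g ij(2)] triv[OF g ij(3)] ij
 by (auto simp: \<rho>2_def \<sigma>2_def ori_def)
 qed
 show "sact H S pairs5 \<rho>2 \<sigma>2"
 by unfold_locales (use 1 c sg t in \<open>auto simp: card_pairs5\<close>)
 show "sact H S pairs5 \<rho>2 ori"
 by unfold_locales (use 1 c t in \<open>auto simp: card_pairs5, auto simp: ori_def\<close>)
qed

text \<open>With the factor \<open>ori\<close> this is the module of the exterior square, see
  \<open>hd_wedge\<close>; without it, the module in which the products \<open>f i * f j\<close> of
  two twisted functions live.\<close>

lemma sact_pairs2: "sact H S pairs5 \<rho>2 (%\<mu> x. \<sigma>2 \<mu> x * ori \<mu> x)"
 by (rule sact.sact_mult[OF sact_pairs])

end

text \<open>Five points with \<open>5\<close> fixed and the partition \<open>{1, 2} | {3, 4}\<close> of the rest preserved.\<close>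

locale five_blocks = five +
 assumes fix5: "\<mu> \<in> H ==> \<rho> \<mu> 5 = 5"
 and blk: "\<mu> \<in> H ==> (\<rho> \<mu> 1 = 1 & \<rho> \<mu> 2 = 2 & \<rho> \<mu> 3 = 3 & \<rho> \<mu> 4 = 4) |
 (\<rho> \<mu> 1 = 2 & \<rho> \<mu> 2 = 1 & \<rho> \<mu> 3 = 3 & \<rho> \<mu> 4 = 4) |
 (\<rho> \<mu> 1 = 1 & \<rho> \<mu> 2 = 2 & \<rho> \<mu> 3 = 4 & \<rho> \<mu> 4 = 3) |
 (\<rho> \<mu> 1 = 2 & \<rho> \<mu> 2 = 1 & \<rho> \<mu> 3 = 4 & \<rho> \<mu> 4 = 3) |
 (\<rho> \<mu> 1 = 3 & \<rho> \<mu> 2 = 4 & \<rho> \<mu> 3 = 1 & \<rho> \<mu> 4 = 2) |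
 (\<rho> \<mu> 1 = 4 & \<rho> \<mu> 2 = 3 & \<rho> \<mu> 3 = 1 & \<rho> \<mu> 4 = 2) |
 (\<rho> \<mu> 1 = 3 & \<rho> \<mu> 2 = 4 & \<rho> \<mu> 3 = 2 & \<rho> \<mu> 4 = 1) |
 (\<rho> \<mu> 1 = 4 & \<rho> \<mu> 2 = 3 & \<rho> \<mu> 3 = 2 & \<rho> \<mu> 4 = 1)"
begin

text \<open>The blocks, the pairs between the blocks, and the pairs with the fixed index 5. On the
  last set \<open>ori\<close> is trivial, so only the first two need an argument.\<close>

abbreviation "XB \<equiv> {(1,2), (3,4)} :: (nat \<times> nat) set"
abbreviation "XC \<equiv> {(1,3), (1,4), (2,3), (2,4)} :: (nat \<times> nat) set"
abbreviation "XE \<equiv> {(1,5), (2,5), (3,5), (4,5)} :: (nat \<times> nat) set"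
abbreviation "X4 \<equiv> {1,2,3,4} :: nat set"

text \<open>The character by which the group permutes the two blocks.\<close>

definition sw :: "('a => 'a) => 'a" where "sw \<mu> = (if \<rho> \<mu> 1 < 3 then 1 else -1)"

lemma stable: "\<mu> \<in> H ==> x \<in> XB ==> \<rho>2 \<mu> x \<in> XB" "\<mu> \<in> H ==> x \<in> XC ==> \<rho>2 \<mu> x \<in> XC"
 "\<mu> \<in> H ==> x \<in> XE ==> \<rho>2 \<mu> x \<in> XE" "\<mu> \<in> H ==> i \<in> X4 ==> \<rho> \<mu> i \<in> X4"
proof -
 assume g: "\<mu> \<in> H"
 show "\<rho>2 \<mu> x \<in> XB" if "x \<in> XB" using that blk[OF g]
 by (elim insertE disjE conjE) (simp_all add: \<rho>2_def)
 show "\<rho>2 \<mu> x \<in> XC" if "x \<in> XC" using that blk[OF g]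
 by (elim insertE disjE conjE) (simp_all add: \<rho>2_def)
 show "\<rho>2 \<mu> x \<in> XE" if "x \<in> XE" using that blk[OF g] fix5[OF g]
 by (elim insertE disjE conjE) (simp_all add: \<rho>2_def)
 show "\<rho> \<mu> i \<in> X4" if "i \<in> X4" using that blk[OF g]
 by (elim insertE disjE conjE) simp_all
qed

lemma sacts: "sact H S XB \<rho>2 \<sigma>2" "sact H S XB \<rho>2 ori" "sact H S XB \<rho>2 (%\<mu> x. \<sigma>2 \<mu> x * ori \<mu> x)"
 "sact H S XB \<rho>2 (%_ _. 1)" "sact H S XC \<rho>2 \<sigma>2" "sact H S XE \<rho>2 \<sigma>2" "sact H S X4 \<rho> \<sigma>" "sact H S X4 \<rho> (%_ _. 1)"
proof -
 have sub: "XB <= pairs5" "XC <= pairs5" "XE <= pairs5" unfolding pairs5_eq by blast+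
 show 1: "sact H S XB \<rho>2 \<sigma>2" by (rule sact.sact_subset[OF sact_pairs(1) sub(1) stable(1)])
 show "sact H S XB \<rho>2 ori" by (rule sact.sact_subset[OF sact_pairs(2) sub(1) stable(1)])
 show "sact H S XB \<rho>2 (%\<mu> x. \<sigma>2 \<mu> x * ori \<mu> x)" by (rule sact.sact_subset[OF sact_pairs2 sub(1) stable(1)])
 show "sact H S XB \<rho>2 (%_ _. 1)" by (rule sact.sact_one[OF 1])
 show "sact H S XC \<rho>2 \<sigma>2" by (rule sact.sact_subset[OF sact_pairs(1) sub(2) stable(2)])
 show "sact H S XE \<rho>2 \<sigma>2" by (rule sact.sact_subset[OF sact_pairs(1) sub(3) stable(3)])
 show 2: "sact H S X4 \<rho> \<sigma>" by (rule sact_subset[OF _ stable(4)]) auto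
 show "sact H S X4 \<rho> (%_ _. 1)" by (rule sact.sact_one[OF 2])
qed

sublocale m4: sact H S X4 \<rho> \<sigma> by (rule sacts)
sublocale mB: sact H S XB \<rho>2 "%\<mu> x. \<sigma>2 \<mu> x * ori \<mu> x" by (rule sacts)
sublocale mC: sact H S XC \<rho>2 \<sigma>2 by (rule sacts)

text \<open>\<open>r\<close> is a nonzero value of a function on one point twisted by
  \<open>sw\<close>. It generates the quadratic (or trivial) extension over which the blocks are
  fixed.\<close>

lemma swap_sign: obtains r where "r ~= 0" "!!\<mu>. \<mu> \<in> H ==> \<mu> r = sw \<mu> * r"
proof -
 have "sact H S {0::nat} (%_ x. x) (%\<mu> _. sw \<mu>)"
 proof unfold_locales
 show "sw (\<mu> \<circ> \<delta>) = sw \<mu> * sw \<delta>" if "\<mu> \<in> H" "\<delta> \<in> H" for \<mu> \<delta>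
 using blk[OF that(1)] blk[OF that(2)] \<rho>_comp[OF that, of 1]
 by (elim disjE conjE) (simp_all add: sw_def)
 show "x = x & sw \<mu> = 1" if "\<mu> \<in> H" "!!s. s \<in> S ==> \<mu> s = s" for \<mu> and x :: nat
 using triv[OF that, of 1] by (simp add: sw_def)
 qed (auto simp: sw_def)
 then obtain f where f: "f \<in> tw H {0::nat} (%_ x. x) (%\<mu> _. sw \<mu>)" "f 0 ~= 0"
 using sact.tw_value_exists by (metis singletonI)
 have "\<mu> (f 0) = sw \<mu> * f 0" if "\<mu> \<in> H" for \<mu>
 proof -
 have "f 0 = sw \<mu> * \<mu> (f 0)" using twD(2)[OF f(1) that, of 0] by simp
 moreover have "sw \<mu> * sw \<mu> = 1" by (simp add: sw_def)
 ultimately show ?thesis by (metis mult.assoc mult_1)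
 qed
 thus ?thesis using that f(2) by blast
qed

text \<open>If \<open>w i^2 + w j^2\<close> vanished on the whole twist, so would its polarisation,
  and the vector supported on \<open>i\<close>, \<open>j\<close> with entries \<open>v i\<close>,
  \<open>v j\<close> would be orthogonal to the twist. For both blocks at once: an automorphism that
  swaps them carries the condition over, and if there is none, two vectors may be glued.\<close>

lemma generic_vector: obtains w where "w \<in> tw H X4 \<rho> \<sigma>" "w 1 ^ 2 + w 2 ^ 2 ~= 0" "w 3 ^ 2 + w 4 ^ 2 ~= 0"
proof -
 have ex: "\<exists>w\<in>tw H X4 \<rho> \<sigma>. w i ^ 2 + w j ^ 2 ~= 0" if ij: "i \<in> X4" "j \<in> X4" "i ~= j" for i j
 proof (rule ccontr)
 assume "~ ?thesis"
 hence n: "w i ^ 2 + w j ^ 2 = 0" if "w \<in> tw H X4 \<rho> \<sigma>" for w using that by blast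
 obtain v where v: "v \<in> tw H X4 \<rho> \<sigma>" "v i ~= 0" using m4.tw_value_exists ij by blast
 define d where "d = (%l. if l = i | l = j then v l else 0)"
 have "d = 0"
 proof (rule m4.descent_nondegenerate)
 show "d \<in> fset X4" using ij by (auto simp: d_def fset_def)
 fix w assume w: "w \<in> tw H X4 \<rho> \<sigma>"
 have "2 * (v i * w i + v j * w j) = 0"
 proof -
 have "(v i + w i)^2 + (v j + w j)^2 = (v i^2 + v j^2) + (w i^2 + w j^2) + 2 * (v i * w i + v j * w j)"
 by (simp add: power2_eq_square algebra_simps)
 thus ?thesis using n[OF m4.q.Vadd[OF v(1) w]] n[OF v(1)] n[OF w] by simp
 qed
 hence "v i * w i + v j * w j = 0" using two_neq mult_eq_0_iff by blast
 moreover have "bil X4 d w = (\<Sum>l\<in>{i, j}. v l * w l)"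
 unfolding wbil_def using ij by (intro sum.mono_neutral_cong_right) (auto simp: d_def)
 ultimately show "bil X4 d w = 0" using ij by simp
 qed
 thus False using v(2) by (metis d_def zero_fun_apply)
 qed
 obtain w where w: "w \<in> tw H X4 \<rho> \<sigma>" "w 1 ^ 2 + w 2 ^ 2 ~= 0" using ex[of 1 2] by auto
 obtain v where v: "v \<in> tw H X4 \<rho> \<sigma>" "v 3 ^ 2 + v 4 ^ 2 ~= 0" using ex[of 3 4] by auto
 show ?thesis
 proof (cases "\<exists>\<mu>\<in>H. ~ \<rho> \<mu> 1 < 3")
 case True
 then obtain \<mu> where g: "\<mu> \<in> H" "~ \<rho> \<mu> 1 < 3" by blast
 have "\<mu> (w 1 ^ 2 + w 2 ^ 2) = w (\<rho> \<mu> 1) ^ 2 + w (\<rho> \<mu> 2) ^ 2"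
 proof -
 have "\<sigma> \<mu> 1 = 1 | \<sigma> \<mu> 1 = -1" "\<sigma> \<mu> 2 = 1 | \<sigma> \<mu> 2 = -1"
 "\<mu> (w 1) = \<sigma> \<mu> 1 * w (\<rho> \<mu> 1)" "\<mu> (w 2) = \<sigma> \<mu> 2 * w (\<rho> \<mu> 2)"
 using m4.\<epsilon>_sign[OF g(1)] m4.tw_eps_sq[OF w(1) g(1)] by auto
 thus ?thesis using g(1) by (elim disjE) (simp_all add: hom_simps)
 qed
 moreover have "\<dots> = w 3 ^ 2 + w 4 ^ 2" using blk[OF g(1)] g(2) by (elim disjE conjE) simp_all
 ultimately have "w 3 ^ 2 + w 4 ^ 2 ~= 0" using w(2) hom_inj[OF g(1), of _ 0] hom_zero[OF g(1)] by metis
 thus ?thesis using that w by blast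
 next
 case False
 define d where "d = (%l. if l < 3 then w l else v l)"
 have "d \<in> tw H X4 \<rho> \<sigma>"
 proof (rule twI)
 show "d l = 0" if "l \<notin> X4" for l using that twD(1)[OF w(1)] twD(1)[OF v(1)] by (auto simp: d_def)
 show "d (\<rho> \<mu> l) = \<sigma> \<mu> l * \<mu> (d l)" if "\<mu> \<in> H" "l \<in> X4" for \<mu> l
 using twD(2)[OF w(1) that] twD(2)[OF v(1) that] blk[OF that(1)] False that
 by (elim disjE conjE) (auto simp: d_def)
 qed
 thus ?thesis using that w v by (auto simp: d_def)
 qed
qed

lemma generic_sign: obtains z where "z \<in> tw H XB \<rho>2 (%\<mu> x. \<sigma>2 \<mu> x * ori \<mu> x)" "z (1,2) ~= 0" "z (3,4) ~= 0"
proof -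
 let ?T = "tw H XB \<rho>2 (%\<mu> x. \<sigma>2 \<mu> x * ori \<mu> x)"
 obtain w where w: "w \<in> ?T" "w (1,2) ~= 0" using mB.tw_value_exists[of "(1,2)"] by auto
 obtain v where v: "v \<in> ?T" "v (3,4) ~= 0" using mB.tw_value_exists[of "(3,4)"] by auto
 show ?thesis
 proof (cases "\<exists>\<mu>\<in>H. ~ \<rho> \<mu> 1 < 3")
 case True
 then obtain \<mu> where g: "\<mu> \<in> H" "~ \<rho> \<mu> 1 < 3" by blast
 have "\<rho>2 \<mu> (1,2) = (3,4)" using blk[OF g(1)] g(2) by (elim disjE conjE) (simp_all add: \<rho>2_def)
 moreover have "\<mu> (w (1,2)) ~= 0" using w(2) hom_inj[OF g(1), of _ 0] hom_zero[OF g(1)] by metis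
 ultimately have "w (3,4) ~= 0" using mB.tw_eps_sq[OF w(1) g(1), of "(1,2)"] by auto
 thus ?thesis using that w by blast
 next
 case False
 define d where "d = (%l. if l = (1,2) then w l else v l)"
 have "d \<in> ?T"
 proof (rule twI)
 show "d l = 0" if "l \<notin> XB" for l using that twD(1)[OF w(1)] twD(1)[OF v(1)] by (auto simp: d_def)
 show "d (\<rho>2 \<mu> l) = \<sigma>2 \<mu> l * ori \<mu> l * \<mu> (d l)" if "\<mu> \<in> H" "l \<in> XB" for \<mu> l
 proof -
 have "\<rho>2 \<mu> l = l" using blk[OF that(1)] False that by (elim disjE conjE) (auto simp: \<rho>2_def)
 thus ?thesis using twD(2)[OF w(1) that] twD(2)[OF v(1) that] by (cases "l = (1,2)") (simp_all add: d_def)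
 qed
 qed
 thus ?thesis using that w v by (auto simp: d_def)
 qed
qed

lemma cross: assumes "\<mu> \<in> H" "(i, j) \<in> XC"
 shows "(sw \<mu> = 1 & \<rho>2 \<mu> (i, j) = (\<rho> \<mu> i, \<rho> \<mu> j) & (\<rho> \<mu> i, \<rho> \<mu> j) \<in> XC) |
 (sw \<mu> = -1 & \<rho>2 \<mu> (i, j) = (\<rho> \<mu> j, \<rho> \<mu> i) & (\<rho> \<mu> j, \<rho> \<mu> i) \<in> XC)" "ori \<mu> (i, j) = sw \<mu>"
proof -
 have "i = 1 | i = 2" "j = 3 | j = 4" using assms(2) by auto
 thus "(sw \<mu> = 1 & \<rho>2 \<mu> (i, j) = (\<rho> \<mu> i, \<rho> \<mu> j) & (\<rho> \<mu> i, \<rho> \<mu> j) \<in> XC) |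
 (sw \<mu> = -1 & \<rho>2 \<mu> (i, j) = (\<rho> \<mu> j, \<rho> \<mu> i) & (\<rho> \<mu> j, \<rho> \<mu> i) \<in> XC)" "ori \<mu> (i, j) = sw \<mu>"
 using blk[OF assms(1)] by (elim disjE conjE; simp add: \<rho>2_def sw_def ori_def)+
qed

lemma block: assumes "\<mu> \<in> H" "(i, j) \<in> XB"
 shows "(ori \<mu> (i, j) = 1 & \<rho>2 \<mu> (i, j) = (\<rho> \<mu> i, \<rho> \<mu> j) & (\<rho> \<mu> i, \<rho> \<mu> j) \<in> XB) |
 (ori \<mu> (i, j) = -1 & \<rho>2 \<mu> (i, j) = (\<rho> \<mu> j, \<rho> \<mu> i) & (\<rho> \<mu> j, \<rho> \<mu> i) \<in> XB)"
proof -
 have "i = 1 & j = 2 | i = 3 & j = 4" using assms(2) by auto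
 thus ?thesis
 using blk[OF assms(1)] by (elim disjE conjE; simp add: \<rho>2_def ori_def)
qed

lemma X4_block: assumes "l \<in> X4" obtains i j where "(i, j) \<in> XB" "l = i | l = j"
 using assms by auto

lemma bil_simps: "bil XB f g = f (1,2) * g (1,2) + f (3,4) * g (3,4)"
 "bil X4 f' g' = f' 1 * g' 1 + f' 2 * g' 2 + f' 3 * g' 3 + f' 4 * g' 4"
 "bil XC f g = f (1,3) * g (1,3) + f (1,4) * g (1,4) + f (2,3) * g (2,3) + f (2,4) * g (2,4)"
 by (simp_all add: wbil_def add.assoc)

lemma sg: "\<mu> \<in> H ==> l \<in> X4 ==> \<sigma> \<mu> l = 1 | \<sigma> \<mu> l = -1"
 by (rule m4.\<epsilon>_sign)

text \<open>On each block a function is the sum of a symmetric and an antisymmetric part, and the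
  latter carries the sign \<open>ori\<close> of the block. The factor 2 comes from (a + b)^2 + (a -
  b)^2.\<close>

lemma hd_X4_one:
 assumes "hd_tw H XB \<rho>2 (%_ _. 1) M" "hd_tw H XB \<rho>2 ori N"
 shows "hd_tw H X4 \<rho> (%_ _. 1) (image_mset ((*) 2) (M + N))"
proof -
 let ?Z = "XB \<times> {0, 1::nat}" and ?\<epsilon> = "%\<mu> (x, n). if n = (0::nat) then 1 else ori \<mu> x"
 have Z: "hd_tw H ?Z (%\<mu> (x, n). (\<rho>2 \<mu> x, n)) ?\<epsilon> (M + N)"
 by (rule hd_pair[OF assms]) (use stable hom_zero in auto)
 define \<Phi> where "\<Phi> F l = (if l = 1 then F ((1,2), 0) + F ((1,2), 1) else if l = 2 then F ((1,2), 0) - F ((1,2), 1)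
 else if l = 3 then F ((3,4), 0) + F ((3,4), 1) else if l = 4 then F ((3,4), 0) - F ((3,4), 1) else 0)"
 for F :: "(nat \<times> nat) \<times> nat => 'a" and l :: nat
 have \<Phi>: "\<Phi> F i = F ((i,j),0) + F ((i,j),1)" "\<Phi> F j = F ((i,j),0) - F ((i,j),1)" if "(i, j) \<in> XB" for F i j
 using that by (auto simp: \<Phi>_def)
 show ?thesis
 proof (rule hd_similar[OF Z two_neq, where \<Phi> = \<Phi>])
 show "\<Phi> F \<in> tw H X4 \<rho> (%_ _. 1)" if F: "F \<in> tw H ?Z (%\<mu> (x, n). (\<rho>2 \<mu> x, n)) ?\<epsilon>" for F
 proof (rule twI)
 show "\<Phi> F l = 0" if "l \<notin> X4" for l using that by (auto simp: \<Phi>_def)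
 fix \<mu> l assume g: "\<mu> \<in> H" and l: "l \<in> X4"
 obtain i j where ij: "(i, j) \<in> XB" "l = i | l = j" using X4_block l by blast
 have e: "F (\<rho>2 \<mu> (i,j), 0) = \<mu> (F ((i,j), 0))" "F (\<rho>2 \<mu> (i,j), 1) = ori \<mu> (i,j) * \<mu> (F ((i,j), 1))"
 using twD(2)[OF F g, of "((i,j), 0)"] twD(2)[OF F g, of "((i,j), 1)"] ij(1) by auto
 show "\<Phi> F (\<rho> \<mu> l) = 1 * \<mu> (\<Phi> F l)"
 using block[OF g ij(1)]
 proof (elim disjE conjE)
 assume b: "ori \<mu> (i, j) = 1" "\<rho>2 \<mu> (i, j) = (\<rho> \<mu> i, \<rho> \<mu> j)" "(\<rho> \<mu> i, \<rho> \<mu> j) \<in> XB"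
 show ?thesis using ij(2) \<Phi>[OF b(3)] \<Phi>[OF ij(1)] e g unfolding b by (auto simp: hom_simps)
 next
 assume b: "ori \<mu> (i, j) = -1" "\<rho>2 \<mu> (i, j) = (\<rho> \<mu> j, \<rho> \<mu> i)" "(\<rho> \<mu> j, \<rho> \<mu> i) \<in> XB"
 show ?thesis using ij(2) \<Phi>[OF b(3)] \<Phi>[OF ij(1)] e g unfolding b by (auto simp: hom_simps)
 qed
 qed
 show "bil X4 (\<Phi> F) (\<Phi> G) = 2 * bil ?Z F G" for F G
 proof -
 have "bil ?Z F G = F ((1,2),0) * G ((1,2),0) + F ((1,2),1) * G ((1,2),1) + (F ((3,4),0) * G ((3,4),0) + F ((3,4),1) * G ((3,4),1))"
 by (subst bil_pair) simp_all
 thus ?thesis unfolding bil_simps by (simp add: \<Phi>_def algebra_simps)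
 qed
 qed (simp add: card_cartesian_product)
qed

lemma w_eq: "w \<in> tw H X4 \<rho> \<sigma> ==> \<mu> \<in> H ==> l \<in> X4 ==> \<mu> (w l) = \<sigma> \<mu> l * w (\<rho> \<mu> l)"
 using m4.tw_eps_sq by blast

lemma XB_X4: "(i, j) \<in> XB ==> i \<in> X4 & j \<in> X4" "(i, j) \<in> XC ==> i \<in> X4 & j \<in> X4"
 by auto

text \<open>With \<open>p = w\<^sub>i\<^sup>2 - w\<^sub>j\<^sup>2\<close>, \<open>q = 2 w\<^sub>i w\<^sub>j\<close> and \<open>u = w\<^sub>i\<^sup>2 + w\<^sub>j\<^sup>2\<close> one has \<open>p\<^sup>2 + q\<^sup>2 = u\<^sup>2\<close>, and the rotation by
  \<open>(p, q) / u\<close> is equivariant.\<close>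

lemma hd_rotate:
 assumes M: "hd_tw H XB \<rho>2 ori M" and N: "hd_tw H XB \<rho>2 \<sigma>2 N"
 and M': "hd_tw H XB \<rho>2 (%_ _. 1) M'" and N': "hd_tw H XB \<rho>2 (%\<mu> x. \<sigma>2 \<mu> x * ori \<mu> x) N'"
 shows "deq (fixf H) (M + N) (M' + N')"
proof -
 let ?Z = "XB \<times> {0, 1::nat}" and ?\<rho> = "%\<mu> (x, n::nat). (\<rho>2 \<mu> x, n)"
 let ?\<epsilon> = "%\<mu> (x, n). if n = (0::nat) then ori \<mu> x else \<sigma>2 \<mu> x"
 let ?\<epsilon>' = "%\<mu> (x, n). if n = (0::nat) then 1 else \<sigma>2 \<mu> x * ori \<mu> x"
 have Z: "hd_tw H ?Z ?\<rho> ?\<epsilon> (M + N)" by (rule hd_pair[OF M N]) (use stable hom_zero in auto)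
 have Z': "hd_tw H ?Z ?\<rho> ?\<epsilon>' (M' + N')" by (rule hd_pair[OF M' N']) (use stable hom_zero in auto)
 interpret z: sact H S ?Z ?\<rho> ?\<epsilon>' by (rule sact_pair[OF sacts(4) sacts(3)])
 obtain w where w: "w \<in> tw H X4 \<rho> \<sigma>" "w 1 ^ 2 + w 2 ^ 2 ~= 0" "w 3 ^ 2 + w 4 ^ 2 ~= 0" by (rule generic_vector)
 define p q u where "p = (%(i, j). w i ^ 2 - w j ^ 2)" and "q = (%(i, j). 2 * w i * w j)" and "u = (%(i, j). w i ^ 2 + w j ^ 2)"
 have u0: "u x ~= 0" if "x \<in> XB" for x using that w by (auto simp: u_def)
 have pq: "p x * p x + q x * q x = u x * u x" for x
 by (cases x) (simp add: p_def q_def u_def power2_eq_square algebra_simps)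
 have eq: "\<mu> (p x) = ori \<mu> x * p (\<rho>2 \<mu> x) & \<mu> (q x) = \<sigma>2 \<mu> x * q (\<rho>2 \<mu> x) & \<mu> (u x) = u (\<rho>2 \<mu> x)"
 if g: "\<mu> \<in> H" and x: "x \<in> XB" for \<mu> x
 proof -
 obtain i j where ij: "x = (i, j)" by (cases x)
 have X: "i \<in> X4" "j \<in> X4" using XB_X4 x ij by auto
 have e: "\<mu> (w i) = \<sigma> \<mu> i * w (\<rho> \<mu> i)" "\<mu> (w j) = \<sigma> \<mu> j * w (\<rho> \<mu> j)" using w_eq[OF w(1) g] X by auto
 have s: "\<sigma> \<mu> i = 1 | \<sigma> \<mu> i = -1" "\<sigma> \<mu> j = 1 | \<sigma> \<mu> j = -1" using sg[OF g] X by auto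
 show ?thesis using block[OF g x[unfolded ij]] s unfolding ij
 by (elim disjE conjE) (simp_all add: p_def q_def u_def \<sigma>2_def hom_simps g e)
 qed
 \<comment> \<open>\<open>p\<close> carries the sign \<open>ori\<close> and \<open>q\<close> the
   sign \<open>\<sigma>2\<close>, so the first rotated component is invariant and the second has the
   product of both signs.\<close>
 define \<Phi> where "\<Phi> F = (%(x, n::nat). if (x, n) \<in> ?Z then (if n = 0 then (p x * F (x, 0) + q x * F (x, 1)) / u x
 else (p x * F (x, 1) - q x * F (x, 0)) / u x) else 0)" for F :: "(nat \<times> nat) \<times> nat => 'a"
 have "hd_tw H ?Z ?\<rho> ?\<epsilon>' (image_mset ((*) 1) (M + N))"
 proof (rule hd_similar[OF Z, where \<Phi> = \<Phi>])
 show "\<Phi> F \<in> tw H ?Z ?\<rho> ?\<epsilon>'" if F: "F \<in> tw H ?Z ?\<rho> ?\<epsilon>" for F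
 proof (rule twI)
 show "\<Phi> F y = 0" if "y \<notin> ?Z" for y using that by (cases y) (simp only: \<Phi>_def split_conv if_False)
 fix \<mu> y assume g: "\<mu> \<in> H" and y: "y \<in> ?Z"
 obtain x n where xn: "y = (x, n)" "x \<in> XB" "n = 0 | n = 1" using y by auto
 have mem: "(x, n) \<in> ?Z" "(\<rho>2 \<mu> x, n) \<in> ?Z" if "n = 0 | n = 1" for n :: nat
 using xn(2) stable(1)[OF g xn(2)] that by auto
 have F0: "F (\<rho>2 \<mu> x, 0) = ori \<mu> x * \<mu> (F (x, 0))" "F (\<rho>2 \<mu> x, 1) = \<sigma>2 \<mu> x * \<mu> (F (x, 1))"
 using twD(2)[OF F g mem(1)[of 0]] twD(2)[OF F g mem(1)[of 1]] by auto
 have s: "ori \<mu> x = 1 | ori \<mu> x = -1" "\<sigma>2 \<mu> x = 1 | \<sigma>2 \<mu> x = -1"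
 using sact.\<epsilon>_sign[OF sacts(2) g xn(2)] sact.\<epsilon>_sign[OF sacts(1) g xn(2)] by auto
 note e = eq[OF g xn(2)]
 show "\<Phi> F (?\<rho> \<mu> y) = ?\<epsilon>' \<mu> y * \<mu> (\<Phi> F y)"
 using xn(3) s unfolding xn(1) \<Phi>_def split_conv
 by (elim disjE) (simp_all only: mem if_True HOL.refl one_neq_zero if_False F0 hom_simps[OF g] e HOL.simp_thms, simp_all add: divide_simps)
 qed
 show "bil ?Z (\<Phi> F) (\<Phi> G) = 1 * bil ?Z F G" for F G
 proof -
 have "\<Phi> F (x, 0) * \<Phi> G (x, 0) + \<Phi> F (x, 1) * \<Phi> G (x, 1) = F (x, 0) * G (x, 0) + F (x, 1) * G (x, 1)"
 if x: "x \<in> XB" for x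
 proof -
 have "(p x * a + q x * b) * (p x * c + q x * d) + (p x * b - q x * a) * (p x * d - q x * c)
 = (p x * p x + q x * q x) * (a * c + b * d)" for a b c d by (simp add: algebra_simps)
 hence "(p x * a + q x * b) / u x * ((p x * c + q x * d) / u x) + (p x * b - q x * a) / u x * ((p x * d - q x * c) / u x)
 = a * c + b * d" for a b c d
 using u0[OF x] by (simp add: times_divide_times_eq add_divide_distrib[symmetric] pq)
 moreover have "(x, 0) \<in> ?Z" "(x, 1) \<in> ?Z" using x by auto
 ultimately show ?thesis unfolding \<Phi>_def split_conv by (simp only: if_True HOL.refl one_neq_zero if_False)
 qed
 thus ?thesis by (subst (1 2) bil_pair) (simp_all del: insert_iff)
 qed
 qed simp_all
 thus ?thesis using z.hd_deq Z' by simp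
qed

text \<open>\<open>M\<close> is the trace form of the quadratic algebra of the two blocks. Its basis
  1 and \<open>r\<close>, written \<open>a\<close> and \<open>b\<close> below, has norms 2 and
  \<open>2 r^2\<close>; taken twice, <2, 2> = <1, 1> removes the factors 2.\<close>

lemma deq_double:
 assumes M: "hd_tw H XB \<rho>2 (%_ _. 1) M" and r: "r ~= 0" "!!\<mu>. \<mu> \<in> H ==> \<mu> r = sw \<mu> * r"
 shows "deq (fixf H) (M + M) {#1, 1, r^2, r^2#}" "r^2 \<in> fixf H"
proof -
 interpret o: sact H S XB \<rho>2 "%_ _. 1" by (rule sacts)
 have "\<mu> (r^2) = r^2" if "\<mu> \<in> H" for \<mu>
 by (cases "sw \<mu> = 1") (use r(2)[OF that] in \<open>auto simp: hom_simps that sw_def\<close>)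
 thus c: "r^2 \<in> fixf H" by (simp add: fixf_def)
 define a b where "a = (%x::nat \<times> nat. if x \<in> XB then 1 else 0 :: 'a)"
 and "b = (%x::nat \<times> nat. if x = (1,2) then r else if x = (3,4) then - r else 0)"
 have aT: "a \<in> o.T" by (rule twI) (use stable(1) in \<open>auto simp: a_def hom_one\<close>)
 have bT: "b \<in> o.T"
 proof (rule twI)
 show "b x = 0" if "x \<notin> XB" for x using that by (auto simp: b_def)
 show "b (\<rho>2 \<mu> x) = 1 * \<mu> (b x)" if g: "\<mu> \<in> H" and x: "x \<in> XB" for \<mu> x
 using x blk[OF g] by (elim insertE disjE conjE) (simp_all add: b_def \<rho>2_def r(2)[OF g] sw_def hom_simps g)
 qed
 have n: "bil XB a a = 2" "bil XB b b = 2 * r^2" "bil XB a b = 0"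
 by (simp_all only: bil_simps) (simp_all add: a_def b_def power2_eq_square)
 have 1: "orth o.T (bil XB) {b}" "card {b} = 1" "norms (bil XB) {b} = {#2 * r^2#}"
 using bT n r two_neq by (simp_all add: orth_def norms_def)
 have "hd_tw H XB \<rho>2 (%_ _. 1) {#2, 2 * r^2#}"
 using orth_insert[OF 1(1) aT] n two_neq 1 by (auto simp: hd_tw_def wbil_sym intro!: exI[of _ "{a, b}"])
 hence M2: "deq (fixf H) M {#2, 2 * r^2#}" using o.hd_deq M by blast
 have d: "deq (fixf H) {#2, 2#} {#1, 1#}"
 by (rule fx.deq_sym, rule deq_binary[where x = 1 and y = 1]) (use two_neq in simp_all)
 have "deq (fixf H) (image_mset ((*) (r^2)) {#2, 2#}) (image_mset ((*) (r^2)) {#1, 1#})"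
 using d c r by (intro fx.deq_scale) auto
 hence "deq (fixf H) ({#2, 2#} + {#2 * r^2, 2 * r^2#}) ({#1, 1#} + {#r^2, r^2#})"
 using d by (intro deq_add2) (simp_all add: mult.commute)
 moreover have "deq (fixf H) (M + M) ({#2, 2 * r^2#} + {#2, 2 * r^2#})" by (intro deq_add2 M2)
 moreover have "{#2, 2 * r^2#} + {#2, 2 * r^2#} = {#2, 2#} + {#2 * r^2, 2 * r^2#}"
 "{#1, 1#} + {#r^2, r^2#} = {#1, 1, r^2, r^2#}" by simp_all
 ultimately show "deq (fixf H) (M + M) {#1, 1, r^2, r^2#}" by (metis deq_trans)
qed

text \<open>On pairs between the blocks the orientation is \<open>sw\<close>, so that multiplication
  by \<open>r\<close> absorbs it.\<close>

lemma hd_cross_twist: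
 assumes N: "hd_tw H XC \<rho>2 \<sigma>2 N" and r: "r ~= 0" "!!\<mu>. \<mu> \<in> H ==> \<mu> r = sw \<mu> * r"
 shows "hd_tw H XC \<rho>2 (%\<mu> x. \<sigma>2 \<mu> x * ori \<mu> x) (image_mset ((*) (r^2)) N)"
proof (rule hd_similar[OF N, where \<Phi> = "%f x. r * f x"])
 show "(%x. r * f x) \<in> tw H XC \<rho>2 (%\<mu> x. \<sigma>2 \<mu> x * ori \<mu> x)" if f: "f \<in> tw H XC \<rho>2 \<sigma>2" for f
 proof (rule twI)
 show "r * f x = 0" if "x \<notin> XC" for x using twD(1)[OF f that] by simp
 show "r * f (\<rho>2 \<mu> x) = \<sigma>2 \<mu> x * ori \<mu> x * \<mu> (r * f x)" if g: "\<mu> \<in> H" and x: "x \<in> XC" for \<mu> x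
 proof -
 have "ori \<mu> x = sw \<mu>" using cross(2)[OF g] x by (cases x) blast
 thus ?thesis using twD(2)[OF f g x] r(2)[OF g] by (simp add: hom_simps g sw_def)
 qed
 qed
 show "bil XC (%x. r * f x) (%x. r * g x) = r^2 * bil XC f g" for f g
 by (simp only: bil_simps) (simp add: power2_eq_square algebra_simps)
qed (use r in auto)

text \<open>On each block \<open>w\<close> and \<open>v\<close> are orthogonal, so the products
  \<open>E w w\<close>, \<open>E v v\<close>, \<open>E w v\<close> and the antisymmetric
  \<open>t2\<close> span the module on the four pairs. The norms \<open>4 u u'\<close> and
  \<open>4 n n'\<close> of the first two are treated by \<open>deq_norm_form\<close>, each with one
  copy of \<open>r^2\<close>. The plane of the other two is similar to itself with factor
  \<open>r^2\<close>, because its vectors \<open>E w v\<close> and \<open>t2\<close> have norms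
  \<open>P\<close> and \<open>r^2 P\<close>.\<close>

lemma deq_cross:
 assumes N: "hd_tw H XC \<rho>2 \<sigma>2 N" and r: "r ~= 0" "!!\<mu>. \<mu> \<in> H ==> \<mu> r = sw \<mu> * r"
 and M: "hd_tw H XB \<rho>2 (%_ _. 1) M"
 shows "deq (fixf H) ({#r^2, r^2#} + N) ({#1, 1#} + image_mset ((*) (r^2)) N)"
proof -
 note One_nat_def [simp del]
 let ?K = "fixf H" and ?c = "r^2"
 have c: "?c \<in> ?K" "?c ~= 0" using deq_double(2)[OF M r] r by auto
 obtain w where w: "w \<in> m4.T" "w 1 ^ 2 + w 2 ^ 2 ~= 0" "w 3 ^ 2 + w 4 ^ 2 ~= 0" by (rule generic_vector)
 obtain z where z: "z \<in> mB.T" "z (1,2) ~= 0" "z (3,4) ~= 0" by (rule generic_sign)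
 \<comment> \<open>A quarter turn of \<open>w\<close> in each block. It changes sign with the
   orientation of the block and interchanges the signs of its two points, which the factor
   \<open>z\<close> compensates.\<close>
 define v where "v l = (if l = 1 then - z (1,2) * w 2 else if l = 2 then z (1,2) * w 1
 else if l = 3 then - z (3,4) * w 4 else if l = 4 then z (3,4) * w 3 else 0)" for l :: nat
 have vB: "v i = - z (i,j) * w j" "v j = z (i,j) * w i" if "(i, j) \<in> XB" for i j
 using that by (auto simp: v_def)
 have vT: "v \<in> m4.T"
 proof (rule twI)
 show "v l = 0" if "l \<notin> X4" for l using that by (auto simp: v_def)
 fix \<mu> l assume g: "\<mu> \<in> H" and l: "l \<in> X4"
 obtain i j where ij: "(i, j) \<in> XB" "l = i | l = j" using X4_block l by blast
 have X: "i \<in> X4" "j \<in> X4" using XB_X4(1)[OF ij(1)] by auto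
 have e: "\<mu> (w i) = \<sigma> \<mu> i * w (\<rho> \<mu> i)" "\<mu> (w j) = \<sigma> \<mu> j * w (\<rho> \<mu> j)" using w_eq[OF w(1) g] X by auto
 have s: "\<sigma> \<mu> i = 1 | \<sigma> \<mu> i = -1" "\<sigma> \<mu> j = 1 | \<sigma> \<mu> j = -1" using sg[OF g] X by auto
 have ez: "\<mu> (z (i,j)) = \<sigma> \<mu> i * \<sigma> \<mu> j * ori \<mu> (i,j) * z (\<rho>2 \<mu> (i,j))"
 using mB.tw_eps_sq[OF z(1) g ij(1)] by (simp add: \<sigma>2_def)
 show "v (\<rho> \<mu> l) = \<sigma> \<mu> l * \<mu> (v l)"
 using block[OF g ij(1)]
 proof (elim disjE[of "_ & _"] conjE)
 assume b: "ori \<mu> (i, j) = 1" "\<rho>2 \<mu> (i, j) = (\<rho> \<mu> i, \<rho> \<mu> j)" "(\<rho> \<mu> i, \<rho> \<mu> j) \<in> XB"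
 show ?thesis using ij(2) s by (elim disjE) (simp_all add: vB[OF b(3)] vB[OF ij(1)] e ez b(1,2) hom_simps g)
 next
 assume b: "ori \<mu> (i, j) = -1" "\<rho>2 \<mu> (i, j) = (\<rho> \<mu> j, \<rho> \<mu> i)" "(\<rho> \<mu> j, \<rho> \<mu> i) \<in> XB"
 show ?thesis using ij(2) s by (elim disjE) (simp_all add: vB[OF b(3)] vB[OF ij(1)] e ez b(1,2) hom_simps g)
 qed
 qed
 define u u' n n' where "u = w 1 ^ 2 + w 2 ^ 2" and "u' = w 3 ^ 2 + w 4 ^ 2" and "n = v 1 ^ 2 + v 2 ^ 2" and "n' = v 3 ^ 2 + v 4 ^ 2"
 have nu: "n = z (1,2) ^ 2 * u" "n' = z (3,4) ^ 2 * u'"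
 by (simp_all add: n_def n'_def u_def u'_def v_def power2_eq_square algebra_simps)
 have nz: "u ~= 0" "u' ~= 0" "n ~= 0" "n' ~= 0" unfolding nu using w z by (auto simp: u_def u'_def)
 have o: "w 1 * v 1 + w 2 * v 2 = 0" "w 3 * v 3 + w 4 * v 4 = 0" by (simp_all add: v_def)
 define E where "E x y = (%(i, j). if (i, j) \<in> XC then x i * y j + y i * x j else 0)" for x y :: "nat => 'a"
 \<comment> \<open>The antisymmetric product changes sign when the blocks are swapped;
   \<open>r\<close> makes it equivariant.\<close>
 define t2 where "t2 = (%(i, j). if (i, j) \<in> XC then r * (w i * v j - v i * w j) else 0)"
 have ET: "E x y \<in> mC.T" if x: "x \<in> m4.T" and y: "y \<in> m4.T" for x y
 proof (rule twI)
 show "E x y p = 0" if "p \<notin> XC" for p using that by (cases p) (simp only: E_def split_conv if_False)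
 fix \<mu> p assume g: "\<mu> \<in> H" and p: "p \<in> XC"
 obtain i j where ij: "p = (i, j)" by (cases p)
 have X: "i \<in> X4" "j \<in> X4" using XB_X4(2) p ij by auto
 have e: "\<mu> (x i) = \<sigma> \<mu> i * x (\<rho> \<mu> i)" "\<mu> (x j) = \<sigma> \<mu> j * x (\<rho> \<mu> j)"
 "\<mu> (y i) = \<sigma> \<mu> i * y (\<rho> \<mu> i)" "\<mu> (y j) = \<sigma> \<mu> j * y (\<rho> \<mu> j)" using w_eq[OF x g] w_eq[OF y g] X by auto
 have s: "\<sigma> \<mu> i = 1 | \<sigma> \<mu> i = -1" "\<sigma> \<mu> j = 1 | \<sigma> \<mu> j = -1" using sg[OF g] X by auto
 show "E x y (\<rho>2 \<mu> p) = \<sigma>2 \<mu> p * \<mu> (E x y p)"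
 using cross(1)[OF g p[unfolded ij]] s unfolding ij E_def
 by (elim disjE conjE) (simp_all only: split_conv p[unfolded ij] if_True hom_simps[OF g] e \<sigma>2_def, simp_all)
 qed
 have t2T: "t2 \<in> mC.T"
 proof (rule twI)
 show "t2 p = 0" if "p \<notin> XC" for p using that by (cases p) (simp only: t2_def split_conv if_False)
 fix \<mu> p assume g: "\<mu> \<in> H" and p: "p \<in> XC"
 obtain i j where ij: "p = (i, j)" by (cases p)
 have X: "i \<in> X4" "j \<in> X4" using XB_X4(2) p ij by auto
 have e: "\<mu> (w i) = \<sigma> \<mu> i * w (\<rho> \<mu> i)" "\<mu> (w j) = \<sigma> \<mu> j * w (\<rho> \<mu> j)"
 "\<mu> (v i) = \<sigma> \<mu> i * v (\<rho> \<mu> i)" "\<mu> (v j) = \<sigma> \<mu> j * v (\<rho> \<mu> j)" using w_eq[OF w(1) g] w_eq[OF vT g] X by auto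
 have s: "\<sigma> \<mu> i = 1 | \<sigma> \<mu> i = -1" "\<sigma> \<mu> j = 1 | \<sigma> \<mu> j = -1" using sg[OF g] X by auto
 show "t2 (\<rho>2 \<mu> p) = \<sigma>2 \<mu> p * \<mu> (t2 p)"
 using cross(1)[OF g p[unfolded ij]] s unfolding ij t2_def
 by (elim disjE conjE) (simp_all only: split_conv p[unfolded ij] if_True hom_simps[OF g] e r(2)[OF g] \<sigma>2_def, simp_all add: algebra_simps)
 qed
 let ?t1 = "E w v"
 have EXC: "E x y (1,3) = x 1 * y 3 + y 1 * x 3" "E x y (1,4) = x 1 * y 4 + y 1 * x 4"
 "E x y (2,3) = x 2 * y 3 + y 2 * x 3" "E x y (2,4) = x 2 * y 4 + y 2 * x 4" for x y
 by (simp_all add: E_def)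
 have tXC: "t2 (1,3) = r * (w 1 * v 3 - v 1 * w 3)" "t2 (1,4) = r * (w 1 * v 4 - v 1 * w 4)"
 "t2 (2,3) = r * (w 2 * v 3 - v 2 * w 3)" "t2 (2,4) = r * (w 2 * v 4 - v 2 * w 4)"
 by (simp_all add: t2_def)
 define P Y where "P = u * n' + n * u'" and "Y = r * (u * n' - n * u')"
 let ?b = "bil XC" and ?o = "w 1 * v 1 + w 2 * v 2" and ?o' = "w 3 * v 3 + w 4 * v 4"
 have ip: "?b (E w w) (E w w) = 4 * (u * u')" "?b (E v v) (E v v) = 4 * (n * n')" "?b (E w w) (E v v) = 4 * (?o * ?o')"
 "?b (E w w) ?t1 = 2 * (u * ?o' + ?o * u')" "?b (E v v) ?t1 = 2 * (?o * n' + n * ?o')"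
 "?b (E w w) t2 = 2 * r * (u * ?o' - ?o * u')" "?b (E v v) t2 = 2 * r * (?o * n' - n * ?o')"
 "?b ?t1 ?t1 = P + 2 * (?o * ?o')" "?b t2 t2 = ?c * (P - 2 * (?o * ?o'))" "?b ?t1 t2 = Y"
 unfolding bil_simps EXC tXC P_def Y_def u_def u'_def n_def n'_def
 by (simp_all only: power2_eq_square) (simp_all only: algebra_simps, simp_all)
 note ip = ip[unfolded o mult_zero_left mult_zero_right add_0_left add_0_right diff_zero]
 have four: "(4::'a) ~= 0" using two_neq by (metis mult_eq_0_iff numeral_Bit0_eq_double)
 have PY: "P \<in> ?K" "Y \<in> ?K" using mC.q.\<beta>_in[OF ET[OF w(1) vT] ET[OF w(1) vT]] mC.q.\<beta>_in[OF ET[OF w(1) vT] t2T] ip by auto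
 have uK: "u * u' \<in> ?K" "n * n' \<in> ?K"
 proof -
 have "4 * (x * y) / 4 = x * y" for x y :: 'a using four by simp
 thus "u * u' \<in> ?K" "n * n' \<in> ?K"
 using fx.divide[OF mC.q.\<beta>_in[OF ET[OF w(1) w(1)] ET[OF w(1) w(1)]] fx.numeral, of "num.Bit0 (num.Bit0 num.One)"]
 fx.divide[OF mC.q.\<beta>_in[OF ET[OF vT vT] ET[OF vT vT]] fx.numeral, of "num.Bit0 (num.Bit0 num.One)"]
 unfolding ip by simp_all
 qed
 \<comment> \<open>The determinant of the plane spanned by \<open>?t1\<close> and \<open>t2\<close>;
   the right-hand side is nonzero.\<close>
 have Pc: "?c * P^2 - Y^2 = ?c * (4 * (u * u') * (n * n'))"
 by (simp add: P_def Y_def power2_eq_square algebra_simps)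
 have flip: "?b y x = 0" if "?b x y = 0" for x y using that wbil_sym by metis
 have flipY: "?b t2 ?t1 = Y" using ip(10) wbil_sym by metis
 have C0: "orth mC.T ?b {E w w}" "card {E w w} = 1" "norms ?b {E w w} = {#4 * (u * u')#}"
 using ET[OF w(1) w(1)] ip nz four by (simp_all add: orth_def norms_def)
 have C1: "orth mC.T ?b {E v v, E w w}" "card {E v v, E w w} = 2" "norms ?b {E v v, E w w} = {#4 * (n * n'), 4 * (u * u')#}"
 using orth_insert[OF C0(1) ET[OF vT vT]] C0(2,3) ip(2) ip(3) flip[OF ip(3)] nz four by auto
 have "\<exists>D d d'. orth mC.T ?b D & card D = 4 & norms ?b D = {#d, d'#} + {#4 * (n * n'), 4 * (u * u')#} &
 deq ?K {#d, d'#} {#?c * d, ?c * d'#}"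
 proof (cases "P = 0")
 case False
 define t2' where "t2' = t2 - fscale (Y / P) ?t1"
 have YP: "Y / P \<in> ?K" using PY by simp
 have T: "?t1 \<in> mC.T" "t2' \<in> mC.T" using ET[OF w(1) vT] t2T YP by (auto simp: t2'_def)
 define d where "d = ?c * P - Y^2 / P"
 have dd: "d = ?c * (4 * (u * u') * (n * n')) / P"
 unfolding Pc[symmetric] d_def using False by (simp add: diff_divide_distrib power2_eq_square)
 have d0: "d ~= 0" unfolding dd using False c nz four by simp
 have sub: "?b x t2' = ?b x t2 - Y / P * ?b x ?t1" "?b t2' x = ?b t2 x - Y / P * ?b ?t1 x" if "x \<in> mC.T" for x
 using that t2T T YP unfolding t2'_def by (simp_all del: fx.divide)
 have ipc: "?b t2 ?t1 = Y" "?b ?t1 (E w w) = 0" "?b ?t1 (E v v) = 0" "?b t2 (E w w) = 0" "?b t2 (E v v) = 0"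
 using flipY flip[OF ip(4)] flip[OF ip(5)] flip[OF ip(6)] flip[OF ip(7)] .
 have tt: "?b ?t1 t2' = 0" "?b t2' ?t1 = 0" "?b t2' t2' = d" "?b t2' (E w w) = 0" "?b t2' (E v v) = 0" "?b (E w w) t2' = 0" "?b (E v v) t2' = 0"
 using sub[OF T(1)] sub[OF T(2)] sub[OF t2T] sub[OF ET[OF w(1) w(1)]] sub[OF ET[OF vT vT]] ip ipc False
 by (simp_all add: d_def power2_eq_square)
 have C2: "orth mC.T ?b {?t1, E v v, E w w}" "card {?t1, E v v, E w w} = 3" "norms ?b {?t1, E v v, E w w} = {#P, 4 * (n * n'), 4 * (u * u')#}"
 using orth_insert[OF C1(1) T(1)] C1 ip ipc False by auto
 have C3: "orth mC.T ?b {t2', ?t1, E v v, E w w}" "card {t2', ?t1, E v v, E w w} = 4"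
 "norms ?b {t2', ?t1, E v v, E w w} = {#d, P, 4 * (n * n'), 4 * (u * u')#}"
 using orth_insert[OF C2(1) T(2)] C2 tt d0 by auto
 have dK: "d \<in> ?K" using c PY by (simp add: d_def)
 \<comment> \<open>The represented value is the norm of \<open>t2\<close>, whose coordinates in the
   orthogonal basis \<open>?t1\<close>, \<open>t2'\<close> are \<open>Y / P\<close> and 1.\<close>
 have "deq ?K {#P, d#} {#?c * P, P * d * (?c * P)#}"
 using False d0 dK PY c
 by (intro deq_binary[where x = "Y / P" and y = 1]) (simp_all add: d_def power2_eq_square)
 also have "deq ?K \<dots> {#?c * P, ?c * d#}"
 unfolding add_mset_commute[of "?c * P"] using False d0 dK PY c
 by (intro deq_square[where x = "inverse P"]) (simp_all add: power2_eq_square field_simps)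
 finally have "deq ?K {#d, P#} {#?c * d, ?c * P#}" by (simp add: add_mset_commute)
 thus ?thesis using C3
 by (intro exI[of _ "{t2', ?t1, E v v, E w w}"] exI[of _ d] exI[of _ P]) simp
 next
 case True
 have "Y^2 ~= 0"
 proof
 assume "Y^2 = 0"
 hence "?c * (4 * (u * u') * (n * n')) = 0" using Pc True by simp
 thus False using c nz four by simp
 qed
 hence Y0: "Y ~= 0" by auto
 \<comment> \<open>Now \<open>?t1\<close> and \<open>t2\<close> are isotropic with product
   \<open>Y\<close>, and this scaling makes the sum and the difference have norms 1 and -1. A
   hyperbolic plane is similar to itself with any factor.\<close>
 define a where "a = inverse (2 * Y)"
 have a: "a \<in> ?K" "2 * a * Y = 1" using PY Y0 two_neq by (simp_all add: a_def)
 define x y where "x = ?t1 + fscale a t2" and "y = ?t1 - fscale a t2"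
 have T: "x \<in> mC.T" "y \<in> mC.T" using ET[OF w(1) vT] t2T a by (simp_all add: x_def y_def)
 have ipc: "?b t2 ?t1 = Y" "?b ?t1 (E w w) = 0" "?b ?t1 (E v v) = 0" "?b t2 (E w w) = 0" "?b t2 (E v v) = 0" "?b ?t1 ?t1 = 0" "?b t2 t2 = 0"
 using flipY flip[OF ip(4)] flip[OF ip(5)] flip[OF ip(6)] flip[OF ip(7)] ip(8,9) True by simp_all
 have tt: "?b x x = 1" "?b y y = -1" "?b x y = 0" "?b y x = 0" "?b x (E w w) = 0" "?b x (E v v) = 0" "?b y (E w w) = 0" "?b y (E v v) = 0"
 using ET[OF w(1) vT] ET[OF vT vT] ET[OF w(1) w(1)] t2T a ip(10) ipc unfolding x_def y_def
 by (simp_all add: algebra_simps)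
 have tt': "?b (E w w) x = 0" "?b (E v v) x = 0" "?b (E w w) y = 0" "?b (E v v) y = 0" using tt(5-8) flip by blast+
 have C2: "orth mC.T ?b {x, E v v, E w w}" "card {x, E v v, E w w} = 3" "norms ?b {x, E v v, E w w} = {#1, 4 * (n * n'), 4 * (u * u')#}"
 using orth_insert[OF C1(1) T(1)] C1 tt tt' by auto
 have C3: "orth mC.T ?b {y, x, E v v, E w w}" "card {y, x, E v v, E w w} = 4"
 "norms ?b {y, x, E v v, E w w} = {#-1, 1, 4 * (n * n'), 4 * (u * u')#}"
 using orth_insert[OF C2(1) T(2)] C2 tt tt' by auto
 have "deq ?K {#?c, - ?c#} {#1, -1#}" using c by (intro fx.deq_hyperbolic)
 hence "deq ?K {#-1, 1#} {#?c * (-1), ?c * 1#}" by (simp add: add_mset_commute fx.deq_sym)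
 thus ?thesis using C3
 by (intro exI[of _ "{y, x, E v v, E w w}"] exI[of _ "-1"] exI[of _ 1]) simp
 qed
 then obtain D d d' where D: "orth mC.T ?b D" "card D = 4" "norms ?b D = {#d, d'#} + {#4 * (n * n'), 4 * (u * u')#}"
 "deq ?K {#d, d'#} {#?c * d, ?c * d'#}" by blast
 let ?N = "{#d, d'#} + {#4 * (n * n'), 4 * (u * u')#}"
 have "hd_tw H XC \<rho>2 \<sigma>2 ?N" unfolding hd_tw_def using D by (intro exI[of _ D]) simp
 hence NN: "deq ?K N ?N" using mC.hd_deq N by blast
 have nf: "deq ?K {#?c, 4 * (n1 * n2)#} {#1, ?c * (4 * (n1 * n2))#}"
 if "n1 * n2 \<in> ?K" "n1 ~= 0" "n2 ~= 0" and y: "y \<in> m4.T" "n1 = y 1 ^ 2 + y 2 ^ 2" "n2 = y 3 ^ 2 + y 4 ^ 2" for n1 n2 y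
 proof (rule fx.deq_norm_form)
 \<comment> \<open>\<open>n1\<close> and \<open>n2\<close> are conjugate under the block swap, so
   \<open>n1 + n2\<close> and \<open>r (n1 - n2)\<close> are fixed. The identity needed is (n1 +
   n2)^2 - (n1 - n2)^2 = 4 n1 n2.\<close>
 let ?A = "2 * (n1 + n2)" and ?B = "2 * (r * (n1 - n2) / ?c)"
 have "n1 + n2 \<in> ?K" using m4.q.\<beta>_in[OF y(1) y(1)] unfolding bil_simps y by (simp add: power2_eq_square add.assoc)
 thus "?A \<in> ?K" by (intro fx.mult fx.numeral)
 have "\<mu> (r * (n1 - n2)) = r * (n1 - n2)" if g: "\<mu> \<in> H" for \<mu>
 proof -
 have e: "\<mu> (y l) ^ 2 = y (\<rho> \<mu> l) ^ 2" if l: "l \<in> X4" for l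
 using w_eq[OF y(1) g l] sg[OF g l] by auto
 have e: "\<mu> (y 1) ^ 2 = y (\<rho> \<mu> 1) ^ 2" "\<mu> (y 2) ^ 2 = y (\<rho> \<mu> 2) ^ 2" "\<mu> (y 3) ^ 2 = y (\<rho> \<mu> 3) ^ 2" "\<mu> (y 4) ^ 2 = y (\<rho> \<mu> 4) ^ 2"
 by (rule e, simp)+
 have "\<mu> n1 = y (\<rho> \<mu> 1) ^ 2 + y (\<rho> \<mu> 2) ^ 2" "\<mu> n2 = y (\<rho> \<mu> 3) ^ 2 + y (\<rho> \<mu> 4) ^ 2"
 unfolding y by (simp_all only: hom_simps[OF g] e)
 hence "sw \<mu> = 1 & \<mu> n1 = n1 & \<mu> n2 = n2 | sw \<mu> = -1 & \<mu> n1 = n2 & \<mu> n2 = n1"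
 using blk[OF g] unfolding y by (elim disjE conjE) (simp_all add: sw_def add.commute)
 thus ?thesis using r(2)[OF g] by (auto simp: hom_simps g algebra_simps)
 qed
 hence "r * (n1 - n2) \<in> ?K" by (simp add: fixf_def)
 thus "?B \<in> ?K" using c by simp
 have "?c * (2 * (r * d / ?c))^2 = 4 * d^2" for d using r(1) by (simp add: power2_eq_square)
 hence "?c * ?B^2 = 4 * (n1 - n2)^2" .
 thus "?A^2 = ?c * ?B^2 + 4 * (4 * (n1 * n2))" by (simp add: power2_eq_square algebra_simps)
 show "4 * (n1 * n2) ~= 0" using that four by simp
 qed (use that c in simp_all)
 have n1: "deq ?K {#?c, 4 * (n * n')#} {#1, ?c * (4 * (n * n'))#}" by (rule nf[OF uK(2) nz(3,4) vT n_def n'_def])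
 have n2: "deq ?K {#?c, 4 * (u * u')#} {#1, ?c * (4 * (u * u'))#}" by (rule nf[OF uK(1) nz(1,2) w(1) u_def u'_def])
 have "deq ?K ({#?c, ?c#} + N) ({#?c, ?c#} + ?N)" using NN by (intro deq_add2) simp_all
 also have "{#?c, ?c#} + ?N = {#d, d'#} + ({#?c, 4 * (n * n')#} + {#?c, 4 * (u * u')#})" by simp
 also have "deq ?K \<dots> ({#?c * d, ?c * d'#} + ({#1, ?c * (4 * (n * n'))#} + {#1, ?c * (4 * (u * u'))#}))"
 by (intro deq_add2 D(4) n1 n2)
 also have "\<dots> = {#1, 1#} + image_mset ((*) ?c) ?N" by simp
 also have "deq ?K \<dots> ({#1, 1#} + image_mset ((*) ?c) N)"
 by (intro deq_add2 deq_refl fx.deq_scale fx.deq_sym[OF NN] c)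
 finally show ?thesis .
qed

text \<open>\<open>hd_X4_one\<close> splits <2> times the permutation form into <2> and two block
  modules, one of them with sign \<open>ori\<close>. \<open>hd_rotate\<close> trades that one and
  the block part of \<open>M2\<close> for a second trivial block module and the block part of
  \<open>M3\<close>. The two trivial ones are <1, 1, c, c> with \<open>c = r^2\<close>, and
  \<open>deq_cross\<close> uses <c, c> to turn the part of \<open>M2\<close> between the blocks into
  that of \<open>M3\<close>.\<close>

theorem signed_identity:
 assumes M1: "hd_tw H {1..5} \<rho> (%_ _. 1) M1" and M2: "hd_tw H pairs5 \<rho>2 \<sigma>2 M2"
 and M3: "hd_tw H pairs5 \<rho>2 (%\<mu> x. \<sigma>2 \<mu> x * ori \<mu> x) M3"
 shows "deq (fixf H) (image_mset ((*) 2) M1 + M2) (M3 + {#1, 1, 1, 1, 2#})"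
proof -
 let ?K = "fixf H"
 obtain r where r: "r ~= 0" "!!\<mu>. \<mu> \<in> H ==> \<mu> r = sw \<mu> * r" using swap_sign by metis
 obtain D1 where D1: "hd_tw H XB \<rho>2 (%_ _. 1) D1" using sact.hd_exists[OF sacts(4)] by blast
 obtain Do where Do: "hd_tw H XB \<rho>2 ori Do" using sact.hd_exists[OF sacts(2)] by blast
 obtain Dt where Dt: "hd_tw H XB \<rho>2 \<sigma>2 Dt" using sact.hd_exists[OF sacts(1)] by blast
 obtain Dz where Dz: "hd_tw H XB \<rho>2 (%\<mu> x. \<sigma>2 \<mu> x * ori \<mu> x) Dz" using sact.hd_exists[OF sacts(3)] by blast
 obtain N where N: "hd_tw H XC \<rho>2 \<sigma>2 N" using sact.hd_exists[OF sacts(5)] by blast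
 obtain E where E: "hd_tw H XE \<rho>2 \<sigma>2 E" using sact.hd_exists[OF sacts(6)] by blast
 let ?c = "r^2"
 have E': "hd_tw H XE \<rho>2 (%\<mu> x. \<sigma>2 \<mu> x * ori \<mu> x) E"
 proof (rule hd_cong[OF E])
 show "\<sigma>2 \<mu> x = \<sigma>2 \<mu> x * ori \<mu> x" if g: "\<mu> \<in> H" and x: "x \<in> XE" for \<mu> x
 proof -
 have "ori \<mu> x = 1" using x blk[OF g] fix5[OF g]
 by (elim insertE disjE conjE) (simp_all add: ori_def)
 thus ?thesis by simp
 qed
 qed
 have fin: "finite XB" "finite XC" "finite XE" "finite (XC \<union> XE)" "XC \<inter> XE = {}" "XB \<inter> (XC \<union> XE) = {}" by auto
 have CE: "\<rho>2 \<mu> x \<in> XC \<union> XE" if "\<mu> \<in> H" "x \<in> XC \<union> XE" for \<mu> x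
 using that stable(2,3)[OF that(1)] by blast
 have P2: "hd_tw H pairs5 \<rho>2 \<sigma>2 (Dt + (N + E))"
 unfolding pairs5_eq
 by (intro hd_Un Dt N E fin stable CE) (simp_all only: hom_zero)
 have P3: "hd_tw H pairs5 \<rho>2 (%\<mu> x. \<sigma>2 \<mu> x * ori \<mu> x) (Dz + (image_mset ((*) ?c) N + E))"
 unfolding pairs5_eq
 by (intro hd_Un Dz hd_cross_twist[OF N r] E' fin stable CE) (simp_all only: hom_zero)
 have five: "hd_tw H {5} \<rho> (%_ _. 1) {#1#}"
 proof -
 let ?f = "udelta 5 :: nat => 'a"
 have "?f \<in> tw H {5} \<rho> (%_ _. 1)" by (rule twI) (auto simp: udelta_def fix5 hom_one)
 moreover have "bil {5} ?f ?f = 1" by (simp add: wbil_def udelta_def)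
 ultimately show ?thesis unfolding hd_tw_def by (intro exI[of _ "{?f}"]) (simp add: orth_def norms_def)
 qed
 have P1: "hd_tw H {1..5} \<rho> (%_ _. 1) (image_mset ((*) 2) (D1 + Do) + {#1#})"
 proof -
 have "{1..5} = X4 \<union> {5}" by auto
 moreover have "hd_tw H (X4 \<union> {5}) \<rho> (%_ _. 1) (image_mset ((*) 2) (D1 + Do) + {#1#})"
 proof (rule hd_Un[OF hd_X4_one[OF D1 Do] five])
 show "\<rho> \<mu> x \<in> X4" if "\<mu> \<in> H" "x \<in> X4" for \<mu> x by (rule stable(4)[OF that])
 show "\<rho> \<mu> x \<in> {5}" if "\<mu> \<in> H" "x \<in> {5}" for \<mu> x using fix5[OF that(1)] that(2) by simp
 qed (simp_all add: hom_zero)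
 ultimately show ?thesis by simp
 qed
 have "deq ?K M1 (image_mset ((*) 2) (D1 + Do) + {#1#})"
 by (rule sact.hd_deq[OF sact_one M1 P1])
 hence "deq ?K (image_mset ((*) 2) M1) (image_mset ((*) 2) (image_mset ((*) 2) (D1 + Do) + {#1#}))"
 using two_neq by (intro fx.deq_scale) simp_all
 also have "\<dots> = image_mset ((*) 4) (D1 + Do) + {#2#}" by (simp add: multiset.map_comp o_def mult.assoc[symmetric])
 also have "deq ?K \<dots> ((D1 + Do) + {#2#})"
 using sact.hd_units[OF sacts(4) D1] sact.hd_units[OF sacts(2) Do] two_neq
 by (intro deq_add2 deq_refl fx.deq_square_scale[where r = 2]) auto
 finally have 1: "deq ?K (image_mset ((*) 2) M1) ((D1 + Do) + {#2#})" .
 have 2: "deq ?K M2 (Dt + (N + E))" by (rule sact.hd_deq[OF sact_pairs(1) M2 P2])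
 have 3: "deq ?K M3 (Dz + (image_mset ((*) ?c) N + E))" by (rule sact.hd_deq[OF sact_pairs2 M3 P3])
 have "deq ?K (image_mset ((*) 2) M1 + M2) (((D1 + Do) + {#2#}) + (Dt + (N + E)))" by (intro deq_add2 1 2)
 also have "((D1 + Do) + {#2#}) + (Dt + (N + E)) = (Do + Dt) + (D1 + {#2#} + N + E)" by simp
 also have "deq ?K \<dots> ((D1 + Dz) + (D1 + {#2#} + N + E))" by (intro deq_add2 deq_refl hd_rotate Do Dt D1 Dz)
 also have "(D1 + Dz) + (D1 + {#2#} + N + E) = (D1 + D1) + (Dz + {#2#} + N + E)" by simp
 also have "deq ?K \<dots> ({#1, 1, ?c, ?c#} + (Dz + {#2#} + N + E))" by (intro deq_add2 deq_refl deq_double[OF D1 r])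
 also have "{#1, 1, ?c, ?c#} + (Dz + {#2#} + N + E) = ({#?c, ?c#} + N) + (Dz + {#1, 1, 2#} + E)" by simp
 also have "deq ?K \<dots> (({#1, 1#} + image_mset ((*) ?c) N) + (Dz + {#1, 1, 2#} + E))"
 by (intro deq_add2 deq_refl deq_cross[OF N r D1])
 also have "({#1, 1#} + image_mset ((*) ?c) N) + (Dz + {#1, 1, 2#} + E) = (Dz + (image_mset ((*) ?c) N + E)) + {#1, 1, 1, 1, 2#}" by simp
 also have "deq ?K \<dots> (M3 + {#1, 1, 1, 1, 2#})" by (intro deq_add2 deq_refl fx.deq_sym[OF 3])
 finally show ?thesis .
qed

end

section \<open>The lattice of signature (1, 6)\<close>

lemma sum7: "(\<Sum>j\<le>6::nat. f j) = f 0 + f 1 + f 2 + f 3 + f 4 + f 5 + f 6" for f :: "nat => 'a::comm_monoid_add"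
proof -
 have "{..6::nat} = {0,1,2,3,4,5,6}" by auto
 thus ?thesis by (simp add: add.assoc)
qed

lemma le6_cases: "(j::nat) \<le> 6 ==> j = 0 | j = 1 | j = 2 | j = 3 | j = 4 | j = 5 | j = 6"
 by linarith

definition eta :: "nat => int" where "eta j = (if j = 0 then 1 else -1)"

lemma eta_sq [simp]: "eta j * eta j = 1" "eta j * (eta j * m) = m"
 by (simp_all add: eta_def)

text \<open>The anticanonical class 3 l_0 - l_1 - ... - l_6 of the plane blown up in six
  points.\<close>

definition hcoord :: "nat => int" where "hcoord j = (if j = 0 then 3 else -1)"

locale lattice7 =
 fixes L :: "'l::ab_group_add set" and zm :: "int => 'l => 'l" and B :: "'l => 'l => int" and h :: 'l
 assumes L0 [simp]: "0 \<in> L" and Ladd [simp]: "x \<in> L ==> y \<in> L ==> x + y \<in> L"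
 and Lzm [simp]: "x \<in> L ==> zm m x \<in> L"
 and zm_one: "zm 1 x = x" and zm_zm: "zm m (zm n x) = zm (m * n) x"
 and zm_add: "zm (m + n) x = zm m x + zm n x" and zm_addR: "zm m (x + y) = zm m x + zm m y"
 and B_sym: "x \<in> L ==> y \<in> L ==> B x y = B y x"
 and B_add: "x \<in> L ==> y \<in> L ==> z \<in> L ==> B (x + y) z = B x z + B y z"
 and B_zm: "x \<in> L ==> z \<in> L ==> B (zm m x) z = m * B x z"
begin

lemma zm_0: "zm 0 x = 0" using zm_add[of 0 0 x] by simp

lemma zm_neg1: "zm (-1) x = - x"
 using zm_add[of "-1" 1 x] by (simp add: zm_one zm_0 eq_neg_iff_add_eq_0)

lemma Lneg [simp]: "x \<in> L ==> - x \<in> L" by (metis Lzm zm_neg1)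

lemma Ldiff [simp]: "x \<in> L ==> y \<in> L ==> x - y \<in> L" using Ladd[of x "- y"] by simp

lemma zm_sum: "zm m (sum f I) = (\<Sum>i\<in>I. zm m (f i))"
proof (induction I rule: infinite_finite_induct)
 have "zm m 0 = 0" using zm_addR[of m 0 0] by simp
 thus "zm m (sum f {}) = (\<Sum>i\<in>{}. zm m (f i))" "infinite A ==> zm m (sum f A) = (\<Sum>i\<in>A. zm m (f i))" for A
 by simp_all
qed (simp add: zm_addR)

lemma L_sum: "(!!i. i \<in> I ==> f i \<in> L) ==> sum f I \<in> L"
 by (induction I rule: infinite_finite_induct) auto

lemma B_0: "z \<in> L ==> B 0 z = 0" using B_add[of 0 0 z] by simp

lemma B_sum: "(!!i. i \<in> I ==> f i \<in> L) ==> z \<in> L ==> B (sum f I) z = (\<Sum>i\<in>I. B (f i) z)"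
 by (induction I rule: infinite_finite_induct) (auto simp: B_0 B_add L_sum)

lemma B_neg: "x \<in> L ==> z \<in> L ==> B (- x) z = - B x z"
 using B_zm[of x z "-1"] by (simp add: zm_neg1)

lemma B_diff: "x \<in> L ==> y \<in> L ==> z \<in> L ==> B (x - y) z = B x z - B y z"
 using B_add[of x "- y" z] by (simp add: B_neg)

lemma B_addR: "x \<in> L ==> y \<in> L ==> z \<in> L ==> B z (x + y) = B z x + B z y"
 using B_add[of x y z] B_sym[of z "x + y"] B_sym[of z x] B_sym[of z y] by simp

lemma B_diffR: "x \<in> L ==> y \<in> L ==> z \<in> L ==> B z (x - y) = B z x - B z y"
 using B_diff[of x y z] B_sym[of z "x - y"] B_sym[of z x] B_sym[of z y] by simp

definition vec :: "(nat => 'l) => (nat => int) => 'l" where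
 "vec l c = (\<Sum>j\<le>6. zm (c j) (l j))"

text \<open>A marking of the Picard lattice: \<open>l 0\<close> is the class of a line in the plane,
  the others are six disjoint exceptional curves. As the norms are units, the last clause makes the
  \<open>l j\<close> a basis over the integers, see \<open>expand\<close>.\<close>

definition frame :: "(nat => 'l) => bool" where
 "frame l \<longleftrightarrow> (\<forall>j\<le>6. l j \<in> L) & (\<forall>i\<le>6. \<forall>j\<le>6. B (l i) (l j) = (if i = j then eta i else 0)) &
 h = vec l hcoord & (\<forall>x\<in>L. (\<forall>j\<le>6. B x (l j) = 0) --> x = 0)"

lemma vec_add: "vec l c + vec l d = vec l (%j. c j + d j)"
 by (simp add: vec_def zm_add sum.distrib)

lemma vec_zm: "zm m (vec l c) = vec l (%j. m * c j)"
 by (simp add: vec_def zm_sum zm_zm)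

lemma vec_neg: "- vec l c = vec l (%j. - c j)"
 using vec_zm[of "-1" l c] by (simp add: zm_neg1)

lemma vec_diff: "vec l c - vec l d = vec l (%j. c j - d j)"
 using vec_add[of l c "%j. - d j"] by (simp add: vec_neg[symmetric])

lemma vec_unit: "i \<le> 6 ==> vec l (%j. if j = i then 1 else 0) = l i"
 unfolding vec_def by (subst sum.remove[of _ i]) (auto simp: zm_one zm_0 intro!: sum.neutral)

lemma vec_cong: "(!!j. j \<le> 6 ==> c j = d j) ==> vec l c = vec l d"
 by (simp add: vec_def)

lemma vec_vec: "vec (%j. vec l (M j)) c = vec l (%i. \<Sum>j\<le>6. c j * M j i)"
proof -
 have "vec (%j. vec l (M j)) c = (\<Sum>j\<le>6. \<Sum>i\<le>6. zm (c j * M j i) (l i))"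
 by (simp add: vec_def[of "%j. vec l (M j)"] vec_zm) (simp add: vec_def)
 also have "\<dots> = (\<Sum>i\<le>6. \<Sum>j\<le>6. zm (c j * M j i) (l i))" by (rule sum.swap)
 also have "\<dots> = vec l (%i. \<Sum>j\<le>6. c j * M j i)" by (simp add: vec_def sum7 zm_add)
 finally show ?thesis .
qed

end

locale framed = lattice7 +
 fixes l assumes fr: "frame l"
begin

lemma l_in: "j \<le> 6 ==> l j \<in> L" and B_l: "i \<le> 6 ==> j \<le> 6 ==> B (l i) (l j) = (if i = j then eta i else 0)"
 and h_vec: "h = vec l hcoord" and complete: "x \<in> L ==> (!!j. j \<le> 6 ==> B x (l j) = 0) ==> x = 0"
 using fr by (auto simp: frame_def)

lemma vec_in [simp]: "vec l c \<in> L"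
 unfolding vec_def by (intro L_sum Lzm l_in) auto

lemma h_in [simp]: "h \<in> L" by (simp add: h_vec)

lemma B_vec_x: "x \<in> L ==> B (vec l c) x = (\<Sum>j\<le>6. c j * B (l j) x)"
 unfolding vec_def by (subst B_sum) (auto simp: l_in B_zm)

lemma B_vec_l: "i \<le> 6 ==> B (vec l c) (l i) = eta i * c i"
proof -
 assume i: "i \<le> 6"
 have "B (vec l c) (l i) = (\<Sum>j\<le>6. if j = i then eta i * c i else 0)"
 unfolding B_vec_x[OF l_in[OF i]] using i by (intro sum.cong HOL.refl) (simp add: B_l)
 thus ?thesis using i by simp
qed

lemma B_vec: "B (vec l c) (vec l d) = (\<Sum>j\<le>6. eta j * c j * d j)"
proof -
 have "B (vec l c) (vec l d) = (\<Sum>j\<le>6. c j * B (l j) (vec l d))" by (rule B_vec_x) simp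
 also have "\<dots> = (\<Sum>j\<le>6. eta j * c j * d j)"
 by (intro sum.cong) (auto simp: B_sym[OF l_in vec_in] B_vec_l)
 finally show ?thesis .
qed

lemma B_h_vec: "B h (vec l c) = (\<Sum>j\<le>6. eta j * hcoord j * c j)"
 by (subst h_vec) (rule B_vec)

lemma B_h_l: "j \<le> 6 ==> B h (l j) = eta j * hcoord j"
 by (subst h_vec) (rule B_vec_l)

lemma expand: "x \<in> L ==> x = vec l (%j. eta j * B x (l j))"
proof -
 assume x: "x \<in> L"
 have "x - vec l (%j. eta j * B x (l j)) = 0"
 by (rule complete) (use x l_in in \<open>auto simp: B_diff B_vec_l\<close>)
 thus ?thesis by simp
qed

lemma vec_eq_iff: "vec l c = vec l d \<longleftrightarrow> (\<forall>j\<le>6. c j = d j)"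
proof
 assume e: "vec l c = vec l d"
 have "eta j * c j = eta j * d j" if "j \<le> 6" for j using e B_vec_l[OF that] by metis
 moreover have "eta j ~= 0" for j by (simp add: eta_def)
 ultimately show "\<forall>j\<le>6. c j = d j" by (metis mult_cancel_left)
qed (auto intro: vec_cong)

lemma frame_perm:
 assumes "\<tau> permutes {1..6}"
 shows "frame (l \<circ> \<tau>)"
proof -
 have t: "\<tau> j \<le> 6" if "j \<le> 6" for j
 using permutes_in_image[OF assms, of j] permutes_not_in[OF assms, of j] that by (cases "j \<in> {1..6}") auto
 have t0: "\<tau> j = 0 \<longleftrightarrow> j = 0" for j
 using permutes_not_in[OF assms, of 0] permutes_inj[OF assms] by (metis atLeastAtMost_iff injD not_one_le_zero)
 have inj: "\<tau> i = \<tau> j \<longleftrightarrow> i = j" for i j using permutes_inj[OF assms] by (auto dest: injD)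
 have p: "\<tau> permutes {..6}" by (rule permutes_subset[OF assms]) auto
 have hc: "hcoord (\<tau> j) = hcoord j" "eta (\<tau> j) = eta j" for j by (simp_all add: hcoord_def eta_def t0)
 have "vec (l \<circ> \<tau>) hcoord = (\<Sum>j\<le>6. zm (hcoord (\<tau> j)) (l (\<tau> j)))" by (simp add: vec_def hc)
 also have "\<dots> = vec l hcoord" unfolding vec_def
 using sum.permute[OF p, of "%j. zm (hcoord j) (l j)"] by (simp add: o_def)
 finally have "h = vec (l \<circ> \<tau>) hcoord" using h_vec by simp
 moreover have "x = 0" if "x \<in> L" "\<forall>j\<le>6. B x ((l \<circ> \<tau>) j) = 0" for x
 proof (rule complete[OF that(1)])
 fix j :: nat assume "j \<le> 6"
 then obtain i where "i \<le> 6" "j = \<tau> i" using permutes_image[OF p] by (metis atMost_iff image_iff)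
 thus "B x (l j) = 0" using that(2) by simp
 qed
 ultimately show ?thesis unfolding frame_def
 proof (intro conjI)
 show "\<forall>j\<le>6. (l \<circ> \<tau>) j \<in> L" using t l_in by simp
 show "\<forall>i\<le>6. \<forall>j\<le>6. B ((l \<circ> \<tau>) i) ((l \<circ> \<tau>) j) = (if i = j then eta i else 0)"
 using t B_l by (simp add: inj hc)
 qed blast+
qed

text \<open>The quadratic transformation centred at the points 1, 2, 3: it sends l_0 to 2 l_0 - l_1
  - l_2 - l_3 and l_1 to l_0 - l_2 - l_3, and fixes l_4, l_5, l_6.\<close>

definition cremona :: "nat => nat => int" where
 "cremona j i = (if j = 0 then (if i = 0 then 2 else if i \<in> {1,2,3} then -1 else 0)
 else if j \<in> {1,2,3} then (if i = 0 then 1 else if i \<in> {1,2,3} - {j} then -1 else 0)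
 else if i = j then 1 else 0)"

lemma frame_cremona: "frame (%j. vec l (cremona j))"
proof -
 have "B (vec l (cremona i)) (vec l (cremona j)) = (if i = j then eta i else 0)" if "i \<le> 6" "j \<le> 6" for i j
 using le6_cases[OF that(1)] le6_cases[OF that(2)]
 by (elim disjE; simp add: B_vec sum7 cremona_def eta_def)
 moreover have "h = vec (%j. vec l (cremona j)) hcoord"
 unfolding vec_vec h_vec vec_eq_iff
 proof (intro allI impI)
 fix j :: nat assume "j \<le> 6"
 thus "hcoord j = (\<Sum>i\<le>6. hcoord i * cremona i j)"
 by (drule_tac le6_cases) (elim disjE; simp add: sum7 cremona_def hcoord_def)
 qed
 moreover have "x = 0" if x: "x \<in> L" and 0: "\<forall>j\<le>6. B x (vec l (cremona j)) = 0" for x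
 proof (rule complete[OF x])
 define b where "b j = B (l j) x" for j
 have bb: "(\<Sum>i\<le>6. cremona j i * b i) = 0" if "j \<le> 6" for j
 using 0 that B_sym[OF x vec_in] B_vec_x[OF x, of "cremona j"] by (simp add: b_def)
 have "2 * b 0 - b 1 - b 2 - b 3 = 0" "b 0 - b 2 - b 3 = 0" "b 0 - b 1 - b 3 = 0" "b 0 - b 1 - b 2 = 0"
 "b 4 = 0" "b 5 = 0" "b 6 = 0"
 using bb[of 0] bb[of 1] bb[of 2] bb[of 3] bb[of 4] bb[of 5] bb[of 6] by (simp_all add: sum7 cremona_def)
 hence "b 0 = 0 & b 1 = 0 & b 2 = 0 & b 3 = 0 & b 4 = 0 & b 5 = 0 & b 6 = 0" by linarith
 hence "b j = 0" if "j \<le> 6" for j using le6_cases[OF that] by auto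
 thus "B x (l j) = 0" if "j \<le> 6" for j using that B_sym[OF x l_in[OF that]] by (simp add: b_def)
 qed
 ultimately show ?thesis unfolding frame_def by auto
qed

end

context lattice7 begin

definition lines :: "'l set" where "lines = {y \<in> L. B h y = 1 & B y y = -1}"

end

lemma int_square_bound: "3 * (a - 1)^2 \<le> (8::int) ==> a = 0 | a = 1 | a = 2"
proof (rule ccontr)
 assume a: "3 * (a - 1)^2 \<le> 8" and n: "~ (a = 0 | a = 1 | a = 2)"
 hence "2 \<le> \<bar>a - 1\<bar>" by linarith
 hence "2^2 \<le> \<bar>a - 1\<bar>^2" by (intro power_mono) auto
 thus False using a by simp
qed

context framed begin

text \<open>The line through the blown up points \<open>a\<close> and \<open>b\<close>.\<close>

definition ln2 :: "nat => nat => nat => int" where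
 "ln2 a b j = (if j = 0 then 1 else if j = a | j = b then -1 else 0)"

text \<open>The conic through the five points other than \<open>a\<close>.\<close>

definition ln5 :: "nat => nat => int" where
 "ln5 a j = (if j = 0 then 2 else if j = a then 0 else -1)"

text \<open>The Cauchy-Schwarz inequality bounds the degree \<open>c\<^sub>0\<close> of a line to \<open>0, 1, 2\<close>; then all the other
  coordinates are \<open>0\<close> or one fixed sign.\<close>

lemma lines_cases:
 assumes "x \<in> lines"
 shows "(\<exists>a\<in>{1..6}. x = l a) | (\<exists>a\<in>{1..6}. \<exists>b\<in>{1..6}. a ~= b & x = vec l (ln2 a b)) |
 (\<exists>a\<in>{1..6}. x = vec l (ln5 a))"
proof -
 define c where "c j = eta j * B x (l j)" for j
 have xL: "x \<in> L" using assms by (simp add: lines_def)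
 have "vec l c = vec l (%j. eta j * B x (l j))" by (rule vec_cong) (simp add: c_def)
 hence x: "x \<in> L" "x = vec l c" using xL expand[OF xL] by simp_all
 have split: "(\<Sum>j\<le>6. f j) = f 0 + (\<Sum>j\<in>{1..6}. f j)" for f :: "nat => int"
 proof -
 have "{..6::nat} = insert 0 {1..6}" by auto
 thus ?thesis by simp
 qed
 have hx: "3 * c 0 + (\<Sum>j\<in>{1..6}. c j) = 1"
 proof -
 have "B h x = (\<Sum>j\<le>6. eta j * hcoord j * c j)" unfolding x(2) by (rule B_h_vec)
 also have "\<dots> = 3 * c 0 + (\<Sum>j\<in>{1..6}. c j)" unfolding split by (simp add: eta_def hcoord_def)
 finally show ?thesis using assms by (simp add: lines_def)
 qed
 have xx: "(\<Sum>j\<in>{1..6}. (c j)^2) = (c 0)^2 + 1"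
 proof -
 have "B x x = (\<Sum>j\<le>6. eta j * c j * c j)" unfolding x(2) by (rule B_vec)
 also have "\<dots> = (c 0)^2 - (\<Sum>j\<in>{1..6}. (c j)^2)" unfolding split
 by (simp add: eta_def power2_eq_square sum_negf)
 finally show ?thesis using assms by (simp add: lines_def)
 qed
 have cs: "(\<Sum>j\<in>{1..6}. c j)^2 \<le> 6 * (\<Sum>j\<in>{1..6}. (c j)^2)"
 proof -
 have "(\<Sum>j\<in>{1..6}. real_of_int (c j))^2 \<le> (\<Sum>j\<in>{1..6}. (real_of_int (c j))^2) * card {1..6::nat}"
 by (rule sum_squared_le_sum_of_squares)
 hence "real_of_int ((\<Sum>j\<in>{1..6}. c j)^2) \<le> real_of_int (6 * (\<Sum>j\<in>{1..6}. (c j)^2))" by simp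
 thus ?thesis by (simp only: of_int_le_iff)
 qed
 have "(\<Sum>j\<in>{1..6}. c j) = 1 - 3 * c 0" using hx by simp
 hence "(1 - 3 * c 0)^2 \<le> 6 * ((c 0)^2 + 1)" using cs xx by simp
 hence "3 * (c 0 - 1)^2 \<le> 8" by (simp add: power2_eq_square algebra_simps)
 hence c0: "c 0 = 0 | c 0 = 1 | c 0 = 2" by (rule int_square_bound)
 \<comment> \<open>For this sign the sum of \<open>(c j)^2 - s * c j\<close> over
   \<open>j \<ge> 1\<close> is 0. No term is negative, so every \<open>c j\<close> is 0 or
   \<open>s\<close>.\<close>
 define s :: int where "s = (if c 0 = 0 then 1 else -1)"
 define I where "I = {j \<in> {1..6}. c j ~= 0}"
 have "(\<Sum>j\<in>{1..6}. (c j)^2 - s * c j) = 0"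
 using c0 hx xx by (auto simp: s_def sum_subtractf sum_distrib_left[symmetric] sum.distrib)
 moreover have nn: "0 \<le> (c j)^2 - s * c j" for j
 proof -
 have "0 \<le> m * (m - 1)" for m :: int by (cases "m \<ge> 1") (auto simp: zero_le_mult_iff)
 from this[of "c j"] this[of "- c j"] show ?thesis by (auto simp: s_def power2_eq_square algebra_simps)
 qed
 ultimately have z: "(c j)^2 = s * c j" if "j \<in> {1..6}" for j
 using sum_nonneg_eq_0_iff[of "{1..6}" "%j. (c j)^2 - s * c j"] that by simp
 have cj: "c j = (if j \<in> I then s else 0)" if "j \<in> {1..6}" for j
 using z[OF that] that by (auto simp: I_def power2_eq_square)
 have ss: "s * s = 1" by (simp add: s_def)
 have "(\<Sum>j\<in>{1..6}. c j) = (\<Sum>j\<in>{1..6}. if j \<in> I then s else 0)" using cj by (intro sum.cong) auto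
 also have "\<dots> = (\<Sum>j\<in>I. s)" by (intro sum.mono_neutral_cong_right) (auto simp: I_def)
 finally have sI: "(\<Sum>j\<in>{1..6}. c j) = s * int (card I)" by simp
 have fI: "finite I" "I <= {1..6}" by (auto simp: I_def)
 show ?thesis using c0
 proof (elim disjE)
 assume 0: "c 0 = 0"
 hence "card I = 1" using sI hx by (simp add: s_def)
 then obtain a where a: "I = {a}" by (auto simp: card_1_singleton_iff)
 hence aI: "a \<in> {1..6}" using fI by auto
 have "x = vec l (%j. if j = a then 1 else 0)" unfolding x(2)
 proof (rule vec_cong)
 show "c j = (if j = a then 1 else 0)" if "j \<le> 6" for j
 using that 0 cj[of j] a aI by (cases "j = 0") (auto simp: s_def)
 qed
 also have "\<dots> = l a" using aI by (intro vec_unit) auto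
 finally show ?thesis using aI by blast
 next
 assume 1: "c 0 = 1"
 hence "card I = 2" using sI hx by (simp add: s_def)
 then obtain a b where ab: "I = {a, b}" "a ~= b" by (auto simp: card_2_iff)
 hence aI: "a \<in> {1..6}" "b \<in> {1..6}" using fI by auto
 have "x = vec l (ln2 a b)" unfolding x(2)
 proof (rule vec_cong)
 show "c j = ln2 a b j" if "j \<le> 6" for j
 using that 1 cj[of j] ab aI by (cases "j = 0") (auto simp: s_def ln2_def)
 qed
 thus ?thesis using aI ab by blast
 next
 assume 2: "c 0 = 2"
 hence "card I = 5" using sI hx by (simp add: s_def)
 hence "card ({1..6} - I) = 1" using fI by (subst card_Diff_subset) auto
 then obtain a where a: "{1..6} - I = {a}" by (auto simp: card_1_singleton_iff)
 have I: "j \<in> I \<longleftrightarrow> j ~= a" if "j \<in> {1..6}" for j using a that by blast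
 have aI: "a \<in> {1..6}" using a by blast
 have "x = vec l (ln5 a)" unfolding x(2)
 proof (rule vec_cong)
 show "c j = ln5 a j" if "j \<le> 6" for j
 using that 2 cj[of j] I[of j] by (cases "j = 0") (auto simp: s_def ln5_def)
 qed
 thus ?thesis using aI by blast
 qed
qed

lemma lines_intro: "a \<in> {1..6} ==> l a \<in> lines" "a \<in> {1..6} ==> b \<in> {1..6} ==> a ~= b ==> vec l (ln2 a b) \<in> lines"
 "a \<in> {1..6} ==> vec l (ln5 a) \<in> lines"
proof -
 assume a: "a \<in> {1..6}"
 hence "a = 1 | a = 2 | a = 3 | a = 4 | a = 5 | a = 6" by auto
 thus "vec l (ln5 a) \<in> lines"
 unfolding lines_def by (elim disjE; simp add: B_h_vec B_vec sum7 ln5_def eta_def hcoord_def)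
 show "l a \<in> lines" using a by (simp add: lines_def B_h_l B_l l_in hcoord_def eta_def)
 assume b: "b \<in> {1..6}" "a ~= b"
 have B2: "B (vec l (ln2 a b)) (l j) = eta j * ln2 a b j" if "j \<le> 6" for j by (rule B_vec_l[OF that])
 have e: "vec l (ln2 a b) = l 0 - l a - l b"
 proof -
 have "l 0 - l a - l b = vec l (%j. (if j = 0 then 1 else 0) - (if j = a then 1 else 0) - (if j = b then 1 else 0))"
 using a b by (simp only: vec_diff[symmetric] vec_unit atLeastAtMost_iff le0)
 thus ?thesis using a b by (auto intro!: vec_cong simp: ln2_def)
 qed
 have "l 0 \<in> L" "l a \<in> L" "l b \<in> L" using a b l_in by auto
 thus "vec l (ln2 a b) \<in> lines"
 using a b by (simp add: lines_def e B_diff B_diffR B_l B_h_l hcoord_def eta_def)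
qed

end

text \<open>Permutations and one quadratic transformation act transitively on the lines.\<close>

lemma (in lattice7) frame_line:
 assumes fr: "frame l" and y: "y \<in> lines"
 shows "\<exists>l'. frame l' & l' 6 = y"
proof -
 have perm: "\<exists>l'. frame l' & l' 6 = l a" if "frame l" "a \<in> {1..6}" for l a
 proof -
 interpret framed L zm B h l by unfold_locales (rule that(1))
 have "Transposition.transpose a 6 permutes {1..6}" using that(2) by (intro permutes_swap_id) auto
 thus ?thesis using frame_perm by (intro exI[of _ "l \<circ> Transposition.transpose a 6"]) auto
 qed
 have two: "\<exists>l'. frame l' & l' 6 = vec l (framed.ln2 a b)" if fr: "frame l" and ab: "a \<in> {1..6}" "b \<in> {1..6}" "a ~= b" for l a b
 proof -
 interpret framed L zm B h l by unfold_locales (rule fr)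
 define \<tau> where "\<tau> = Transposition.transpose 1 a \<circ> Transposition.transpose 2 (Transposition.transpose 1 a b)"
 have t: "Transposition.transpose 1 a permutes {1..6}" using ab by (intro permutes_swap_id) auto
 have tb: "Transposition.transpose 1 a b \<in> {1..6}" using permutes_in_image[OF t] ab by blast
 have tb1: "Transposition.transpose 1 a b ~= 1" using ab(3) by (metis transpose_apply_first transpose_involutory)
 have "\<tau> permutes {1..6}" unfolding \<tau>_def
 by (rule permutes_compose[OF permutes_swap_id t]) (use tb in auto)
 moreover have "\<tau> 1 = a" "\<tau> 2 = b" using tb1 by (auto simp: \<tau>_def Transposition.transpose_def split: if_splits)
 ultimately have f: "frame (l \<circ> \<tau>)" using frame_perm by blast
 have \<tau>0: "\<tau> 0 = 0" using \<open>\<tau> permutes {1..6}\<close> by (simp add: permutes_def)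
 interpret p: framed L zm B h "l \<circ> \<tau>" by unfold_locales (rule f)
 \<comment> \<open>The third new exceptional curve is the line through the points 1 and 2, which
   \<tau> has moved to \<open>a\<close> and \<open>b\<close>.\<close>
 have "vec (l \<circ> \<tau>) (p.cremona 3) = (l \<circ> \<tau>) 0 - (l \<circ> \<tau>) 1 - (l \<circ> \<tau>) 2"
 proof -
 have "(l \<circ> \<tau>) 0 - (l \<circ> \<tau>) 1 - (l \<circ> \<tau>) 2 =
 vec (l \<circ> \<tau>) (%j. (if j = 0 then 1 else 0) - (if j = 1 then 1 else 0) - (if j = 2 then 1 else 0))"
 unfolding vec_diff[symmetric] by (subst (1 2 3) vec_unit) simp_all
 also have "\<dots> = vec (l \<circ> \<tau>) (p.cremona 3)" by (rule vec_cong) (auto simp: p.cremona_def)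
 finally show ?thesis by simp
 qed
 also have "\<dots> = l 0 - l a - l b" using \<open>\<tau> 1 = a\<close> \<open>\<tau> 2 = b\<close> \<tau>0 by simp
 also have "\<dots> = vec l (ln2 a b)"
 proof -
 have "l 0 - l a - l b = vec l (%j. (if j = 0 then 1 else 0) - (if j = a then 1 else 0) - (if j = b then 1 else 0))"
 using ab by (simp only: vec_diff[symmetric] vec_unit atLeastAtMost_iff le0)
 thus ?thesis using ab by (auto intro!: vec_cong simp: ln2_def)
 qed
 finally show ?thesis using perm[OF p.frame_cremona, of 3] by auto
 qed
 have five: "\<exists>l'. frame l' & l' 6 = vec l (framed.ln5 a)" if fr: "frame l" and a: "a \<in> {1..6}" for l a
 proof -
 interpret framed L zm B h l by unfold_locales (rule fr)
 have t: "Transposition.transpose a 6 permutes {1..6}" using a by (intro permutes_swap_id) auto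
 interpret p: framed L zm B h "l \<circ> Transposition.transpose a 6" by unfold_locales (rule frame_perm[OF t])
 interpret c: framed L zm B h "%j. vec (l \<circ> Transposition.transpose a 6) (p.cremona j)" by unfold_locales (rule p.frame_cremona)
 have "vec l (ln5 a) = vec (l \<circ> Transposition.transpose a 6) (p.ln5 6)"
 proof -
 have p7: "Transposition.transpose a 6 permutes {..6}" by (rule permutes_subset[OF t]) auto
 have "vec l (ln5 a) = (\<Sum>j\<le>6. zm (ln5 a (Transposition.transpose a 6 j)) (l (Transposition.transpose a 6 j)))"
 unfolding vec_def using sum.permute[OF p7, of "%j. zm (ln5 a j) (l j)"] by (simp add: o_def)
 also have "\<dots> = vec (l \<circ> Transposition.transpose a 6) (p.ln5 6)"
 unfolding vec_def using a by (intro sum.cong) (auto simp: ln5_def p.ln5_def Transposition.transpose_def)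
 finally show ?thesis .
 qed
 \<comment> \<open>The conic through the points 1 to 5 becomes, after the quadratic transformation,
   the line through the points 4 and 5; this reduces to the case of lines through two
   points.\<close>
 also have "\<dots> = vec (%j. vec (l \<circ> Transposition.transpose a 6) (p.cremona j)) (c.ln2 4 5)"
 unfolding vec_vec p.vec_eq_iff
 proof (intro allI impI)
 fix j :: nat assume "j \<le> 6"
 thus "p.ln5 6 j = (\<Sum>i\<le>6. c.ln2 4 5 i * p.cremona i j)"
 by (drule_tac le6_cases) (elim disjE; simp add: sum7 p.cremona_def p.ln5_def c.ln2_def)
 qed
 finally show ?thesis using two[OF p.frame_cremona, of 4 5] by simp
 qed
 interpret framed L zm B h l by unfold_locales (rule fr)
 from lines_cases[OF y] show ?thesis
 proof (elim disjE bexE conjE)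
 fix a assume a: "a \<in> {1..6}" "y = l a"
 show ?thesis unfolding a(2) by (rule perm[OF fr a(1)])
 next
 fix a b assume a: "a \<in> {1..6}" "b \<in> {1..6}" "a ~= b" "y = vec l (ln2 a b)"
 show ?thesis unfolding a(4) by (rule two[OF fr a(1-3)])
 next
 fix a assume a: "a \<in> {1..6}" "y = vec l (ln5 a)"
 show ?thesis unfolding a(2) by (rule five[OF fr a(1)])
 qed
qed

section \<open>The 27 lines seen from one of them\<close>

text \<open>The index set of the 16 lines skew to \<open>l 6\<close>: \<open>A\<close> consists of
  the \<open>i\<close> at which the product with \<open>u i\<close> is negative. These sign patterns
  are the weights of a half-spin representation of type D_5.\<close>

definition even5 :: "nat set set" where "even5 = {A. A <= {1..5} & even (card A)}"

text \<open>The characters of the group of subsets under symmetric difference, restricted later to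
  the even subsets.\<close>

definition chi :: "nat set => nat set => 's::field" where
 "chi A I = (\<Prod>i\<in>I. if i \<in> A then -1 else 1)"

lemma finite_even5: "finite even5"
 by (rule finite_subset[of _ "Pow {1..5}"]) (auto simp: even5_def)

lemma card_even5: "card even5 = 16"
proof -
 let ?f = "%A. if even (card A) then A else insert 5 A" and ?g = "%A. A - {5::nat}"
 have "bij_betw ?f (Pow {1..4}) even5"
 proof (rule bij_betw_byWitness[where f' = ?g])
 show "\<forall>A\<in>Pow {1..4}. ?g (?f A) = A" by (auto split: if_splits)
 show "\<forall>A\<in>even5. ?f (?g A) = A"
 proof
 fix A assume A: "A \<in> even5"
 hence "finite A" by (auto simp: even5_def intro: finite_subset)
 thus "?f (?g A) = A" using A by (cases "5 \<in> A") (auto simp: even5_def card_Diff_singleton insert_absorb)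
 qed
 show "?f ` Pow {1..4} <= even5"
 proof (intro image_subsetI)
 fix A assume "A \<in> Pow {1..4::nat}"
 hence "finite A" "5 \<notin> A" "A <= {1..5}" by (auto intro: finite_subset)
 thus "?f A \<in> even5" by (simp add: even5_def)
 qed
 show "?g ` even5 <= Pow {1..4}"
 proof (intro image_subsetI)
 fix A assume "A \<in> even5"
 hence "A <= {1..5}" by (simp add: even5_def)
 moreover have "{1..5::nat} - {5} = {1..4}" by auto
 ultimately show "?g A \<in> Pow {1..4}" by blast
 qed
 qed
 hence "card (Pow {1..4::nat}) = card even5" by (rule bij_betw_same_card)
 thus ?thesis by (simp add: card_Pow)
qed

text \<open>Flipping the membership of two elements, one inside and one outside of \<open>I \<triangle> I'\<close>, changes the
  sign of \<open>\<chi>\<^sub>I \<chi>\<^sub>I\<^sub>'\<close>.\<close>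

lemma chi_orthogonal:
 assumes I: "I <= {1..5}" "I' <= {1..5}" "I ~= I'" "card I + card I' < 5" and two: "(2::'s::field) ~= 0"
 shows "(\<Sum>A\<in>even5. chi A I * chi A I' :: 's) = 0"
proof -
 let ?D = "(I - I') \<union> (I' - I)"
 obtain a where a: "a \<in> ?D" using I(3) by blast
 have fin: "finite I" "finite I'" using I finite_subset by blast+
 have "card ?D \<le> card I + card I'"
 using card_Un_le[of "I - I'" "I' - I"] card_mono[OF fin(1), of "I - I'"] card_mono[OF fin(2), of "I' - I"] by force
 \<comment> \<open>The full set has to be avoided: its character is constant on even subsets. The
   bound on the cardinalities serves this purpose.\<close>
 hence "?D ~= {1..5}" using I(4) by (metis card_atLeastAtMost diff_Suc_1 linorder_not_le)
 then obtain b where b: "b \<in> {1..5}" "b \<notin> ?D" using I by blast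
 have ab: "a ~= b" "a \<in> {1..5}" using a b I by auto
 define F where "F A = (A - {a, b}) \<union> ({a, b} - A)" for A
 have FF: "F (F A) = A" for A by (auto simp: F_def)
 have FE: "F A \<in> even5" if A: "A \<in> even5" for A
 proof -
 have f: "finite A" "A <= {1..5}" "even (card A)" using A by (auto simp: even5_def intro: finite_subset)
 have "card (F A) + 2 * card (A \<inter> {a, b}) = card A + 2"
 proof -
 have "card (F A) = card (A - {a, b}) + card ({a, b} - A)"
 unfolding F_def using f by (intro card_Un_disjoint) auto
 moreover have "card (A - {a, b}) + card (A \<inter> {a, b}) = card A"
 using f card_Int_Diff[of A "{a, b}"] by simp
 moreover have "card ({a, b} - A) + card ({a, b} \<inter> A) = card {a, b}"
 using card_Int_Diff[of "{a, b}" A] by simp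
 ultimately show ?thesis using ab by (simp add: Int_commute)
 qed
 hence "even (card (F A))" using f(3) by presburger
 thus ?thesis using f ab b by (auto simp: even5_def F_def)
 qed
 have bij: "bij_betw F even5 even5"
 by (rule bij_betw_byWitness[where f' = F]) (use FF FE in auto)
 have flip: "(chi (F A) J :: 's) = chi A J * ((if a \<in> J then -1 else 1) * (if b \<in> J then -1 else 1))" if J: "finite J" for A J
 proof -
 have "(chi (F A) J :: 's) = (\<Prod>i\<in>J. (if i \<in> A then -1 else 1) * ((if i = a then -1 else 1) * (if i = b then -1 else 1)))"
 unfolding chi_def using ab by (intro prod.cong) (auto simp: F_def)
 also have "\<dots> = chi A J * ((\<Prod>i\<in>J. if i = a then -1 else 1) * (\<Prod>i\<in>J. if i = b then -1 else 1))"
 by (simp only: prod.distrib chi_def)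
 finally show ?thesis using J by simp
 qed
 have "(\<Sum>A\<in>even5. chi A I * chi A I' :: 's) = (\<Sum>A\<in>even5. chi (F A) I * chi (F A) I')"
 by (rule sum.reindex_bij_betw[OF bij, symmetric])
 also have "\<dots> = (\<Sum>A\<in>even5. - (chi A I * chi A I'))"
 unfolding flip[OF fin(1)] flip[OF fin(2)] using a b by (intro sum.cong) auto
 finally have "2 * (\<Sum>A\<in>even5. chi A I * chi A I' :: 's) = 0" by (simp add: sum_negf eq_neg_iff_add_eq_0)
 thus ?thesis using two by simp
qed

lemma chi_self: "finite I ==> (\<Sum>A\<in>even5. chi A I * chi A I :: 's::field) = 16"
proof -
 have "chi A I * chi A I = (1 :: 's)" for A
 unfolding chi_def prod.distrib[symmetric] by (rule prod.neutral) auto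
 thus ?thesis using card_even5 by simp
qed

lemma chi_pair: "i ~= j ==> chi A {i, j} = chi A {i} * chi A {j}"
 by (simp add: chi_def)

lemma chi_sums:
 assumes two: "(2::'s::field) ~= 0"
 shows "i \<in> {1..5} ==> (\<Sum>A\<in>even5. chi A {i} :: 's) = 0"
 and "i \<in> {1..5} ==> j \<in> {1..5} ==> (\<Sum>A\<in>even5. chi A {i} * chi A {j} :: 's) = (if i = j then 16 else 0)"
 and "p \<in> pairs5 ==> (\<Sum>A\<in>even5. chi A {fst p, snd p} :: 's) = 0"
 and "i \<in> {1..5} ==> p \<in> pairs5 ==> (\<Sum>A\<in>even5. chi A {i} * chi A {fst p, snd p} :: 's) = 0"
 and "p \<in> pairs5 ==> q \<in> pairs5 ==> (\<Sum>A\<in>even5. chi A {fst p, snd p} * chi A {fst q, snd q} :: 's) = (if p = q then 16 else 0)"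
proof -
 have e: "chi A {} = (1 :: 's)" for A by (simp add: chi_def)
 have P: "fst p \<in> {1..5}" "snd p \<in> {1..5}" "fst p < snd p" "card {fst p, snd p} = 2" if "p \<in> pairs5" for p
 using that by (auto simp: pairs5_def)
 show "(\<Sum>A\<in>even5. chi A {i} :: 's) = 0" if "i \<in> {1..5}"
 using chi_orthogonal[of "{}" "{i}", OF _ _ _ _ two] that by (simp add: e)
 show "(\<Sum>A\<in>even5. chi A {i} * chi A {j} :: 's) = (if i = j then 16 else 0)" if "i \<in> {1..5}" "j \<in> {1..5}"
 using chi_orthogonal[of "{i}" "{j}", OF _ _ _ _ two] chi_self[of "{i}"] that by (cases "i = j") simp_all
 show "(\<Sum>A\<in>even5. chi A {fst p, snd p} :: 's) = 0" if "p \<in> pairs5"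
 using chi_orthogonal[of "{}" "{fst p, snd p}", OF _ _ _ _ two] P[OF that] by (simp add: e)
 show "(\<Sum>A\<in>even5. chi A {i} * chi A {fst p, snd p} :: 's) = 0" if "i \<in> {1..5}" "p \<in> pairs5"
 proof (rule chi_orthogonal[OF _ _ _ _ two])
 show "{i} ~= {fst p, snd p}" using P(3)[OF that(2)] by auto
 qed (use that(1) P[OF that(2)] in auto)
 show "(\<Sum>A\<in>even5. chi A {fst p, snd p} * chi A {fst q, snd q} :: 's) = (if p = q then 16 else 0)"
 if p: "p \<in> pairs5" and q: "q \<in> pairs5"
 proof (cases "p = q")
 case True
 thus ?thesis using chi_self[of "{fst p, snd p}"] by simp
 next
 case False
 have "{fst p, snd p} ~= {fst q, snd q}"
 using False P(3)[OF p] P(3)[OF q] by (auto simp: doubleton_eq_iff prod_eq_iff)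
 hence "(\<Sum>A\<in>even5. chi A {fst p, snd p} * chi A {fst q, snd q} :: 's) = 0"
 using P[OF p] P[OF q] by (intro chi_orthogonal[OF _ _ _ _ two]) auto
 thus ?thesis using False by simp
 qed
qed

context framed begin

text \<open>\<open>u i\<close> is the difference \<open>yp i - ym i\<close> of the two lines that
  form a triangle with \<open>l 6\<close>. The five vectors are orthogonal to each other, to
  \<open>h\<close> and to \<open>l 6\<close>.\<close>

definition ucoord :: "nat => nat => int" where
 "ucoord i j = (if j = 0 then -1 else if j = 6 then 0 else if j = i then -1 else 1)"

text \<open>One formula for the three kinds of lines skew to \<open>l 6\<close>: the conic
  \<open>ln5 6\<close> for the empty set, a line through two points for a pair, an exceptional curve
  for four elements; see \<open>z_special\<close>.\<close>

definition zcoord :: "nat set => nat => int" where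
 "zcoord A j = (if j = 0 then 2 - int (card A div 2) else if j = 6 then 0
 else int (card A div 2) - 1 - (if j \<in> A then 1 else 0))"

definition u where "u i = vec l (ucoord i)"
definition zA where "zA A = vec l (zcoord A)"
definition ten where "ten = {x \<in> lines. B x (l 6) = 1}"
definition six where "six = {x \<in> lines. B x (l 6) = 0}"

abbreviation "yp i \<equiv> vec l (ln2 i 6)"
abbreviation "ym i \<equiv> vec l (ln5 i)"

lemma five_cases: "i \<in> {1..5} ==> i = 1 | i = 2 | i = 3 | i = 4 | i = (5::nat)"
 by auto

lemma u_in [simp]: "u i \<in> L" by (simp add: u_def)

lemma B_uu: "i \<in> {1..5} ==> j \<in> {1..5} ==> B (u i) (u j) = (if i = j then -4 else 0)"
 by (drule five_cases, drule five_cases) (elim disjE; simp add: u_def B_vec sum7 ucoord_def eta_def)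

lemma B_u_l6: "B (u i) (l 6) = 0"
 by (simp add: u_def B_vec_l ucoord_def)

lemma B_h_u: "i \<in> {1..5} ==> B h (u i) = 0"
 by (drule five_cases) (elim disjE; simp add: u_def B_h_vec sum7 ucoord_def eta_def hcoord_def)

lemma B_yp_u: "i \<in> {1..5} ==> j \<in> {1..5} ==> B (yp i) (u j) = (if i = j then -2 else 0)"
 by (drule five_cases, drule five_cases) (elim disjE; simp add: u_def B_vec sum7 ucoord_def ln2_def eta_def)

lemma B_ym_u: "i \<in> {1..5} ==> j \<in> {1..5} ==> B (ym i) (u j) = (if i = j then 2 else 0)"
 by (drule five_cases, drule five_cases) (elim disjE; simp add: u_def B_vec sum7 ucoord_def ln5_def eta_def)

lemma B_z_u:
 assumes A: "A \<in> even5" and i: "i \<in> {1..5}"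
 shows "B (zA A) (u i) = (if i \<in> A then -1 else 1)"
proof -
 have A5: "A <= {1..5}" "finite A" using A by (auto simp: even5_def intro: finite_subset)
 define b where "b j = (if j \<in> A then 1 else 0 :: int)" for j
 define m where "m = int (card A div 2)"
 have "(\<Sum>j\<in>{1..5}. b j) = int (card A)"
 unfolding b_def using A5 by (simp add: sum.If_cases Int_absorb1)
 moreover have "(\<Sum>j\<in>{1..5::nat}. b j) = b 1 + b 2 + b 3 + b 4 + b 5"
 proof -
 have "{1..5::nat} = {1,2,3,4,5}" by auto
 thus ?thesis by simp
 qed
 moreover have "int (card A) = 2 * m" using A by (auto simp: even5_def m_def)
 ultimately have bs: "b 1 + b 2 + b 3 + b 4 + b 5 = 2 * m" by simp
 have z: "zcoord A j = (if j = 0 then 2 - m else if j = 6 then 0 else m - 1 - b j)" for j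
 by (simp add: zcoord_def m_def b_def)
 have "B (zA A) (u i) = 1 - 2 * b i"
 using five_cases[OF i] bs by (elim disjE) (simp_all add: zA_def u_def B_vec sum7 ucoord_def eta_def z)
 thus ?thesis by (simp add: b_def)
qed

lemma u_yp: "i \<in> {1..5} ==> u i = yp i + yp i - h + l 6" "i \<in> {1..5} ==> - u i = ym i + ym i - h + l 6"
proof -
 assume i: "i \<in> {1..5}"
 have l6: "l 6 = vec l (%j. if j = 6 then 1 else 0)" by (rule vec_unit[symmetric]) simp
 have "u i = vec l (%j. ln2 i 6 j + ln2 i 6 j - hcoord j + (if j = 6 then 1 else 0))"
 unfolding u_def by (rule vec_cong) (use i in \<open>auto simp: ucoord_def ln2_def hcoord_def\<close>)
 thus "u i = yp i + yp i - h + l 6" by (subst l6, subst h_vec) (simp only: vec_add vec_diff)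
 have "- u i = vec l (%j. ln5 i j + ln5 i j - hcoord j + (if j = 6 then 1 else 0))"
 unfolding u_def vec_neg by (rule vec_cong) (use i in \<open>auto simp: ucoord_def ln5_def hcoord_def\<close>)
 thus "- u i = ym i + ym i - h + l 6" by (subst l6, subst h_vec) (simp only: vec_add vec_diff)
qed

lemma z_special: "a \<in> {1..5} ==> zA ({1..5} - {a}) = l a"
 "a \<in> {1..5} ==> b \<in> {1..5} ==> a ~= b ==> zA {a, b} = vec l (ln2 a b)"
 "zA {} = vec l (ln5 6)"
proof -
 show "zA {} = vec l (ln5 6)" unfolding zA_def by (rule vec_cong) (auto simp: zcoord_def ln5_def)
 assume a: "a \<in> {1..5}"
 have "zA ({1..5} - {a}) = vec l (%j. if j = a then 1 else 0)"
 unfolding zA_def by (rule vec_cong) (use a in \<open>auto simp: zcoord_def\<close>)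
 also have "\<dots> = l a" using a by (intro vec_unit) auto
 finally show "zA ({1..5} - {a}) = l a" .
 show "zA {a, b} = vec l (ln2 a b)" if "b \<in> {1..5}" "a ~= b"
 unfolding zA_def by (rule vec_cong) (use a that in \<open>auto simp: zcoord_def ln2_def\<close>)
qed

lemma even5_cases:
 assumes "A \<in> even5"
 obtains "A = {}" | a b where "a \<in> {1..5}" "b \<in> {1..5}" "a ~= b" "A = {a, b}" | a where "a \<in> {1..5}" "A = {1..5} - {a}"
proof -
 have A: "A <= {1..5}" "finite A" "even (card A)" using assms by (auto simp: even5_def intro: finite_subset)
 hence "card A \<le> 5" using card_mono[of "{1..5}" A] by simp
 with A(3) have "card A = 0 | card A = 2 | card A = 4" by presburger
 thus ?thesis
 proof (elim disjE)
 assume "card A = 4"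
 hence "card ({1..5} - A) = 1" using A by (subst card_Diff_subset) auto
 then obtain a where a: "{1..5} - A = {a}" by (auto simp: card_1_singleton_iff)
 hence "a \<in> {1..5}" "A = {1..5} - {a}" using A by auto
 thus ?thesis using that by blast
 next
 assume "card A = 2"
 then obtain a b where "A = {a, b}" "a ~= b" by (auto simp: card_2_iff)
 thus ?thesis using A that by auto
 qed (use A that in auto)
qed

lemma z_lines: "A \<in> even5 ==> zA A \<in> lines"
proof (erule even5_cases)
 show "zA A \<in> lines" if "A = {}" using that z_special(3) lines_intro(3)[of 6] by simp
 show "zA A \<in> lines" if "a \<in> {1..5}" "b \<in> {1..5}" "a ~= b" "A = {a, b}" for a b
 using that z_special(2)[of a b] lines_intro(2)[of a b] by simp
 show "zA A \<in> lines" if "a \<in> {1..5}" "A = {1..5} - {a}" for a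
 using that z_special(1)[of a] lines_intro(1)[of a] by simp
qed

lemma B_l6: "B (zA A) (l 6) = 0" "i \<in> {1..5} ==> B (yp i) (l 6) = 1" "i \<in> {1..5} ==> B (ym i) (l 6) = 1"
 by (simp_all add: zA_def B_vec_l zcoord_def ln2_def ln5_def eta_def)

lemma lines_split: "x \<in> lines ==> x = l 6 | (\<exists>i\<in>{1..5}. x = yp i | x = ym i) | (\<exists>A\<in>even5. x = zA A)"
proof -
 assume "x \<in> lines"
 have e: "{1..5} - {a} \<in> even5" "{} \<in> even5" if "a \<in> {1..5}" for a using that by (auto simp: even5_def)
 have e2: "{a, b} \<in> even5" if "a \<in> {1..5}" "b \<in> {1..5}" "a ~= b" for a b using that by (auto simp: even5_def)
 have a5: "a \<in> {1..5} | a = 6" if "a \<in> {1..6}" for a :: nat using that by auto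
 have sy: "vec l (ln2 a b) = vec l (ln2 b a)" for a b by (rule vec_cong) (auto simp: ln2_def)
 from lines_cases[OF \<open>x \<in> lines\<close>] show ?thesis
 proof (elim disjE bexE conjE)
 fix a assume a: "a \<in> {1..6}" "x = l a"
 thus ?thesis using a5[OF a(1)] e(1)[of a] z_special(1)[of a] by metis
 next
 fix a b assume ab: "a \<in> {1..6}" "b \<in> {1..6}" "a ~= b" "x = vec l (ln2 a b)"
 thus ?thesis using a5[OF ab(1)] a5[OF ab(2)] e2[of a b] z_special(2)[of a b] sy by metis
 next
 fix a assume a: "a \<in> {1..6}" "x = vec l (ln5 a)"
 have "{} \<in> even5" by (simp add: even5_def)
 with a show ?thesis using a5[OF a(1)] z_special(3) by metis
 qed
qed

lemma ten_eq: "ten = yp ` {1..5} \<union> ym ` {1..5}"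
proof
 show "ten <= yp ` {1..5} \<union> ym ` {1..5}"
 proof
 fix x assume x: "x \<in> ten"
 hence "B x (l 6) = 1" "x \<in> lines" by (auto simp: ten_def)
 moreover have "B (l 6) (l 6) ~= 1" by (simp add: B_l eta_def)
 ultimately show "x \<in> yp ` {1..5} \<union> ym ` {1..5}" using lines_split[of x] B_l6(1) by auto
 qed
 show "yp ` {1..5} \<union> ym ` {1..5} <= ten"
 using lines_intro(2)[of _ 6] lines_intro(3) B_l6(2,3) by (auto simp: ten_def)
qed

lemma six_eq: "six = zA ` even5"
proof
 show "six <= zA ` even5"
 proof
 fix x assume x: "x \<in> six"
 hence "B x (l 6) = 0" "x \<in> lines" by (auto simp: six_def)
 moreover have "B (l 6) (l 6) ~= 0" by (simp add: B_l eta_def)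
 ultimately show "x \<in> zA ` even5" using lines_split[of x] B_l6(2,3) by auto
 qed
 show "zA ` even5 <= six" using z_lines B_l6(1) by (auto simp: six_def)
qed

lemma lines_Un: "lines = {l 6} \<union> (ten \<union> six)" "l 6 \<notin> ten \<union> six" "ten \<inter> six = {}"
proof -
 show "lines = {l 6} \<union> (ten \<union> six)"
 proof
 show "lines <= {l 6} \<union> (ten \<union> six)" using lines_split ten_eq six_eq by blast
 show "{l 6} \<union> (ten \<union> six) <= lines" using lines_intro(1)[of 6] by (auto simp: ten_def six_def)
 qed
 show "l 6 \<notin> ten \<union> six" by (simp add: ten_def six_def B_l eta_def)
 show "ten \<inter> six = {}" by (auto simp: ten_def six_def)
qed

lemma inj_z: "inj_on zA even5"
proof (rule inj_onI)
 fix A C assume AC: "A \<in> even5" "C \<in> even5" "zA A = zA C"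
 have "i \<in> A \<longleftrightarrow> i \<in> C" if "i \<in> {1..5}" for i
 using B_z_u[OF AC(1) that] B_z_u[OF AC(2) that] AC(3) by (auto split: if_splits)
 thus "A = C" using AC by (auto simp: even5_def)
qed

lemma inj_y: "inj_on yp {1..5}" "inj_on ym {1..5}" "yp ` {1..5} \<inter> ym ` {1..5} = {}"
proof -
 show "inj_on yp {1..5}"
 proof (rule inj_onI)
 fix i j assume a: "i \<in> {1..5}" "j \<in> {1..5}" "yp i = yp j"
 show "i = j" using B_yp_u[OF a(1,1)] B_yp_u[OF a(2,1)] unfolding a(3) by (cases "i = j") simp_all
 qed
 show "inj_on ym {1..5}"
 proof (rule inj_onI)
 fix i j assume a: "i \<in> {1..5}" "j \<in> {1..5}" "ym i = ym j"
 show "i = j" using B_ym_u[OF a(1,1)] B_ym_u[OF a(2,1)] unfolding a(3) by (cases "i = j") simp_all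
 qed
 have "yp i ~= ym j" if "i \<in> {1..5}" "j \<in> {1..5}" for i j
 proof
 assume e: "yp i = ym j"
 show False using B_yp_u[OF that(1,1)] B_ym_u[OF that(2,1)] unfolding e by (cases "i = j") simp_all
 qed
 thus "yp ` {1..5} \<inter> ym ` {1..5} = {}" by blast
qed

lemma sum_ten: "(\<Sum>x\<in>ten. f x) = (\<Sum>i\<in>{1..5}. f (yp i) + f (ym i))" for f :: "_ => 's::comm_monoid_add"
proof -
 have "(\<Sum>x\<in>ten. f x) = sum f (yp ` {1..5}) + sum f (ym ` {1..5})"
 unfolding ten_eq by (rule sum.union_disjoint[OF _ _ inj_y(3)]) simp_all
 also have "\<dots> = (\<Sum>i\<in>{1..5}. f (yp i)) + (\<Sum>i\<in>{1..5}. f (ym i))"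
 unfolding sum.reindex[OF inj_y(1)] sum.reindex[OF inj_y(2)] o_def ..
 finally show ?thesis by (simp only: sum.distrib)
qed

lemma sum_six: "(\<Sum>x\<in>six. f x) = (\<Sum>A\<in>even5. f (zA A))" for f :: "_ => 's::comm_monoid_add"
 unfolding six_eq by (simp add: sum.reindex inj_z)

lemma finite_lines: "finite ten" "finite six" "finite lines"
proof -
 show 1: "finite ten" "finite six" by (simp_all add: ten_eq six_eq finite_even5)
 thus "finite lines" unfolding lines_Un(1) by simp
qed

lemma card_lines: "card ten = 10" "card six = 16" "card lines = 27"
proof -
 show 1: "card ten = 10" unfolding ten_eq
 by (subst card_Un_disjoint[OF _ _ inj_y(3)]) (simp_all only: card_image[OF inj_y(1)] card_image[OF inj_y(2)], simp_all)
 show 2: "card six = 16" unfolding six_eq by (simp add: card_image[OF inj_z] card_even5)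
 show "card lines = 27" unfolding lines_Un(1)
 using lines_Un(2,3) finite_lines 1 2 by (subst card_Un_disjoint) (auto simp: card_Un_disjoint)
qed

end

section \<open>Group actions on the lattice\<close>

lemma mset_bijection:
 assumes "finite I" "finite F" "image_mset q (mset_set F) = image_mset n (mset_set I)"
 shows "\<exists>\<phi>. bij_betw \<phi> I F & (\<forall>i\<in>I. q (\<phi> i) = n i)"
 using assms
proof (induction I arbitrary: F rule: finite_induct)
 case empty
 thus ?case by (auto simp: bij_betw_def mset_set_empty_iff)
next
 case (insert i I)
 have "n i \<in># image_mset q (mset_set F)" using insert by simp
 then obtain x where x: "x \<in> F" "q x = n i" using insert.prems(1) by auto
 have "image_mset q (mset_set F) = add_mset (q x) (image_mset q (mset_set (F - {x})))"
 using x insert.prems(1) by (metis image_mset_add_mset mset_set.remove)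
 hence "image_mset q (mset_set (F - {x})) = image_mset n (mset_set I)" using insert x by simp
 then obtain \<phi> where p: "bij_betw \<phi> I (F - {x})" "\<forall>i\<in>I. q (\<phi> i) = n i"
 using insert.IH[of "F - {x}"] insert.prems(1) by auto
 have "bij_betw (\<phi>(i := x)) I (F - {x})"
 using p(1) insert.hyps(2) by (subst bij_betw_cong[of I _ \<phi>]) auto
 hence "bij_betw (\<phi>(i := x)) (I \<union> {i}) ((F - {x}) \<union> {(\<phi>(i := x)) i})"
 using insert.hyps(2) by (intro notIn_Un_bij_betw) auto
 hence "bij_betw (\<phi>(i := x)) (insert i I) (insert x (F - {x}))" by simp
 hence "bij_betw (\<phi>(i := x)) (insert i I) F" using x(1) by (simp only: insert_Diff)
 moreover have "\<forall>j\<in>insert i I. q ((\<phi>(i := x)) j) = n j" using p(2) insert.hyps(2) x(2) by auto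
 ultimately show ?case by blast
qed

lemma sum_product_swap:
 "(\<Sum>A\<in>E. (\<Sum>i\<in>I. f i * w A i) * (\<Sum>j\<in>J. g j * v A j)) = (\<Sum>i\<in>I. \<Sum>j\<in>J. f i * g j * (\<Sum>A\<in>E. w A i * v A j))"
 for f :: "_ => 's::comm_ring_1"
proof -
 have "(\<Sum>A\<in>E. (\<Sum>i\<in>I. f i * w A i) * (\<Sum>j\<in>J. g j * v A j)) = (\<Sum>A\<in>E. \<Sum>i\<in>I. \<Sum>j\<in>J. f i * g j * (w A i * v A j))"
 by (simp add: sum_product mult_ac)
 also have "\<dots> = (\<Sum>i\<in>I. \<Sum>A\<in>E. \<Sum>j\<in>J. f i * g j * (w A i * v A j))" by (rule sum.swap)
 also have "\<dots> = (\<Sum>i\<in>I. \<Sum>j\<in>J. \<Sum>A\<in>E. f i * g j * (w A i * v A j))"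
 by (intro sum.cong HOL.refl sum.swap)
 finally show ?thesis by (simp add: sum_distrib_left)
qed

text \<open>The diagonal form \<open>\<lambda>\<^sup>2 q\<^sub>5 + \<langle>1, 2\<rangle> q\<^sub>5 + 6 + \<langle>2\<rangle>\<close> for \<open>q\<^sub>5 = \<langle>a\<^sub>1, \<dots>, a\<^sub>5\<rangle>\<close>.\<close>

definition target :: "(nat => 's::field) => 's multiset" where
 "target a = image_mset (%p. a (fst p) * a (snd p)) (mset_set pairs5) +
 (image_mset a (mset_set {1..5}) + image_mset (%i. 2 * a i) (mset_set {1..5})) + {#1, 1, 1, 1, 1, 1, 2#}"

lemma hd_mono: "hd_tw H X \<rho> \<epsilon> M ==> H' <= H ==> hd_tw H' X \<rho> \<epsilon> M"
proof -
 assume a: "hd_tw H X \<rho> \<epsilon> M" "H' <= H"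
 hence "tw H X \<rho> \<epsilon> <= tw H' X \<rho> \<epsilon>" by (auto simp: tw_def)
 thus ?thesis using a(1) by (auto simp: hd_tw_def orth_def)
qed

lemma fixf_mono: "H' <= H ==> fixf H <= fixf H'"
 by (auto simp: fixf_def)

locale lat_act = lattice7 L zm B h + gal H S
 for L :: "'l::ab_group_add set" and zm B h and H :: "('s::field => 's) set" and S +
 fixes g :: "('s => 's) => 'l => 'l"
 assumes g_in: "\<mu> \<in> H ==> x \<in> L ==> g \<mu> x \<in> L"
 and g_add: "\<mu> \<in> H ==> x \<in> L ==> y \<in> L ==> g \<mu> (x + y) = g \<mu> x + g \<mu> y"
 and g_zm: "\<mu> \<in> H ==> x \<in> L ==> g \<mu> (zm m x) = zm m (g \<mu> x)"
 and g_B: "\<mu> \<in> H ==> x \<in> L ==> y \<in> L ==> B (g \<mu> x) (g \<mu> y) = B x y"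
 and g_h: "\<mu> \<in> H ==> g \<mu> h = h" and h_L: "h \<in> L"
 and g_comp: "\<mu> \<in> H ==> \<delta> \<in> H ==> x \<in> L ==> g (\<mu> \<circ> \<delta>) x = g \<mu> (g \<delta> x)"
 and g_triv: "\<mu> \<in> H ==> (!!s. s \<in> S ==> \<mu> s = s) ==> x \<in> L ==> g \<mu> x = x"
begin

definition LF :: "('l => 's) set" where
 "LF = {p. (\<forall>x. x \<notin> L --> p x = 0) & (\<forall>x\<in>L. \<forall>y\<in>L. p (x + y) = p x + p y) & (\<forall>m. \<forall>x\<in>L. p (zm m x) = of_int m * p x)}"

text \<open>Since \<open>L\<close> is unimodular, \<open>k\<^sub>s \<otimes> L\<close> is identified with the space \<open>LF\<close> of additive maps
  \<open>L \<rightarrow> k\<^sub>s\<close>, an element \<open>x\<close> of \<open>L\<close> corresponding to \<open>z \<mapsto> x \<cdot> z\<close>.\<close>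

definition V7 :: "('l => 's) set" where
 "V7 = {p \<in> LF. \<forall>\<mu>\<in>H. \<forall>x\<in>L. p (g \<mu> x) = \<mu> (p x)}"

definition fn :: "'l => 'l => 's" where
 "fn x = (%z. if z \<in> L then of_int (B x z) else 0)"

text \<open>The form dual to \<open>B\<close>, computed in a frame, whose Gram matrix is its own
  inverse. It does not depend on the frame, by \<open>b7_frame\<close>.\<close>

definition b7 :: "(nat => 'l) => ('l => 's) => ('l => 's) => 's" where
 "b7 l p q = (\<Sum>j\<le>6. of_int (eta j) * p (l j) * q (l j))"

lemma g_id: "x \<in> L ==> g id x = x"
 using g_triv[of id x] by simp

lemma g_invE: assumes "\<mu> \<in> H"
 obtains \<delta> where "\<delta> \<in> H" "!!x. x \<in> L ==> g \<delta> (g \<mu> x) = x" "!!x. x \<in> L ==> g \<mu> (g \<delta> x) = x"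
proof -
 obtain \<delta> where d: "\<delta> \<in> H" "\<delta> \<circ> \<mu> = id" "\<mu> \<circ> \<delta> = id" using inv_ex assms by blast
 have "g \<delta> (g \<mu> x) = x" "g \<mu> (g \<delta> x) = x" if "x \<in> L" for x
 using g_comp[OF d(1) assms that] g_comp[OF assms d(1) that] d g_id that by simp_all
 thus ?thesis using d(1) by (rule_tac that)
qed

lemma LF_sum: "finite I ==> p \<in> LF ==> (!!i. i \<in> I ==> f i \<in> L) ==> p (sum f I) = (\<Sum>i\<in>I. p (f i))"
proof (induction I rule: finite_induct)
 case empty
 have "p (zm 0 0) = 0" using empty.prems(1) L0 by (auto simp: LF_def)
 thus ?case by (simp add: zm_0)
next
 case (insert i I)
 hence "p (f i + sum f I) = p (f i) + p (sum f I)" using L_sum[of I f] by (auto simp: LF_def)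
 thus ?case using insert by simp
qed

lemma LF_expand: assumes "frame l" "p \<in> LF" "x \<in> L"
 shows "p x = (\<Sum>j\<le>6. of_int (eta j) * of_int (B x (l j)) * p (l j))"
proof -
 interpret framed L zm B h l by unfold_locales fact
 have "p x = p (\<Sum>j\<le>6. zm (eta j * B x (l j)) (l j))" using expand[OF assms(3)] by (simp add: vec_def)
 also have "\<dots> = (\<Sum>j\<le>6. p (zm (eta j * B x (l j)) (l j)))"
 using l_in by (intro LF_sum assms) auto
 also have "\<dots> = (\<Sum>j\<le>6. of_int (eta j) * of_int (B x (l j)) * p (l j))"
 using assms(2) l_in by (intro sum.cong) (auto simp: LF_def)
 finally show ?thesis .
qed

lemma fn_LF: "x \<in> L ==> fn x \<in> LF"
 by (auto simp: LF_def fn_def B_addR B_sym[of x "zm _ _"] B_sym[of x] B_zm)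

lemma b7_fn: "frame l ==> p \<in> LF ==> x \<in> L ==> b7 l (fn x) p = p x"
proof -
 assume a: "frame l" "p \<in> LF" "x \<in> L"
 hence "l j \<in> L" if "j \<le> 6" for j using that by (simp add: frame_def)
 thus ?thesis unfolding LF_expand[OF a] by (simp add: b7_def fn_def)
qed

lemma b7_sym: "b7 l p q = b7 l q p"
 by (simp add: b7_def mult_ac)

lemma b7_frame: assumes "frame l" "frame l'" "p \<in> LF" "q \<in> LF"
 shows "b7 l p q = b7 l' p q"
proof -
 interpret framed L zm B h l by unfold_locales fact
 interpret l': framed L zm B h l' by unfold_locales fact
 have "b7 l' p q = (\<Sum>j\<le>6. of_int (eta j) * (\<Sum>i\<le>6. of_int (eta i) * of_int (B (l' j) (l i)) * p (l i)) * q (l' j))"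
 unfolding b7_def using LF_expand[OF assms(1,3)] l'.l_in by (intro sum.cong) auto
 also have "\<dots> = (\<Sum>j\<le>6. \<Sum>i\<le>6. of_int (eta i) * p (l i) * (of_int (eta j) * of_int (B (l i) (l' j)) * q (l' j)))"
 using B_sym[OF l'.l_in l_in] by (intro sum.cong) (auto simp: sum_distrib_left sum_distrib_right mult_ac intro!: sum.cong)
 also have "\<dots> = (\<Sum>i\<le>6. \<Sum>j\<le>6. of_int (eta i) * p (l i) * (of_int (eta j) * of_int (B (l i) (l' j)) * q (l' j)))"
 by (rule sum.swap)
 also have "\<dots> = b7 l p q"
 unfolding b7_def using LF_expand[OF assms(2,4)] l_in by (intro sum.cong) (auto simp: sum_distrib_left)
 finally show ?thesis by simp
qed

lemma frame_g: assumes "frame l" "\<mu> \<in> H" shows "frame (%j. g \<mu> (l j))"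
proof -
 interpret framed L zm B h l by unfold_locales fact
 obtain \<delta> where d: "\<delta> \<in> H" "!!x. x \<in> L ==> g \<delta> (g \<mu> x) = x" "!!x. x \<in> L ==> g \<mu> (g \<delta> x) = x"
 using g_invE[OF assms(2)] by metis
 have gs: "g \<mu> (sum f I) = (\<Sum>i\<in>I. g \<mu> (f i))" if "finite I" "!!i. i \<in> I ==> f i \<in> L" for f :: "nat => 'l" and I
 using that
 proof (induction I rule: finite_induct)
 case empty
 have "g \<mu> (zm 0 0) = zm 0 (g \<mu> 0)" by (rule g_zm[OF assms(2) L0])
 thus ?case by (simp add: zm_0)
 next
 case (insert i I)
 thus ?case using g_add[OF assms(2)] L_sum[of I f] by simp
 qed
 have "vec (%j. g \<mu> (l j)) hcoord = g \<mu> (vec l hcoord)"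
 unfolding vec_def using l_in by (subst gs) (auto simp: g_zm assms(2))
 hence "h = vec (%j. g \<mu> (l j)) hcoord" using h_vec g_h[OF assms(2)] by simp
 moreover have "x = 0" if x: "x \<in> L" "\<forall>j\<le>6. B x (g \<mu> (l j)) = 0" for x
 proof -
 have "B (g \<delta> x) (l j) = 0" if "j \<le> 6" for j
 using g_B[OF assms(2) g_in[OF d(1) x(1)] l_in[OF that]] d(3)[OF x(1)] x(2) that by simp
 hence "g \<delta> x = 0" using complete g_in d(1) x(1) by blast
 hence "x = g \<mu> 0" using d(3)[OF x(1)] by simp
 also have "\<dots> = 0" using gs[of "{}"] by simp
 finally show ?thesis .
 qed
 ultimately show ?thesis unfolding frame_def using assms(2) l_in B_l by (auto simp: g_in g_B)
qed

lemma b7_fixed: assumes "frame l" "p \<in> V7" "q \<in> V7" shows "b7 l p q \<in> fixf H"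
proof -
 interpret framed L zm B h l by unfold_locales fact
 have "\<mu> (b7 l p q) = b7 l p q" if g: "\<mu> \<in> H" for \<mu>
 proof -
 have "\<mu> (b7 l p q) = b7 (%j. g \<mu> (l j)) p q"
 using assms(2,3) g l_in by (simp add: b7_def hom_sum hom_simps V7_def)
 also have "\<dots> = b7 l p q" using b7_frame[OF frame_g[OF assms(1) g] assms(1)] assms(2,3) by (simp add: V7_def)
 finally show ?thesis .
 qed
 thus ?thesis by (simp add: fixf_def)
qed

lemma qsp_LF: assumes "frame l" shows "qsp UNIV LF fscale (b7 l)"
 by unfold_locales
 (auto simp: two_neq b7_sym, auto simp: LF_def fscale_def b7_def algebra_simps sum.distrib sum_distrib_left)

lemma qsp_V7: assumes "frame l" shows "qsp (fixf H) V7 fscale (b7 l)"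
 by unfold_locales
 (auto simp: b7_sym b7_fixed[OF assms], auto simp: V7_def LF_def fscale_def b7_def algebra_simps sum.distrib sum_distrib_left hom_simps fixf_def)

lemma obas_LF: assumes "frame l"
 shows "obas LF (b7 l) ((%j. fn (l j)) ` {..6})" "card ((%j. fn (l j)) ` {..6}) = 7"
proof -
 interpret framed L zm B h l by unfold_locales fact
 have v: "fn (l j) \<in> LF" if "j \<in> {..6}" for j using that fn_LF l_in by auto
 have e: "b7 l p (fn (l j)) = p (l j)" if "p \<in> LF" "j \<in> {..6}" for p j
 using that b7_fn[OF assms that(1)] l_in b7_sym by simp
 have d: "b7 l (fn (l j)) (fn (l j)) = of_int (eta j) & of_int (eta j) ~= (0::'s)" if "j \<in> {..6}" for j
 using that e[OF v[OF that] that] l_in B_l by (auto simp: fn_def eta_def)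
 have o: "b7 l (fn (l i)) (fn (l j)) = 0" if "i \<in> {..6}" "j \<in> {..6}" "i ~= j" for i j
 using that e[OF v[OF that(1)] that(2)] l_in B_l by (auto simp: fn_def)
 note F = orth_family[of "{..6::nat}" "%j. fn (l j)" LF "b7 l" "%j. of_int (eta j)", OF _ v d o]
 show "card ((%j. fn (l j)) ` {..6}) = 7" using F(2) by simp
 have "p = 0" if p: "p \<in> LF" "\<forall>q\<in>(%j. fn (l j)) ` {..6}. b7 l p q = 0" for p
 proof
 fix x
 have "p (l j) = 0" if "j \<in> {..6}" for j using p(2) e[OF p(1) that] that by simp
 thus "p x = 0 x" using LF_expand[OF assms p(1), of x] p(1) by (cases "x \<in> L") (auto simp: LF_def)
 qed
 thus "obas LF (b7 l) ((%j. fn (l j)) ` {..6})" using F(1) by (auto simp: obas_def)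
qed

lemma V7_orth_obas: assumes "frame l" "orth V7 (b7 l) C" "card C = 7" shows "obas V7 (b7 l) C"
proof -
 have s: "V7 <= LF" by (auto simp: V7_def)
 hence "orth LF (b7 l) C" using assms(2) by (auto simp: orth_def)
 hence "obas LF (b7 l) C"
 using qsp.orth_card_obas[OF qsp_LF[OF assms(1)] _ obas_LF(1)[OF assms(1)]] obas_LF(2)[OF assms(1)] assms(3) by simp
 thus ?thesis using assms(2) s by (auto simp: obas_def)
qed

lemma g_lines: "\<mu> \<in> H ==> x \<in> lines ==> g \<mu> x \<in> lines"
proof -
 assume a: "\<mu> \<in> H" "x \<in> lines"
 have "B (g \<mu> h) (g \<mu> x) = B h x" using a h_L by (intro g_B) (auto simp: lines_def)
 thus ?thesis using a by (auto simp: lines_def g_in g_B g_h)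
qed

lemma sact_lines: assumes "frame l" shows "sact H S lines g (%_ _. 1)"
proof -
 interpret framed L zm B h l by unfold_locales fact
 have "x \<in> L" if "x \<in> lines" for x using that by (simp add: lines_def)
 thus ?thesis by unfold_locales (auto simp: finite_lines g_lines g_comp g_triv)
qed

text \<open>The relation q_7 = <-2> q_5 + <1, -1> with q_5 diagonalised as \<open>a\<close>. It is
  demanded for every frame because the descent passes to frames adapted to a line and to an
  index.\<close>

definition hyp7 :: "(nat => 's) => bool" where
 "hyp7 a \<longleftrightarrow> (\<forall>i\<in>{1..5}. a i \<in> fixf H - {0}) & (\<forall>l. frame l --> (\<exists>C. orth V7 (b7 l) C & card C = 7 &
 norms (b7 l) C = {#1, -1#} + image_mset (%i. - 2 * a i) (mset_set {1..5})))"

end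

lemma lat_act_sub:
 assumes "lat_act L zm B h H S g" "H' <= H" "aut_group H'"
 shows "lat_act L zm B h H' S g" "lat_act.hyp7 L zm B h H g a ==> lat_act.hyp7 L zm B h H' g a"
proof -
 interpret lat_act L zm B h H S g by fact
 interpret a: aut_group H' by fact
 show 1: "lat_act L zm B h H' S g"
 by unfold_locales (simp_all add: finS S_in g_in g_add g_zm g_B g_h h_L g_comp g_triv subsetD[OF assms(2)])
 interpret b: lat_act L zm B h H' S g by (rule 1)
 have "V7 <= b.V7" using assms(2) by (auto simp: V7_def b.V7_def)
 hence "orth V7 (b7 l) C ==> orth b.V7 (b7 l) C" for l C by (auto simp: orth_def)
 thus "lat_act.hyp7 L zm B h H g a ==> lat_act.hyp7 L zm B h H' g a"
 unfolding hyp7_def b.hyp7_def using fixf_mono[OF assms(2)] by blast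
qed

section \<open>The stabiliser of a line, acting by signed permutations of the five vectors
  \<open>u i\<close>\<close>

locale lat_line = lat_act L zm B h H S g + framed L zm B h l
 for L :: "'l::ab_group_add set" and zm B h and H :: "('s::field => 's) set" and S g l +
 assumes g_l6: "\<mu> \<in> H ==> g \<mu> (l 6) = l 6"
begin

lemma l6_in: "l 6 \<in> L" by (rule l_in) simp

lemma g_ten: "\<mu> \<in> H ==> x \<in> ten ==> g \<mu> x \<in> ten" and g_six: "\<mu> \<in> H ==> x \<in> six ==> g \<mu> x \<in> six"
proof -
 have e: "B (g \<mu> x) (l 6) = B x (l 6)" if "\<mu> \<in> H" "x \<in> lines" for \<mu> x
 using g_B[OF that(1), of x "l 6"] that g_l6 l6_in by (simp add: lines_def)
 show "g \<mu> x \<in> ten" if "\<mu> \<in> H" "x \<in> ten" using that e[of \<mu> x] g_lines by (auto simp: ten_def)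
 show "g \<mu> x \<in> six" if "\<mu> \<in> H" "x \<in> six" using that e[of \<mu> x] g_lines by (auto simp: six_def)
qed

lemma g_neg: "\<mu> \<in> H ==> x \<in> L ==> g \<mu> (- x) = - g \<mu> x"
 using g_zm[of \<mu> x "-1"] by (simp add: zm_neg1)

text \<open>The ten lines meeting \<open>l 6\<close> are permuted, and \<open>u i\<close> or its
  negative is \<open>2 y - h + l 6\<close> for such a line \<open>y\<close>, where \<open>h\<close>
  and \<open>l 6\<close> are fixed.\<close>

lemma g_u_ex:
 assumes "\<mu> \<in> H" "i \<in> {1..5}"
 shows "\<exists>j\<in>{1..5}. \<exists>t\<in>{1, -1}. g \<mu> (u i) = zm t (u j)"
proof -
 have y: "yp i \<in> ten" using assms(2) ten_eq by blast
 have d: "g \<mu> (x - h) = g \<mu> x - h" if "x \<in> L" for x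
 using g_add[OF assms(1) that Lneg[OF h_L]] g_neg[OF assms(1) h_L] g_h[OF assms(1)] by simp
 have "g \<mu> (u i) = g \<mu> (yp i + yp i - h + l 6)" using u_yp(1)[OF assms(2)] by simp
 also have "\<dots> = g \<mu> (yp i) + g \<mu> (yp i) - h + l 6"
 using assms(1) l6_in by (simp add: g_add g_l6 d)
 finally have e: "g \<mu> (u i) = g \<mu> (yp i) + g \<mu> (yp i) - h + l 6" .
 have "g \<mu> (yp i) \<in> ten" using g_ten assms(1) y by blast
 then obtain j where "j \<in> {1..5}" "g \<mu> (yp i) = yp j | g \<mu> (yp i) = ym j" unfolding ten_eq by blast
 thus ?thesis using e u_yp[of j] zm_one[of "u j"] zm_neg1[of "u j"] by force
qed

lemma u_unique:
 assumes "i \<in> {1..5}" "j \<in> {1..5}" "s \<in> {1, -1}" "t \<in> {1, -1}" "zm s (u i) = zm t (u j)"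
 shows "i = j & s = t"
proof -
 have "s * B (u i) (u j) = t * B (u j) (u j)" using assms(5) B_zm[of "u i" "u j" s] B_zm[of "u j" "u j" t] by simp
 thus ?thesis using assms(1-4) by (cases "i = j") (simp_all add: B_uu)
qed

definition rho :: "('s => 's) => nat => nat" where
 "rho \<mu> i = (SOME j. j \<in> {1..5} & (\<exists>t\<in>{1, -1}. g \<mu> (u i) = zm t (u j)))"

definition tau :: "('s => 's) => nat => int" where
 "tau \<mu> i = (SOME t. t \<in> {1, -1} & g \<mu> (u i) = zm t (u (rho \<mu> i)))"

lemma g_u: assumes "\<mu> \<in> H" "i \<in> {1..5}"
 shows "rho \<mu> i \<in> {1..5}" "tau \<mu> i \<in> {1, -1}" "g \<mu> (u i) = zm (tau \<mu> i) (u (rho \<mu> i))"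
proof -
 have r: "rho \<mu> i \<in> {1..5} & (\<exists>t\<in>{1, -1}. g \<mu> (u i) = zm t (u (rho \<mu> i)))"
 unfolding rho_def by (rule someI_ex) (use g_u_ex[OF assms] in blast)
 thus "rho \<mu> i \<in> {1..5}" by blast
 have "tau \<mu> i \<in> {1, -1} & g \<mu> (u i) = zm (tau \<mu> i) (u (rho \<mu> i))"
 unfolding tau_def by (rule someI_ex) (use r in blast)
 thus "tau \<mu> i \<in> {1, -1}" "g \<mu> (u i) = zm (tau \<mu> i) (u (rho \<mu> i))" by blast+
qed

lemma rho_eqI: "\<mu> \<in> H ==> i \<in> {1..5} ==> j \<in> {1..5} ==> t \<in> {1, -1} ==> g \<mu> (u i) = zm t (u j) ==> rho \<mu> i = j & tau \<mu> i = t"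
 by (rule u_unique[OF g_u(1) _ g_u(2)]) (simp_all only: g_u(3)[symmetric])

sublocale five H S rho "%\<mu> i. of_int (tau \<mu> i)"
proof unfold_locales
 fix \<mu> \<delta> i assume g: "\<mu> \<in> H" "\<delta> \<in> H" and i: "i \<in> {1..5::nat}"
 note a = g_u[OF g(2) i]
 note b = g_u[OF g(1) a(1)]
 have "g (\<mu> \<circ> \<delta>) (u i) = zm (tau \<mu> (rho \<delta> i) * tau \<delta> i) (u (rho \<mu> (rho \<delta> i)))"
 using g a(3) b(3) by (simp add: g_comp g_zm zm_zm mult.commute)
 moreover have "tau \<mu> (rho \<delta> i) * tau \<delta> i \<in> {1, -1}" using a(2) b(2) by auto
 ultimately have "rho (\<mu> \<circ> \<delta>) i = rho \<mu> (rho \<delta> i) & tau (\<mu> \<circ> \<delta>) i = tau \<mu> (rho \<delta> i) * tau \<delta> i"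
 using rho_eqI[OF comp_in[OF g] i b(1)] by blast
 thus "rho (\<mu> \<circ> \<delta>) i = rho \<mu> (rho \<delta> i)"
 "(of_int (tau (\<mu> \<circ> \<delta>) i) :: 's) = of_int (tau \<mu> (rho \<delta> i)) * of_int (tau \<delta> i)" by simp_all
next
 fix \<mu> i assume g: "\<mu> \<in> H" and i: "i \<in> {1..5::nat}"
 show "rho \<mu> i \<in> {1..5}" "(of_int (tau \<mu> i) :: 's) = 1 | (of_int (tau \<mu> i) :: 's) = -1"
 using g_u[OF g i] by auto
 assume "!!s. s \<in> S ==> \<mu> s = s"
 hence "g \<mu> (u i) = zm 1 (u i)" using g_triv[OF g _ u_in] by (simp only: zm_one)
 thus "rho \<mu> i = i & (of_int (tau \<mu> i) :: 's) = 1" using rho_eqI[OF g i i, of 1] by simp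
qed simp

abbreviation sg where "sg \<equiv> %\<mu> i. of_int (tau \<mu> i) :: 's"

definition bb :: "'l => nat => 's" where "bb x i = of_int (B x (u i))"

lemma bb_g: assumes "\<mu> \<in> H" "x \<in> L" "i \<in> {1..5}"
 shows "bb (g \<mu> x) (rho \<mu> i) = sg \<mu> i * bb x i"
proof -
 note u = g_u[OF assms(1,3)]
 have "B x (u i) = B (g \<mu> x) (zm (tau \<mu> i) (u (rho \<mu> i)))" using g_B[OF assms(1,2) u_in, of i] u(3) by simp
 also have "\<dots> = tau \<mu> i * B (g \<mu> x) (u (rho \<mu> i))"
 using assms by (simp add: B_sym[of "g \<mu> x"] B_zm g_in)
 finally show ?thesis using u(2) by (auto simp: bb_def)
qed

text \<open>Linear polynomials in the coordinates \<open>bb x i\<close>; the signs of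
  \<open>f\<close> and of \<open>bb\<close> cancel. The next two lemmas do the same for sums of
  squares and of products of two coordinates.\<close>

lemma equivariant_sum:
 assumes f: "f \<in> tw H {1..5} rho sg" and g: "\<mu> \<in> H" and x: "x \<in> L"
 shows "(\<Sum>i\<in>{1..5}. f i * bb (g \<mu> x) i) = \<mu> (\<Sum>i\<in>{1..5}. f i * bb x i)"
proof -
 have "(\<Sum>i\<in>{1..5}. f i * bb (g \<mu> x) i) = (\<Sum>i\<in>{1..5}. f (rho \<mu> i) * bb (g \<mu> x) (rho \<mu> i))"
 by (rule sum.reindex_bij_betw[OF \<rho>_bij[OF g], symmetric])
 also have "\<dots> = (\<Sum>i\<in>{1..5}. (sg \<mu> i * sg \<mu> i) * (\<mu> (f i) * bb x i))"
 by (intro sum.cong HOL.refl) (simp only: twD(2)[OF f g] bb_g[OF g x] mult_ac)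
 also have "\<dots> = (\<Sum>i\<in>{1..5}. \<mu> (f i * bb x i))"
 using \<epsilon>_sq[OF g] g by (intro sum.cong) (auto simp: hom_simps bb_def)
 finally show ?thesis using g by (simp add: hom_sum)
qed

lemma equivariant_square_sum:
 assumes f: "f \<in> tw H {1..5} rho (%_ _. 1)" and g: "\<mu> \<in> H" and x: "x \<in> L"
 shows "(\<Sum>i\<in>{1..5}. f i * (bb (g \<mu> x) i)^2) = \<mu> (\<Sum>i\<in>{1..5}. f i * (bb x i)^2)"
proof -
 have "(\<Sum>i\<in>{1..5}. f i * (bb (g \<mu> x) i)^2) = (\<Sum>i\<in>{1..5}. f (rho \<mu> i) * (bb (g \<mu> x) (rho \<mu> i))^2)"
 by (rule sum.reindex_bij_betw[OF \<rho>_bij[OF g], symmetric])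
 also have "\<dots> = (\<Sum>i\<in>{1..5}. (sg \<mu> i * sg \<mu> i) * (\<mu> (f i) * (bb x i)^2))"
 by (intro sum.cong HOL.refl) (simp only: twD(2)[OF f g] bb_g[OF g x] power2_eq_square mult_ac mult_1_left)
 also have "\<dots> = (\<Sum>i\<in>{1..5}. \<mu> (f i * (bb x i)^2))"
 using \<epsilon>_sq[OF g] g by (intro sum.cong) (auto simp: hom_simps bb_def)
 finally show ?thesis using g by (simp add: hom_sum)
qed

lemma equivariant_pair_sum:
 assumes f: "f \<in> tw H pairs5 \<rho>2 \<sigma>2" and g: "\<mu> \<in> H" and x: "x \<in> L"
 shows "(\<Sum>p\<in>pairs5. f p * (bb (g \<mu> x) (fst p) * bb (g \<mu> x) (snd p))) = \<mu> (\<Sum>p\<in>pairs5. f p * (bb x (fst p) * bb x (snd p)))"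
proof -
 interpret p: sact H S pairs5 \<rho>2 \<sigma>2 by (rule sact_pairs)
 have e: "bb (g \<mu> x) (fst (\<rho>2 \<mu> p)) * bb (g \<mu> x) (snd (\<rho>2 \<mu> p)) = \<sigma>2 \<mu> p * (bb x (fst p) * bb x (snd p))"
 if p: "p \<in> pairs5" for p
 proof -
 obtain i j where ij: "p = (i, j)" "i \<in> {1..5}" "j \<in> {1..5}" using p by (auto simp: pairs5_def)
 have "bb (g \<mu> x) (fst (\<rho>2 \<mu> p)) * bb (g \<mu> x) (snd (\<rho>2 \<mu> p)) = bb (g \<mu> x) (rho \<mu> i) * bb (g \<mu> x) (rho \<mu> j)"
 by (simp add: ij \<rho>2_def min_def max_def)
 thus ?thesis unfolding bb_g[OF g x ij(2)] bb_g[OF g x ij(3)] by (simp add: ij \<sigma>2_def mult_ac)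
 qed
 have "(\<Sum>p\<in>pairs5. f p * (bb (g \<mu> x) (fst p) * bb (g \<mu> x) (snd p))) =
 (\<Sum>p\<in>pairs5. f (\<rho>2 \<mu> p) * (bb (g \<mu> x) (fst (\<rho>2 \<mu> p)) * bb (g \<mu> x) (snd (\<rho>2 \<mu> p))))"
 by (rule sum.reindex_bij_betw[OF p.\<rho>_bij[OF g], symmetric])
 also have "\<dots> = (\<Sum>p\<in>pairs5. (\<sigma>2 \<mu> p * \<sigma>2 \<mu> p) * (\<mu> (f p) * (bb x (fst p) * bb x (snd p))))"
 by (intro sum.cong HOL.refl) (simp only: twD(2)[OF f g] e mult_ac)
 also have "\<dots> = (\<Sum>p\<in>pairs5. \<mu> (f p * (bb x (fst p) * bb x (snd p))))"
 using p.\<epsilon>_sq[OF g] g by (intro sum.cong) (auto simp: hom_simps bb_def)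
 finally show ?thesis using g by (simp add: hom_sum)
qed

end

section \<open>The forms on the ten and on the sixteen lines\<close>

lemma bilinear_family_sum:
 fixes f g :: "'i => 's::comm_ring_1"
 assumes "finite I" "!!i j. i \<in> I ==> j \<in> I ==> (\<Sum>A\<in>E. w A i * w A j) = (if i = j then c else 0)"
 shows "(\<Sum>A\<in>E. (\<Sum>i\<in>I. f i * w A i) * (\<Sum>j\<in>I. g j * w A j)) = c * (\<Sum>i\<in>I. f i * g i)"
proof -
 have "(\<Sum>A\<in>E. (\<Sum>i\<in>I. f i * w A i) * (\<Sum>j\<in>I. g j * w A j)) = (\<Sum>i\<in>I. \<Sum>j\<in>I. f i * g j * (if i = j then c else 0))"
 unfolding sum_product_swap using assms(2) by (intro sum.cong) auto
 also have "\<dots> = (\<Sum>i\<in>I. \<Sum>j\<in>I. if i = j then c * (f i * g i) else 0)"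
 by (intro sum.cong) auto
 also have "\<dots> = c * (\<Sum>i\<in>I. f i * g i)" using assms(1) by (simp add: sum_distrib_left)
 finally show ?thesis .
qed

lemma hd_image:
 assumes "hd_tw H X \<rho> \<epsilon> M" "c ~= 0"
 and "!!f. f \<in> tw H X \<rho> \<epsilon> ==> \<Phi> f \<in> V"
 and "!!f g. f \<in> tw H X \<rho> \<epsilon> ==> g \<in> tw H X \<rho> \<epsilon> ==> \<beta> (\<Phi> f) (\<Phi> g) = c * bil X f g"
 obtains C where "orth V \<beta> C" "card C = card X" "norms \<beta> C = image_mset ((*) c) M" "C <= \<Phi> ` tw H X \<rho> \<epsilon>"
proof -
 obtain C where C: "orth (tw H X \<rho> \<epsilon>) (bil X) C" "card C = card X" "norms (bil X) C = M"
 using assms(1) by (auto simp: hd_tw_def)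
 have Ci: "f \<in> tw H X \<rho> \<epsilon>" if "f \<in> C" for f using C(1) that by (auto simp: orth_def)
 show ?thesis
 using orth_image[where T = \<Phi> and V' = V and \<beta>' = \<beta>, OF C(1) assms(2)] C Ci assms(3,4)
 by (intro that[of "\<Phi> ` C"]) auto
qed

lemma sum5: "(\<Sum>i\<in>{1..5::nat}. f i) = f 1 + f 2 + f 3 + f 4 + f 5" for f :: "nat => 'a::comm_monoid_add"
proof -
 have "{1..5::nat} = {1,2,3,4,5}" by auto
 thus ?thesis by (simp add: add.assoc)
qed

lemma sum_pairs5: "(\<Sum>p\<in>pairs5. f p) = f (1,2) + f (3,4) + f (1,3) + f (1,4) + f (2,3) + f (2,4) + f (1,5) + f (2,5) + f (3,5) + f (4,5)"
 for f :: "nat \<times> nat => 'a::comm_monoid_add"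
 unfolding pairs5_eq by (simp add: ac_simps)

text \<open>The Cauchy-Binet formula for two rows: the unit form on pairs, evaluated on 2 by 2
  minors, is the form of the exterior square.\<close>

lemma lagrange_identity5:
 fixes x y z w :: "nat => 's::comm_ring_1"
 shows "(\<Sum>p\<in>pairs5. (x (fst p) * y (snd p) - x (snd p) * y (fst p)) * (z (fst p) * w (snd p) - z (snd p) * w (fst p))) =
 (\<Sum>i\<in>{1..5}. x i * z i) * (\<Sum>i\<in>{1..5}. y i * w i) - (\<Sum>i\<in>{1..5}. x i * w i) * (\<Sum>i\<in>{1..5}. y i * z i)"
 unfolding sum_pairs5 sum5 fst_conv snd_conv by (simp add: algebra_simps)

text \<open>The coordinates of a wedge of two twisted functions are their 2 by 2 minors, and sorting
  the pair of indices produces the sign \<open>ori\<close>.\<close>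

lemma (in five) hd_wedge:
 assumes n: "hd_tw H {1..5} \<rho> \<sigma> (image_mset b (mset_set {1..5}))" and b: "!!i. i \<in> {1..5} ==> b i ~= 0"
 shows "hd_tw H pairs5 \<rho>2 (%\<mu> x. \<sigma>2 \<mu> x * ori \<mu> x) (image_mset (%p. b (fst p) * b (snd p)) (mset_set pairs5))"
proof -
 obtain F where F: "orth T (bil {1..5}) F" "card F = card {1..5::nat}" "norms (bil {1..5}) F = image_mset b (mset_set {1..5})"
 using n by (auto simp: hd_tw_def)
 obtain \<phi> where p: "bij_betw \<phi> {1..5} F" "\<forall>i\<in>{1..5}. bil {1..5} (\<phi> i) (\<phi> i) = b i"
 using mset_bijection[of "{1..5::nat}" F "%x. bil {1..5} x x" b] F orth_finite[OF F(1)] by (auto simp: norms_def)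
 have \<phi>F: "\<phi> i \<in> F" if "i \<in> {1..5}" for i using p(1) that by (auto simp: bij_betw_def)
 have \<phi>T: "\<phi> i \<in> T" if "i \<in> {1..5}" for i using \<phi>F[OF that] F(1) by (auto simp: orth_def)
 have ip: "bil {1..5} (\<phi> i) (\<phi> j) = (if i = j then b i else 0)" if "i \<in> {1..5}" "j \<in> {1..5}" for i j
 proof (cases "i = j")
 case False
 hence "\<phi> i ~= \<phi> j" using p(1) that by (auto simp: bij_betw_def inj_on_def)
 thus ?thesis using F(1) \<phi>F that False by (auto simp: orth_def)
 qed (use p(2) that in auto)
 define W where "W p q = (if q \<in> pairs5 then \<phi> (fst p) (fst q) * \<phi> (snd p) (snd q) - \<phi> (fst p) (snd q) * \<phi> (snd p) (fst q) else 0)"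
 for p q :: "nat \<times> nat"
 have P: "fst p \<in> {1..5}" "snd p \<in> {1..5}" "fst p < snd p" if "p \<in> pairs5" for p using that by (auto simp: pairs5_def)
 have WT: "W p \<in> tw H pairs5 \<rho>2 (%\<mu> x. \<sigma>2 \<mu> x * ori \<mu> x)" if pp: "p \<in> pairs5" for p
 proof (rule twI)
 show "W p q = 0" if "q \<notin> pairs5" for q using that by (simp add: W_def)
 fix \<mu> q assume g: "\<mu> \<in> H" and q: "q \<in> pairs5"
 obtain k m where km: "q = (k, m)" "k \<in> {1..5}" "m \<in> {1..5}" using q by (auto simp: pairs5_def)
 have q': "\<rho>2 \<mu> q \<in> pairs5" using sact.\<rho>_in[OF sact_pairs(1) g q] .
 have e: "\<mu> (\<phi> i k) = \<sigma> \<mu> k * \<phi> i (\<rho> \<mu> k)" "\<mu> (\<phi> i m) = \<sigma> \<mu> m * \<phi> i (\<rho> \<mu> m)" if "i \<in> {1..5}" for i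
 using tw_eps_sq[OF \<phi>T[OF that] g] km by auto
 have s: "\<sigma> \<mu> k = 1 | \<sigma> \<mu> k = -1" "\<sigma> \<mu> m = 1 | \<sigma> \<mu> m = -1" using \<epsilon>_sign[OF g] km by auto
 show "W p (\<rho>2 \<mu> q) = \<sigma>2 \<mu> q * ori \<mu> q * \<mu> (W p q)"
 using q q' s unfolding W_def km \<rho>2_def \<sigma>2_def ori_def split_conv
 by (elim disjE; cases "\<rho> \<mu> k < \<rho> \<mu> m")
 (simp_all add: hom_simps g e[OF P(1)[OF pp]] e[OF P(2)[OF pp]] min_def max_def)
 qed
 have B: "bil pairs5 (W p) (W q) = bil {1..5} (\<phi> (fst p)) (\<phi> (fst q)) * bil {1..5} (\<phi> (snd p)) (\<phi> (snd q))
 - bil {1..5} (\<phi> (fst p)) (\<phi> (snd q)) * bil {1..5} (\<phi> (snd p)) (\<phi> (fst q))" for p q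
 proof -
 have "bil pairs5 (W p) (W q) = (\<Sum>r\<in>pairs5. (\<phi> (fst p) (fst r) * \<phi> (snd p) (snd r) - \<phi> (fst p) (snd r) * \<phi> (snd p) (fst r)) *
 (\<phi> (fst q) (fst r) * \<phi> (snd q) (snd r) - \<phi> (fst q) (snd r) * \<phi> (snd q) (fst r)))"
 unfolding wbil_def by (intro sum.cong) (simp_all add: W_def)
 thus ?thesis unfolding lagrange_identity5 by (simp add: wbil_def)
 qed
 have d: "bil pairs5 (W p) (W p) = b (fst p) * b (snd p) & b (fst p) * b (snd p) ~= 0" if "p \<in> pairs5" for p
 using P[OF that] b unfolding B ip[OF P(1)[OF that] P(1)[OF that]] ip[OF P(2)[OF that] P(2)[OF that]]
 ip[OF P(1)[OF that] P(2)[OF that]] by simp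
 have o: "bil pairs5 (W p) (W q) = 0" if "p \<in> pairs5" "q \<in> pairs5" "p ~= q" for p q
 using P(3)[OF that(1)] P(3)[OF that(2)] that(3)
 unfolding B ip[OF P(1)[OF that(1)] P(1)[OF that(2)]] ip[OF P(2)[OF that(1)] P(2)[OF that(2)]]
 ip[OF P(1)[OF that(1)] P(2)[OF that(2)]] ip[OF P(2)[OF that(1)] P(1)[OF that(2)]]
 by (auto simp: prod_eq_iff)
 show ?thesis unfolding hd_tw_def
 using orth_family[of pairs5 W "tw H pairs5 \<rho>2 (%\<mu> x. \<sigma>2 \<mu> x * ori \<mu> x)" "bil pairs5", OF card_pairs5(1) WT d o] by blast
qed

context lat_line begin

text \<open>The even and odd parts under exchange of \<open>yp i\<close> and \<open>ym i\<close>.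
  The coordinate is -2 or 2 there, so the squares take the value \<open>4 f i\<close> on both lines
  and the linear sums take -2 and 2 times \<open>f i\<close>; this gives the factors 2 * 16 = 32 and
  2 * 4 = 8.\<close>

lemma hd_ten:
 assumes S1: "hd_tw H {1..5} rho (%_ _. 1) S1" and S2: "hd_tw H {1..5} rho sg S2"
 shows "hd_tw H ten g (%_ _. 1) (image_mset ((*) 32) S1 + image_mset ((*) 8) S2)"
proof -
 have ten_L: "x \<in> L" if "x \<in> ten" for x using that by (simp add: ten_def lines_def)
 have pw: "(2::'s) ^ n ~= 0" for n using two_neq by simp
 have n0: "(32::'s) ~= 0" "(8::'s) ~= 0" using pw[of 5] pw[of 3] by simp_all
 define \<Phi> where "\<Phi> f x = (if x \<in> ten then \<Sum>i\<in>{1..5}. f i * (bb x i)^2 else 0)" for f x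
 define \<Psi> where "\<Psi> f x = (if x \<in> ten then \<Sum>i\<in>{1..5}. f i * bb x i else 0)" for f x
 have yt: "yp i \<in> ten" "ym i \<in> ten" if "i \<in> {1..5}" for i using that ten_eq by blast+
 have val: "\<Phi> f (yp i) = 4 * f i" "\<Phi> f (ym i) = 4 * f i" "\<Psi> f (yp i) = - 2 * f i" "\<Psi> f (ym i) = 2 * f i"
 if i: "i \<in> {1..5}" for f i
 proof -
 have e: "bb (yp i) j = (if j = i then -2 else 0)" "bb (ym i) j = (if j = i then 2 else 0)" if "j \<in> {1..5}" for j
 using B_yp_u[OF i that] B_ym_u[OF i that] by (auto simp: bb_def)
 have "(\<Sum>j\<in>{1..5}. f j * (bb (yp i) j)^2) = (\<Sum>j\<in>{1..5}. if j = i then 4 * f i else 0)"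
 "(\<Sum>j\<in>{1..5}. f j * (bb (ym i) j)^2) = (\<Sum>j\<in>{1..5}. if j = i then 4 * f i else 0)"
 "(\<Sum>j\<in>{1..5}. f j * bb (yp i) j) = (\<Sum>j\<in>{1..5}. if j = i then - 2 * f i else 0)"
 "(\<Sum>j\<in>{1..5}. f j * bb (ym i) j) = (\<Sum>j\<in>{1..5}. if j = i then 2 * f i else 0)"
 by (intro sum.cong HOL.refl, simp add: e)+
 thus "\<Phi> f (yp i) = 4 * f i" "\<Phi> f (ym i) = 4 * f i" "\<Psi> f (yp i) = - 2 * f i" "\<Psi> f (ym i) = 2 * f i"
 using i yt[OF i] by (simp_all add: \<Phi>_def \<Psi>_def)
 qed
 have T1: "\<Phi> f \<in> tw H ten g (%_ _. 1)" if "f \<in> tw H {1..5} rho (%_ _. 1)" for f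
 by (rule twI) (use that g_ten ten_L equivariant_square_sum in \<open>simp_all add: \<Phi>_def\<close>)
 have T2: "\<Psi> f \<in> tw H ten g (%_ _. 1)" if "f \<in> tw H {1..5} rho sg" for f
 by (rule twI) (use that g_ten ten_L equivariant_sum in \<open>simp_all add: \<Psi>_def\<close>)
 have b: "bil ten F G = (\<Sum>i\<in>{1..5}. F (yp i) * G (yp i) + F (ym i) * G (ym i))" for F G
 by (simp add: wbil_def sum_ten)
 have b1: "bil ten (\<Phi> f) (\<Phi> f') = 32 * bil {1..5} f f'" for f f'
 by (subst b) (unfold wbil_def sum_distrib_left, intro sum.cong HOL.refl, simp add: val)
 have b2: "bil ten (\<Psi> f) (\<Psi> f') = 8 * bil {1..5} f f'" for f f'
 by (subst b) (unfold wbil_def sum_distrib_left, intro sum.cong HOL.refl, simp add: val)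
 have b3: "bil ten (\<Phi> f) (\<Psi> f') = 0" for f f'
 unfolding b by (intro sum.neutral) (simp add: val)
 obtain C where C: "orth (tw H ten g (%_ _. 1)) (bil ten) C" "card C = card {1..5::nat}"
 "norms (bil ten) C = image_mset ((*) 32) S1" "C <= \<Phi> ` tw H {1..5} rho (%_ _. 1)"
 by (rule hd_image[where \<Phi> = \<Phi> and V = "tw H ten g (%_ _. 1)" and \<beta> = "bil ten", OF S1 n0(1) T1 b1])
 obtain D where D: "orth (tw H ten g (%_ _. 1)) (bil ten) D" "card D = card {1..5::nat}"
 "norms (bil ten) D = image_mset ((*) 8) S2" "D <= \<Psi> ` tw H {1..5} rho sg"
 by (rule hd_image[where \<Phi> = \<Psi> and V = "tw H ten g (%_ _. 1)" and \<beta> = "bil ten", OF S2 n0(2) T2 b2])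
 have z: "bil ten F G = 0 & bil ten G F = 0" if FG: "F \<in> C" "G \<in> D" for F G
 proof -
 obtain f f' where "F = \<Phi> f" "G = \<Psi> f'" using FG C(4) D(4) by blast
 thus ?thesis using b3 wbil_sym[of ten _ G F] by simp
 qed
 note U = orth_Un[OF C(1) D(1) z]
 have "card (C \<union> D) = card ten"
 using card_Un_disjoint[OF orth_finite[OF C(1)] orth_finite[OF D(1)] U(2)] C(2) D(2) card_lines(1) by simp
 thus ?thesis unfolding hd_tw_def using U(1,3) C(3) D(3) by (intro exI[of _ "C \<union> D"]) simp
qed

text \<open>All coordinates are 1 or -1 there. The 1 + 5 + 10 monomials of degree at most two in
  distinct coordinates are orthogonal characters of norm 16, and they fill the space of functions on
  16 lines.\<close>

lemma hd_six:
 assumes S: "hd_tw H {1..5} rho sg S1" and S2: "hd_tw H pairs5 \<rho>2 \<sigma>2 S2"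
 shows "hd_tw H six g (%_ _. 1) ({#16#} + (image_mset ((*) 16) S1 + image_mset ((*) 16) S2))"
proof -
 have six_L: "x \<in> L" if "x \<in> six" for x using that by (simp add: six_def lines_def)
 have n0: "(16::'s) ~= 0" using two_neq power_not_zero[of "2::'s" 4] by simp
 define \<Psi> where "\<Psi> f x = (if x \<in> six then \<Sum>i\<in>{1..5}. f i * bb x i else 0)" for f x
 define \<Theta> where "\<Theta> f x = (if x \<in> six then \<Sum>p\<in>pairs5. f p * (bb x (fst p) * bb x (snd p)) else 0)" for f x
 define c where "c x = (if x \<in> six then 1 else 0 :: 's)" for x
 have zs: "zA A \<in> six" if "A \<in> even5" for A using that six_eq by blast
 have bz: "bb (zA A) i = chi A {i}" if "A \<in> even5" "i \<in> {1..5}" for A i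
 using B_z_u[OF that] by (simp add: bb_def chi_def)
 have val: "\<Psi> f (zA A) = (\<Sum>i\<in>{1..5}. f i * chi A {i})" "\<Theta> f' (zA A) = (\<Sum>p\<in>pairs5. f' p * chi A {fst p, snd p})" "c (zA A) = 1"
 if A: "A \<in> even5" for f f' A
 proof -
 have "bb (zA A) (fst p) * bb (zA A) (snd p) = chi A {fst p, snd p}" if "p \<in> pairs5" for p
 proof -
 have "fst p \<in> {1..5}" "snd p \<in> {1..5}" "fst p ~= snd p" using that by (auto simp: pairs5_def)
 thus ?thesis using bz[OF A] by (simp only: chi_pair[of "fst p" "snd p" A] if_True not_False_eq_True)
 qed
 thus "\<Theta> f' (zA A) = (\<Sum>p\<in>pairs5. f' p * chi A {fst p, snd p})"
 using zs[OF A] by (simp add: \<Theta>_def)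
 show "\<Psi> f (zA A) = (\<Sum>i\<in>{1..5}. f i * chi A {i})" using zs[OF A] bz[OF A] by (simp add: \<Psi>_def)
 show "c (zA A) = 1" using zs[OF A] by (simp add: c_def)
 qed
 have T1: "\<Psi> f \<in> tw H six g (%_ _. 1)" if "f \<in> tw H {1..5} rho sg" for f
 by (rule twI) (use that g_six six_L equivariant_sum in \<open>simp_all add: \<Psi>_def\<close>)
 have T2: "\<Theta> f \<in> tw H six g (%_ _. 1)" if "f \<in> tw H pairs5 \<rho>2 \<sigma>2" for f
 by (rule twI) (use that g_six six_L equivariant_pair_sum in \<open>simp_all add: \<Theta>_def\<close>)
 have T3: "c \<in> tw H six g (%_ _. 1)" by (rule twI) (use g_six in \<open>simp_all add: c_def hom_one\<close>)
 have b: "bil six F G = (\<Sum>A\<in>even5. F (zA A) * G (zA A))" for F G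
 by (simp add: wbil_def sum_six)
 note cs = chi_sums[OF two_neq]
 have b1: "bil six (\<Psi> f) (\<Psi> f') = 16 * bil {1..5} f f'" for f f'
 proof -
 have "bil six (\<Psi> f) (\<Psi> f') = (\<Sum>A\<in>even5. (\<Sum>i\<in>{1..5}. f i * chi A {i}) * (\<Sum>i\<in>{1..5}. f' i * chi A {i}))"
 unfolding b using val by (intro sum.cong) auto
 also have "\<dots> = 16 * (\<Sum>i\<in>{1..5}. f i * f' i)" by (rule bilinear_family_sum) (use cs(2) in auto)
 finally show ?thesis by (simp add: wbil_def)
 qed
 have b2: "bil six (\<Theta> f) (\<Theta> f') = 16 * bil pairs5 f f'" for f f'
 proof -
 have "bil six (\<Theta> f) (\<Theta> f') = (\<Sum>A\<in>even5. (\<Sum>p\<in>pairs5. f p * chi A {fst p, snd p}) * (\<Sum>p\<in>pairs5. f' p * chi A {fst p, snd p}))"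
 unfolding b using val by (intro sum.cong) auto
 also have "\<dots> = 16 * (\<Sum>i\<in>pairs5. f i * f' i)" by (rule bilinear_family_sum) (use cs(5) card_pairs5 in auto)
 finally show ?thesis by (simp add: wbil_def)
 qed
 have b3: "bil six (\<Psi> f) (\<Theta> f') = 0" for f f'
 proof -
 have "bil six (\<Psi> f) (\<Theta> f') = (\<Sum>A\<in>even5. (\<Sum>i\<in>{1..5}. f i * chi A {i}) * (\<Sum>p\<in>pairs5. f' p * chi A {fst p, snd p}))"
 unfolding b using val by (intro sum.cong) auto
 also have "\<dots> = 0" unfolding sum_product_swap using cs(4) by (intro sum.neutral) auto
 finally show ?thesis .
 qed
 have b4: "bil six c (\<Psi> f) = 0" for f
 proof -
 have "bil six c (\<Psi> f) = (\<Sum>A\<in>even5. \<Sum>i\<in>{1..5}. f i * chi A {i})"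
 unfolding b using val by (intro sum.cong) auto
 also have "\<dots> = (\<Sum>i\<in>{1..5}. f i * (\<Sum>A\<in>even5. chi A {i}))" unfolding sum_distrib_left by (rule sum.swap)
 also have "\<dots> = 0" using cs(1) by (intro sum.neutral) auto
 finally show ?thesis .
 qed
 have b5: "bil six c (\<Theta> f) = 0" for f
 proof -
 have "bil six c (\<Theta> f) = (\<Sum>A\<in>even5. \<Sum>p\<in>pairs5. f p * chi A {fst p, snd p})"
 unfolding b using val by (intro sum.cong) auto
 also have "\<dots> = (\<Sum>p\<in>pairs5. f p * (\<Sum>A\<in>even5. chi A {fst p, snd p}))" unfolding sum_distrib_left by (rule sum.swap)
 also have "\<dots> = 0" using cs(3) by (intro sum.neutral) auto
 finally show ?thesis .
 qed
 have b6: "bil six c c = 16"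
 proof -
 have "bil six c c = (\<Sum>A\<in>even5. 1)" unfolding b using val(3) by (intro sum.cong) auto
 thus ?thesis by (simp add: card_even5)
 qed
 obtain C where C: "orth (tw H six g (%_ _. 1)) (bil six) C" "card C = card {1..5::nat}"
 "norms (bil six) C = image_mset ((*) 16) S1" "C <= \<Psi> ` tw H {1..5} rho sg"
 by (rule hd_image[where \<Phi> = \<Psi> and V = "tw H six g (%_ _. 1)" and \<beta> = "bil six", OF S n0 T1 b1])
 obtain D where D: "orth (tw H six g (%_ _. 1)) (bil six) D" "card D = card pairs5"
 "norms (bil six) D = image_mset ((*) 16) S2" "D <= \<Theta> ` tw H pairs5 \<rho>2 \<sigma>2"
 by (rule hd_image[where \<Phi> = \<Theta> and V = "tw H six g (%_ _. 1)" and \<beta> = "bil six", OF S2 n0 T2 b2])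
 have z: "bil six F G = 0 & bil six G F = 0" if FG: "F \<in> C" "G \<in> D" for F G
 proof -
 obtain f f' where "F = \<Psi> f" "G = \<Theta> f'" using FG C(4) D(4) by blast
 thus ?thesis using b3 wbil_sym[of six _ G F] by simp
 qed
 note U = orth_Un[OF C(1) D(1) z]
 have c1: "orth (tw H six g (%_ _. 1)) (bil six) {c}" "norms (bil six) {c} = {#16#}"
 using T3 b6 n0 by (auto simp: orth_def norms_def)
 have z': "bil six F G = 0 & bil six G F = 0" if F: "F \<in> {c}" and G: "G \<in> C \<union> D" for F G
 proof -
 have "bil six c G = 0" using G C(4) D(4) b4 b5 by blast
 thus ?thesis using F wbil_sym[of six _ G F] by simp
 qed
 note U' = orth_Un[OF c1(1) U(1) z']
 have "finite C" "finite D" using C(1) D(1) by (simp_all add: orth_finite)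
 hence "card ({c} \<union> (C \<union> D)) = 1 + (card C + card D)" using U(2) U'(2) by (simp add: card_Un_disjoint)
 also note C(2) also note D(2)
 finally have "card ({c} \<union> (C \<union> D)) = card six"
 using card_lines(2) card_pairs5(2) by simp
 thus ?thesis unfolding hd_tw_def using U'(1,3) U(3) C(3) D(3) c1(2) by (intro exI[of _ "{c} \<union> (C \<union> D)"]) simp
qed

lemma hd_lines:
 assumes "hd_tw H {1..5} rho (%_ _. 1) S1" "hd_tw H {1..5} rho sg S2" "hd_tw H pairs5 \<rho>2 \<sigma>2 S3"
 shows "hd_tw H lines g (%_ _. 1) ({#1#} + ((image_mset ((*) 32) S1 + image_mset ((*) 8) S2) +
 ({#16#} + (image_mset ((*) 16) S2 + image_mset ((*) 16) S3))))"
proof -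
 have "hd_tw H {l 6} g (%_ _. 1) {#1#}"
 proof -
 let ?f = "udelta (l 6) :: 'l => 's"
 have "?f \<in> tw H {l 6} g (%_ _. 1)" by (rule twI) (auto simp: udelta_def g_l6 hom_one)
 moreover have "bil {l 6} ?f ?f = 1" by (simp add: wbil_def udelta_def)
 ultimately show ?thesis unfolding hd_tw_def by (intro exI[of _ "{?f}"]) (simp add: orth_def norms_def)
 qed
 moreover have "hd_tw H (ten \<union> six) g (%_ _. 1) ((image_mset ((*) 32) S1 + image_mset ((*) 8) S2) +
 ({#16#} + (image_mset ((*) 16) S2 + image_mset ((*) 16) S3)))"
 by (rule hd_Un[OF hd_ten[OF assms(1,2)] hd_six[OF assms(2,3)] lines_Un(3) finite_lines(1,2)])
 (simp_all add: g_ten g_six hom_zero)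
 ultimately show ?thesis unfolding lines_Un(1)
 by (rule hd_Un) (use lines_Un(2) finite_lines g_ten g_six g_l6 hom_zero in auto)
qed

text \<open>In \<open>q\<^sub>7\<close>, the fixed line \<open>y\<close>, the vector \<open>h + y\<close> and the \<open>u\<^sub>i\<close> give
  \<open>\<langle>-1, 4\<rangle> + \<langle>-4\<rangle> q(u)\<close>, so that \<open>q\<^sub>5\<close> is twice the form on the \<open>u\<^sub>i\<close>.\<close>

lemma hd_five:
 assumes a: "hyp7 a"
 shows "hd_tw H {1..5} rho sg (image_mset (%i. a i / 2) (mset_set {1..5}))"
proof -
 let ?K = "fixf H" and ?b = "b7 l"
 have aK: "a i \<in> ?K" "a i ~= 0" if "i \<in> {1..5}" for i using a that by (auto simp: hyp7_def)
 interpret v: qsp ?K V7 fscale ?b by (rule qsp_V7[OF fr])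
 obtain M where M: "hd_tw H {1..5} rho sg M" using hd_exists by blast
 have four: "(4::'s) ~= 0" "(-4::'s) ~= 0" using two_neq power_not_zero[of "2::'s" 2] by simp_all
 define P where "P f z = (if z \<in> L then \<Sum>i\<in>{1..5}. f i * bb z i else 0)" for f z
 have PV: "P f \<in> V7" if f: "f \<in> tw H {1..5} rho sg" for f
 proof -
 have "P f \<in> LF" by (auto simp: LF_def P_def bb_def B_add B_zm algebra_simps sum.distrib sum_distrib_left)
 thus ?thesis using equivariant_sum[OF f] g_in by (auto simp: V7_def P_def)
 qed
 have Pb: "?b (P f) q = (\<Sum>i\<in>{1..5}. f i * q (u i))" if q: "q \<in> LF" for f q
 proof -
 have "?b (P f) q = (\<Sum>j\<le>6. \<Sum>i\<in>{1..5}. f i * (of_int (eta j) * bb (l j) i * q (l j)))"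
 unfolding b7_def P_def using l_in by (intro sum.cong) (auto simp: sum_distrib_left sum_distrib_right mult_ac)
 also have "\<dots> = (\<Sum>i\<in>{1..5}. f i * (\<Sum>j\<le>6. of_int (eta j) * bb (l j) i * q (l j)))"
 unfolding sum_distrib_left by (rule sum.swap)
 also have "\<dots> = (\<Sum>i\<in>{1..5}. f i * q (u i))"
 proof -
 have "(\<Sum>j\<le>6. of_int (eta j) * bb (l j) i * q (l j)) = q (u i)" for i
 unfolding LF_expand[OF fr q u_in] bb_def using l_in by (intro sum.cong) (auto simp: B_sym[of "u i"])
 thus ?thesis by simp
 qed
 finally show ?thesis .
 qed
 have uu: "bb (u i) j = (if i = j then - 4 else 0)" if "i \<in> {1..5}" "j \<in> {1..5}" for i j
 using B_uu[OF that] by (simp add: bb_def)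
 have PP: "?b (P f) (P f') = - 4 * bil {1..5} f f'" if "f' \<in> tw H {1..5} rho sg" for f f'
 proof -
 have "P f' (u i) = - 4 * f' i" if i: "i \<in> {1..5}" for i
 proof -
 have "P f' (u i) = (\<Sum>j\<in>{1..5}. if i = j then - 4 * f' i else 0)"
 unfolding P_def using i by (simp only: u_in if_True) (intro sum.cong HOL.refl, simp add: uu)
 thus ?thesis using i by simp
 qed
 hence "?b (P f) (P f') = (\<Sum>i\<in>{1..5}. f i * (- 4 * f' i))"
 using PV[OF that] by (subst Pb) (auto simp: V7_def intro!: sum.cong)
 thus ?thesis by (simp add: wbil_def sum_distrib_left mult_ac)
 qed
 obtain C where C: "orth V7 ?b C" "card C = card {1..5::nat}" "norms ?b C = image_mset ((*) (-4)) M" "C <= P ` tw H {1..5} rho sg"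
 by (rule hd_image[where \<Phi> = P and V = V7 and \<beta> = ?b, OF M four(2) PV PP])
 have hL: "h \<in> L" "h + l 6 \<in> L" using l6_in by auto
 have fnV: "fn x \<in> V7" if "x \<in> L" "!!\<mu>. \<mu> \<in> H ==> g \<mu> x = x" for x
 proof -
 have "B x (g \<mu> z) = B x z" if "\<mu> \<in> H" "z \<in> L" for \<mu> z using g_B[OF that(1) \<open>x \<in> L\<close> that(2)] \<open>!!\<mu>. \<mu> \<in> H ==> g \<mu> x = x\<close> that(1) by simp
 thus ?thesis using fn_LF[OF that(1)] g_in by (auto simp: V7_def fn_def hom_of_int)
 qed
 have V: "fn (l 6) \<in> V7" "fn (h + l 6) \<in> V7"
 by (rule fnV; use l6_in hL g_l6 g_h g_add in simp)+
 have LFV: "x \<in> LF" if "x \<in> V7" for x using that by (simp add: V7_def)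
 have Bv: "B (l 6) (l 6) = -1" "B h (l 6) = 1" "B h h = 3" "B (l 6) h = 1"
 using B_sym[OF l6_in hL(1)] B_h_vec[of hcoord] by (simp_all add: B_l B_h_l eta_def hcoord_def h_vec[symmetric] sum7)
 \<comment> \<open>Adding \<open>l 6\<close> makes \<open>h + l 6\<close> orthogonal to
   \<open>l 6\<close>: the products of \<open>h\<close> and \<open>l 6\<close> are 3, 1 and -1. The
   resulting norm 4 is a square, so this pair cancels against <1, -1>.\<close>
 have n: "?b (fn (l 6)) (fn (l 6)) = -1" "?b (fn (h + l 6)) (fn (h + l 6)) = 4" "?b (fn (l 6)) (fn (h + l 6)) = 0" "?b (fn (h + l 6)) (fn (l 6)) = 0"
 using hL l6_in Bv by (simp_all add: b7_fn[OF fr] fn_LF) (simp_all add: fn_def B_add B_addR)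
 have n0: "?b (fn x) (P f) = 0 & ?b (P f) (fn x) = 0"
 if "x = l 6 | x = h + l 6" and f: "f \<in> tw H {1..5} rho sg" for x f
 proof -
 have x: "x \<in> L" using that(1) hL l6_in by auto
 have "B x (u i) = 0" if i: "i \<in> {1..5}" for i
 using \<open>x = l 6 | x = h + l 6\<close> B_u_l6[of i] B_h_u[OF i] B_sym[OF u_in l6_in, of i] hL l6_in by (auto simp: B_add)
 hence "?b (P f) (fn x) = 0" using Pb[OF fn_LF[OF x]] by (simp add: fn_def)
 thus ?thesis by (simp add: b7_sym)
 qed
 have D: "orth V7 ?b {fn (l 6), fn (h + l 6)}" "card {fn (l 6), fn (h + l 6)} = 2" "norms ?b {fn (l 6), fn (h + l 6)} = {#-1, 4#}"
 proof -
 have 1: "orth V7 ?b {fn (h + l 6)}" "norms ?b {fn (h + l 6)} = {#4#}" using V n four by (auto simp: orth_def norms_def)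
 show "orth V7 ?b {fn (l 6), fn (h + l 6)}" "card {fn (l 6), fn (h + l 6)} = 2" "norms ?b {fn (l 6), fn (h + l 6)} = {#-1, 4#}"
 using orth_insert[OF 1(1) V(1)] n 1(2) by auto
 qed
 have z: "?b F G = 0 & ?b G F = 0" if FG: "F \<in> {fn (l 6), fn (h + l 6)}" "G \<in> C" for F G
 proof -
 obtain f where "f \<in> tw H {1..5} rho sg" "G = P f" using FG C(4) by blast
 thus ?thesis using n0 FG(1) by blast
 qed
 note U = orth_Un[OF D(1) C(1) z]
 have "card ({fn (l 6), fn (h + l 6)} \<union> C) = 2 + card {1..5::nat}"
 using card_Un_disjoint[OF _ orth_finite[OF C(1)] U(2)] C(2) D(2) by simp
 also have "\<dots> = 7" by simp
 finally have c7: "card ({fn (l 6), fn (h + l 6)} \<union> C) = 7" .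
 have oU: "obas V7 ?b ({fn (l 6), fn (h + l 6)} \<union> C)" by (rule V7_orth_obas[OF fr U(1) c7])
 obtain E where E: "orth V7 ?b E" "card E = 7" "norms ?b E = {#1, -1#} + image_mset (%i. - 2 * a i) (mset_set {1..5})"
 using a fr by (auto simp: hyp7_def)
 let ?A = "image_mset (%i. - 2 * a i) (mset_set {1..5})"
 have nU: "norms ?b ({fn (l 6), fn (h + l 6)} \<union> C) = {#-1, 4#} + image_mset ((*) (-4)) M"
 using U(3) by (simp only: C(3) D(3))
 have "deq ?K ({#1, -1#} + ?A) ({#-1, 4#} + image_mset ((*) (-4)) M)"
 using v.obas_unique(1)[OF V7_orth_obas[OF fr E(1,2)] oU] unfolding E(3) nU .
 also have "deq ?K \<dots> ({#1, -1#} + image_mset ((*) (-4)) M)"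
 proof (rule deq_add)
 have "deq ?K {#4, -1#} {#1, -1#}" by (rule fx.deq_sym, rule deq_square[where x = 2]) (use two_neq in auto)
 thus "deq ?K {#-1, 4#} {#1, -1#}" by (simp add: add_mset_commute)
 qed
 finally have "deq ?K ?A (image_mset ((*) (-4)) M)"
 by (rule fx.deq_cancel) (use aK two_neq in auto)
 \<comment> \<open>Scaling by -1/4 isolates \<open>M\<close> and turns \<open>- 2 * a i\<close> into
   \<open>a i / 2\<close>.\<close>
 hence "deq ?K (image_mset ((*) (- (1/4))) ?A) (image_mset ((*) (- (1/4))) (image_mset ((*) (-4)) M))"
 using four by (intro fx.deq_scale) (auto intro!: fx.neg fx.divide)
 moreover have "image_mset ((*) (- (1/4))) (image_mset ((*) (-4)) M) = M"
 using four by (simp add: multiset.map_comp o_def)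
 moreover have "image_mset ((*) (- (1/4))) ?A = image_mset (%i. a i / 2) (mset_set {1..5})"
 proof -
 have "- (1/4) * (- 2 * x) = x / 2" for x :: 's
 proof -
 have "- (1/4) * (- 2 * x) = (2 * x) / (2 * 2)" by simp
 also have "\<dots> = x / 2" using two_neq by (subst mult_divide_mult_cancel_left) auto
 finally show ?thesis .
 qed
 thus ?thesis by (simp only: multiset.map_comp o_def)
 qed
 ultimately have "deq ?K M (image_mset (%i. a i / 2) (mset_set {1..5}))" by (simp add: fx.deq_sym)
 thus ?thesis by (rule hd_transport[OF M])
qed

text \<open>The constants of \<open>hd_lines\<close> reduce modulo squares: 32 to 2 and 16 to 1,
  while 8 and 16 times \<open>a i / 2\<close> become \<open>a i\<close> and \<open>2 * a i\<close>.
  The fixed line and the constant function on the sixteen supply <1, 1>;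
  \<open>signed_identity\<close> adds the other four ones and <2>.\<close>

theorem deq_target_blocks:
 assumes fb: "five_blocks H S rho sg" and a: "hyp7 a" and N: "hd_tw H lines g (%_ _. 1) N"
 shows "deq (fixf H) N (target a)"
proof -
 let ?K = "fixf H"
 interpret f: five_blocks H S rho sg by (rule fb)
 let ?A = "image_mset a (mset_set {1..5})" and ?A2 = "image_mset (%i. a i / 2) (mset_set {1..5})"
 have aK: "a i \<in> ?K" "a i ~= 0" if "i \<in> {1..5}" for i using a that by (auto simp: hyp7_def)
 have four: "(4::'s) ~= 0" using two_neq power_not_zero[of "2::'s" 2] by simp
 obtain S1 where S1: "hd_tw H {1..5} rho (%_ _. 1) S1" using sact.hd_exists[OF sact_one] by blast
 obtain S3 where S3: "hd_tw H pairs5 \<rho>2 \<sigma>2 S3" using sact.hd_exists[OF sact_pairs(1)] by blast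
 note S2 = hd_five[OF a]
 let ?W = "image_mset (%p. a (fst p) / 2 * (a (snd p) / 2)) (mset_set pairs5)"
 have W: "hd_tw H pairs5 \<rho>2 (%\<mu> x. \<sigma>2 \<mu> x * ori \<mu> x) ?W"
 using hd_wedge[OF S2] aK two_neq by simp
 note u1 = sact.hd_units[OF sact_one S1] and u2 = hd_units[OF S2] and u3 = sact.hd_units[OF sact_pairs(1) S3]
 have "deq ?K N ({#1#} + ((image_mset ((*) 32) S1 + image_mset ((*) 8) ?A2) +
 ({#16#} + (image_mset ((*) 16) ?A2 + image_mset ((*) 16) S3))))"
 by (rule sact.hd_deq[OF sact_lines[OF fr] N hd_lines[OF S1 S2 S3]])
 also have "deq ?K \<dots> ({#1#} + ((image_mset ((*) 2) S1 + ?A) + ({#1#} + (image_mset (%i. 2 * a i) (mset_set {1..5}) + S3))))"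
 proof (intro deq_add2 deq_refl)
 have t: "(4::'s)^2 = 16" "(2::'s)^2 = 4" by simp_all
 have "deq ?K (image_mset ((*) 16) (image_mset ((*) 2) S1)) (image_mset ((*) 2) S1)"
 using u1 two_neq four by (intro fx.deq_square_scale[where r = 4]) auto
 thus "deq ?K (image_mset ((*) 32) S1) (image_mset ((*) 2) S1)"
 by (simp add: multiset.map_comp o_def mult.assoc[symmetric])
 show "deq ?K (image_mset ((*) 16) S3) S3" using u3 four by (intro fx.deq_square_scale[where r = 4]) auto
 show "deq ?K {#16#} {#1#}" by (rule fx.deq_sym, rule deq_square[where x = 4]) (use four in auto)
 have e: "8 * (x / 2) = 4 * x" "16 * (x / 2) = 4 * (2 * x)" for x :: 's
 proof -
 have n: "(8::'s) = 4 * 2" "(16::'s) = 4 * (2 * 2)" by simp_all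
 have "2 * (x / 2) = x" using two_neq by simp
 thus "8 * (x / 2) = 4 * x" "16 * (x / 2) = 4 * (2 * x)" by (simp_all only: n mult.assoc)
 qed
 have "deq ?K (image_mset (%i. 4 * a i) (mset_set {1..5})) ?A"
 using aK two_neq by (intro fx.deq_image_square) (auto intro!: bexI[of _ 2])
 thus "deq ?K (image_mset ((*) 8) ?A2) ?A" by (simp only: multiset.map_comp o_def e)
 have "deq ?K (image_mset (%i. 4 * (2 * a i)) (mset_set {1..5})) (image_mset (%i. 2 * a i) (mset_set {1..5}))"
 using aK two_neq by (intro fx.deq_image_square) (auto intro!: bexI[of _ 2])
 thus "deq ?K (image_mset ((*) 16) ?A2) (image_mset (%i. 2 * a i) (mset_set {1..5}))"
 by (simp only: multiset.map_comp o_def e)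
 qed
 also have "{#1#} + ((image_mset ((*) 2) S1 + ?A) + ({#1#} + (image_mset (%i. 2 * a i) (mset_set {1..5}) + S3))) =
 (image_mset ((*) 2) S1 + S3) + ({#1, 1#} + ?A + image_mset (%i. 2 * a i) (mset_set {1..5}))" by simp
 also have "deq ?K \<dots> ((?W + {#1, 1, 1, 1, 2#}) + ({#1, 1#} + ?A + image_mset (%i. 2 * a i) (mset_set {1..5})))"
 by (intro deq_add2 deq_refl f.signed_identity[OF S1 S3 W])
 also have "deq ?K \<dots> ((image_mset (%p. a (fst p) * a (snd p)) (mset_set pairs5) + {#1, 1, 1, 1, 2#}) + ({#1, 1#} + ?A + image_mset (%i. 2 * a i) (mset_set {1..5})))"
 proof (intro deq_add2 deq_refl fx.deq_image_square conjI)
 fix p assume "p \<in># mset_set pairs5"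
 hence p: "fst p \<in> {1..5}" "snd p \<in> {1..5}" using card_pairs5(1) by (auto simp: pairs5_def)
 show "a (fst p) * a (snd p) \<in> ?K" "a (fst p) * a (snd p) ~= 0" using aK[OF p(1)] aK[OF p(2)] by auto
 show "\<exists>r\<in>?K. r ~= 0 & a (fst p) / 2 * (a (snd p) / 2) = a (fst p) * a (snd p) * r^2"
 using two_neq by (intro bexI[of _ "1 / 2"]) (auto simp: power2_eq_square intro!: fx.divide)
 qed
 also have "(image_mset (%p. a (fst p) * a (snd p)) (mset_set pairs5) + {#1, 1, 1, 1, 2#}) + ({#1, 1#} + ?A + image_mset (%i. 2 * a i) (mset_set {1..5})) = target a"
 by (simp add: target_def)
 finally show ?thesis .
qed

end

section \<open>Descent to the block situation\<close>

definition synthemes :: "nat set set set" where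
 "synthemes = {{{1,2},{3,4}}, {{1,3},{2,4}}, {{1,4},{2,3}}}"

lemma card_synthemes: "card synthemes = 3" "finite synthemes"
 by (simp_all add: synthemes_def doubleton_eq_iff)

lemma synthemes_perm:
 assumes "P \<in> synthemes"
 obtains \<tau> where "\<tau> permutes {1,2,3,4::nat}" "P = {{\<tau> 1, \<tau> 2}, {\<tau> 3, \<tau> 4}}"
proof -
 have "id permutes {1,2,3,4::nat}" by (rule permutes_id)
 moreover have "Transposition.transpose 2 3 permutes {1,2,3,4::nat}" by (rule permutes_swap_id) auto
 moreover have "Transposition.transpose 2 4 permutes {1,2,3,4::nat}" by (rule permutes_swap_id) auto
 moreover have "{{1,2},{3,4}} = {{id 1, id 2}, {id 3, id (4::nat)}}" by simp
 moreover have "{{1,3},{2,4}} = {{Transposition.transpose 2 3 1, Transposition.transpose 2 3 2},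
 {Transposition.transpose 2 3 3, Transposition.transpose 2 3 (4::nat)}}"
 by (simp add: Transposition.transpose_def)
 moreover have "{{1,4},{2,3}} = {{Transposition.transpose 2 4 1, Transposition.transpose 2 4 2},
 {Transposition.transpose 2 4 3, Transposition.transpose 2 4 (4::nat)}}"
 by (simp add: Transposition.transpose_def insert_commute)
 ultimately show ?thesis using assms that unfolding synthemes_def by blast
qed

lemma synthemes_I:
 assumes "bij_betw r {1,2,3,4} {1,2,3,4::nat}"
 shows "{{r (1::nat), r 2}, {r 3, r 4}} \<in> synthemes"
proof -
 have im: "r ` {1,2,3,4} = {1,2,3,4}" and inj: "inj_on r {1,2,3,4}" using assms by (auto simp: bij_betw_def)
 have "{r 3, r 4} = r ` ({1,2,3,4} - {1,2})" by (simp add: insert_Diff_if)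
 also have "\<dots> = r ` {1,2,3,4} - r ` {1, 2}" by (rule inj_on_image_set_diff[OF inj]) auto
 also have "\<dots> = {1,2,3,4} - {r 1, r 2}" unfolding im by simp
 finally have e: "{r 3, r 4} = {1,2,3,4} - {r 1, r 2}" .
 have "r 1 \<in> {1,2,3,4}" "r 2 \<in> {1,2,3,4}" using im by blast+
 moreover have "r 1 ~= r 2" using inj by (auto simp: inj_on_def)
 ultimately show ?thesis
 unfolding synthemes_def insert_iff empty_iff e by (elim disjE) (simp_all add: insert_commute insert_Diff_if)
qed

context lat_line begin

text \<open>Renumbering the first five exceptional curves conjugates \<open>rho\<close>. In this way
  any partition is brought to {1, 2} | {3, 4}, and any fixed index to 5.\<close>

lemma perm_line:
 assumes t: "\<tau> permutes {1..5}"
 shows "lat_line L zm B h H S g (l \<circ> \<tau>)"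
 and "\<mu> \<in> H ==> i \<in> {1..5} ==> \<tau> (lat_line.rho zm g (l \<circ> \<tau>) \<mu> i) = rho \<mu> (\<tau> i)"
proof -
 have "\<tau> permutes {1..6}" by (rule permutes_subset[OF t]) auto
 hence f: "frame (l \<circ> \<tau>)" by (rule frame_perm)
 have t6: "\<tau> 6 = 6" "\<tau> 0 = 0" by (rule permutes_not_in[OF t]; simp)+
 show 1: "lat_line L zm B h H S g (l \<circ> \<tau>)"
 by unfold_locales (use f g_l6 t6 in simp_all)
 interpret n: lat_line L zm B h H S g "l \<circ> \<tau>" by (rule 1)
 have p: "\<tau> permutes {..6}" by (rule permutes_subset[OF t]) auto
 have inj: "\<tau> i = \<tau> j \<longleftrightarrow> i = j" for i j using permutes_inj[OF t] by (auto dest: injD)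
 have t0: "\<tau> i = 0 \<longleftrightarrow> i = 0" "\<tau> i = 6 \<longleftrightarrow> i = 6" for i using inj[of i 0] inj[of i 6] t6 by simp_all
 have uc: "ucoord (\<tau> i) (\<tau> j) = ucoord i j" for i j
 by (simp add: ucoord_def t0 inj)
 have nu: "n.u i = u (\<tau> i)" for i
 proof -
 have "n.u i = (\<Sum>j\<le>6. zm (ucoord (\<tau> i) (\<tau> j)) (l (\<tau> j)))" by (simp add: n.u_def vec_def uc)
 also have "\<dots> = u (\<tau> i)" unfolding u_def vec_def
 using sum.permute[OF p, of "%j. zm (ucoord (\<tau> i) j) (l j)"] by (simp add: o_def)
 finally show ?thesis .
 qed
 show "\<tau> (n.rho \<mu> i) = rho \<mu> (\<tau> i)" if g: "\<mu> \<in> H" and i: "i \<in> {1..5}"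
 proof -
 have "g \<mu> (u (\<tau> i)) = zm (n.tau \<mu> i) (u (\<tau> (n.rho \<mu> i)))" using n.g_u(3)[OF g i] by (simp add: nu)
 moreover have "\<tau> i \<in> {1..5}" "\<tau> (n.rho \<mu> i) \<in> {1..5}"
 using permutes_in_image[OF t] i n.g_u(1)[OF g i] by blast+
 ultimately show ?thesis using rho_eqI[OF g] n.g_u(2)[OF g i] by metis
 qed
qed

lemma rho_bij4: assumes "\<mu> \<in> H" "rho \<mu> 5 = 5" shows "bij_betw (rho \<mu>) {1,2,3,4} {1,2,3,4}"
proof -
 have b: "bij_betw (rho \<mu>) {1..5} {1..5}" by (rule \<rho>_bij[OF assms(1)])
 have e: "{1..5} - {5} = {1,2,3,4::nat}" by auto
 have "bij_betw (rho \<mu>) ({1..5} - {5}) ({1..5} - {rho \<mu> 5})"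
 by (rule bij_betw_DiffI[OF b]) (simp_all add: assms(2))
 thus ?thesis by (simp only: assms(2) e)
qed

lemma deq_target_blocks_perm:
 assumes t: "\<tau> permutes {1,2,3,4}" and r5: "!!\<mu>. \<mu> \<in> H ==> rho \<mu> 5 = 5"
 and bl: "!!\<mu>. \<mu> \<in> H ==> {rho \<mu> (\<tau> 1), rho \<mu> (\<tau> 2)} \<in> {{\<tau> 1, \<tau> 2}, {\<tau> 3, \<tau> 4}}"
 and a: "hyp7 a" and N: "hd_tw H lines g (%_ _. 1) N"
 shows "deq (fixf H) N (target a)"
proof -
 have t': "\<tau> permutes {1..5}" by (rule permutes_subset[OF t]) auto
 interpret n: lat_line L zm B h H S g "l \<circ> \<tau>" by (rule perm_line[OF t'])
 have inj: "\<tau> i = \<tau> j \<longleftrightarrow> i = j" for i j using permutes_inj[OF t] by (auto dest: injD)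
 have t5: "\<tau> 5 = 5" by (rule permutes_not_in[OF t]) simp
 have "five_blocks H S n.rho n.sg"
 proof (intro five_blocks.intro n.five_axioms five_blocks_axioms.intro)
 fix \<mu> assume g: "\<mu> \<in> H"
 note r = perm_line(2)[OF t' g]
 show n5: "n.rho \<mu> 5 = 5" using r[of 5] r5[OF g] inj[of _ 5] by (simp add: t5)
 have i4: "i \<in> {1..5}" if "i \<in> {1,2,3,4::nat}" for i using that by auto
 have "\<tau> ` {n.rho \<mu> 1, n.rho \<mu> 2} \<in> {\<tau> ` {1, 2}, \<tau> ` {3, 4}}" using bl[OF g] r[of 1] r[of 2] by simp
 hence "{n.rho \<mu> 1, n.rho \<mu> 2} \<in> {{1, 2}, {3, 4}}"
 using permutes_inj[OF t] by (auto simp only: inj_image_eq_iff insert_iff empty_iff)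
 moreover have b: "bij_betw (n.rho \<mu>) {1,2,3,4} {1,2,3,4}" by (rule n.rho_bij4[OF g n5])
 hence "n.rho \<mu> 3 \<in> {1,2,3,4}" "n.rho \<mu> 4 \<in> {1,2,3,4}"
 "n.rho \<mu> 1 ~= n.rho \<mu> 3" "n.rho \<mu> 1 ~= n.rho \<mu> 4" "n.rho \<mu> 2 ~= n.rho \<mu> 3" "n.rho \<mu> 2 ~= n.rho \<mu> 4" "n.rho \<mu> 3 ~= n.rho \<mu> 4"
 by (auto simp: bij_betw_def)
 ultimately show "(n.rho \<mu> 1 = 1 & n.rho \<mu> 2 = 2 & n.rho \<mu> 3 = 3 & n.rho \<mu> 4 = 4) |
 (n.rho \<mu> 1 = 2 & n.rho \<mu> 2 = 1 & n.rho \<mu> 3 = 3 & n.rho \<mu> 4 = 4) |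
 (n.rho \<mu> 1 = 1 & n.rho \<mu> 2 = 2 & n.rho \<mu> 3 = 4 & n.rho \<mu> 4 = 3) |
 (n.rho \<mu> 1 = 2 & n.rho \<mu> 2 = 1 & n.rho \<mu> 3 = 4 & n.rho \<mu> 4 = 3) |
 (n.rho \<mu> 1 = 3 & n.rho \<mu> 2 = 4 & n.rho \<mu> 3 = 1 & n.rho \<mu> 4 = 2) |
 (n.rho \<mu> 1 = 4 & n.rho \<mu> 2 = 3 & n.rho \<mu> 3 = 1 & n.rho \<mu> 4 = 2) |
 (n.rho \<mu> 1 = 3 & n.rho \<mu> 2 = 4 & n.rho \<mu> 3 = 2 & n.rho \<mu> 4 = 1) |
 (n.rho \<mu> 1 = 4 & n.rho \<mu> 2 = 3 & n.rho \<mu> 3 = 2 & n.rho \<mu> 4 = 1)"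
 unfolding insert_iff empty_iff doubleton_eq_iff by (elim disjE conjE) simp_all
 qed
 thus ?thesis by (rule n.deq_target_blocks[OF _ a N])
qed

lemma hyp7_target: "hyp7 a ==> set_mset (target a) <= fixf H - {0}"
proof -
 assume "hyp7 a"
 hence "a i \<in> fixf H" "a i ~= 0" if "i \<in> {1..5}" for i using that by (auto simp: hyp7_def)
 thus ?thesis using two_neq card_pairs5(1) by (auto simp: target_def pairs5_def)
qed

lemma sub_line:
 assumes "H' <= H" "aut_group H'"
 shows "lat_line L zm B h H' S g l"
proof -
 interpret s: lat_act L zm B h H' S g using lat_act_sub(1)[OF lat_act_axioms assms] .
 show ?thesis by unfold_locales (use assms(1) g_l6 in auto)
qed

lemma rho_id: "i \<in> {1..5} ==> rho id i = i"
 using triv[OF id_in] by simp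

text \<open>As 5 is fixed, the other four indices are permuted, and with them their three partitions
  into pairs, an odd number.\<close>

lemma deq_target_fix5:
 assumes r5: "!!\<mu>. \<mu> \<in> H ==> rho \<mu> 5 = 5" and a: "hyp7 a" and N: "hd_tw H lines g (%_ _. 1) N"
 shows "deq (fixf H) N (target a)"
proof -
 define \<pi> where "\<pi> \<mu> P = (%A. rho \<mu> ` A) ` P" for \<mu> and P :: "nat set set"
 have el: "i \<in> {1..5}" if "P \<in> synthemes" "A \<in> P" "i \<in> A" for P A i
 using that by (auto simp: synthemes_def)
 have ga: "gact H synthemes \<pi>"
 proof unfold_locales
 fix \<mu> P assume g: "\<mu> \<in> H" and P: "P \<in> synthemes"
 obtain \<tau> where t: "\<tau> permutes {1,2,3,4}" "P = {{\<tau> 1, \<tau> 2}, {\<tau> 3, \<tau> 4}}" by (rule synthemes_perm[OF P])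
 have "bij_betw (rho \<mu> \<circ> \<tau>) {1,2,3,4} {1,2,3,4}"
 by (rule bij_betw_trans[OF permutes_imp_bij[OF t(1)] rho_bij4[OF g r5[OF g]]])
 thus "\<pi> \<mu> P \<in> synthemes" using synthemes_I by (fastforce simp: \<pi>_def t(2))
 next
 fix \<mu> \<delta> P assume g: "\<mu> \<in> H" "\<delta> \<in> H" and P: "P \<in> synthemes"
 have "rho (\<mu> \<circ> \<delta>) ` A = rho \<mu> ` rho \<delta> ` A" if "A \<in> P" for A
 unfolding image_image using el[OF P that] g by (intro image_cong HOL.refl \<rho>_comp) auto
 thus "\<pi> (\<mu> \<circ> \<delta>) P = \<pi> \<mu> (\<pi> \<delta> P)" unfolding \<pi>_def by (auto simp: image_iff)
 next
 fix P assume P: "P \<in> synthemes"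
 have "rho id ` A = A" if "A \<in> P" for A
 proof -
 have "rho id ` A = (%i. i) ` A" using el[OF P that] rho_id by (intro image_cong) auto
 thus ?thesis by simp
 qed
 hence "\<pi> id P = (%A. A) ` P" unfolding \<pi>_def by (intro image_cong) auto
 thus "\<pi> id P = P" by simp
 qed (rule card_synthemes)
 interpret ga: gact H synthemes \<pi> by (rule ga)
 show ?thesis
 proof (rule deq_descend_odd[OF ga])
 show "odd (card synthemes)" by (simp add: card_synthemes)
 show "set_mset N <= fixf H - {0}" by (rule sact.hd_units[OF sact_lines[OF fr] N])
 show "set_mset (target a) <= fixf H - {0}" by (rule hyp7_target[OF a])
 fix P assume P: "P \<in> synthemes"
 let ?H = "{\<mu> \<in> H. \<pi> \<mu> P = P}"
 have ag: "aut_group ?H" by (rule stab_group[OF ga.\<pi>_comp[OF _ _ P] ga.\<pi>_id[OF P]])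
 have sub: "?H <= H" by auto
 interpret s: lat_line L zm B h ?H S g l by (rule sub_line[OF sub ag])
 obtain \<tau> where t: "\<tau> permutes {1,2,3,4}" "P = {{\<tau> 1, \<tau> 2}, {\<tau> 3, \<tau> 4}}" by (rule synthemes_perm[OF P])
 show "deq (fixf ?H) N (target a)"
 proof (rule s.deq_target_blocks_perm[OF t(1)])
 show "s.hyp7 a" by (rule lat_act_sub(2)[OF lat_act_axioms sub ag a])
 show "hd_tw ?H lines g (%_ _. 1) N" by (rule hd_mono[OF N sub])
 fix \<mu> assume g: "\<mu> \<in> ?H"
 thus "rho \<mu> 5 = 5" using r5 by blast
 have "rho \<mu> ` {\<tau> 1, \<tau> 2} \<in> \<pi> \<mu> P" unfolding \<pi>_def t(2) by blast
 thus "{rho \<mu> (\<tau> 1), rho \<mu> (\<tau> 2)} \<in> {{\<tau> 1, \<tau> 2}, {\<tau> 3, \<tau> 4}}" using g t(2) by simp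
 qed
 qed
qed

lemma deq_target_line:
 assumes a: "hyp7 a" and N: "hd_tw H lines g (%_ _. 1) N"
 shows "deq (fixf H) N (target a)"
proof -
 have ga: "gact H {1..5} rho"
 by unfold_locales (use g_u(1) \<rho>_comp rho_id in auto)
 show ?thesis
 proof (rule deq_descend_odd[OF ga])
 show "odd (card {1..5::nat})" by simp
 show "set_mset N <= fixf H - {0}" by (rule sact.hd_units[OF sact_lines[OF fr] N])
 show "set_mset (target a) <= fixf H - {0}" by (rule hyp7_target[OF a])
 fix i :: nat assume i: "i \<in> {1..5}"
 \<comment> \<open>After exchanging \<open>i\<close> and 5 in the frame, the stabiliser of
   \<open>i\<close> fixes the index 5.\<close>
 let ?H = "{\<mu> \<in> H. rho \<mu> i = i}" and ?t = "Transposition.transpose i 5"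
 have ag: "aut_group ?H" by (rule stab_group[OF \<rho>_comp[OF _ _ i] rho_id[OF i]])
 have sub: "?H <= H" by auto
 interpret s: lat_line L zm B h ?H S g l by (rule sub_line[OF sub ag])
 have t: "?t permutes {1..5}" using i by (intro permutes_swap_id) auto
 interpret n: lat_line L zm B h ?H S g "l \<circ> ?t" by (rule s.perm_line(1)[OF t])
 show "deq (fixf ?H) N (target a)"
 proof (rule n.deq_target_fix5)
 show "s.hyp7 a" by (rule lat_act_sub(2)[OF lat_act_axioms sub ag a])
 show "hd_tw ?H lines g (%_ _. 1) N" by (rule hd_mono[OF N sub])
 fix \<mu> assume g: "\<mu> \<in> ?H"
 have "?t (n.rho \<mu> 5) = rho \<mu> (?t 5)" using s.perm_line(2)[OF t g, of 5] by simp
 also have "\<dots> = ?t 5" using g by simp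
 finally show "n.rho \<mu> 5 = 5" by (auto simp: transpose_eq_iff)
 qed
 qed
qed

end

theorem (in lat_act) deq_target:
 assumes fr: "frame l" and a: "hyp7 a" and N: "hd_tw H lines g (%_ _. 1) N"
 shows "deq (fixf H) N (target a)"
proof -
 interpret f: framed L zm B h l by unfold_locales (rule fr)
 have lL: "y \<in> L" if "y \<in> lines" for y using that by (simp add: lines_def)
 have ga: "gact H lines g"
 by unfold_locales (use f.finite_lines g_lines g_comp g_id lL in auto)
 show ?thesis
 proof (rule deq_descend_odd[OF ga])
 show "odd (card lines)" by (simp add: f.card_lines)
 show "set_mset N <= fixf H - {0}" by (rule sact.hd_units[OF sact_lines[OF fr] N])
 have "a i \<in> fixf H" "a i ~= 0" if "i \<in> {1..5}" for i using a that by (auto simp: hyp7_def)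
 thus "set_mset (target a) <= fixf H - {0}" using two_neq card_pairs5(1) by (auto simp: target_def pairs5_def)
 fix y assume y: "y \<in> lines"
 let ?H = "{\<mu> \<in> H. g \<mu> y = y}"
 have ag: "aut_group ?H" by (rule stab_group[where \<pi> = g, OF g_comp[OF _ _ lL[OF y]] g_id[OF lL[OF y]]])
 have sub: "?H <= H" by auto
 interpret s: lat_act L zm B h ?H S g using lat_act_sub(1)[OF lat_act_axioms sub ag] .
 obtain l' where l': "frame l'" "l' 6 = y" using frame_line[OF fr y] by blast
 interpret n: lat_line L zm B h ?H S g l' by unfold_locales (use l' in auto)
 show "deq (fixf ?H) N (target a)"
 by (rule n.deq_target_line[OF lat_act_sub(2)[OF lat_act_axioms sub ag a] hd_mono[OF N sub]])
 qed
qed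

section \<open>The lattice of the root system\<close>

lemma sum6: "(\<Sum>i\<in>{1..6::nat}. f i) = f 1 + f 2 + f 3 + f 4 + f 5 + f 6" for f :: "nat => 'a::comm_monoid_add"
proof -
 have "{1..6::nat} = {1,2,3,4,5,6}" by auto
 thus ?thesis by (simp add: add.assoc)
qed

lemma six_cases: "i \<in> {1..6::nat} ==> i = 1 | i = 2 | i = 3 | i = 4 | i = 5 | i = 6"
 by auto

text \<open>The form of the lattice in the basis consisting of (1, \<omega>), of norm 1/3 - 4/3 =
  -1, and the simple roots, on which it is minus the Cartan matrix.\<close>

definition LB :: "(nat => int) => (nat => int) => int" where
 "LB c d = - c 0 * d 0 - c 0 * d 1 - c 1 * d 0
 - 2 * (c 1 * d 1 + c 2 * d 2 + c 3 * d 3 + c 4 * d 4 + c 5 * d 5 + c 6 * d 6)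
 + (c 1 * d 3 + c 3 * d 1 + c 3 * d 4 + c 4 * d 3 + c 4 * d 5 + c 5 * d 4 + c 5 * d 6 + c 6 * d 5 + c 2 * d 4 + c 4 * d 2)"

text \<open>The lines \<open>\<omega>\<^sub>1\<close>, \<open>\<omega>\<^sub>1 - \<alpha>\<^sub>1\<close>, \<open>\<omega>\<^sub>1 - \<alpha>\<^sub>1 - \<alpha>\<^sub>3\<close>, \dots{} are six disjoint lines; the first row is the class
  of the pullback of a line in the plane.\<close>

definition frame_coord :: "nat => nat => int" where
 "frame_coord j i = [[3,-3,-1,-3,-3,-2,-1], [1,-1,0,-1,-1,-1,-1], [1,-1,0,-1,-1,-1,0], [1,-1,0,-1,-1,0,0],
 [1,-1,0,-1,0,0,0], [1,-1,0,0,0,0,0], [1,0,0,0,0,0,0]] ! j ! i"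

locale e6 =
 fixes R :: "'v::euclidean_space set" and \<alpha> :: "nat => 'v" and e :: "'v => 3"
 assumes rs: "E6_root_system R \<alpha>" and wc: "weight_class R \<alpha> e"
begin

abbreviation Q where "Q \<equiv> root_lattice R"
abbreviation P where "P \<equiv> weight_lattice R"
abbreviation LL where "LL \<equiv> carr (lattice_L R e)"
abbreviation LZ where "LZ \<equiv> scal (lattice_L R e)"
abbreviation LF where "LF \<equiv> form (lattice_L R e)"

lemma \<alpha>R: "i \<in> {1..6} ==> \<alpha> i \<in> R"
 using rs by (auto simp: E6_root_system_def simple_roots_def)

lemma \<alpha>\<alpha>: "i \<in> {1..6} ==> j \<in> {1..6} ==> \<alpha> i \<bullet> \<alpha> j = (if i = j then 2 else if {i, j} \<in> E6_edges then -1 else 0)"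
 using rs \<alpha>R by (auto simp: E6_root_system_def)

lemma RR: "\<beta> \<in> R ==> \<beta> \<bullet> \<beta> = 2"
 using rs by (auto simp: E6_root_system_def)

sublocale Z: module "%m::int. (*\<^sub>R) (of_int m) :: 'v => 'v"
 by unfold_locales (simp_all add: algebra_simps)

definition comb :: "(nat => int) => 'v" where
 "comb c = (\<Sum>i\<in>{1..6}. of_int (c i) *\<^sub>R \<alpha> i)"

lemma comb_simps: "comb c + comb d = comb (%i. c i + d i)" "of_int m *\<^sub>R comb c = comb (%i. m * c i)" "- comb c = comb (%i. - c i)"
 by (simp_all add: comb_def sum.distrib scaleR_left_distrib scaleR_sum_right sum_negf)

lemma Q_eq: "Q = range comb"
proof
 have "R <= range comb"
 proof
 fix \<beta> assume "\<beta> \<in> R"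
 then obtain c :: "nat => nat" where "\<beta> = (\<Sum>i=1..6. of_nat (c i) *\<^sub>R \<alpha> i) | \<beta> = - (\<Sum>i=1..6. of_nat (c i) *\<^sub>R \<alpha> i)"
 using rs unfolding E6_root_system_def simple_roots_def by blast
 hence "\<beta> = comb (%i. int (c i)) | \<beta> = comb (%i. - int (c i))"
 by (simp add: comb_def sum_negf)
 thus "\<beta> \<in> range comb" by blast
 qed
 moreover have "comb (%_. 0) = 0" by (simp add: comb_def)
 hence "0 \<in> range comb" by (metis rangeI)
 hence "Z.subspace (range comb)" unfolding Z.subspace_def by (auto simp: comb_simps)
 ultimately show "Q <= range comb" unfolding root_lattice_def by (rule Z.span_minimal)
 show "range comb <= Q" unfolding root_lattice_def comb_def
 using \<alpha>R by (intro image_subsetI Z.span_sum Z.span_scale Z.span_base) auto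
qed

lemma Q_sub: "Z.subspace Q" unfolding root_lattice_def by (rule Z.subspace_span)

lemma Q_closed: "0 \<in> Q" "x \<in> Q ==> y \<in> Q ==> x + y \<in> Q" "x \<in> Q ==> of_int m *\<^sub>R x \<in> Q" "x \<in> Q ==> - x \<in> Q" "\<beta> \<in> R ==> \<beta> \<in> Q"
 unfolding root_lattice_def by (fact Z.span_zero Z.span_add Z.span_scale Z.span_neg Z.span_base)+

lemma P_closed: "x \<in> P ==> y \<in> P ==> x + y \<in> P" "x \<in> P ==> of_int m *\<^sub>R x \<in> P" "x \<in> P ==> - x \<in> P"
 by (auto simp: weight_lattice_def inner_add_left)

lemma PQ: "x \<in> Q ==> x \<in> P" "x \<in> Q ==> e x = 0" "x \<in> P ==> e x = 0 ==> x \<in> Q"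
 using wc unfolding weight_class_def by blast+

lemma e_add: "x \<in> P ==> y \<in> P ==> e (x + y) = e x + e y"
 using wc by (auto simp: weight_class_def)

lemma e_neg: "x \<in> P ==> e (- x) = - e x"
proof -
 assume x: "x \<in> P"
 have "e (x + - x) = 0" using PQ(2)[OF Q_closed(1)] by simp
 hence "e x + e (- x) = 0" using e_add[OF x P_closed(3)[OF x]] by simp
 thus ?thesis by (simp add: minus_unique)
qed

lemma e_zm: "x \<in> P ==> e (of_int m *\<^sub>R x) = of_int m * e x"
proof -
 assume x: "x \<in> P"
 have n: "e (of_int (int n) *\<^sub>R x) = of_nat n * e x" for n
 proof (induction n)
 case 0 thus ?case using PQ(2)[OF Q_closed(1)] by simp
 next
 case (Suc n)
 have "e (of_int (int (Suc n)) *\<^sub>R x) = e (x + of_int (int n) *\<^sub>R x)" by (simp add: algebra_simps)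
 thus ?case using Suc e_add[OF x P_closed(2)[OF x, of "int n"]] by (simp add: algebra_simps)
 qed
 show ?thesis
 proof (cases m)
 case (nonneg n) thus ?thesis using n[of n] by simp
 next
 case (neg n)
 have "e (of_int m *\<^sub>R x) = e (- (of_int (int (Suc n)) *\<^sub>R x))" unfolding neg by (simp only: of_int_minus scaleR_minus_left)
 thus ?thesis using e_neg[OF P_closed(2)[OF x, of "int (Suc n)"]] n[of "Suc n"] neg by (simp del: of_nat_Suc)
 qed
qed

text \<open>The coefficients are the first row of the inverse Cartan matrix.\<close>

definition \<omega> :: 'v where
 "\<omega> = (1/3) *\<^sub>R (4 *\<^sub>R \<alpha> 1 + 3 *\<^sub>R \<alpha> 2 + 5 *\<^sub>R \<alpha> 3 + 6 *\<^sub>R \<alpha> 4 + 4 *\<^sub>R \<alpha> 5 + 2 *\<^sub>R \<alpha> 6)"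

lemma \<omega>\<alpha>: "j \<in> {1..6} ==> \<omega> \<bullet> \<alpha> j = (if j = 1 then 1 else 0)"
 by (drule six_cases) (elim disjE; simp add: \<omega>_def inner_add_left \<alpha>\<alpha> E6_edges_def doubleton_eq_iff)

lemma \<omega>\<omega>: "\<omega> \<bullet> \<omega> = 4/3"
proof -
 have "\<omega> \<bullet> \<omega> = (1/3) * (4 * (\<omega> \<bullet> \<alpha> 1) + 3 * (\<omega> \<bullet> \<alpha> 2) + 5 * (\<omega> \<bullet> \<alpha> 3) + 6 * (\<omega> \<bullet> \<alpha> 4) + 4 * (\<omega> \<bullet> \<alpha> 5) + 2 * (\<omega> \<bullet> \<alpha> 6))"
 by (subst (2) \<omega>_def) (simp add: inner_add_right)
 thus ?thesis by (simp add: \<omega>\<alpha>)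
qed

lemma fund_weight_1: "fund_weight \<alpha> 1 = \<omega>"
 unfolding fund_weight_def
proof (rule the_equality)
 show "\<forall>j\<in>{1..6}. \<omega> \<bullet> \<alpha> j = (if 1 = j then 1 else 0)" using \<omega>\<alpha> by simp
 fix w assume w: "\<forall>j\<in>{1..6}. w \<bullet> \<alpha> j = (if 1 = j then 1 else 0)"
 have "R <= {x. (w - \<omega>) \<bullet> x = 0}"
 proof
 fix \<beta> assume "\<beta> \<in> R"
 then obtain c where c: "\<beta> = comb c" using Q_closed(5) Q_eq by blast
 have "(w - \<omega>) \<bullet> \<alpha> j = 0" if "j \<in> {1..6}" for j using w \<omega>\<alpha> that by (simp add: inner_diff_left)
 thus "\<beta> \<in> {x. (w - \<omega>) \<bullet> x = 0}" by (simp add: c comb_def inner_sum_right)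
 qed
 hence "span R <= {x. (w - \<omega>) \<bullet> x = 0}" by (rule span_minimal) (rule subspace_hyperplane)
 moreover have "span R = UNIV" using rs by (simp add: E6_root_system_def root_system_def)
 ultimately have "(w - \<omega>) \<bullet> (w - \<omega>) = 0" by blast
 thus "w = \<omega>" by simp
qed

lemma \<omega>P: "\<omega> \<in> P" and e\<omega>: "e \<omega> = 1"
proof -
 have "\<omega> \<bullet> comb c = of_int (c 1)" for c
 unfolding comb_def sum6 by (simp add: inner_add_right \<omega>\<alpha>)
 thus "\<omega> \<in> P" by (auto simp: weight_lattice_def Q_eq)
 show "e \<omega> = 1" using wc fund_weight_1 by (simp add: weight_class_def)
qed

definition pt :: "(nat => int) => int \<times> 'v" where
 "pt c = (c 0, of_int (c 0) *\<^sub>R \<omega> + comb c)"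

lemma pt_add: "pt c + pt d = pt (%i. c i + d i)"
 by (simp add: pt_def comb_simps(1)[symmetric] algebra_simps)

lemma pt_zm: "LZ m (pt c) = pt (%i. m * c i)"
 by (simp add: pt_def lattice_L_def comb_simps(2)[symmetric] algebra_simps)

lemma pt_in: "pt c \<in> LL"
proof -
 have c: "comb c \<in> Q" using Q_eq by blast
 show ?thesis using P_closed \<omega>P PQ[of "comb c"] c e_add[of "of_int (c 0) *\<^sub>R \<omega>" "comb c"] e_zm[OF \<omega>P]
 by (simp add: pt_def lattice_L_def e\<omega>)
qed

text \<open>For \<open>(n, p)\<close> in the lattice \<open>p - n \<omega>\<close> has class 0, so
  it lies in the root lattice.\<close>

lemma LL_eq: "LL = range pt"
proof
 show "range pt <= LL" using pt_in by blast
 show "LL <= range pt"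
 proof
 fix y assume y: "y \<in> LL"
 obtain n p where np: "y = (n, p)" by force
 have p: "p \<in> P" "of_int n = e p" using y np by (auto simp: lattice_L_def)
 have w: "- (of_int n *\<^sub>R \<omega>) \<in> P" using P_closed \<omega>P by blast
 have "e (p + - (of_int n *\<^sub>R \<omega>)) = 0"
 using e_add[OF p(1) w] e_neg[OF P_closed(2)[OF \<omega>P]] e_zm[OF \<omega>P] e\<omega> p(2) by simp
 hence "p + - (of_int n *\<^sub>R \<omega>) \<in> Q" using PQ(3) P_closed(1)[OF p(1) w] by blast
 then obtain c where c: "p + - (of_int n *\<^sub>R \<omega>) = comb c" using Q_eq by blast
 have "comb (c(0 := n)) = comb c" unfolding comb_def by (intro sum.cong) auto
 hence "y = pt (c(0 := n))" using c by (simp add: pt_def np algebra_simps)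
 thus "y \<in> range pt" by blast
 qed
qed

lemma LF_pt: "LF (pt c) (pt d) = LB c d"
proof -
 have "(of_int (c 0) *\<^sub>R \<omega> + comb c) \<bullet> (of_int (d 0) *\<^sub>R \<omega> + comb d) =
 of_int (c 0) * of_int (d 0) * (\<omega> \<bullet> \<omega>) + of_int (c 0) * (\<omega> \<bullet> comb d) + of_int (d 0) * (\<omega> \<bullet> comb c) + comb c \<bullet> comb d"
 by (simp add: inner_add_left inner_add_right inner_commute algebra_simps)
 moreover have "\<omega> \<bullet> comb c = of_int (c 1)" for c
 unfolding comb_def sum6 by (simp add: inner_add_right \<omega>\<alpha>)
 moreover have "comb c \<bullet> comb d = of_int (2 * (c 1 * d 1 + c 2 * d 2 + c 3 * d 3 + c 4 * d 4 + c 5 * d 5 + c 6 * d 6)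
 - (c 1 * d 3 + c 3 * d 1 + c 3 * d 4 + c 4 * d 3 + c 4 * d 5 + c 5 * d 4 + c 5 * d 6 + c 6 * d 5 + c 2 * d 4 + c 4 * d 2))"
 unfolding comb_def sum6
 by (simp add: inner_add_right inner_add_left \<alpha>\<alpha> E6_edges_def doubleton_eq_iff) (simp add: algebra_simps)
 ultimately have "of_int (c 0 * d 0) / 3 - (of_int (c 0) *\<^sub>R \<omega> + comb c) \<bullet> (of_int (d 0) *\<^sub>R \<omega> + comb d) = of_int (LB c d)"
 by (simp add: \<omega>\<omega> LB_def field_simps)
 thus ?thesis unfolding pt_def lattice_L_def by (simp del: of_int_mult)
qed

sublocale lattice7 LL LZ LF "(3, 0)"
proof unfold_locales
 have "0 = pt (%_. 0)" by (simp add: pt_def comb_def zero_prod_def)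
 thus "0 \<in> LL" using pt_in by metis
qed (auto simp: LL_eq pt_add pt_zm LF_pt, simp_all add: lattice_L_def split_beta prod_eq_iff algebra_simps, simp_all add: LB_def algebra_simps)

lemma frame_pt: "frame (%j. pt (frame_coord j))"
proof -
 have B: "LB (frame_coord i) (frame_coord j) = (if i = j then eta i else 0)" if "i \<le> 6" "j \<le> 6" for i j
 using le6_cases[OF that(1)] le6_cases[OF that(2)]
 by (elim disjE; simp add: LB_def frame_coord_def eta_def)
 \<comment> \<open>The six root coefficients are -3 times those of \<omega>, so the weight component
   \<open>3 \<omega>\<close> is cancelled.\<close>
 have "vec (%j. pt (frame_coord j)) hcoord = pt ((!) [3,-4,-3,-5,-6,-4,-2])"
 unfolding vec_def sum7 pt_zm pt_add unfolding pt_def comb_def sum6 by (simp add: frame_coord_def hcoord_def)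
 also have "\<dots> = (3, 0)"
 unfolding pt_def comb_def sum6 by (simp add: \<omega>_def algebra_simps)
 finally have h: "(3, 0) = vec (%j. pt (frame_coord j)) hcoord" by simp
 have "x = 0" if x: "x \<in> LL" "\<forall>j\<le>6. LF x (pt (frame_coord j)) = 0" for x
 proof -
 obtain c where c: "x = pt c" using x(1) LL_eq by blast
 have "LB c (frame_coord j) = 0" if "j \<le> 6" for j using x(2) that by (simp add: c LF_pt)
 from this[of 0] this[of 1] this[of 2] this[of 3] this[of 4] this[of 5] this[of 6]
 have "c 0 = 0 & c 1 = 0 & c 2 = 0 & c 3 = 0 & c 4 = 0 & c 5 = 0 & c 6 = 0"
 by (simp add: LB_def frame_coord_def)
 thus ?thesis unfolding c pt_def comb_def sum6 by (simp add: zero_prod_def)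
 qed
 thus ?thesis unfolding frame_def using h by (auto simp: LF_pt B pt_in)
qed

lemma lines_eq: "lines = set_Y R e"
 by (simp add: lines_def set_Y_def)

lemma refl_eq: "\<beta> \<in> R ==> root_reflection \<beta> x = x - (x \<bullet> \<beta>) *\<^sub>R \<beta>"
 by (simp add: root_reflection_def RR)

text \<open>The clause \<open>w p - p \<in> Q\<close> makes the class \<open>e\<close> invariant,
  and thereby the lattice stable. It holds for a reflection because weights have integral products
  with roots.\<close>

lemma weyl:
 assumes "w \<in> weyl_group R"
 shows "w (x + y) = w x + w y" "w (c *\<^sub>R x) = c *\<^sub>R w x" "w x \<bullet> w y = x \<bullet> y" "p \<in> P ==> w p - p \<in> Q" "bij w"
proof -
 have "(\<forall>x y. w (x + y) = w x + w y) & (\<forall>c x. w (c *\<^sub>R x) = c *\<^sub>R w x) & (\<forall>x y. w x \<bullet> w y = x \<bullet> y) & (\<forall>p\<in>P. w p - p \<in> Q) & bij w"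
 using assms
 proof (induction rule: weyl_group.induct)
 case one
 thus ?case using Q_closed bij_id by (simp add: id_def)
 next
 case (refl \<beta> w)
 note r = refl_eq[OF refl.hyps(1)] and b = RR[OF refl.hyps(1)]
 have i: "root_reflection \<beta> (root_reflection \<beta> x) = x" for x by (simp add: r inner_diff_left b)
 have "bij (root_reflection \<beta>)" by (rule o_bij[where g = "root_reflection \<beta>"]) (auto simp: i)
 moreover have "root_reflection \<beta> x \<bullet> root_reflection \<beta> y = x \<bullet> y" for x y
 by (simp add: r inner_diff_left inner_diff_right b inner_commute)
 moreover have "root_reflection \<beta> (x + y) = root_reflection \<beta> x + root_reflection \<beta> y"
 "root_reflection \<beta> (c *\<^sub>R x) = c *\<^sub>R root_reflection \<beta> x" for x y c
 by (simp_all add: r inner_add_left algebra_simps)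
 moreover have "root_reflection \<beta> (w p) - p \<in> Q" if p: "p \<in> P" for p
 proof -
 have wp: "w p - p \<in> Q" using refl.IH p by blast
 hence "w p \<in> P" using P_closed(1)[OF PQ(1)[OF wp] p] by simp
 hence "w p \<bullet> \<beta> \<in> \<int>" using Q_closed(5)[OF refl.hyps(1)] by (simp add: weight_lattice_def)
 then obtain m where m: "w p \<bullet> \<beta> = of_int m" by (auto elim: Ints_cases)
 have "root_reflection \<beta> (w p) - p = (w p - p) + of_int (- m) *\<^sub>R \<beta>" by (simp add: r m)
 thus ?thesis using Q_closed(2)[OF wp Q_closed(3)[OF Q_closed(5)[OF refl.hyps(1)]]] by metis
 qed
 moreover have "bij (root_reflection \<beta> \<circ> w)" by (rule bij_comp) (use refl.IH calculation(1) in blast)+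
 ultimately show ?case using refl.IH by (simp add: o_def)
 qed
 thus "w (x + y) = w x + w y" "w (c *\<^sub>R x) = c *\<^sub>R w x" "w x \<bullet> w y = x \<bullet> y" "p \<in> P ==> w p - p \<in> Q" "bij w" by blast+
qed

lemma act:
 assumes w: "w \<in> weyl_group R"
 shows "x \<in> LL ==> lattice_act w x \<in> LL" "lattice_act w (x + y) = lattice_act w x + lattice_act w y"
 "lattice_act w (LZ m x) = LZ m (lattice_act w x)" "LF (lattice_act w x) (lattice_act w y) = LF x y"
 "lattice_act w (3, 0) = (3, 0)"
proof -
 have "p \<in> P ==> w p \<in> P & e (w p) = e p" for p
 proof -
 assume p: "p \<in> P"
 have q: "w p - p \<in> Q" by (rule weyl(4)[OF w p])
 show ?thesis using e_add[OF PQ(1)[OF q] p] P_closed(1)[OF PQ(1)[OF q] p] PQ(2)[OF q] by simp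
 qed
 thus "x \<in> LL ==> lattice_act w x \<in> LL" by (auto simp: lattice_L_def lattice_act_def)
 show "lattice_act w (x + y) = lattice_act w x + lattice_act w y"
 "lattice_act w (LZ m x) = LZ m (lattice_act w x)" "LF (lattice_act w x) (lattice_act w y) = LF x y"
 by (simp_all add: lattice_act_def lattice_L_def split_beta prod_eq_iff weyl[OF w])
 show "lattice_act w (3, 0) = (3, 0)" using weyl(2)[OF w, of 0 0] by (simp add: lattice_act_def)
qed

end

section \<open>Orthogonal bases of the constructions\<close>

interpretation fs: module "fscale :: 'r::comm_ring_1 => ('b => 'r) => 'b => 'r"
 by unfold_locales (auto simp: fscale_def fun_eq_iff algebra_simps)

text \<open>Tensor products, exterior squares and base changes are spans of evaluations. A finite
  expansion that holds for the generators holds on the span, so the values at the coordinate maps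
  \<xi> determine an element.\<close>

lemma span_functionals:
 fixes G :: "('b => 'r::comm_ring_1) set"
 assumes g: "!!v \<beta>. v \<in> G ==> v \<beta> = (\<Sum>i\<in>I. v (\<xi> i) * w i \<beta>)" and u: "u \<in> fs.span G"
 shows "u \<beta> = (\<Sum>i\<in>I. u (\<xi> i) * w i \<beta>)"
proof -
 let ?S = "{u. \<forall>\<beta>. u \<beta> = (\<Sum>i\<in>I. u (\<xi> i) * w i \<beta>)}"
 have "fs.subspace ?S" unfolding fs.subspace_def
 proof (intro conjI ballI allI)
 fix x y :: "'b => 'r" and c assume x: "x \<in> ?S" and y: "y \<in> ?S"
 have "x \<beta> + y \<beta> = (\<Sum>i\<in>I. (x (\<xi> i) + y (\<xi> i)) * w i \<beta>)" for \<beta>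
 proof -
 have "x \<beta> = (\<Sum>i\<in>I. x (\<xi> i) * w i \<beta>)" by (rule CollectD[OF x, rule_format])
 moreover have "y \<beta> = (\<Sum>i\<in>I. y (\<xi> i) * w i \<beta>)" by (rule CollectD[OF y, rule_format])
 ultimately show ?thesis unfolding distrib_right sum.distrib by metis
 qed
 thus "x + y \<in> ?S" unfolding mem_Collect_eq plus_fun_apply by blast
 next
 fix x :: "'b => 'r" and c assume x: "x \<in> ?S"
 have "c * x \<beta> = (\<Sum>i\<in>I. c * x (\<xi> i) * w i \<beta>)" for \<beta>
 proof -
 have "x \<beta> = (\<Sum>i\<in>I. x (\<xi> i) * w i \<beta>)" by (rule CollectD[OF x, rule_format])
 thus ?thesis unfolding mult.assoc sum_distrib_left[symmetric] by metis
 qed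
 thus "fscale c x \<in> ?S" unfolding mem_Collect_eq fscale_def by blast
 qed simp
 moreover have "G <= ?S" using g by blast
 ultimately have "fs.span G <= ?S" by (intro fs.span_minimal)
 hence "u \<in> ?S" using u by (rule subsetD)
 hence "\<forall>\<beta>. u \<beta> = (\<Sum>i\<in>I. u (\<xi> i) * w i \<beta>)" by (rule CollectD)
 thus ?thesis by (rule spec)
qed

text \<open>An orthogonal basis with an index set and prescribed norms, as needed for bases indexed
  by products and pairs.\<close>

definition ofam :: "'x::zero set => ('x => 'x => 'f::field) => 'i set => ('i => 'x) => ('i => 'f) => bool" where
 "ofam V \<beta> I v n \<longleftrightarrow> finite I & (\<forall>i\<in>I. v i \<in> V & n i ~= 0) &
 (\<forall>i\<in>I. \<forall>j\<in>I. \<beta> (v i) (v j) = (if i = j then n i else 0)) & (\<forall>x\<in>V. (\<forall>i\<in>I. \<beta> x (v i) = 0) --> x = 0)"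

lemma ofamD:
 assumes "ofam V \<beta> I v n"
 shows "finite I" "i \<in> I ==> v i \<in> V" "i \<in> I ==> n i ~= 0"
 "i \<in> I ==> j \<in> I ==> \<beta> (v i) (v j) = (if i = j then n i else 0)" "x \<in> V ==> (!!i. i \<in> I ==> \<beta> x (v i) = 0) ==> x = 0"
 using assms by (auto simp: ofam_def)

lemma ofam_obas: assumes "ofam V \<beta> I v n"
 shows "obas V \<beta> (v ` I)" "norms \<beta> (v ` I) = image_mset n (mset_set I)" "card (v ` I) = card I"
proof -
 note o = ofamD[OF assms]
 note F = orth_family[of I v V \<beta> n, OF o(1,2)]
 have 1: "\<beta> (v i) (v i) = n i & n i ~= 0" if "i \<in> I" for i using o(3,4) that by simp
 have 2: "\<beta> (v i) (v j) = 0" if "i \<in> I" "j \<in> I" "i ~= j" for i j using o(4) that by simp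
 show "obas V \<beta> (v ` I)" using F(1)[OF _ 1 2] o(5) by (auto simp: obas_def)
 show "norms \<beta> (v ` I) = image_mset n (mset_set I)" "card (v ` I) = card I" using F(2,3)[OF _ 1 2] by auto
qed

text \<open>The argument common to tensor product and exterior square: the \<xi> are coordinate maps
  dual to the generators \<open>w\<close>, and the form is diagonal in them.\<close>

lemma functional_ofam:
 fixes N :: "'i => 'k::field"
 assumes two: "(2::'k) ~= 0" and I: "finite I" "!!i. i \<in> I ==> N i ~= 0" "!!i. i \<in> I ==> w i \<in> fs.span G"
 and g: "!!v \<beta>. v \<in> G ==> v \<beta> = (\<Sum>i\<in>I. v (\<xi> i) * w i \<beta>)"
 and d: "!!i j. i \<in> I ==> j \<in> I ==> w i (\<xi> j) = (if i = j then 1 else 0)"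
 and F: "!!u v. u \<in> fs.span G ==> v \<in> fs.span G ==> frm u v = (\<Sum>i\<in>I. u (\<xi> i) * v (\<xi> i) * N i)"
 shows "qsp UNIV (fs.span G) fscale frm" "ofam (fs.span G) frm I w N"
proof -
 show "qsp UNIV (fs.span G) fscale frm"
 proof unfold_locales
 show "u + v \<in> fs.span G" if "u \<in> fs.span G" "v \<in> fs.span G" for u v using that by (rule fs.span_add)
 show "fscale a u \<in> fs.span G" if "u \<in> fs.span G" for a u using that by (rule fs.span_scale)
 show "frm u v = frm v u" if "u \<in> fs.span G" "v \<in> fs.span G" for u v
 unfolding F[OF that] F[OF that(2,1)] by (simp add: mult_ac)
 show "frm (u + v) z = frm u z + frm v z" if "u \<in> fs.span G" "v \<in> fs.span G" "z \<in> fs.span G" for u v z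
 using F[OF fs.span_add[OF that(1,2)] that(3)] F[OF that(1,3)] F[OF that(2,3)] by (simp add: algebra_simps sum.distrib)
 show "frm (fscale a u) z = a * frm u z" if "u \<in> fs.span G" "z \<in> fs.span G" for u z a
 using F[OF fs.span_scale[OF that(1)] that(2)] F[OF that] by (simp add: fscale_def sum_distrib_left mult_ac)
 qed (use two in \<open>simp_all add: fs.span_zero fscale_def fun_eq_iff algebra_simps\<close>)
 have e: "frm u (w j) = u (\<xi> j) * N j" if u: "u \<in> fs.span G" and j: "j \<in> I" for u j
 proof -
 have "frm u (w j) = (\<Sum>i\<in>I. if i = j then u (\<xi> j) * N j else 0)"
 unfolding F[OF u I(3)[OF j]] using d[OF j] by (intro sum.cong) auto
 thus ?thesis using I(1) j by simp
 qed
 show "ofam (fs.span G) frm I w N" unfolding ofam_def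
 proof (intro conjI ballI impI)
 fix u assume u: "u \<in> fs.span G" and z: "\<forall>i\<in>I. frm u (w i) = 0"
 have "u (\<xi> i) = 0" if "i \<in> I" for i using e[OF u that] z I(2)[OF that] that by simp
 show "u = 0"
 proof
 fix \<beta>
 have "u \<beta> = (\<Sum>i\<in>I. u (\<xi> i) * w i \<beta>)" by (rule span_functionals[OF g u])
 also have "\<dots> = 0" using \<open>!!i. i \<in> I ==> u (\<xi> i) = 0\<close> by (intro sum.neutral) simp
 finally show "u \<beta> = 0 \<beta>" by simp
 qed
 qed (use I e d in auto)
qed

text \<open>The index set is nonempty because the carrier is not known here to contain 0, nor
  \<open>f\<close> to vanish there.\<close>

lemma linear_along_sum:
 fixes q :: "('r::comm_ring_1, 'm::ab_group_add) form_module"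
 assumes f: "linear_along \<iota> q f" and I: "finite I" "I ~= {}" and v: "!!i. i \<in> I ==> v i \<in> carr q"
 and cl: "!!x y. x \<in> carr q ==> y \<in> carr q ==> x + y \<in> carr q" "!!c x. x \<in> carr q ==> scal q c x \<in> carr q"
 shows "f (\<Sum>i\<in>I. scal q (c i) (v i)) = (\<Sum>i\<in>I. \<iota> (c i) * f (v i)) & (\<Sum>i\<in>I. scal q (c i) (v i)) \<in> carr q"
 using I v
proof (induction I rule: finite_ne_induct)
 case (singleton i)
 thus ?case using f cl by (simp add: linear_along_def)
next
 case (insert i I)
 thus ?case using f cl by (simp add: linear_along_def)
qed

lemma quadratic_space_qsp:
 fixes q :: "('k::field, 'm::ab_group_add) form_module"
 assumes "quadratic_space q" "(2::'k) ~= 0"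
 shows "qsp UNIV (carr q) (scal q) (form q)"
proof -
 interpret vector_space "scal q" using assms(1) by (simp add: quadratic_space_def)
 have "subspace (carr q)" using assms(1) by (simp add: quadratic_space_def)
 thus ?thesis
 by unfold_locales (use assms in \<open>auto simp: quadratic_space_def subspace_def scale_left_distrib\<close>)
qed

lemma ofam_linear:
 fixes q :: "('k::field, 'm::ab_group_add) form_module"
 assumes "qsp UNIV (carr q) (scal q) (form q)" "ofam (carr q) (form q) I v n" "linear_along id q f" "x \<in> carr q"
 shows "f x = (\<Sum>i\<in>I. form q x (v i) / n i * f (v i))"
proof -
 interpret qsp UNIV "carr q" "scal q" "form q" by fact
 note o = ofamD[OF assms(2)]
 have inj: "inj_on v I" using o(3,4) unfolding inj_on_def by metis
 have "x = (\<Sum>b\<in>v ` I. scal q (form q x b / form q b b) b)"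
 by (rule obas_expand[OF ofam_obas(1)[OF assms(2)] assms(4)])
 also have "\<dots> = (\<Sum>i\<in>I. scal q (form q x (v i) / n i) (v i))"
 using o(4) by (simp add: sum.reindex[OF inj])
 finally have e: "x = (\<Sum>i\<in>I. scal q (form q x (v i) / n i) (v i))" .
 show ?thesis
 proof (cases "I = {}")
 case True
 have "f (0 + 0) = f 0 + f 0" using assms(3) V0 unfolding linear_along_def by blast
 hence "f 0 = f 0 + f 0" by (simp only: add_0_left)
 hence "f 0 = 0" by (simp only: add_cancel_right_right)
 thus ?thesis using e True by simp
 next
 case False
 thus ?thesis using linear_along_sum[where v = v and c = "%i. form q x (v i) / n i", OF assms(3) o(1) False o(2)] e by simp
 qed
qed

lemma bilinear_map_sum:
 assumes q: "qsp UNIV (carr q) (scal q) (form q)" and r: "qsp UNIV (carr r) (scal r) (form r)"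
 and F: "!!x y. x \<in> carr q ==> y \<in> carr r ==> F x y = (\<Sum>p\<in>I. C p * B p x y)"
 and B: "!!p. p \<in> I ==> bilinear_map q r (B p)"
 shows "bilinear_map q r F"
proof -
 interpret q: qsp UNIV "carr q" "scal q" "form q" by (rule q)
 interpret r: qsp UNIV "carr r" "scal r" "form r" by (rule r)
 have 1: "F (x + x') y = F x y + F x' y" if "x \<in> carr q" "x' \<in> carr q" "y \<in> carr r" for x x' y
 proof -
 have "F (x + x') y = (\<Sum>p\<in>I. C p * B p x y + C p * B p x' y)"
 using that B by (subst F) (auto intro!: sum.cong simp: bilinear_map_def linear_along_def algebra_simps)
 thus ?thesis using that by (simp add: F sum.distrib)
 qed
 have 2: "F x (y + y') = F x y + F x y'" if "x \<in> carr q" "y \<in> carr r" "y' \<in> carr r" for x y y'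
 proof -
 have "F x (y + y') = (\<Sum>p\<in>I. C p * B p x y + C p * B p x y')"
 using that B by (subst F) (auto intro!: sum.cong simp: bilinear_map_def linear_along_def algebra_simps)
 thus ?thesis using that by (simp add: F sum.distrib)
 qed
 have 3: "F (scal q c x) y = c * F x y" if "x \<in> carr q" "y \<in> carr r" for c x y
 proof -
 have "F (scal q c x) y = (\<Sum>p\<in>I. c * (C p * B p x y))"
 using that B by (subst F) (auto intro!: sum.cong simp: bilinear_map_def linear_along_def algebra_simps)
 thus ?thesis using that by (simp add: F sum_distrib_left)
 qed
 have 4: "F x (scal r c y) = c * F x y" if "x \<in> carr q" "y \<in> carr r" for c x y
 proof -
 have "F x (scal r c y) = (\<Sum>p\<in>I. c * (C p * B p x y))"
 using that B by (subst F) (auto intro!: sum.cong simp: bilinear_map_def linear_along_def algebra_simps)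
 thus ?thesis using that by (simp add: F sum_distrib_left)
 qed
 show ?thesis unfolding bilinear_map_def linear_along_def using 1 2 3 4 by simp
qed

lemma tensor_ofam:
 fixes q :: "('k::field, 'a::ab_group_add) form_module" and r :: "('k, 'b::ab_group_add) form_module"
 assumes Q: "qsp UNIV (carr q) (scal q) (form q)" "ofam (carr q) (form q) I v n"
 and W: "qsp UNIV (carr r) (scal r) (form r)" "ofam (carr r) (form r) J w m"
 shows "qsp UNIV (carr (q \<otimes>\<^sub>q r)) (scal (q \<otimes>\<^sub>q r)) (form (q \<otimes>\<^sub>q r))"
 and "ofam (carr (q \<otimes>\<^sub>q r)) (form (q \<otimes>\<^sub>q r)) (I \<times> J) (%p. pure_tensor q r (v (fst p)) (w (snd p))) (%p. n (fst p) * m (snd p))"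
proof -
 interpret q: qsp UNIV "carr q" "scal q" "form q" by (rule Q)
 interpret r: qsp UNIV "carr r" "scal r" "form r" by (rule W)
 note o = ofamD[OF Q(2)] and o' = ofamD[OF W(2)]
 let ?G = "{pure_tensor q r x y | x y. x \<in> carr q & y \<in> carr r}"
 let ?\<xi> = "%p x y. form q x (v (fst p)) / n (fst p) * (form r y (w (snd p)) / m (snd p))"
 let ?w = "%p. pure_tensor q r (v (fst p)) (w (snd p))"
 have b: "bilinear_map q r (?\<xi> p)" if "p \<in> I \<times> J" for p
 using that o(2) o'(2) by (auto simp: bilinear_map_def linear_along_def algebra_simps add_divide_distrib)
 have wG: "?w p \<in> ?G" if "p \<in> I \<times> J" for p
 proof -
 have "v (fst p) \<in> carr q" "w (snd p) \<in> carr r" using that o(2) o'(2) by auto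
 thus ?thesis by blast
 qed
 have g: "u \<beta> = (\<Sum>p\<in>I \<times> J. u (?\<xi> p) * ?w p \<beta>)" if u: "u \<in> ?G" for u \<beta>
 proof -
 obtain x y where xy: "u = pure_tensor q r x y" "x \<in> carr q" "y \<in> carr r" using u by blast
 have e: "u (?\<xi> p) = ?\<xi> p x y" if "p \<in> I \<times> J" for p using b[OF that] by (simp add: xy pure_tensor_def)
 show ?thesis
 proof (cases "bilinear_map q r \<beta>")
 case True
 have l: "linear_along id q (%x. \<beta> x y)" "!!x. x \<in> carr q ==> linear_along id r (\<beta> x)"
 using True xy by (auto simp: bilinear_map_def)
 have "\<beta> x y = (\<Sum>i\<in>I. form q x (v i) / n i * \<beta> (v i) y)" by (rule ofam_linear[OF Q l(1) xy(2)])
 also have "\<dots> = (\<Sum>i\<in>I. form q x (v i) / n i * (\<Sum>j\<in>J. form r y (w j) / m j * \<beta> (v i) (w j)))"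
 using ofam_linear[OF W l(2)[OF o(2)] xy(3)] by (intro sum.cong) auto
 also have "\<dots> = (\<Sum>p\<in>I \<times> J. ?\<xi> p x y * \<beta> (v (fst p)) (w (snd p)))"
 by (simp add: sum_distrib_left sum.cartesian_product split_beta mult.assoc)
 finally show ?thesis using True e by (simp add: xy pure_tensor_def)
 qed (simp add: xy pure_tensor_def)
 qed
 have d: "?w p (?\<xi> p') = (if p = p' then 1 else 0)" if "p \<in> I \<times> J" "p' \<in> I \<times> J" for p p'
 proof -
 have pi: "fst p \<in> I" "snd p \<in> J" "fst p' \<in> I" "snd p' \<in> J" using that by auto
 show ?thesis using b[OF that(2)] o(3)[OF pi(3)] o'(3)[OF pi(4)]
 by (simp add: pure_tensor_def o(4)[OF pi(1,3)] o'(4)[OF pi(2,4)] prod_eq_iff)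
 qed
 have F: "form (q \<otimes>\<^sub>q r) u u' = (\<Sum>p\<in>I \<times> J. u (?\<xi> p) * u' (?\<xi> p) * (n (fst p) * m (snd p)))"
 if u: "u \<in> fs.span ?G" "u' \<in> fs.span ?G" for u u'
 proof -
 let ?K = "%x y x' y'. form q x x' * form r y y'"
 have b1: "bilinear_map q r (?K x y)" if "x \<in> carr q" "y \<in> carr r" for x y
 using that by (auto simp: bilinear_map_def linear_along_def algebra_simps)
 have K: "u' (?K x y) = (\<Sum>p\<in>I \<times> J. u' (?\<xi> p) * (form q x (v (fst p)) * form r y (w (snd p))))" if "x \<in> carr q" "y \<in> carr r" for x y
 using span_functionals[where G = ?G and I = "I \<times> J" and \<xi> = ?\<xi> and w = ?w and \<beta> = "?K x y", OF g u(2)] b1[OF that] by (simp add: pure_tensor_def)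
 \<comment> \<open>Evaluations are 0 at maps that are not bilinear, so \<open>u\<close> can be
   expanded at this map only after its bilinearity is established.\<close>
 have bK: "bilinear_map q r (%x y. u' (?K x y))"
 by (rule bilinear_map_sum[OF Q(1) W(1) K])
 (use o(2) o'(2) in \<open>auto simp: bilinear_map_def linear_along_def algebra_simps\<close>)
 have "form (q \<otimes>\<^sub>q r) u u' = u (%x y. u' (?K x y))" by (simp add: tensor_def)
 also have "\<dots> = (\<Sum>p\<in>I \<times> J. u (?\<xi> p) * u' (?K (v (fst p)) (w (snd p))))"
 using span_functionals[where G = ?G and I = "I \<times> J" and \<xi> = ?\<xi> and w = ?w and \<beta> = "%x y. u' (?K x y)", OF g u(1)] bK by (simp add: pure_tensor_def)
 also have "\<dots> = (\<Sum>p\<in>I \<times> J. u (?\<xi> p) * u' (?\<xi> p) * (n (fst p) * m (snd p)))"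
 proof (intro sum.cong HOL.refl)
 fix p assume p: "p \<in> I \<times> J"
 hence pi: "fst p \<in> I" "snd p \<in> J" by auto
 have "u' (?K (v (fst p)) (w (snd p))) = (\<Sum>p'\<in>I \<times> J. if p' = p then u' (?\<xi> p) * (n (fst p) * m (snd p)) else 0)"
 unfolding K[OF o(2)[OF pi(1)] o'(2)[OF pi(2)]]
 by (intro sum.cong HOL.refl) (auto simp: o(4)[OF pi(1)] o'(4)[OF pi(2)] prod_eq_iff)
 thus "u (?\<xi> p) * u' (?K (v (fst p)) (w (snd p))) = u (?\<xi> p) * u' (?\<xi> p) * (n (fst p) * m (snd p))"
 using p o(1) o'(1) by (simp add: mult.assoc)
 qed
 finally show ?thesis .
 qed
 have I2: "n (fst p) * m (snd p) ~= 0" if "p \<in> I \<times> J" for p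
 using o(3) o'(3) that by auto
 have I1: "finite (I \<times> J)" using o(1) o'(1) by simp
 have "qsp UNIV (fs.span ?G) fscale (form (q \<otimes>\<^sub>q r))"
 "ofam (fs.span ?G) (form (q \<otimes>\<^sub>q r)) (I \<times> J) ?w (%p. n (fst p) * m (snd p))"
 by (rule functional_ofam[where \<xi> = ?\<xi> and w = ?w and G = ?G and I = "I \<times> J" and N = "%p. n (fst p) * m (snd p)",
 OF q.two I1 I2 fs.span_base[OF wG] g d F]; assumption)+
 thus "qsp UNIV (carr (q \<otimes>\<^sub>q r)) (scal (q \<otimes>\<^sub>q r)) (form (q \<otimes>\<^sub>q r))"
 "ofam (carr (q \<otimes>\<^sub>q r)) (form (q \<otimes>\<^sub>q r)) (I \<times> J) ?w (%p. n (fst p) * m (snd p))"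
 by (simp_all add: tensor_def)
qed

lemma alternating_sum5:
 fixes x y :: "nat => 'k::comm_ring_1"
 assumes "!!i. \<beta> i i = 0" "!!i j. \<beta> j i = - \<beta> i j"
 shows "(\<Sum>i\<in>{1..5::nat}. x i * (\<Sum>j\<in>{1..5::nat}. y j * \<beta> i j)) = (\<Sum>p\<in>pairs5. (x (fst p) * y (snd p) - x (snd p) * y (fst p)) * \<beta> (fst p) (snd p))"
 unfolding sum_pairs5 sum5 fst_conv snd_conv
 unfolding assms(1) assms(2)[of 1 2] assms(2)[of 1 3] assms(2)[of 1 4] assms(2)[of 1 5] assms(2)[of 2 3] assms(2)[of 2 4]
 assms(2)[of 2 5] assms(2)[of 3 4] assms(2)[of 3 5] assms(2)[of 4 5]
 by (simp add: algebra_simps)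

lemma ext_ofam:
 fixes q :: "('k::field, 'a::ab_group_add) form_module"
 assumes Q: "qsp UNIV (carr q) (scal q) (form q)" "ofam (carr q) (form q) {1..5} v n"
 shows "qsp UNIV (carr (ext_square q)) (scal (ext_square q)) (form (ext_square q))"
 and "ofam (carr (ext_square q)) (form (ext_square q)) pairs5 (%p. wedge q (v (fst p)) (v (snd p))) (%p. n (fst p) * n (snd p))"
proof -
 interpret q: qsp UNIV "carr q" "scal q" "form q" by (rule Q)
 note o = ofamD[OF Q(2)]
 have P: "fst p \<in> {1..5}" "snd p \<in> {1..5}" "fst p < snd p" if "p \<in> pairs5" for p using that by (auto simp: pairs5_def)
 let ?G = "{wedge q x y | x y. x \<in> carr q & y \<in> carr q}"
 let ?c = "%x i. form q x (v i) / n i"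
 \<comment> \<open>The Pluecker coordinates of the wedge of \<open>x\<close> and
   \<open>y\<close>.\<close>
 let ?\<xi> = "%p x y. ?c x (fst p) * ?c y (snd p) - ?c x (snd p) * ?c y (fst p)"
 let ?w = "%p. wedge q (v (fst p)) (v (snd p))"
 define alt where "alt \<beta> \<longleftrightarrow> bilinear_map q q \<beta> & (\<forall>z\<in>carr q. \<beta> z z = 0)" for \<beta>
 have we: "wedge q x y \<beta> = (if alt \<beta> then \<beta> x y else 0)" for x y \<beta> by (simp add: wedge_def alt_def)
 have b: "alt (?\<xi> p)" if "p \<in> pairs5" for p
 using P[OF that] o(2) unfolding alt_def
 by (auto simp: bilinear_map_def linear_along_def algebra_simps add_divide_distrib)
 have wG: "?w p \<in> ?G" if "p \<in> pairs5" for p using P[OF that] o(2) by blast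
 have skew: "\<beta> y x = - \<beta> x y" if "alt \<beta>" "x \<in> carr q" "y \<in> carr q" for \<beta> x y
 proof -
 have l: "linear_along id q (%x. \<beta> x z)" "linear_along id q (\<beta> z)" if "z \<in> carr q" for z
 using \<open>alt \<beta>\<close> that by (auto simp: alt_def bilinear_map_def)
 have z: "\<beta> z z = 0" if "z \<in> carr q" for z using \<open>alt \<beta>\<close> that by (simp add: alt_def)
 have xy: "x + y \<in> carr q" using that by simp
 have "\<beta> (x + y) (x + y) = \<beta> x (x + y) + \<beta> y (x + y)" using l(1)[OF xy] that by (simp add: linear_along_def)
 also have "\<dots> = (\<beta> x x + \<beta> x y) + (\<beta> y x + \<beta> y y)"
 using l(2)[OF that(2)] l(2)[OF that(3)] that by (simp add: linear_along_def)
 finally have "\<beta> y x + \<beta> x y = 0" using z that xy by (simp add: add.commute)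
 thus ?thesis by (simp add: eq_neg_iff_add_eq_0)
 qed
 have ex: "\<beta> x y = (\<Sum>p\<in>pairs5. ?\<xi> p x y * \<beta> (v (fst p)) (v (snd p)))"
 if a: "alt \<beta>" and xy: "x \<in> carr q" "y \<in> carr q" for x y \<beta>
 proof -
 have l: "linear_along id q (%x. \<beta> x y)" "!!x. x \<in> carr q ==> linear_along id q (\<beta> x)"
 using a xy by (auto simp: bilinear_map_def alt_def)
 let ?b = "%i j. if i \<in> {1..5} & j \<in> {1..5} then \<beta> (v i) (v j) else 0"
 have "\<beta> x y = (\<Sum>i\<in>{1..5}. ?c x i * \<beta> (v i) y)" by (rule ofam_linear[OF Q l(1) xy(1)])
 also have "\<dots> = (\<Sum>i\<in>{1..5}. ?c x i * (\<Sum>j\<in>{1..5}. ?c y j * ?b i j))"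
 using ofam_linear[OF Q l(2)[OF o(2)] xy(2)] by (intro sum.cong HOL.refl) simp
 also have "\<dots> = (\<Sum>p\<in>pairs5. ?\<xi> p x y * ?b (fst p) (snd p))"
 by (rule alternating_sum5) (use a o(2) skew in \<open>auto simp: alt_def\<close>)
 also have "\<dots> = (\<Sum>p\<in>pairs5. ?\<xi> p x y * \<beta> (v (fst p)) (v (snd p)))"
 using P by (intro sum.cong) auto
 finally show ?thesis .
 qed
 have g: "u \<beta> = (\<Sum>p\<in>pairs5. u (?\<xi> p) * ?w p \<beta>)" if u: "u \<in> ?G" for u \<beta>
 proof -
 obtain x y where xy: "u = wedge q x y" "x \<in> carr q" "y \<in> carr q" using u by blast
 have e: "u (?\<xi> p) = ?\<xi> p x y" if "p \<in> pairs5" for p using b[OF that] by (simp add: xy we)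
 show ?thesis
 proof (cases "alt \<beta>")
 case True
 thus ?thesis using ex[OF True xy(2,3)] e by (simp add: xy we)
 qed (simp add: xy we)
 qed
 have d: "?w p (?\<xi> p') = (if p = p' then 1 else 0)" if "p \<in> pairs5" "p' \<in> pairs5" for p p'
 proof -
 note p = P[OF that(1)] and p' = P[OF that(2)]
 have "?w p (?\<xi> p') = ?\<xi> p' (v (fst p)) (v (snd p))" using b[OF that(2)] by (simp add: we)
 also have "\<dots> = (if p = p' then 1 else 0)"
 unfolding o(4)[OF p(1) p'(1)] o(4)[OF p(1) p'(2)] o(4)[OF p(2) p'(1)] o(4)[OF p(2) p'(2)]
 using p(3) p'(3) o(3)[OF p'(1)] o(3)[OF p'(2)] by (auto simp: prod_eq_iff)
 finally show ?thesis .
 qed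
 have F: "form (ext_square q) u u' = (\<Sum>p\<in>pairs5. u (?\<xi> p) * u' (?\<xi> p) * (n (fst p) * n (snd p)))"
 if u: "u \<in> fs.span ?G" "u' \<in> fs.span ?G" for u u'
 proof -
 let ?K = "%x y x' y'. form q x x' * form q y y' - form q x y' * form q y x'"
 have b1: "alt (?K x y)" if "x \<in> carr q" "y \<in> carr q" for x y
 using that by (auto simp: alt_def bilinear_map_def linear_along_def algebra_simps)
 have K: "u' (?K x y) = (\<Sum>p\<in>pairs5. u' (?\<xi> p) * ?K x y (v (fst p)) (v (snd p)))" if "x \<in> carr q" "y \<in> carr q" for x y
 using span_functionals[where G = ?G and I = pairs5 and \<xi> = ?\<xi> and w = ?w and \<beta> = "?K x y", OF g u(2)] b1[OF that] by (simp add: we)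
 have bK: "alt (%x y. u' (?K x y))"
 unfolding alt_def
 proof
 show "bilinear_map q q (%x y. u' (?K x y))"
 by (rule bilinear_map_sum[OF Q(1) Q(1) K])
 (use o(2)[OF P(1)] o(2)[OF P(2)] in \<open>auto simp: bilinear_map_def linear_along_def algebra_simps\<close>)
 show "\<forall>z\<in>carr q. u' (?K z z) = 0"
 proof
 fix z assume z: "z \<in> carr q"
 show "u' (?K z z) = 0" unfolding K[OF z z] by (intro sum.neutral ballI) (simp add: mult.commute)
 qed
 qed
 have "form (ext_square q) u u' = u (%x y. u' (?K x y))" by (simp add: ext_square_def)
 also have "\<dots> = (\<Sum>p\<in>pairs5. u (?\<xi> p) * u' (?K (v (fst p)) (v (snd p))))"
 using span_functionals[where G = ?G and I = pairs5 and \<xi> = ?\<xi> and w = ?w and \<beta> = "%x y. u' (?K x y)", OF g u(1)] bK by (simp add: we)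
 also have "\<dots> = (\<Sum>p\<in>pairs5. u (?\<xi> p) * u' (?\<xi> p) * (n (fst p) * n (snd p)))"
 proof (intro sum.cong HOL.refl)
 fix p assume p: "p \<in> pairs5"
 note pi = P[OF p]
 have "u' (?K (v (fst p)) (v (snd p))) = (\<Sum>p'\<in>pairs5. if p' = p then u' (?\<xi> p) * (n (fst p) * n (snd p)) else 0)"
 unfolding K[OF o(2)[OF pi(1)] o(2)[OF pi(2)]]
 proof (intro sum.cong HOL.refl)
 fix p' assume p': "p' \<in> pairs5"
 note pi' = P[OF p']
 show "u' (?\<xi> p') * ?K (v (fst p)) (v (snd p)) (v (fst p')) (v (snd p')) = (if p' = p then u' (?\<xi> p) * (n (fst p) * n (snd p)) else 0)"
 unfolding o(4)[OF pi(1) pi'(1)] o(4)[OF pi(1) pi'(2)] o(4)[OF pi(2) pi'(1)] o(4)[OF pi(2) pi'(2)]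
 using pi(3) pi'(3) by (auto simp: prod_eq_iff)
 qed
 thus "u (?\<xi> p) * u' (?K (v (fst p)) (v (snd p))) = u (?\<xi> p) * u' (?\<xi> p) * (n (fst p) * n (snd p))"
 using p card_pairs5(1) by (simp add: mult.assoc)
 qed
 finally show ?thesis .
 qed
 have I2: "n (fst p) * n (snd p) ~= 0" if "p \<in> pairs5" for p
 using o(3)[OF P(1)[OF that]] o(3)[OF P(2)[OF that]] by simp
 have "qsp UNIV (fs.span ?G) fscale (form (ext_square q))"
 "ofam (fs.span ?G) (form (ext_square q)) pairs5 ?w (%p. n (fst p) * n (snd p))"
 by (rule functional_ofam[where \<xi> = ?\<xi> and w = ?w and G = ?G and I = pairs5 and N = "%p. n (fst p) * n (snd p)",
 OF q.two card_pairs5(1) I2 fs.span_base[OF wG] g d F]; assumption)+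
 thus "qsp UNIV (carr (ext_square q)) (scal (ext_square q)) (form (ext_square q))"
 "ofam (carr (ext_square q)) (form (ext_square q)) pairs5 ?w (%p. n (fst p) * n (snd p))"
 by (simp_all add: ext_square_def)
qed

lemma diag_ofam:
 fixes as :: "'k::field list"
 assumes two: "(2::'k) ~= 0" and nz: "0 \<notin> set as"
 shows "qsp UNIV (carr (diag as)) (scal (diag as)) (form (diag as))"
 and "ofam (carr (diag as)) (form (diag as)) {..<length as} udelta ((!) as)"
proof -
 show "qsp UNIV (carr (diag as)) (scal (diag as)) (form (diag as))"
 by unfold_locales (use two in \<open>auto simp: diag_def algebra_simps sum.distrib sum_distrib_left\<close>)
 have e: "form (diag as) x (udelta i) = as ! i * x i" if "i < length as" for x i
 proof -
 have "form (diag as) x (udelta i) = (\<Sum>j<length as. as ! j * x j * udelta i j)" by (simp add: diag_def)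
 also have "\<dots> = (\<Sum>j<length as. if j = i then as ! i * x i else 0)"
 by (intro sum.cong HOL.refl) (simp add: udelta_def)
 finally have "form (diag as) x (udelta i) = (\<Sum>j<length as. if j = i then as ! i * x i else 0)" .
 thus ?thesis using that by simp
 qed
 have n: "as ! i ~= 0" if "i < length as" for i using nz that nth_mem by metis
 show "ofam (carr (diag as)) (form (diag as)) {..<length as} udelta ((!) as)"
 unfolding ofam_def
 proof (intro conjI ballI impI)
 fix x assume x: "x \<in> carr (diag as)" "\<forall>i\<in>{..<length as}. form (diag as) x (udelta i) = 0"
 show "x = 0"
 proof
 fix i
 show "x i = 0 i"
 proof (cases "i < length as")
 case True
 thus ?thesis using x(2) e[OF True, of x] n[OF True] by simp
 next
 case False
 thus ?thesis using x(1) by (simp add: diag_def)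
 qed
 qed
 qed (use e n in \<open>auto simp: udelta_def diag_def\<close>)
qed

lemma osum_ofam:
 fixes q :: "('k::field, 'a::ab_group_add) form_module" and r :: "('k, 'b::ab_group_add) form_module"
 assumes Q: "qsp UNIV (carr q) (scal q) (form q)" "obas (carr q) (form q) B"
 and W: "qsp UNIV (carr r) (scal r) (form r)" "obas (carr r) (form r) C"
 shows "qsp UNIV (carr (q \<oplus>\<^sub>q r)) (scal (q \<oplus>\<^sub>q r)) (form (q \<oplus>\<^sub>q r))"
 and "\<exists>D. obas (carr (q \<oplus>\<^sub>q r)) (form (q \<oplus>\<^sub>q r)) D & norms (form (q \<oplus>\<^sub>q r)) D = norms (form q) B + norms (form r) C"
proof -
 interpret q: qsp UNIV "carr q" "scal q" "form q" by (rule Q)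
 interpret r: qsp UNIV "carr r" "scal r" "form r" by (rule W)
 show "qsp UNIV (carr (q \<oplus>\<^sub>q r)) (scal (q \<oplus>\<^sub>q r)) (form (q \<oplus>\<^sub>q r))"
 proof unfold_locales
 show "form (q \<oplus>\<^sub>q r) x y = form (q \<oplus>\<^sub>q r) y x" if "x \<in> carr (q \<oplus>\<^sub>q r)" "y \<in> carr (q \<oplus>\<^sub>q r)" for x y
 using that by (auto simp: osum_def q.\<beta>_sym r.\<beta>_sym)
 qed (auto simp: osum_def zero_prod_def q.sc_one r.sc_one q.sc_sc r.sc_sc q.sc_add r.sc_add distrib_left)
 let ?V = "carr (q \<oplus>\<^sub>q r)" and ?f = "form (q \<oplus>\<^sub>q r)"
 have B: "orth (carr q) (form q) B" and C: "orth (carr r) (form r) C" using Q(2) W(2) by (auto simp: obas_def)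
 have BV: "x \<in> carr q" if "x \<in> B" for x using B that by (auto simp: orth_def)
 have CV: "x \<in> carr r" if "x \<in> C" for x using C that by (auto simp: orth_def)
 note i1 = orth_image[where T = "%x. (x, 0)" and V' = ?V and \<beta>' = ?f and c = 1, OF B]
 note i2 = orth_image[where T = "%x. (0, x)" and V' = ?V and \<beta>' = ?f and c = 1, OF C]
 have 1: "orth ?V ?f ((%x. (x, 0)) ` B)" "norms ?f ((%x. (x, 0)) ` B) = norms (form q) B"
 using i1 BV by (simp_all add: osum_def)
 have 2: "orth ?V ?f ((%x. (0, x)) ` C)" "norms ?f ((%x. (0, x)) ` C) = norms (form r) C"
 using i2 CV by (simp_all add: osum_def)
 have z: "?f a b = 0 & ?f b a = 0" if "a \<in> (%x. (x, 0)) ` B" "b \<in> (%x. (0, x)) ` C" for a b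
 using that BV CV by (auto simp: osum_def)
 note U = orth_Un[OF 1(1) 2(1) z]
 have "obas ?V ?f ((%x. (x, 0)) ` B \<union> (%x. (0, x)) ` C)" unfolding obas_def
 proof (intro conjI U(1) ballI impI)
 fix x assume x: "x \<in> ?V" and zz: "\<forall>b\<in>(%x. (x, 0)) ` B \<union> (%x. (0, x)) ` C. ?f x b = 0"
 have "form q (fst x) b = 0" if "b \<in> B" for b using bspec[OF zz, of "(b, 0)"] that x by (auto simp: osum_def)
 moreover have "form r (snd x) b = 0" if "b \<in> C" for b using bspec[OF zz, of "(0, b)"] that x by (auto simp: osum_def)
 ultimately show "x = 0" using x Q(2) W(2) by (auto simp: obas_def osum_def prod_eq_iff)
 qed
 thus "\<exists>D. obas ?V ?f D & norms ?f D = norms (form q) B + norms (form r) C" using U(3) 1(2) 2(2) by metis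
qed

text \<open>Equal multisets of norms give a norm preserving bijection of the bases, extended
  linearly by orthogonal expansion.\<close>

lemma isometric_obas:
 fixes q :: "('k::field, 'a::ab_group_add) form_module" and r :: "('k, 'b::ab_group_add) form_module"
 assumes Q: "qsp UNIV (carr q) (scal q) (form q)" "obas (carr q) (form q) B"
 and W: "qsp UNIV (carr r) (scal r) (form r)" "obas (carr r) (form r) C"
 and n: "norms (form q) B = norms (form r) C"
 shows "q \<simeq> r"
proof -
 interpret q: qsp UNIV "carr q" "scal q" "form q" by (rule Q)
 interpret r: qsp UNIV "carr r" "scal r" "form r" by (rule W)
 have B: "orth (carr q) (form q) B" "finite B" and C: "orth (carr r) (form r) C" "finite C" using Q(2) W(2) by (auto simp: obas_def orth_def)
 have BV: "x \<in> carr q" if "x \<in> B" for x using B that by (auto simp: orth_def)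
 have CV: "x \<in> carr r" if "x \<in> C" for x using C that by (auto simp: orth_def)
 obtain \<phi> where p: "bij_betw \<phi> B C" "!!b. b \<in> B ==> form r (\<phi> b) (\<phi> b) = form q b b"
 using mset_bijection[OF B(2) C(2), of "%x. form r x x" "%x. form q x x"] n[unfolded norms_def] by auto
 have pC: "\<phi> b \<in> C" if "b \<in> B" for b using p(1) that by (auto simp: bij_betw_def)
 have r0: "form r (\<phi> b) (\<phi> b') = (if b = b' then form q b b else 0)" if "b \<in> B" "b' \<in> B" for b b'
 proof (cases "b = b'")
 case False
 hence "\<phi> b ~= \<phi> b'" using p(1) that by (auto simp: bij_betw_def inj_on_def)
 thus ?thesis using C(1) pC that False by (auto simp: orth_def)
 qed (use p(2) that in auto)
 have nz: "form q b b ~= 0" if "b \<in> B" for b using B(1) that by (auto simp: orth_def)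
 define f where "f x = (\<Sum>b\<in>B. scal r (form q x b / form q b b) (\<phi> b))" for x
 have fV: "f x \<in> carr r" for x unfolding f_def using pC CV by (intro r.V_sum) auto
 have fb: "form r (f x) (\<phi> b) = form q x b" if b: "b \<in> B" for x b
 proof -
 have "form r (f x) (\<phi> b) = (\<Sum>b'\<in>B. form r (scal r (form q x b' / form q b' b') (\<phi> b')) (\<phi> b))"
 unfolding f_def using pC CV b by (intro r.\<beta>_sum) auto
 also have "\<dots> = (\<Sum>b'\<in>B. if b' = b then form q x b else 0)"
 using pC CV b nz by (intro sum.cong HOL.refl) (auto simp: r0)
 finally show ?thesis using B(2) b by simp
 qed
 \<comment> \<open>Vectors are determined by their products with the basis; linearity and
   surjectivity of \<open>f\<close> are verified in this way.\<close>
 have uq: "y = z" if yz: "y \<in> carr r" "z \<in> carr r" "!!b. b \<in> B ==> form r y (\<phi> b) = form r z (\<phi> b)" for y z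
 proof -
 have "form r (y - z) c = 0" if c: "c \<in> C" for c
 proof -
 obtain b where "b \<in> B" "c = \<phi> b" using p(1) c by (auto simp: bij_betw_def)
 thus ?thesis using yz CV c by simp
 qed
 hence "y - z = 0" using W(2) yz(1,2) unfolding obas_def by (meson r.Vdiff)
 thus ?thesis by simp
 qed
 have "bij_betw f (carr q) (carr r)"
 proof (rule bij_betw_imageI)
 show "inj_on f (carr q)"
 proof (rule inj_onI)
 fix x y assume xy: "x \<in> carr q" "y \<in> carr q" "f x = f y"
 have "form q (x - y) b = 0" if "b \<in> B" for b using fb[OF that, of x] fb[OF that, of y] xy BV that by simp
 hence "x - y = 0" using Q(2) xy(1,2) unfolding obas_def by (meson q.Vdiff)
 thus "x = y" by simp
 qed
 show "f ` carr q = carr r"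
 proof
 show "carr r <= f ` carr q"
 proof
 fix z assume z: "z \<in> carr r"
 let ?x = "\<Sum>b\<in>B. scal q (form r z (\<phi> b) / form q b b) b"
 have x: "?x \<in> carr q" using BV by (intro q.V_sum) auto
 have "form q ?x b = form r z (\<phi> b)" if b: "b \<in> B" for b
 proof -
 have "form q ?x b = (\<Sum>b'\<in>B. form q (scal q (form r z (\<phi> b') / form q b' b') b') b)"
 using BV b by (intro q.\<beta>_sum) auto
 also have "\<dots> = (\<Sum>b'\<in>B. if b' = b then form r z (\<phi> b) else 0)"
 proof (intro sum.cong HOL.refl)
 fix b' assume b': "b' \<in> B"
 hence "b' ~= b ==> form q b' b = 0" using B(1) b by (auto simp: orth_def)
 thus "form q (scal q (form r z (\<phi> b') / form q b' b') b') b = (if b' = b then form r z (\<phi> b) else 0)"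
 using BV b b' nz by auto
 qed
 finally show ?thesis using B(2) b by simp
 qed
 hence fz: "f ?x = z" using fb by (intro uq fV z) simp
 show "z \<in> f ` carr q" by (rule image_eqI[where f = f, OF fz[symmetric] x])
 qed
 qed (use fV in auto)
 qed
 moreover have "f (x + y) = f x + f y" if "x \<in> carr q" "y \<in> carr q" for x y
 using that BV CV pC by (intro uq) (auto simp: fV fb)
 moreover have "f (scal q c x) = scal r c (f x)" if "x \<in> carr q" for x c
 using that BV CV pC by (intro uq) (auto simp: fV fb)
 moreover have "form r (f x) (f y) = form q x y" if xy: "x \<in> carr q" "y \<in> carr q" for x y
 proof -
 have "form r (f y) (f x) = (\<Sum>b\<in>B. form q y b / form q b b * form q x b)"
 proof -
 have "form r (f y) (f x) = (\<Sum>b\<in>B. form r (scal r (form q y b / form q b b) (\<phi> b)) (f x))"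
 unfolding f_def[of y] using pC CV fV by (intro r.\<beta>_sum) auto
 also have "\<dots> = (\<Sum>b\<in>B. form q y b / form q b b * form q x b)"
 using pC CV fV fb by (intro sum.cong HOL.refl) (simp add: r.\<beta>_sym[of "\<phi> _" "f x"])
 finally show ?thesis .
 qed
 also have "\<dots> = form q y x"
 proof -
 have "form q y x = form q (\<Sum>b\<in>B. scal q (form q y b / form q b b) b) x" using q.obas_expand[OF Q(2) xy(2)] by simp
 also have "\<dots> = (\<Sum>b\<in>B. form q (scal q (form q y b / form q b b) b) x)" using BV xy by (intro q.\<beta>_sum) auto
 also have "\<dots> = (\<Sum>b\<in>B. form q y b / form q b b * form q x b)"
 using BV xy by (intro sum.cong HOL.refl) (simp add: q.\<beta>_sym[of _ x])
 finally show ?thesis by simp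
 qed
 finally show ?thesis using r.\<beta>_sym[OF fV fV] q.\<beta>_sym[OF xy] by metis
 qed
 ultimately show ?thesis unfolding isometric_def by (intro exI[of _ f] conjI ballI allI)
qed

section \<open>Base change of free modules\<close>

lemma sum_fun_apply: "(\<Sum>i\<in>I. F i) x = (\<Sum>i\<in>I. F i x)" for F :: "'i => 'x => 'a::comm_monoid_add"
 by (induction I rule: infinite_finite_induct) auto

text \<open>A free module with basis \<open>b\<close> and coordinates \<open>c\<close>. Freeness is
  expressed by expanding linear maps, since elements of the base change see vectors only through
  these. The instances are the lattice over the integers, its base change to \<open>k\<close>, and
  the functions on the lines.\<close>

locale based =
 fixes \<iota> :: "'r::comm_ring_1 => 's::comm_ring_1" and M :: "('r, 'm::ab_group_add) form_module"
 and J :: "'j set" and b :: "'j => 'm" and c :: "'j => 'm => 'r"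
 assumes \<iota>_add: "\<iota> (s + t) = \<iota> s + \<iota> t" and \<iota>_mult: "\<iota> (s * t) = \<iota> s * \<iota> t" and \<iota>_one: "\<iota> 1 = 1"
 and Madd: "x \<in> carr M ==> y \<in> carr M ==> x + y \<in> carr M" and Mscal: "x \<in> carr M ==> scal M a x \<in> carr M"
 and finJ: "finite J" and b_in: "j \<in> J ==> b j \<in> carr M"
 and c_add: "j \<in> J ==> x \<in> carr M ==> y \<in> carr M ==> c j (x + y) = c j x + c j y"
 and c_scal: "j \<in> J ==> x \<in> carr M ==> c j (scal M a x) = a * c j x"
 and c_b: "i \<in> J ==> j \<in> J ==> c i (b j) = (if i = j then 1 else 0)"
 and expand: "x \<in> carr M ==> linear_along \<iota> M f ==> f x = (\<Sum>j\<in>J. \<iota> (c j x) * f (b j))"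
 and f_add: "x \<in> carr M ==> y \<in> carr M ==> z \<in> carr M ==> form M (x + y) z = form M x z + form M y z"
 and f_scal: "x \<in> carr M ==> z \<in> carr M ==> form M (scal M a x) z = a * form M x z"
 and f_addR: "x \<in> carr M ==> y \<in> carr M ==> z \<in> carr M ==> form M z (x + y) = form M z x + form M z y"
 and f_scalR: "x \<in> carr M ==> z \<in> carr M ==> form M z (scal M a x) = a * form M z x"
begin

abbreviation BC where "BC \<equiv> carr (base_change \<iota> M)"
abbreviation co where "co U j \<equiv> U (%x. \<iota> (c j x))"

lemma \<iota>_zero: "\<iota> 0 = 0" using \<iota>_add[of 0 0] by simp

lemma BC_eq: "BC = fs.span (unit_tensor \<iota> M ` carr M)" by (simp add: base_change_def)

lemma lin_c: "j \<in> J ==> linear_along \<iota> M (%x. \<iota> (c j x))"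
 by (simp add: linear_along_def c_add c_scal \<iota>_add \<iota>_mult)

lemma ut_in: "x \<in> carr M ==> unit_tensor \<iota> M x \<in> BC"
 unfolding BC_eq by (intro fs.span_base imageI)

lemma BC_closed: "U \<in> BC ==> V \<in> BC ==> U + V \<in> BC" "U \<in> BC ==> fscale a U \<in> BC" "0 \<in> BC"
 unfolding BC_eq by (fact fs.span_add fs.span_scale fs.span_zero)+

lemma BC_sum: "(!!i. i \<in> I ==> F i \<in> BC) ==> (\<Sum>i\<in>I. F i) \<in> BC"
 unfolding BC_eq by (rule fs.span_sum)

lemma bc_apply: assumes "U \<in> BC" shows "U f = (\<Sum>j\<in>J. co U j * unit_tensor \<iota> M (b j) f)"
proof (rule span_functionals[OF _ assms[unfolded BC_eq]])
 fix v :: "('m => 's) => 's" and f assume "v \<in> unit_tensor \<iota> M ` carr M"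
 then obtain x where x: "v = unit_tensor \<iota> M x" "x \<in> carr M" by blast
 show "v f = (\<Sum>j\<in>J. co v j * unit_tensor \<iota> M (b j) f)"
 using expand[OF x(2)] lin_c by (simp add: x unit_tensor_def)
qed

lemma bc_linear: "U \<in> BC ==> linear_along \<iota> M f ==> U f = (\<Sum>j\<in>J. co U j * f (b j))"
 using bc_apply[of U f] by (simp add: unit_tensor_def)

lemma bc_eq: "U \<in> BC ==> V \<in> BC ==> (!!j. j \<in> J ==> co U j = co V j) ==> U = V"
 by (rule ext) (subst (1 2) bc_apply, auto)

definition mk where "mk a = (\<Sum>j\<in>J. fscale (a j) (unit_tensor \<iota> M (b j)))"

lemma mk_in: "mk a \<in> BC"
 unfolding mk_def by (intro BC_sum BC_closed ut_in b_in)

lemma co_ut: "j \<in> J ==> x \<in> carr M ==> co (unit_tensor \<iota> M x) j = \<iota> (c j x)"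
 using lin_c by (simp add: unit_tensor_def)

lemma co_mk: assumes j: "j \<in> J" shows "co (mk a) j = a j"
proof -
 have "co (mk a) j = (\<Sum>i\<in>J. if i = j then a j else 0)"
 unfolding mk_def sum_fun_apply using j by (intro sum.cong HOL.refl) (auto simp: fscale_def co_ut b_in c_b \<iota>_one \<iota>_zero)
 thus ?thesis using finJ j by simp
qed

lemma bc_form: assumes "U \<in> BC" "V \<in> BC"
 shows "form (base_change \<iota> M) U V = (\<Sum>i\<in>J. \<Sum>j\<in>J. co U i * co V j * \<iota> (form M (b i) (b j)))"
proof -
 have V: "V (%y. \<iota> (form M x y)) = (\<Sum>j\<in>J. co V j * \<iota> (form M x (b j)))" if "x \<in> carr M" for x
 using that by (intro bc_linear assms) (simp add: linear_along_def f_addR f_scalR \<iota>_add \<iota>_mult)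
 have "linear_along \<iota> M (%x. V (%y. \<iota> (form M x y)))"
 unfolding linear_along_def using Madd Mscal
 by (simp add: V f_add f_scal b_in \<iota>_add \<iota>_mult algebra_simps sum.distrib sum_distrib_left)
 hence "U (%x. V (%y. \<iota> (form M x y))) = (\<Sum>i\<in>J. co U i * (\<Sum>j\<in>J. co V j * \<iota> (form M (b i) (b j))))"
 using bc_linear[OF assms(1)] V b_in by simp
 thus ?thesis by (simp add: base_change_def sum_distrib_left mult.assoc)
qed

end

text \<open>The semilinear action moves the coefficients by \<mu> and the basis vectors by
  \<open>g\<close>, of which \<open>g'\<close> is the inverse.\<close>

lemma twist_coord:
 fixes \<iota> :: "'k::field => 's::field"
 assumes "based \<iota> M J b c" and \<mu>: "\<mu> \<in> galois_group \<iota>" and U: "U \<in> carr (base_change \<iota> M)"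
 and g: "!!x. x \<in> carr M ==> g x \<in> carr M" "!!x y. x \<in> carr M ==> y \<in> carr M ==> g (x + y) = g x + g y"
 "!!a x. x \<in> carr M ==> g (scal M a x) = scal M a (g x)"
 and g': "!!x. x \<in> carr M ==> g' x \<in> carr M" "!!x. x \<in> carr M ==> g (g' x) = x" "!!x. x \<in> carr M ==> g' (g x) = x"
 shows "galois_act \<mu> (base_change_map g U) \<in> carr (base_change \<iota> M)"
 and "i \<in> J ==> galois_act \<mu> (base_change_map g U) (%x. \<iota> (c i x)) = (\<Sum>j\<in>J. \<mu> (U (%x. \<iota> (c j x))) * \<iota> (c i (g (b j))))"
proof -
 interpret based \<iota> M J b c by fact
 have G: "bij \<mu>" "!!x y. \<mu> (x + y) = \<mu> x + \<mu> y" "!!x y. \<mu> (x * y) = \<mu> x * \<mu> y" "!!a. \<mu> (\<iota> a) = \<iota> a"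
 using \<mu> by (auto simp: galois_group_def)
 have gi: "\<mu> (inv \<mu> x) = x" "inv \<mu> (\<mu> x) = x" for x
 using G(1) by (simp_all add: bij_is_surj surj_f_inv_f bij_is_inj)
 have z: "\<mu> 0 = 0" using G(2)[of 0 0] by (simp only: add_0_left add_cancel_right_right)
 have gs: "\<mu> (sum f I) = (\<Sum>i\<in>I. \<mu> (f i))" for f :: "'j => 's" and I
 by (induction I rule: infinite_finite_induct) (auto simp: z G)
 have i: "inv \<mu> (x + y) = inv \<mu> x + inv \<mu> y" "inv \<mu> (x * y) = inv \<mu> x * inv \<mu> y" "inv \<mu> (\<iota> a) = \<iota> a" for x y a
 by (metis G(2-4) gi)+
 have "g' (x + y) = g' x + g' y" if "x \<in> carr M" "y \<in> carr M" for x y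
 proof -
 have "g (g' x + g' y) = x + y" using g(2) g'(1,2) that by simp
 thus ?thesis using g'(3)[of "g' x + g' y"] g'(1) that Madd by simp
 qed
 moreover have "g' (scal M a x) = scal M a (g' x)" if "x \<in> carr M" for a x
 proof -
 have "g (scal M a (g' x)) = scal M a x" using g(3) g'(1,2) that by simp
 thus ?thesis using g'(3)[of "scal M a (g' x)"] g'(1) that Mscal by simp
 qed
 ultimately have "linear_along \<iota> M (\<mu> \<circ> f \<circ> g')" if "linear_along \<iota> M f" for f
 using that g'(1) by (simp add: linear_along_def G)
 moreover have "linear_along \<iota> M (inv \<mu> \<circ> f \<circ> g)" if "linear_along \<iota> M f" for f
 using that g by (simp add: linear_along_def i)
 moreover have "linear_along \<iota> M (\<mu> \<circ> (inv \<mu> \<circ> f \<circ> g) \<circ> g') \<longleftrightarrow> linear_along \<iota> M f" for f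
 using g' Madd Mscal by (simp add: linear_along_def gi)
 \<comment> \<open>Both directions matter: \<open>unit_tensor\<close> is 0 at nonlinear maps, so the
   substitution must neither create nor destroy linearity.\<close>
 ultimately have L: "linear_along \<iota> M (inv \<mu> \<circ> f \<circ> g) \<longleftrightarrow> linear_along \<iota> M f" for f by blast
 have "galois_act \<mu> (base_change_map g U) = (\<Sum>j\<in>J. fscale (\<mu> (co U j)) (unit_tensor \<iota> M (g (b j))))" (is "?A = ?B")
 proof
 fix f
 have "?A f = \<mu> (U (inv \<mu> \<circ> f \<circ> g))" by (simp add: galois_act_def base_change_map_def)
 also have "\<dots> = (\<Sum>j\<in>J. \<mu> (co U j) * \<mu> (unit_tensor \<iota> M (b j) (inv \<mu> \<circ> f \<circ> g)))"
 by (subst bc_apply[OF U]) (simp add: gs G)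
 also have "\<dots> = ?B f" unfolding sum_fun_apply by (intro sum.cong) (auto simp: fscale_def unit_tensor_def L gi z)
 finally show "?A f = ?B f" .
 qed
 note e = this
 show "galois_act \<mu> (base_change_map g U) \<in> BC"
 unfolding e by (intro BC_sum BC_closed ut_in g b_in)
 show "co (galois_act \<mu> (base_change_map g U)) i = (\<Sum>j\<in>J. \<mu> (co U j) * \<iota> (c i (g (b j))))" if "i \<in> J"
 unfolding e sum_fun_apply by (intro sum.cong) (auto simp: fscale_def co_ut[OF that] g b_in)
qed

section \<open>The Galois group\<close>

lemma two_neq_zero: "CHAR('k::field) ~= 2 ==> (2::'k) ~= 0"
proof
 assume c: "CHAR('k) ~= 2" and "(2::'k) = 0"
 hence "of_nat 2 = (0::'k)" by simp
 hence "CHAR('k) dvd 2" by (simp only: of_nat_eq_0_iff_char_dvd)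
 hence "CHAR('k) = 1 | CHAR('k) = 2" using two_is_prime_nat by (metis prime_nat_iff)
 moreover have "CHAR('k) ~= 1"
 proof
 assume "CHAR('k) = 1"
 thus False using of_nat_eq_0_iff_char_dvd[where 'a = 'k and n = 1] by simp
 qed
 ultimately show False using c by simp
qed

lemma aut_group_galois:
 fixes \<iota> :: "'k::field => 's::field"
 assumes "(2::'s) ~= 0" shows "aut_group (galois_group \<iota>)"
proof unfold_locales
 fix \<mu> assume g: "\<mu> \<in> galois_group \<iota>"
 hence G: "bij \<mu>" "!!x y. \<mu> (x + y) = \<mu> x + \<mu> y" "!!x y. \<mu> (x * y) = \<mu> x * \<mu> y" "!!a. \<mu> (\<iota> a) = \<iota> a"
 by (auto simp: galois_group_def)
 have gi: "\<mu> (inv \<mu> x) = x" "inv \<mu> (\<mu> x) = x" for x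
 using G(1) by (simp_all add: bij_is_surj surj_f_inv_f bij_is_inj)
 have "inv \<mu> (x + y) = inv \<mu> x + inv \<mu> y" "inv \<mu> (x * y) = inv \<mu> x * inv \<mu> y" "inv \<mu> (\<iota> a) = \<iota> a" for x y a
 by (metis G(2-4) gi)+
 hence "inv \<mu> \<in> galois_group \<iota>" using bij_imp_bij_inv[OF G(1)] by (simp add: galois_group_def)
 thus "\<exists>\<delta>\<in>galois_group \<iota>. \<delta> \<circ> \<mu> = id & \<mu> \<circ> \<delta> = id" using gi by (intro bexI[of _ "inv \<mu>"]) auto
 show "\<mu> (x + y) = \<mu> x + \<mu> y" "\<mu> (x * y) = \<mu> x * \<mu> y" for x y by (fact G)+
qed (use assms in \<open>auto simp: galois_group_def bij_comp\<close>)

text \<open>The kernel of \<phi> is open, so it contains all automorphisms that fix some finite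
  \<open>S0\<close> pointwise. \<open>S\<close> consists of the conjugates of \<open>S0\<close>: it
  is stable under the group, and finite because each element is a root of a nonzero polynomial over
  \<open>k\<close>.\<close>

lemma gal_kernel:
 fixes \<iota> :: "'k::field => 's::field" and \<phi> :: "('s => 's) => 'v => 'v"
 assumes two: "(2::'s) ~= 0" and sc: "separable_closure \<iota>" and ct: "continuous_hom \<iota> G \<phi>" and one: "\<phi> id = id"
 obtains S where "gal (galois_group \<iota>) S" "!!\<mu>. \<mu> \<in> galois_group \<iota> ==> (!!s. s \<in> S ==> \<mu> s = s) ==> \<phi> \<mu> = id"
proof -
 let ?\<Gamma> = "galois_group \<iota>"
 interpret aut_group ?\<Gamma> by (rule aut_group_galois[OF two])
 have top: "topspace (krull_topology \<iota>) = ?\<Gamma>" by (simp add: krull_topology_def)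
 have cm: "continuous_map (krull_topology \<iota>) (discrete_topology G) \<phi>" using ct by (simp add: continuous_hom_def)
 have "\<phi> id \<in> G" using cm id_in unfolding continuous_map_def top by auto
 hence "id \<in> G" by (simp add: one)
 hence "openin (krull_topology \<iota>) {\<mu> \<in> ?\<Gamma>. \<phi> \<mu> \<in> {id}}"
 using cm unfolding continuous_map_def top by (auto dest!: spec[of _ "{id}"])
 then obtain U where U: "openin (product_topology (%_. discrete_topology UNIV) UNIV) U" "{\<mu> \<in> ?\<Gamma>. \<phi> \<mu> \<in> {id}} = U \<inter> ?\<Gamma>"
 unfolding krull_topology_def openin_subtopology by blast
 have "id \<in> U" using U(2) one id_in by blast
 then obtain X where X: "finite {i. X i ~= UNIV}" "id \<in> Pi\<^sub>E UNIV X" "Pi\<^sub>E UNIV X <= U"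
 using U(1) unfolding openin_product_topology_alt by auto
 define S0 where "S0 = {i. X i ~= UNIV}"
 define S where "S = (\<Union>s\<in>S0. (%\<mu>. \<mu> s) ` ?\<Gamma>)"
 have k: "\<phi> \<mu> = id" if g: "\<mu> \<in> ?\<Gamma>" and f: "!!s. s \<in> S0 ==> \<mu> s = s" for \<mu>
 proof -
 have "\<mu> i \<in> X i" for i
 using X(2) f[of i] by (cases "i \<in> S0") (auto simp: S0_def PiE_iff)
 hence "\<mu> \<in> U" using X(3) by (auto simp: PiE_iff)
 thus ?thesis using U(2) g by blast
 qed
 have io: "\<iota> (x + y) = \<iota> x + \<iota> y" "\<iota> (x * y) = \<iota> x * \<iota> y" "\<iota> 1 = 1" for x y
 using sc by (auto simp: separable_closure_def)
 have i0: "\<iota> 0 = 0" using io(1)[of 0 0] by (simp only: add_0_left add_cancel_right_right)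
 have iz: "x = 0" if "\<iota> x = 0" for x
 proof (rule ccontr)
 assume "x ~= 0"
 thus False using io(2)[of x "inverse x"] that io(3) by simp
 qed
 have "finite ((%\<mu>. \<mu> s) ` ?\<Gamma>)" for s
 proof -
 obtain p where p: "separable_poly p" "poly (map_poly \<iota> p) s = 0"
 using sc unfolding separable_closure_def by metis
 have "p ~= 0" using p(1) by (auto simp: separable_poly_def)
 hence m: "map_poly \<iota> p ~= 0" using iz i0 by (metis coeff_map_poly leading_coeff_0_iff coeff_0)
 have "poly (map_poly \<iota> p) (\<mu> s) = 0" if g: "\<mu> \<in> ?\<Gamma>" for \<mu>
 proof -
 have gi: "\<mu> (\<iota> a) = \<iota> a" for a using g by (simp add: galois_group_def)
 have "poly (map_poly \<iota> p) (\<mu> s) = (\<Sum>i\<le>degree (map_poly \<iota> p). \<iota> (coeff p i) * \<mu> s ^ i)"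
 unfolding poly_altdef using i0 by (simp add: coeff_map_poly)
 also have "\<dots> = \<mu> (\<Sum>i\<le>degree (map_poly \<iota> p). \<iota> (coeff p i) * s ^ i)"
 by (simp add: hom_sum[OF g] hom_mult[OF g] hom_power[OF g] gi)
 also have "(\<Sum>i\<le>degree (map_poly \<iota> p). \<iota> (coeff p i) * s ^ i) = poly (map_poly \<iota> p) s"
 unfolding poly_altdef using i0 by (simp add: coeff_map_poly)
 finally show ?thesis using p(2) hom_zero[OF g] by simp
 qed
 hence "(%\<mu>. \<mu> s) ` ?\<Gamma> <= {x. poly (map_poly \<iota> p) x = 0}" by blast
 thus ?thesis using poly_roots_finite[OF m] finite_subset by blast
 qed
 hence "finite S" using X(1) by (simp add: S_def S0_def)
 moreover have "\<mu> s \<in> S" if "\<mu> \<in> ?\<Gamma>" "s \<in> S" for \<mu> s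
 proof -
 obtain s0 \<delta> where s: "s0 \<in> S0" "\<delta> \<in> ?\<Gamma>" "s = \<delta> s0" using \<open>s \<in> S\<close> by (auto simp: S_def)
 have "\<mu> s = (\<mu> \<circ> \<delta>) s0" by (simp add: s)
 moreover have "\<mu> \<circ> \<delta> \<in> ?\<Gamma>" using s that by (intro comp_in)
 ultimately show ?thesis using s(1) unfolding S_def by blast
 qed
 ultimately have "gal ?\<Gamma> S" by unfold_locales
 moreover have "S0 <= S"
 proof
 fix s assume "s \<in> S0"
 moreover have "s \<in> (%\<mu>. \<mu> s) ` ?\<Gamma>" by (rule image_eqI[OF _ id_in]) simp
 ultimately show "s \<in> S" unfolding S_def by blast
 qed
 ultimately show ?thesis using that k by blast
qed

section \<open>The twisted forms in coordinates\<close>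

locale twisted = e6 R \<alpha> e for R :: "'v::euclidean_space set" and \<alpha> e +
 fixes \<iota> :: "'k::field => 's::field" and \<phi> :: "('s => 's) => 'v => 'v" and S :: "'s set"
 assumes two_s: "(2::'s) ~= 0" and sep: "separable_closure \<iota>" and cont: "continuous_hom \<iota> (weyl_group R) \<phi>"
 and gal_S: "gal (galois_group \<iota>) S"
 and ker_S: "\<mu> \<in> galois_group \<iota> ==> (!!s. s \<in> S ==> \<mu> s = s) ==> \<phi> \<mu> = id"
begin

abbreviation \<Gamma> where "\<Gamma> \<equiv> galois_group \<iota>"
abbreviation lv where "lv \<equiv> %j. pt (frame_coord j)"
abbreviation act where "act \<mu> \<equiv> lattice_act (\<phi> \<mu>)"

lemma \<phi>_in: "\<mu> \<in> \<Gamma> ==> \<phi> \<mu> \<in> weyl_group R"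
 using cont by (auto simp: continuous_hom_def continuous_map_def krull_topology_def)

lemma \<phi>_comp: "\<mu> \<in> \<Gamma> ==> \<delta> \<in> \<Gamma> ==> \<phi> (\<mu> \<circ> \<delta>) = \<phi> \<mu> \<circ> \<phi> \<delta>"
 using cont by (simp add: continuous_hom_def)

sublocale fr: framed LL LZ LF "(3, 0)" lv
 by unfold_locales (rule frame_pt)

sublocale A: lat_act LL LZ LF "(3, 0)" \<Gamma> S act
proof (intro lat_act.intro lattice7_axioms gal_S lat_act_axioms.intro)
 fix \<mu> assume g: "\<mu> \<in> \<Gamma>"
 note a = act[OF \<phi>_in[OF g]]
 show "x \<in> LL ==> act \<mu> x \<in> LL" "act \<mu> (x + y) = act \<mu> x + act \<mu> y" "act \<mu> (LZ m x) = LZ m (act \<mu> x)"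
 "LF (act \<mu> x) (act \<mu> y) = LF x y" "act \<mu> (3, 0) = (3, 0)" for x y m by (fact a)+
 show "act (\<mu> \<circ> \<delta>) x = act \<mu> (act \<delta> x)" if "\<delta> \<in> \<Gamma>" for \<delta> x
 using \<phi>_comp[OF g that] by (simp add: lattice_act_def split_beta)
 show "act \<mu> x = x" if "!!s. s \<in> S ==> \<mu> s = s" for x
 using ker_S[OF g that] by (simp add: lattice_act_def)
qed (rule fr.h_in)

lemma \<iota>_hom: "\<iota> (x + y) = \<iota> x + \<iota> y" "\<iota> (x * y) = \<iota> x * \<iota> y" "\<iota> 1 = 1"
 using sep by (auto simp: separable_closure_def)

lemma \<iota>_0: "\<iota> 0 = 0"
 using \<iota>_hom(1)[of 0 0] by (simp only: add_0_left add_cancel_right_right)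

lemma \<iota>_neg: "\<iota> (- x) = - \<iota> x"
 using \<iota>_hom(1)[of x "- x"] by (simp add: \<iota>_0 minus_unique)

lemma \<iota>_of_int: "\<iota> (of_int n) = of_int n"
proof -
 have n: "\<iota> (of_nat m) = of_nat m" for m by (induction m) (simp_all add: \<iota>_0 \<iota>_hom)
 show ?thesis by (cases n) (simp_all add: n \<iota>_neg \<iota>_hom del: of_nat_Suc)
qed

lemma \<iota>_eq_0: "\<iota> x = 0 \<longleftrightarrow> x = 0"
proof
 assume z: "\<iota> x = 0"
 show "x = 0"
 proof (rule ccontr)
 assume "x ~= 0"
 thus False using \<iota>_hom(2)[of x "inverse x"] z \<iota>_hom(3) by simp
 qed
qed (simp add: \<iota>_0)

lemma inj_\<iota>: "inj \<iota>"
proof (rule injI)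
 fix x y assume "\<iota> x = \<iota> y"
 hence "\<iota> (x + - y) = 0" by (simp only: \<iota>_hom \<iota>_neg) simp
 thus "x = y" by (simp add: \<iota>_eq_0)
qed

lemma inv_\<iota>: "inv \<iota> (\<iota> x) = x"
 using inj_\<iota> by simp

lemma two_k: "(2::'k) ~= 0"
 using two_s \<iota>_of_int[of 2] \<iota>_0 by auto

lemma \<Gamma>_inv:
 assumes "\<mu> \<in> \<Gamma>"
 obtains \<delta> where "\<delta> \<in> \<Gamma>" "\<forall>x. act \<mu> (act \<delta> x) = x" "\<forall>x. act \<delta> (act \<mu> x) = x" "inv (\<phi> \<mu>) = \<phi> \<delta>" "inv (\<phi> \<delta>) = \<phi> \<mu>"
proof -
 obtain \<delta> where d: "\<delta> \<in> \<Gamma>" "\<delta> \<circ> \<mu> = id" "\<mu> \<circ> \<delta> = id" using A.inv_ex assms by blast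
 have "\<phi> id = id" using ker_S[of id] by simp
 hence e: "\<phi> \<mu> \<circ> \<phi> \<delta> = id" "\<phi> \<delta> \<circ> \<phi> \<mu> = id"
 using \<phi>_comp[OF assms d(1)] \<phi>_comp[OF d(1) assms] d by simp_all
 hence "\<phi> \<mu> (\<phi> \<delta> x) = x" "\<phi> \<delta> (\<phi> \<mu> x) = x" for x by (metis comp_apply id_apply)+
 hence "\<forall>x. act \<mu> (act \<delta> x) = x" "\<forall>x. act \<delta> (act \<mu> x) = x" by (simp_all add: lattice_act_def split_beta)
 moreover have "inv (\<phi> \<mu>) = \<phi> \<delta>" "inv (\<phi> \<delta>) = \<phi> \<mu>" using e by (simp_all add: inv_unique_comp)
 ultimately show ?thesis using d(1) that by blast
qed

definition lc :: "nat => int \<times> 'v => int" where "lc j x = eta j * LF x (lv j)"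

lemma LF_addR: "x \<in> LL ==> y \<in> LL ==> z \<in> LL ==> LF z (x + y) = LF z x + LF z y"
 using B_sym[of z "x + y"] B_sym[of z x] B_sym[of z y] B_add[of x y z] by simp

lemma LF_zmR: "x \<in> LL ==> z \<in> LL ==> LF z (LZ m x) = m * LF z x"
 using B_sym[of z "LZ m x"] B_sym[of z x] B_zm[of x z m] by simp

lemma eta_sq: "eta j * eta j = 1" by (simp add: eta_def)

lemma lc_expand: "x \<in> LL ==> x = (\<Sum>j\<le>6. LZ (lc j x) (lv j))"
 using fr.expand[of x] by (simp add: vec_def lc_def)

lemma lc_pair: "x \<in> LL ==> y \<in> LL ==> (\<Sum>i\<le>6. lc i x * LF (lv i) y) = LF x y"
 using fr.expand[of x] fr.B_vec_x[of y "%j. eta j * LF x (lv j)"] by (simp add: lc_def)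

sublocale B1: based "of_int :: int => 'k" "lattice_L R e" "{..6}" lv lc
proof unfold_locales
 show "f x = (\<Sum>j\<le>6. of_int (lc j x) * f (lv j))" if "x \<in> LL" "linear_along of_int (lattice_L R e) f" for x and f :: "int \<times> 'v => 'k"
 using linear_along_sum[where v = lv and c = "%j. lc j x" and I = "{..6::nat}", OF that(2)] lc_expand[OF that(1)] pt_in by simp
 show "LF z (x + y) = LF z x + LF z y" if "x \<in> LL" "y \<in> LL" "z \<in> LL" for x y z using that by (rule LF_addR)
 show "LF z (LZ a x) = a * LF z x" if "x \<in> LL" "z \<in> LL" for x z a using that by (rule LF_zmR)
 show "lc i (lv j) = (if i = j then 1 else 0)" if "i \<in> {..6}" "j \<in> {..6}" for i j
 using that fr.B_l[of j i] by (simp add: lc_def eta_sq)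
qed (auto simp: pt_in lc_def B_add B_zm algebra_simps)

abbreviation Q7 where "Q7 \<equiv> q7 R e :: ('k, (int \<times> 'v => 'k) => 'k) form_module"
abbreviation E where "E j \<equiv> unit_tensor (of_int :: int => 'k) (lattice_L R e) (lv j)"
abbreviation cE where "cE j \<equiv> %X :: (int \<times> 'v => 'k) => 'k. X (%x. of_int (lc j x))"

lemma Q7_carr: "carr Q7 = B1.BC" "scal Q7 = fscale" by (simp_all add: q7_def base_change_def)

lemma B1_expand: "X \<in> B1.BC ==> X = (\<Sum>j\<le>6. fscale (cE j X) (E j))"
 by (rule ext) (subst B1.bc_apply, auto simp: sum_fun_apply fscale_def)

sublocale B2: based \<iota> Q7 "{..6}" E cE
proof unfold_locales
 show "f X = (\<Sum>j\<le>6. \<iota> (cE j X) * f (E j))" if "X \<in> carr Q7" "linear_along \<iota> Q7 f" for X and f :: "((int \<times> 'v => 'k) => 'k) => 's"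
 proof -
 have "f (\<Sum>j\<le>6. scal Q7 (cE j X) (E j)) = (\<Sum>j\<le>6. \<iota> (cE j X) * f (E j))"
 using linear_along_sum[where v = E and c = "%j. cE j X" and I = "{..6::nat}", OF that(2)] B1.ut_in pt_in
 by (simp add: Q7_carr B1.BC_closed)
 thus ?thesis using B1_expand[of X] that(1) by (simp add: Q7_carr)
 qed
 show "cE i (E j) = (if i = j then 1 else 0)" if "i \<in> {..6}" "j \<in> {..6}" for i j
 using that B1.co_ut[of i "lv j"] B1.c_b[of i j] pt_in by simp
 show "form Q7 Z (X + Y) = form Q7 Z X + form Q7 Z Y" if "X \<in> carr Q7" "Y \<in> carr Q7" "Z \<in> carr Q7" for X Y Z
 using that unfolding Q7_carr q7_def by (simp add: B1.bc_form B1.BC_closed algebra_simps sum.distrib)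
 show "form Q7 Z (scal Q7 a X) = a * form Q7 Z X" if "X \<in> carr Q7" "Z \<in> carr Q7" for X Z a
 using that B1.bc_form[of Z "fscale a X"] B1.bc_form[of Z X] B1.BC_closed(2)[of X a]
 unfolding Q7_carr unfolding q7_def by (simp add: fscale_def sum_distrib_left algebra_simps)
qed (auto simp: \<iota>_hom Q7_carr B1.BC_closed B1.ut_in pt_in, simp_all add: q7_def base_change_def fscale_def)

text \<open>The identification of the twofold base change, from the integers to \<open>k\<close> and
  then to the separable closure, with additive maps on the lattice. Under it, being fixed by the
  twisted action becomes membership in \<open>A.V7\<close>.\<close>

definition pU :: "((((int \<times> 'v => 'k) => 'k) => 's) => 's) => int \<times> 'v => 's" where
 "pU U = (%z. if z \<in> LL then \<Sum>j\<le>6. B2.co U j * of_int (LF (lv j) z) else 0)"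

definition bt :: "(int \<times> 'v => 's) => (int \<times> 'v => 's) => 's" where "bt = A.b7 lv"

lemma pU_LF: "pU U \<in> A.LF"
 unfolding A.LF_def mem_Collect_eq
proof (intro conjI allI impI ballI)
 show "pU U x = 0" if "x \<notin> LL" for x using that by (simp add: pU_def)
 show "pU U (x + y) = pU U x + pU U y" if "x \<in> LL" "y \<in> LL" for x y
 using that by (simp add: pU_def LF_addR pt_in distrib_left sum.distrib)
 show "pU U (LZ m x) = of_int m * pU U x" if "x \<in> LL" for x m
 using that by (simp add: pU_def LF_zmR pt_in sum_distrib_left mult.left_commute)
qed

lemma pU_l: "j \<le> 6 ==> pU U (lv j) = B2.co U j * of_int (eta j)"
proof -
 assume j: "j \<le> 6"
 have "pU U (lv j) = (\<Sum>i\<le>6. if i = j then B2.co U j * of_int (eta j) else 0)"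
 unfolding pU_def using pt_in by (simp only: if_True) (intro sum.cong HOL.refl, use fr.B_l[OF _ j] in auto)
 thus ?thesis using j by simp
qed

lemma pU_add: "pU (U + V) = pU U + pU V" and pU_scale: "pU (fscale a U) = fscale a (pU U)" and pU_0: "pU 0 = 0"
 by (auto simp: pU_def fscale_def fun_eq_iff sum.distrib algebra_simps sum_distrib_left)

lemma pU_inj: "U \<in> B2.BC ==> V \<in> B2.BC ==> pU U = pU V ==> U = V"
proof (rule B2.bc_eq)
 fix j assume e: "pU U = pU V" and "j \<in> {..6::nat}"
 hence j: "j \<le> 6" by simp
 have "B2.co U j * of_int (eta j) = B2.co V j * of_int (eta j)"
 using pU_l[OF j, of U] pU_l[OF j, of V] unfolding e by (rule trans[OF sym])
 moreover have "(of_int (eta j) :: 's) ~= 0" by (simp add: eta_def)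
 ultimately show "B2.co U j = B2.co V j" by (metis mult_right_cancel)
qed

lemma pU_surj: assumes "p \<in> A.LF" obtains U where "U \<in> B2.BC" "pU U = p"
proof (rule that[OF B2.mk_in])
 show "pU (B2.mk (%j. of_int (eta j) * p (lv j))) = p"
 proof
 fix z
 show "pU (B2.mk (%j. of_int (eta j) * p (lv j))) z = p z"
 proof (cases "z \<in> LL")
 case True
 have "pU (B2.mk (%j. of_int (eta j) * p (lv j))) z = (\<Sum>j\<le>6. of_int (eta j) * of_int (LF z (lv j)) * p (lv j))"
 unfolding pU_def using True B_sym[OF pt_in True] by (auto simp: B2.co_mk intro!: sum.cong)
 thus ?thesis using A.LF_expand[OF frame_pt assms True] by simp
 next
 case False
 moreover have "p z = 0" using assms False unfolding A.LF_def by blast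
 ultimately show ?thesis by (simp add: pU_def)
 qed
 qed
qed

lemma form_E: assumes "i \<le> 6" "j \<le> 6" shows "form Q7 (E i) (E j) = (if i = j then of_int (eta i) else 0)"
proof -
 have "form Q7 (E i) (E j) = (of_int (LF (lv i) (lv j)) :: 'k)"
 unfolding q7_def by (intro form_base_change) (simp_all add: linear_along_def B_add B_zm LF_addR LF_zmR pt_in)
 thus ?thesis using fr.B_l[OF assms] by simp
qed

lemma form_bt: assumes "U \<in> B2.BC" "V \<in> B2.BC" shows "form (base_change \<iota> Q7) U V = bt (pU U) (pU V)"
proof -
 have "form (base_change \<iota> Q7) U V = (\<Sum>i\<le>6. \<Sum>j\<le>6. if j = i then B2.co U i * B2.co V i * of_int (eta i) else 0)"
 unfolding B2.bc_form[OF assms] by (intro sum.cong HOL.refl) (auto simp: form_E \<iota>_of_int \<iota>_0)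
 also have "\<dots> = (\<Sum>i\<le>6. B2.co U i * B2.co V i * of_int (eta i))" by simp
 also have "\<dots> = bt (pU U) (pU V)"
 unfolding bt_def A.b7_def
 proof (intro sum.cong HOL.refl)
 fix j assume "j \<in> {..6::nat}"
 moreover have "(of_int (eta j) :: 's) * of_int (eta j) = 1" by (simp add: eta_def)
 ultimately show "B2.co U j * B2.co V j * of_int (eta j) = of_int (eta j) * pU U (lv j) * pU V (lv j)"
 by (simp add: pU_l)
 qed
 finally show ?thesis .
qed

lemma linear_act: assumes "\<mu> \<in> \<Gamma>"
 shows "linear_along (of_int :: int => 'k) (lattice_L R e) (f \<circ> act \<mu>) \<longleftrightarrow> linear_along of_int (lattice_L R e) f"
proof -
 obtain \<delta> where d: "\<delta> \<in> \<Gamma>" "\<forall>x. act \<mu> (act \<delta> x) = x" "\<forall>x. act \<delta> (act \<mu> x) = x" "inv (\<phi> \<mu>) = \<phi> \<delta>" "inv (\<phi> \<delta>) = \<phi> \<mu>"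
 by (rule \<Gamma>_inv[OF assms])
 have 1: "linear_along (of_int :: int => 'k) (lattice_L R e) (f \<circ> act \<mu>)"
 if "\<mu> \<in> \<Gamma>" "linear_along of_int (lattice_L R e) f" for \<mu> and f :: "int \<times> 'v => 'k"
 using that A.g_in[OF that(1)] by (simp add: linear_along_def A.g_add A.g_zm)
 have e: "f \<circ> act \<mu> \<circ> act \<delta> = f" using d(2) by (simp add: fun_eq_iff)
 show ?thesis using 1[OF assms] 1[OF d(1), of "f \<circ> act \<mu>"] unfolding e by blast
qed

lemma bcm_in: assumes g: "\<mu> \<in> \<Gamma>" and X: "X \<in> carr Q7" shows "base_change_map (act \<mu>) X \<in> carr Q7"
proof -
 have "base_change_map (act \<mu>) X = (\<Sum>j\<le>6. fscale (cE j X) (unit_tensor of_int (lattice_L R e) (act \<mu> (lv j))))"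
 proof
 fix f
 have "base_change_map (act \<mu>) X f = (\<Sum>j\<le>6. cE j X * E j (f \<circ> act \<mu>))"
 unfolding base_change_map_def using B1.bc_apply X by (simp add: Q7_carr)
 thus "base_change_map (act \<mu>) X f = (\<Sum>j\<le>6. fscale (cE j X) (unit_tensor of_int (lattice_L R e) (act \<mu> (lv j)))) f"
 by (simp add: sum_fun_apply fscale_def unit_tensor_def linear_act[OF g] cong: if_cong)
 qed
 thus ?thesis using A.g_in[OF g] pt_in by (simp add: Q7_carr B1.BC_sum B1.BC_closed B1.ut_in)
qed

lemma gal_pU:
 assumes g: "\<mu> \<in> \<Gamma>" and U: "U \<in> B2.BC"
 defines "U' \<equiv> galois_act \<mu> (base_change_map (base_change_map (act \<mu>)) U)"
 shows "U' \<in> B2.BC" "z \<in> LL ==> pU U' (act \<mu> z) = \<mu> (pU U z)"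
proof -
 obtain \<delta> where d: "\<delta> \<in> \<Gamma>" "\<forall>x. act \<mu> (act \<delta> x) = x" "\<forall>x. act \<delta> (act \<mu> x) = x" "inv (\<phi> \<mu>) = \<phi> \<delta>" "inv (\<phi> \<delta>) = \<phi> \<mu>"
 by (rule \<Gamma>_inv[OF g])
 have "act \<mu> \<circ> act \<delta> = id" "act \<delta> \<circ> act \<mu> = id" using d(2,3) by (simp_all add: fun_eq_iff)
 hence bb: "base_change_map (act \<mu>) (base_change_map (act \<delta>) X) = X" "base_change_map (act \<delta>) (base_change_map (act \<mu>) X) = X"
 for X :: "(int \<times> 'v => 'k) => 'k"
 by (simp_all add: base_change_map_def comp_assoc)
 note T = twist_coord[of \<iota> Q7 "{..6}" E cE \<mu> U "base_change_map (act \<mu>)" "base_change_map (act \<delta>)", OF B2.based_axioms g U]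
 have a: "base_change_map (act \<mu>) (X + Y) = base_change_map (act \<mu>) X + base_change_map (act \<mu>) Y"
 "base_change_map (act \<mu>) (scal Q7 a X) = scal Q7 a (base_change_map (act \<mu>) X)" for X Y :: "(int \<times> 'v => 'k) => 'k" and a
 by (simp_all add: base_change_map_def Q7_carr fscale_def fun_eq_iff)
 show "U' \<in> B2.BC" unfolding U'_def by (rule T(1)) (simp_all add: bcm_in g d(1) a bb)
 have co: "B2.co U' i = (\<Sum>j\<le>6. \<mu> (B2.co U j) * of_int (lc i (act \<mu> (lv j))))" if i: "i \<in> {..6}" for i
 proof -
 have "B2.co U' i = (\<Sum>j\<le>6. \<mu> (B2.co U j) * \<iota> (cE i (base_change_map (act \<mu>) (E j))))"
 unfolding U'_def by (rule T(2)[OF _ _ _ _ _ _ i]) (simp_all add: bcm_in g d(1) a bb)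
 also have "\<dots> = (\<Sum>j\<le>6. \<mu> (B2.co U j) * of_int (lc i (act \<mu> (lv j))))"
 proof (intro sum.cong HOL.refl)
 fix j
 have "linear_along (of_int :: int => 'k) (lattice_L R e) ((%x. of_int (lc i x)) \<circ> act \<mu>)"
 using B1.lin_c[OF i] linear_act[OF g] by blast
 thus "\<mu> (B2.co U j) * \<iota> (cE i (base_change_map (act \<mu>) (E j))) = \<mu> (B2.co U j) * of_int (lc i (act \<mu> (lv j)))"
 by (simp add: base_change_map_def unit_tensor_def \<iota>_of_int)
 qed
 finally show ?thesis .
 qed
 show "pU U' (act \<mu> z) = \<mu> (pU U z)" if z: "z \<in> LL"
 proof -
 have az: "act \<mu> z \<in> LL" by (rule A.g_in[OF g z])
 have "pU U' (act \<mu> z) = (\<Sum>i\<le>6. \<Sum>j\<le>6. \<mu> (B2.co U j) * (of_int (lc i (act \<mu> (lv j))) * of_int (LF (lv i) (act \<mu> z))))"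
 unfolding pU_def using az by (simp add: co sum_distrib_right mult.assoc)
 also have "\<dots> = (\<Sum>j\<le>6. \<mu> (B2.co U j) * of_int (\<Sum>i\<le>6. lc i (act \<mu> (lv j)) * LF (lv i) (act \<mu> z)))"
 by (subst sum.swap) (simp add: sum_distrib_left)
 also have "\<dots> = (\<Sum>j\<le>6. \<mu> (B2.co U j) * of_int (LF (lv j) z))"
 using lc_pair[OF A.g_in[OF g pt_in] az] A.g_B[OF g pt_in z] by simp
 also have "\<dots> = \<mu> (pU U z)" unfolding pU_def using z g by (simp add: A.hom_sum A.hom_simps)
 finally show ?thesis .
 qed
qed

abbreviation T7 where "T7 \<equiv> q7_twist \<iota> R e \<phi>"

lemma T7_iff: "U \<in> carr T7 \<longleftrightarrow> U \<in> B2.BC & pU U \<in> A.V7"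
proof -
 have c: "U \<in> carr T7 \<longleftrightarrow> U \<in> B2.BC & (\<forall>\<mu>\<in>\<Gamma>. galois_act \<mu> (base_change_map (base_change_map (act \<mu>)) U) = U)"
 by (simp add: q7_twist_def twist_def)
 have "galois_act \<mu> (base_change_map (base_change_map (act \<mu>)) U) = U \<longleftrightarrow> (\<forall>x\<in>LL. pU U (act \<mu> x) = \<mu> (pU U x))"
 if U: "U \<in> B2.BC" and g: "\<mu> \<in> \<Gamma>" for \<mu>
 proof
 assume "galois_act \<mu> (base_change_map (base_change_map (act \<mu>)) U) = U"
 thus "\<forall>x\<in>LL. pU U (act \<mu> x) = \<mu> (pU U x)" using gal_pU(2)[OF g U] by simp
 next
 assume a: "\<forall>x\<in>LL. pU U (act \<mu> x) = \<mu> (pU U x)"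
 obtain \<delta> where d: "\<delta> \<in> \<Gamma>" "\<forall>x. act \<mu> (act \<delta> x) = x" "\<forall>x. act \<delta> (act \<mu> x) = x" "inv (\<phi> \<mu>) = \<phi> \<delta>" "inv (\<phi> \<delta>) = \<phi> \<mu>"
 by (rule \<Gamma>_inv[OF g])
 show "galois_act \<mu> (base_change_map (base_change_map (act \<mu>)) U) = U"
 proof (rule pU_inj[OF gal_pU(1)[OF g U] U], rule ext)
 fix z
 show "pU (galois_act \<mu> (base_change_map (base_change_map (act \<mu>)) U)) z = pU U z"
 proof (cases "z \<in> LL")
 case True
 hence z: "act \<delta> z \<in> LL" by (rule A.g_in[OF d(1)])
 show ?thesis using gal_pU(2)[OF g U z] bspec[OF a z] by (simp only: spec[OF d(2), of z])
 qed (simp add: pU_def)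
 qed
 qed
 thus ?thesis unfolding c A.V7_def using pU_LF by blast
qed

text \<open>That \<open>inv \<iota>\<close> is applied to an element of the range of \<iota> is
  known only after \<open>fixed_field\<close>.\<close>

lemma T7_form: "U \<in> carr T7 ==> V \<in> carr T7 ==> form T7 U V = inv \<iota> (bt (pU U) (pU V))"
 using form_bt by (simp add: T7_iff) (simp add: q7_twist_def twist_def)

lemma T7_surj: assumes "p \<in> A.V7" obtains U where "U \<in> carr T7" "pU U = p"
 using pU_surj[of p] assms T7_iff by (auto simp: A.V7_def)

lemma lines_finite: "finite lines" and lines_L: "y \<in> lines ==> y \<in> LL"
 using fr.finite_lines by (simp_all add: lines_def)

definition kU :: "(((int \<times> 'v => 'k) => 's) => 's) => int \<times> 'v => 's" where
 "kU U = (%y. if y \<in> lines then U (%x. \<iota> (x y)) else 0)"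

abbreviation Q27 where "Q27 \<equiv> q27 R e :: ('k, int \<times> 'v => 'k) form_module"

lemma Q27_simps: "carr Q27 = {x. \<forall>y. y \<notin> lines --> x y = 0}" "scal Q27 = fscale" "form Q27 x x' = (\<Sum>y\<in>lines. x y * x' y)"
 by (simp_all add: q27_def lines_eq)

sublocale B3: based \<iota> Q27 lines udelta "%y x. x y"
proof unfold_locales
 show "f x = (\<Sum>y\<in>lines. \<iota> (x y) * f (udelta y))" if x: "x \<in> carr Q27" and f: "linear_along \<iota> Q27 f" for x and f :: "(int \<times> 'v => 'k) => 's"
 proof -
 have "x z = (\<Sum>y\<in>lines. fscale (x y) (udelta y)) z" for z
 proof -
 have "(\<Sum>y\<in>lines. fscale (x y) (udelta y)) z = (\<Sum>y\<in>lines. if y = z then x z else 0)"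
 unfolding sum_fun_apply by (intro sum.cong) (auto simp: fscale_def udelta_def)
 moreover have "x z = 0" if "z \<notin> lines" using x that unfolding Q27_simps by blast
 ultimately show ?thesis using lines_finite by auto
 qed
 hence e: "x = (\<Sum>y\<in>lines. scal Q27 (x y) (udelta y))" unfolding Q27_simps by (rule ext)
 have ne: "lines ~= {}" using fr.card_lines by force
 have v: "udelta y \<in> carr Q27" if "y \<in> lines" for y using that unfolding Q27_simps udelta_def by auto
 have "f (\<Sum>y\<in>lines. scal Q27 (x y) (udelta y)) = (\<Sum>y\<in>lines. \<iota> (x y) * f (udelta y))"
 by (rule conjunct1[OF linear_along_sum[where v = udelta and c = "%y. x y", OF f lines_finite ne v]])
 (simp_all add: Q27_simps fscale_def)
 thus ?thesis unfolding e[symmetric] .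
 qed
qed (auto simp: \<iota>_hom Q27_simps fscale_def udelta_def lines_finite algebra_simps sum.distrib sum_distrib_left)

lemma gal_kU:
 assumes g: "\<mu> \<in> \<Gamma>" and U: "U \<in> B3.BC"
 defines "U' \<equiv> galois_act \<mu> (base_change_map (perm_act (\<phi> \<mu>)) U)"
 shows "U' \<in> B3.BC" "y \<in> lines ==> kU U' (act \<mu> y) = \<mu> (kU U y)"
proof -
 obtain \<delta> where d: "\<delta> \<in> \<Gamma>" "\<forall>x. act \<mu> (act \<delta> x) = x" "\<forall>x. act \<delta> (act \<mu> x) = x" "inv (\<phi> \<mu>) = \<phi> \<delta>" "inv (\<phi> \<delta>) = \<phi> \<mu>"
 by (rule \<Gamma>_inv[OF g])
 note T = twist_coord[of \<iota> Q27 lines udelta "%y x. x y" \<mu> U "perm_act (\<phi> \<mu>)" "perm_act (\<phi> \<delta>)", OF B3.based_axioms g U]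
 have L: "act \<mu> y \<in> lines \<longleftrightarrow> y \<in> lines" "act \<delta> y \<in> lines \<longleftrightarrow> y \<in> lines" for y
 using A.g_lines[OF g] A.g_lines[OF d(1)] d(2,3) by metis+
 have p: "perm_act (\<phi> \<mu>) x = (%y. x (act \<delta> y))" "perm_act (\<phi> \<delta>) x = (%y. x (act \<mu> y))" for x :: "int \<times> 'v => 'k"
 by (simp_all add: perm_act_def d)
 have pc: "perm_act (\<phi> \<mu>) x \<in> carr Q27" "perm_act (\<phi> \<delta>) x \<in> carr Q27" if "x \<in> carr Q27" for x
 using that L unfolding Q27_simps p mem_Collect_eq by blast+
 have pa: "perm_act (\<phi> \<mu>) (x + x') = perm_act (\<phi> \<mu>) x + perm_act (\<phi> \<mu>) x'"
 "perm_act (\<phi> \<mu>) (scal Q27 a x) = scal Q27 a (perm_act (\<phi> \<mu>) x)"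
 "perm_act (\<phi> \<mu>) (perm_act (\<phi> \<delta>) x) = x" "perm_act (\<phi> \<delta>) (perm_act (\<phi> \<mu>) x) = x" for x x' :: "int \<times> 'v => 'k" and a
 by (rule ext, simp add: p Q27_simps fscale_def d(2,3))+
 show "U' \<in> B3.BC" unfolding U'_def by (rule T(1)) (simp_all add: pc pa)
 have co: "B3.co U' i = (\<Sum>j\<in>lines. \<mu> (B3.co U j) * \<iota> (perm_act (\<phi> \<mu>) (udelta j) i))" if i: "i \<in> lines" for i
 unfolding U'_def by (rule T(2)[OF _ _ _ _ _ _ i]) (simp_all add: pc pa)
 show "kU U' (act \<mu> y) = \<mu> (kU U y)" if y: "y \<in> lines"
 proof -
 have "B3.co U' (act \<mu> y) = (\<Sum>j\<in>lines. if j = y then \<mu> (B3.co U y) else 0)"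
 using co[of "act \<mu> y"] y L by (auto simp: p udelta_def d(3) \<iota>_hom \<iota>_0 intro!: sum.cong)
 thus ?thesis using y L lines_finite by (simp add: kU_def)
 qed
qed

abbreviation T27 where "T27 \<equiv> q27_twist \<iota> R e \<phi>"
abbreviation tw27 where "tw27 \<equiv> tw \<Gamma> lines act (%_ _. 1 :: 's)"

lemma kU_inj: "U \<in> B3.BC ==> V \<in> B3.BC ==> kU U = kU V ==> U = V"
 by (rule B3.bc_eq) (auto simp: kU_def fun_eq_iff split: if_splits)

lemma T27_iff: "U \<in> carr T27 \<longleftrightarrow> U \<in> B3.BC & kU U \<in> tw27"
proof -
 have c: "U \<in> carr T27 \<longleftrightarrow> U \<in> B3.BC & (\<forall>\<mu>\<in>\<Gamma>. galois_act \<mu> (base_change_map (perm_act (\<phi> \<mu>)) U) = U)"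
 by (simp add: q27_twist_def twist_def)
 have "galois_act \<mu> (base_change_map (perm_act (\<phi> \<mu>)) U) = U \<longleftrightarrow> (\<forall>x\<in>lines. kU U (act \<mu> x) = \<mu> (kU U x))"
 if U: "U \<in> B3.BC" and g: "\<mu> \<in> \<Gamma>" for \<mu>
 proof
 assume "galois_act \<mu> (base_change_map (perm_act (\<phi> \<mu>)) U) = U"
 thus "\<forall>x\<in>lines. kU U (act \<mu> x) = \<mu> (kU U x)" using gal_kU(2)[OF g U] by simp
 next
 assume a: "\<forall>x\<in>lines. kU U (act \<mu> x) = \<mu> (kU U x)"
 obtain \<delta> where d: "\<delta> \<in> \<Gamma>" "\<forall>x. act \<mu> (act \<delta> x) = x" "\<forall>x. act \<delta> (act \<mu> x) = x" "inv (\<phi> \<mu>) = \<phi> \<delta>" "inv (\<phi> \<delta>) = \<phi> \<mu>"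
 by (rule \<Gamma>_inv[OF g])
 show "galois_act \<mu> (base_change_map (perm_act (\<phi> \<mu>)) U) = U"
 proof (rule kU_inj[OF gal_kU(1)[OF g U] U], rule ext)
 fix z
 show "kU (galois_act \<mu> (base_change_map (perm_act (\<phi> \<mu>)) U)) z = kU U z"
 proof (cases "z \<in> lines")
 case True
 hence z: "act \<delta> z \<in> lines" by (rule A.g_lines[OF d(1)])
 show ?thesis using gal_kU(2)[OF g U z] bspec[OF a z] by (simp only: spec[OF d(2), of z])
 qed (simp add: kU_def)
 qed
 qed
 hence "U \<in> carr T27 \<longleftrightarrow> U \<in> B3.BC & (\<forall>\<mu>\<in>\<Gamma>. \<forall>x\<in>lines. kU U (act \<mu> x) = \<mu> (kU U x))"
 unfolding c by blast
 moreover have "kU U x = 0" if "x \<notin> lines" for x using that by (simp add: kU_def)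
 ultimately show ?thesis unfolding tw_def fset_def mem_Collect_eq mult_1_left by blast
qed

lemma T27_form: "U \<in> carr T27 ==> V \<in> carr T27 ==> form T27 U V = inv \<iota> (bil lines (kU U) (kU V))"
proof -
 assume a: "U \<in> carr T27" "V \<in> carr T27"
 hence BC: "U \<in> B3.BC" "V \<in> B3.BC" by (simp_all add: T27_iff)
 have "form (base_change \<iota> Q27) U V = (\<Sum>i\<in>lines. \<Sum>j\<in>lines. if j = i then B3.co U i * B3.co V i else 0)"
 unfolding B3.bc_form[OF BC]
 proof (intro sum.cong HOL.refl)
 fix i j assume ij: "i \<in> lines" "j \<in> lines"
 have "form Q27 (udelta i) (udelta j) = (\<Sum>y\<in>lines. if y = i then (if j = i then 1 else 0) else 0)"
 unfolding Q27_simps by (intro sum.cong) (auto simp: udelta_def)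
 thus "B3.co U i * B3.co V j * \<iota> (form Q27 (udelta i) (udelta j)) = (if j = i then B3.co U i * B3.co V i else 0)"
 using ij lines_finite by (simp add: \<iota>_hom \<iota>_0)
 qed
 also have "\<dots> = bil lines (kU U) (kU V)" using lines_finite by (simp add: wbil_def kU_def)
 finally show ?thesis by (simp add: q27_twist_def twist_def)
qed

lemma T27_surj: assumes "f \<in> tw27" obtains U where "U \<in> carr T27" "kU U = f"
proof -
 have "kU (B3.mk f) = f" using assms by (auto simp: kU_def fun_eq_iff B3.co_mk tw_def fset_def)
 thus ?thesis using that[of "B3.mk f"] B3.mk_in assms by (simp add: T27_iff)
qed

lemma kU_add: "kU (U + V) = kU U + kU V" and kU_scale: "kU (fscale a U) = fscale a (kU U)" and kU_0: "kU 0 = 0"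
 by (auto simp: kU_def fscale_def fun_eq_iff)

end

section \<open>Nondegeneracy of the twisted form of rank 7, and the fixed field\<close>

context twisted begin

lemma sact27: "sact \<Gamma> S lines act (%_ _. 1 :: 's)"
 by (rule A.sact_lines[OF frame_pt])

text \<open>Descent for the permutation module of the lines is used. If \<open>g\<close> is a
  twisted function on the lines, the sum of \<open>g y\<close> times the image of \<open>y\<close>
  lies in \<open>A.V7\<close>. Hence the restriction of \<open>p\<close> to the lines is orthogonal
  to all such \<open>g\<close> and vanishes; since the lines generate the lattice,
  \<open>p = 0\<close>.\<close>

lemma V7_nondegenerate:
 assumes p: "p \<in> A.LF" and z: "!!q. q \<in> A.V7 ==> bt p q = 0"
 shows "p = 0"
proof -
 interpret s: sact \<Gamma> S lines act "%_ _. 1 :: 's" by (rule sact27)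
 define f where "f y = (if y \<in> lines then p y else 0)" for y
 have "bil lines f g = 0" if g: "g \<in> tw27" for g
 proof -
 define q where "q x = (\<Sum>y\<in>lines. g y * A.fn y x)" for x
 have fn: "A.fn y \<in> A.LF" if "y \<in> lines" for y using A.fn_LF lines_L that by blast
 have "q \<in> A.LF" unfolding A.LF_def mem_Collect_eq
 proof (intro conjI allI impI ballI)
 show "q x = 0" if "x \<notin> LL" for x using that by (simp add: q_def A.fn_def)
 show "q (x + y) = q x + q y" if "x \<in> LL" "y \<in> LL" for x y
 proof -
 have "q (x + y) = (\<Sum>w\<in>lines. g w * A.fn w x + g w * A.fn w y)"
 unfolding q_def using fn that by (intro sum.cong HOL.refl) (simp add: A.LF_def distrib_left)
 thus ?thesis by (simp add: q_def sum.distrib)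
 qed
 show "q (LZ m x) = of_int m * q x" if "x \<in> LL" for x m
 proof -
 have "q (LZ m x) = (\<Sum>w\<in>lines. of_int m * (g w * A.fn w x))"
 unfolding q_def using fn that by (intro sum.cong HOL.refl) (simp add: A.LF_def)
 thus ?thesis by (simp add: q_def sum_distrib_left)
 qed
 qed
 moreover have "q (act \<mu> x) = \<mu> (q x)" if c: "\<mu> \<in> \<Gamma>" and x: "x \<in> LL" for \<mu> x
 proof -
 have "q (act \<mu> x) = (\<Sum>y\<in>lines. g (act \<mu> y) * A.fn (act \<mu> y) (act \<mu> x))"
 unfolding q_def by (rule sum.reindex_bij_betw[OF s.\<rho>_bij[OF c], symmetric])
 also have "\<dots> = (\<Sum>y\<in>lines. \<mu> (g y * A.fn y x))"
 using c x A.g_in[OF c x] lines_L by (intro sum.cong HOL.refl) (simp add: twD(2)[OF g c] A.fn_def A.g_B A.hom_simps)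
 finally show ?thesis using c by (simp add: q_def A.hom_sum)
 qed
 ultimately have "q \<in> A.V7" by (simp add: A.V7_def)
 hence "bt p q = 0" by (rule z)
 moreover have "bt p q = (\<Sum>y\<in>lines. g y * bt p (A.fn y))"
 unfolding bt_def A.b7_def q_def sum_distrib_left by (subst sum.swap) (intro sum.cong HOL.refl, simp add: mult_ac)
 moreover have "bt p (A.fn y) = p y" if "y \<in> lines" for y
 unfolding bt_def using A.b7_fn[OF frame_pt p lines_L[OF that]] A.b7_sym by simp
 ultimately have "(\<Sum>y\<in>lines. g y * p y) = 0" by simp
 thus ?thesis by (simp add: wbil_def f_def mult.commute)
 qed
 hence "f = 0" by (intro s.descent_nondegenerate) (simp_all add: f_def fset_def)
 hence pl: "p y = 0" if "y \<in> lines" for y using that by (metis f_def zero_fun_apply)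
 have p1: "p (lv j) = 0" if "j \<in> {1..6}" for j
 proof (rule pl)
 have "LF (3, 0) (lv j) = 1" "LF (lv j) (lv j) = -1"
 using fr.B_h_l[of j] fr.B_l[of j j] that by (auto simp: eta_def hcoord_def)
 thus "lv j \<in> lines" using pt_in by (simp add: lines_def)
 qed
 \<comment> \<open>The line l_0 - l_1 - l_2, which together with the exceptional curves yields
   l_0.\<close>
 define c where "c = (%j::nat. if j = 0 then 1 else if j \<le> 2 then -1 else 0 :: int)"
 have "vec lv c \<in> lines"
 using fr.vec_in by (simp add: lines_def fr.B_h_vec fr.B_vec sum7 c_def eta_def hcoord_def)
 hence "p (vec lv c) = 0" by (rule pl)
 moreover have "p (vec lv c) = (\<Sum>j\<le>6. of_int (c j) * p (lv j))"
 unfolding A.LF_expand[OF frame_pt p fr.vec_in]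
 proof (intro sum.cong HOL.refl)
 fix j :: nat assume "j \<in> {..6}"
 hence "eta j * LF (vec lv c) (lv j) = c j" using fr.B_vec_l[of j c] by (simp add: eta_sq mult.assoc[symmetric])
 thus "of_int (eta j) * of_int (LF (vec lv c) (lv j)) * p (lv j) = of_int (c j) * p (lv j)"
 by (metis of_int_mult)
 qed
 ultimately have "p (lv 0) = 0" using p1 unfolding sum7 by (simp add: c_def)
 hence p0: "p (lv j) = 0" if "j \<in> {..6}" for j using p1[of j] that by (cases "j = 0") auto
 show ?thesis
 proof
 fix x show "p x = 0 x"
 proof (cases "x \<in> LL")
 case True
 thus ?thesis using A.LF_expand[OF frame_pt p True] p0 by simp
 next
 case False
 thus ?thesis using p unfolding A.LF_def by (metis (mono_tags, lifting) mem_Collect_eq zero_fun_apply)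
 qed
 qed
qed

text \<open>Galois descent shows only that the form on the twist takes values in the fixed field of \<open>\<Gamma>\<close>. If
  this were larger than \<open>\<iota>(k)\<close>, then the form obtained with \<open>inv \<iota>\<close>, which is constant outside the
  range, would not be additive.\<close>

lemma fixed_field:
 assumes add: "!!U U' V. U \<in> carr T7 ==> U' \<in> carr T7 ==> V \<in> carr T7 ==> form T7 (U + U') V = form T7 U V + form T7 U' V"
 shows "fixf \<Gamma> = range \<iota>"
proof
 show "range \<iota> <= fixf \<Gamma>" by (auto simp: fixf_def galois_group_def)
 interpret v: qsp "fixf \<Gamma>" A.V7 fscale bt unfolding bt_def by (rule A.qsp_V7[OF frame_pt])
 show "fixf \<Gamma> <= range \<iota>"
 proof (rule ccontr)
 assume "~ fixf \<Gamma> <= range \<iota>"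
 then obtain x where x: "x \<in> fixf \<Gamma>" "x \<notin> range \<iota>" by blast
 have hV: "A.fn (3, 0) \<in> A.V7"
 proof -
 have "LF (3, 0) (act \<mu> z) = LF (3, 0) z" if "\<mu> \<in> \<Gamma>" "z \<in> LL" for \<mu> z
 using A.g_B[OF that(1) fr.h_in that(2)] A.g_h[OF that(1)] by simp
 thus ?thesis using A.fn_LF[OF fr.h_in] A.g_in by (auto simp: A.V7_def A.fn_def A.hom_of_int)
 qed
 have "A.fn (3, 0) (lv 1) = 1" using fr.B_h_l[of 1] pt_in by (simp add: A.fn_def eta_def hcoord_def)
 hence "A.fn (3, 0) ~= 0" by (metis zero_fun_apply zero_neq_one)
 then obtain q where q: "q \<in> A.V7" "bt (A.fn (3, 0)) q ~= 0"
 using V7_nondegenerate[OF A.fn_LF[OF fr.h_in]] by blast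
 define c where "c = inverse (bt (A.fn (3, 0)) q)"
 have c: "c \<in> fixf \<Gamma>" using hV q(1) by (simp add: c_def)
 \<comment> \<open>Scaled so that the values of the form below are 1, \<open>x\<close> and
   \<open>1 + x\<close>.\<close>
 define w where "w = fscale c (A.fn (3, 0))"
 have b: "bt w q = 1" using hV q c by (simp add: c_def w_def)
 have V: "w \<in> A.V7" using hV c by (simp add: w_def)
 obtain U where U: "U \<in> carr T7" "pU U = w" by (rule T7_surj[OF V])
 obtain V where V': "V \<in> carr T7" "pU V = q" by (rule T7_surj[OF q(1)])
 obtain U' where U': "U' \<in> carr T7" "pU U' = fscale x (pU U)"
 by (rule T7_surj[of "fscale x (pU U)"]) (simp only: U(2) v.Vsc[OF x(1) V])
 have UU: "U + U' \<in> carr T7" using U U' V by (simp add: T7_iff B2.BC_closed pU_add x(1))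
 have "form T7 (U + U') V = inv \<iota> (1 + x)" "form T7 U V = inv \<iota> 1" "form T7 U' V = inv \<iota> x"
 using T7_form[OF UU V'(1)] T7_form[OF U(1) V'(1)] T7_form[OF U'(1) V'(1)] V q(1) x(1) b
 by (simp_all add: pU_add U(2) U'(2) V'(2))
 hence e: "inv \<iota> (1 + x) = inv \<iota> 1 + inv \<iota> x" using add[OF U(1) U'(1) V'(1)] by simp
 have "1 + x \<notin> range \<iota>"
 proof
 assume "1 + x \<in> range \<iota>"
 then obtain y where "1 + x = \<iota> y" by blast
 hence "x = \<iota> (y + - 1)" by (simp only: \<iota>_hom \<iota>_neg) (metis add_diff_cancel_left' uminus_add_conv_diff add.commute)
 thus False using x(2) by blast
 qed
 hence n: "~ (\<iota> y = x)" "~ (\<iota> y = 1 + x)" for y using x(2) by (metis rangeI)+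
 \<comment> \<open>Neither argument is in the range, so both choices are made from the same
   unsatisfiable predicate and give one default value; additivity would then force 1 = 0.\<close>
 have "inv \<iota> (1 + x) = inv \<iota> x" by (simp only: inv_into_def n)
 moreover have "inv \<iota> 1 = 1" using inv_\<iota>[of 1] \<iota>_hom(3) by simp
 ultimately show False using e by simp
 qed
qed

end

section \<open>Diagonalisation of both sides and the isometry\<close>

lemma image_mset_nth: "image_mset ((!) as) (mset_set {..<length as}) = mset as"
proof -
 have "mset as = mset (map ((!) as) [0..<length as])" by (simp add: map_nth)
 thus ?thesis by (simp add: atLeast0LessThan)
qed

lemma tensor_norms:
 assumes "finite J"
 shows "image_mset (%p. [c] ! fst p * a (snd p)) (mset_set ({..<Suc 0} \<times> J)) = image_mset (%i. c * a i) (mset_set J)"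
 and "image_mset (%p. [c, d] ! fst p * a (snd p)) (mset_set ({..<2::nat} \<times> J)) = image_mset (%i. c * a i) (mset_set J) + image_mset (%i. d * a i) (mset_set J)"
proof -
 have m: "mset_set (Pair n ` J) = image_mset (Pair n) (mset_set J)" for n :: nat
 by (rule image_mset_mset_set[symmetric]) (simp add: inj_on_def)
 have 1: "{..<Suc 0} \<times> J = Pair 0 ` J" by auto
 have 2: "{..<2::nat} \<times> J = Pair 0 ` J \<union> Pair 1 ` J" by (auto simp: less_2_cases_iff)
 show "image_mset (%p. [c] ! fst p * a (snd p)) (mset_set ({..<Suc 0} \<times> J)) = image_mset (%i. c * a i) (mset_set J)"
 unfolding 1 m by (simp add: multiset.map_comp o_def)
 show "image_mset (%p. [c, d] ! fst p * a (snd p)) (mset_set ({..<2::nat} \<times> J)) = image_mset (%i. c * a i) (mset_set J) + image_mset (%i. d * a i) (mset_set J)"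
 unfolding 2 using assms by (subst mset_set_Union) (auto simp: m[unfolded One_nat_def] multiset.map_comp o_def)
qed

text \<open>Orthogonal families are independent, so the rank bounds their size and a complete one
  exists; since it spans, its size is the rank.\<close>

lemma nondegenerate_ofam:
 fixes q :: "('k::field, 'm::ab_group_add) form_module"
 assumes q: "quadratic_space q" and two: "(2::'k) ~= 0" and r: "form_rank q = n" "n > 0"
 and nd: "!!x. x \<in> carr q ==> (!!y. y \<in> carr q ==> form q x y = 0) ==> x = 0"
 obtains v a where "ofam (carr q) (form q) {1..n} v a"
proof -
 interpret qsp UNIV "carr q" "scal q" "form q" by (rule quadratic_space_qsp[OF q two])
 interpret V: vector_space "scal q" using q by (simp add: quadratic_space_def)
 have ind: "V.independent C" if C: "orth (carr q) (form q) C" for C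
 proof (rule V.independent_if_scalars_zero)
 show "finite C" using C by (simp add: orth_def)
 fix f x assume s: "(\<Sum>x\<in>C. scal q (f x) x) = 0" and x: "x \<in> C"
 have cV: "y \<in> carr q" if "y \<in> C" for y using C that by (auto simp: orth_def)
 have "0 = form q (\<Sum>x\<in>C. scal q (f x) x) x" using s cV[OF x] by simp
 also have "\<dots> = (\<Sum>y\<in>C. form q (scal q (f y) y) x)" using cV x by (intro \<beta>_sum) auto
 also have "\<dots> = (\<Sum>y\<in>C. if y = x then f x * form q x x else 0)"
 using C cV x by (intro sum.cong HOL.refl) (auto simp: orth_def)
 also have "\<dots> = f x * form q x x" using C x by (simp add: orth_def)
 finally show "f x = 0" using C x by (auto simp: orth_def)
 qed
 obtain T where T: "T <= carr q" "V.independent T" "carr q <= V.span T" "card T = n"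
 using V.basis_exists[of "carr q"] r(1) by (metis form_rank_def)
 hence fT: "finite T" using r(2) card_gt_0_iff by metis
 have "\<exists>B. obas (carr q) (form q) B"
 proof (rule obas_exists)
 show "\<exists>y\<in>carr q. form q x y ~= 0" if "x \<in> carr q" "x ~= 0" for x using nd that by blast
 show "card C \<le> n" if C: "orth (carr q) (form q) C" for C
 proof -
 have "C <= V.span T" using C T(3) by (auto simp: orth_def)
 thus ?thesis using V.independent_span_bound[OF fT ind[OF C]] T(4) by simp
 qed
 qed
 then obtain B where B: "obas (carr q) (form q) B" by blast
 hence oB: "orth (carr q) (form q) B" by (simp add: obas_def)
 have "carr q <= V.span B"
 proof
 fix x assume "x \<in> carr q"
 hence "x = (\<Sum>b\<in>B. scal q (form q x b / form q b b) b)" by (rule obas_expand[OF B])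
 also have "\<dots> \<in> V.span B" by (intro V.span_sum V.span_scale V.span_base)
 finally show "x \<in> V.span B" .
 qed
 hence cB: "card B = n" using V.dim_unique[of B "carr q" "card B"] ind[OF oB] oB r(1) by (simp add: form_rank_def orth_def)
 obtain v where v: "bij_betw v {1..n} B" using ex_bij_betw_nat_finite_1[of B] oB cB by (auto simp: orth_def)
 have vB: "v i \<in> B" if "i \<in> {1..n}" for i using v that by (auto simp: bij_betw_def)
 have "ofam (carr q) (form q) {1..n} v (%i. form q (v i) (v i))" unfolding ofam_def
 proof (intro conjI ballI impI)
 show "v i \<in> carr q" "form q (v i) (v i) ~= 0" if "i \<in> {1..n}" for i using vB[OF that] oB by (auto simp: orth_def)
 show "form q (v i) (v j) = (if i = j then form q (v i) (v i) else 0)" if ij: "i \<in> {1..n}" "j \<in> {1..n}" for i j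
 proof (cases "i = j")
 case False
 hence "v i ~= v j" using inj_on_eq_iff[OF bij_betw_imp_inj_on[OF v] ij] by simp
 thus ?thesis using vB[OF ij(1)] vB[OF ij(2)] oB False by (auto simp: orth_def)
 qed simp
 show "x = 0" if "x \<in> carr q" "\<forall>i\<in>{1..n}. form q x (v i) = 0" for x
 using that B v by (auto simp: obas_def bij_betw_def)
 qed simp
 thus ?thesis by (rule that)
qed

text \<open>The coordinate along \<open>x\<close> in a basis of the ambient vector space that
  contains \<open>x\<close> is a functional detecting the tensor.\<close>

lemma pure_tensor_eq_0:
 fixes q :: "('k::field, 'm::ab_group_add) form_module"
 assumes q: "quadratic_space q" and x: "x \<in> carr q" and z: "pure_tensor (diag [c]) q (udelta 0) x = 0"
 shows "x = 0"
proof (rule ccontr)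
 assume nz: "x ~= 0"
 interpret V: vector_space "scal q" using q by (simp add: quadratic_space_def)
 let ?B = "V.extend_basis {x}"
 have i: "V.independent {x}" using nz by simp
 have B: "V.independent ?B" "V.span ?B = UNIV" "x \<in> ?B"
 using V.independent_extend_basis[OF i] V.span_extend_basis[OF i] V.extend_basis_superset[OF i] by auto
 let ?r = "%y. V.representation ?B y x"
 have r: "?r (y + z) = ?r y + ?r z" "?r (scal q a y) = a * ?r y" "?r x = 1" for y z a
 using V.representation_add[OF B(1), of y z] V.representation_scale[OF B(1), of y a] V.representation_basis[OF B(1,3)] B(2)
 by (simp_all add: add.commute)
 let ?\<beta> = "%(s :: nat => 'k) y. s 0 * ?r y"
 have "bilinear_map (diag [c]) q ?\<beta>"
 by (auto simp: bilinear_map_def linear_along_def r diag_def algebra_simps)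
 hence "pure_tensor (diag [c]) q (udelta 0) x ?\<beta> = 1" by (simp add: pure_tensor_def udelta_def r)
 thus False using z by simp
qed

context twisted begin

lemma isometry:
 fixes q5 :: "('k, 'w::ab_group_add) form_module"
 assumes q: "quadratic_space q5" and r: "form_rank q5 = 5" and iso: "T7 \<simeq> diag [-2] \<otimes>\<^sub>q q5 \<oplus>\<^sub>q diag [1, -1]"
 shows "T27 \<simeq> ext_square q5 \<oplus>\<^sub>q diag [1, 2] \<otimes>\<^sub>q q5 \<oplus>\<^sub>q diag (replicate 6 1) \<oplus>\<^sub>q diag [2]"
proof -
 let ?D = "diag [-2] :: ('k, nat => 'k) form_module" and ?H = "diag [1, -1] :: ('k, nat => 'k) form_module"
 let ?W = "?D \<otimes>\<^sub>q q5 \<oplus>\<^sub>q ?H"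
 obtain f where f: "bij_betw f (carr T7) (carr ?W)"
 "!!x y. x \<in> carr T7 ==> y \<in> carr T7 ==> f (x + y) = f x + f y"
 "!!x y. x \<in> carr T7 ==> y \<in> carr T7 ==> form ?W (f x) (f y) = form T7 x y"
 using iso unfolding isometric_def by metis
 interpret q: qsp UNIV "carr q5" "scal q5" "form q5" by (rule quadratic_space_qsp[OF q two_k])
 interpret v: qsp "fixf \<Gamma>" A.V7 fscale bt unfolding bt_def by (rule A.qsp_V7[OF frame_pt])
 have T7_add: "U + V \<in> carr T7" if "U \<in> carr T7" "V \<in> carr T7" for U V
 using that by (simp add: T7_iff B2.BC_closed pU_add)
 have fx: "fixf \<Gamma> = range \<iota>"
 proof (rule fixed_field)
 fix U U' V assume a: "U \<in> carr T7" "U' \<in> carr T7" "V \<in> carr T7"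
 \<comment> \<open>The right-hand form is additive by construction, and the given isometry carries
   this to the twist, as \<open>fixed_field\<close> requires.\<close>
 have "form ?W (x + y) z = form ?W x z + form ?W y z" for x y z
 by (cases x; cases y; cases z) (simp add: osum_def tensor_def diag_def algebra_simps sum.distrib)
 thus "form T7 (U + U') V = form T7 U V + form T7 U' V"
 using a f(2)[OF a(1,2)] f(3)[OF T7_add[OF a(1,2)] a(3)] f(3)[OF a(1,3)] f(3)[OF a(2,3)] by simp
 qed
 have \<iota>i: "\<iota> (inv \<iota> x) = x" if "x \<in> fixf \<Gamma>" for x using that unfolding fx by (rule f_inv_into_f)
 have T7b: "bt (pU U) (pU V) = \<iota> (form T7 U V)" if "U \<in> carr T7" "V \<in> carr T7" for U V
 using T7_form[OF that] \<iota>i that by (simp add: T7_iff)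
 \<comment> \<open>Nondegeneracy of \<open>q5\<close> is inherited from the twist: for
   \<open>x\<close> in its radical, the tensor with \<open>x\<close> is in the radical of the
   right-hand form, hence corresponds to a vector that \<open>V7_nondegenerate\<close> shows to be
   0.\<close>
 have nd: "x = 0" if x: "x \<in> carr q5" and z: "!!y. y \<in> carr q5 ==> form q5 x y = 0" for x
 proof (rule pure_tensor_eq_0[OF q x])
 let ?e = "udelta 0 :: nat => 'k" and ?p = "pure_tensor ?D q5 (udelta 0) x"
 have e: "?e \<in> carr ?D" by (simp add: diag_def udelta_def)
 let ?G = "{pure_tensor ?D q5 s y | s y. s \<in> carr ?D & y \<in> carr q5}"
 let ?K = "%s y. ?p (%s' y'. form ?D s s' * form q5 y y')"
 have K: "?K s y = 0" if "y \<in> carr q5" for s y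
 using z[OF that] q.\<beta>_sym[OF x that] by (simp add: pure_tensor_def)
 have "u ?K = 0" if "u \<in> fs.span ?G" for u
 proof -
 have "fs.subspace {u. u ?K = 0}" by (auto simp: fs.subspace_def fscale_def)
 moreover have "?G <= {u. u ?K = 0}" using K by (auto simp: pure_tensor_def)
 ultimately have "fs.span ?G <= {u. u ?K = 0}" by (intro fs.span_minimal)
 thus ?thesis using that by blast
 qed
 hence W0: "form ?W w (?p, 0) = 0" if "w \<in> carr ?W" for w
 using that by (auto simp: osum_def tensor_def diag_def)
 have "?p \<in> fs.span ?G" using e x by (intro fs.span_base) blast
 hence "(?p, 0) \<in> carr ?W" by (simp add: osum_def tensor_def) (simp add: diag_def)
 hence "(?p, 0) \<in> f ` carr T7" by (simp only: bij_betw_imp_surj_on[OF f(1)])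
 then obtain U where U': "(?p, 0) = f U" "U \<in> carr T7" by (rule imageE)
 note U = U'(2) U'(1)[symmetric]
 have "pU U = 0"
 proof (rule V7_nondegenerate)
 show "pU U \<in> A.LF" by (rule pU_LF)
 fix p assume "p \<in> A.V7"
 then obtain V where V: "V \<in> carr T7" "pU V = p" by (rule T7_surj)
 have "f V \<in> carr ?W" using f(1) V(1) by (auto simp: bij_betw_def)
 hence "form T7 V U = 0" using f(3)[OF V(1) U(1)] W0 U(2) by simp
 hence "bt (pU V) (pU U) = 0" using T7b[OF V(1) U(1)] by (simp add: \<iota>_0)
 thus "bt (pU U) p = 0" using V(2) by (simp add: bt_def A.b7_sym)
 qed
 hence U0: "U = 0" using pU_inj[of U 0] U(1) pU_0 B2.BC_closed(3) by (simp add: T7_iff)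
 hence "f (0 + 0) = f 0 + f 0" using f(2)[OF U(1) U(1)] by simp
 hence "f 0 = 0" by (simp only: add_0_left add_cancel_right_right)
 thus "?p = 0" using U(2) U0 by (simp add: zero_prod_def)
 qed
 have "(5::nat) > 0" by simp
 then obtain b a where ba: "ofam (carr q5) (form q5) {1..5::nat} b a"
 by (rule nondegenerate_ofam[OF q two_k r _ nd])
 have a0: "a i ~= 0" if "i \<in> {1..5}" for i using ofamD(3)[OF ba that] .
 have nz: "(0::'k) \<notin> set [-2]" "(0::'k) \<notin> set [1, -1]" "(0::'k) \<notin> set [1, 2]" "(0::'k) \<notin> set (replicate 6 1)" "(0::'k) \<notin> set [2]"
 using two_k by auto
 note dg = diag_ofam[OF two_k]
 note t1 = tensor_ofam[OF dg[OF nz(1)] q.qsp_axioms ba] and t2 = tensor_ofam[OF dg[OF nz(3)] q.qsp_axioms ba]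
 and ex = ext_ofam[OF q.qsp_axioms ba]
 have nt1: "norms (form (?D \<otimes>\<^sub>q q5)) ((%p. pure_tensor ?D q5 (udelta (fst p)) (b (snd p))) ` ({..<length [-2::'k]} \<times> {1..5}))
 = image_mset (%i. - 2 * a i) (mset_set {1..5})"
 unfolding ofam_obas(2)[OF t1(2)] using tensor_norms(1)[of "{1..5::nat}" "-2" a] by simp
 have dn: "norms (form (diag as)) (udelta ` {..<length as}) = mset as" if "(0::'k) \<notin> set as" for as
 unfolding ofam_obas(2)[OF dg(2)[OF that]] by (rule image_mset_nth)
 obtain D where D: "obas (carr ?W) (form ?W) D" "norms (form ?W) D = image_mset (%i. - 2 * a i) (mset_set {1..5}) + {#1, -1#}"
 using osum_ofam(2)[OF t1(1) ofam_obas(1)[OF t1(2)] dg(1)[OF nz(2)] ofam_obas(1)[OF dg(2)[OF nz(2)]]]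
 unfolding nt1 dn[OF nz(2)] by auto
 have oD: "orth (carr ?W) (form ?W) D" using D(1) by (simp add: obas_def)
 define g where "g = inv_into (carr T7) f"
 have g: "g w \<in> carr T7" "f (g w) = w" if "w \<in> D" for w
 proof -
 have "w \<in> f ` carr T7" using oD f(1) that by (auto simp: orth_def bij_betw_def)
 thus "g w \<in> carr T7" "f (g w) = w" unfolding g_def by (rule inv_into_into, rule f_inv_into_f)
 qed
 have gb: "bt (pU (g w)) (pU (g w')) = \<iota> (form ?W w w')" if "w \<in> D" "w' \<in> D" for w w'
 using T7b[OF g(1)[OF that(1)] g(1)[OF that(2)]] f(3)[OF g(1)[OF that(1)] g(1)[OF that(2)]] g(2) that by simp
 \<comment> \<open>The orthogonal basis of the right-hand form is pulled back along the isometry and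
   read as additive maps on the lattice.\<close>
 have hyp: "A.hyp7 (\<iota> \<circ> a)" unfolding A.hyp7_def
 proof (intro conjI ballI allI impI)
 show "(\<iota> \<circ> a) i \<in> fixf \<Gamma> - {0}" if "i \<in> {1..5}" for i using a0[OF that] by (simp add: fx \<iota>_eq_0)
 fix l assume l: "frame l"
 have bl: "A.b7 l (pU (g w)) (pU (g w')) = \<iota> (form ?W w w')" if "w \<in> D" "w' \<in> D" for w w'
 using gb[OF that] A.b7_frame[OF frame_pt l pU_LF pU_LF] by (simp add: bt_def)
 note F = orth_family[of D "%w. pU (g w)" A.V7 "A.b7 l" "%w. \<iota> (form ?W w w)"]
 have F1: "orth A.V7 (A.b7 l) ((%w. pU (g w)) ` D)" "card ((%w. pU (g w)) ` D) = card D"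
 "norms (A.b7 l) ((%w. pU (g w)) ` D) = image_mset (%w. \<iota> (form ?W w w)) (mset_set D)"
 by (rule F; use oD g bl in \<open>auto simp: orth_def T7_iff \<iota>_eq_0 \<iota>_0\<close>)+
 have "card D = size (norms (form ?W) D)" by (simp only: norms_size)
 also have "\<dots> = 7" by (simp only: D(2)) simp
 finally have c7: "card D = 7" .
 have "image_mset (%w. \<iota> (form ?W w w)) (mset_set D) = image_mset \<iota> (norms (form ?W) D)"
 by (simp add: norms_def multiset.map_comp o_def)
 also have "\<dots> = {#1, -1#} + image_mset (%i. - 2 * (\<iota> \<circ> a) i) (mset_set {1..5})"
 proof -
 have "\<iota> (- 2 * x) = - 2 * \<iota> x" for x
 using \<iota>_of_int[of "-2"] \<iota>_hom(2)[of "-2" x] by simp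
 moreover have "\<iota> (- 1) = - 1" using \<iota>_of_int[of "-1"] by simp
 ultimately show ?thesis unfolding D(2) by (simp add: multiset.map_comp o_def \<iota>_hom)
 qed
 finally have "norms (A.b7 l) ((%w. pU (g w)) ` D) = {#1, -1#} + image_mset (%i. - 2 * (\<iota> \<circ> a) i) (mset_set {1..5})"
 unfolding F1(3) .
 thus "\<exists>C. orth A.V7 (A.b7 l) C & card C = 7 &
 norms (A.b7 l) C = {#1, -1#} + image_mset (%i. - 2 * (\<iota> \<circ> a) i) (mset_set {1..5})"
 using F1(1,2) c7 by metis
 qed
 interpret s: sact \<Gamma> S lines act "%_ _. 1 :: 's" by (rule sact27)
 obtain N where N: "hd_tw \<Gamma> lines act (%_ _. 1) N" using s.hd_exists by blast
 \<comment> \<open>The chain equivalence over the fixed field is realised by a basis of the twist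
   with the wanted norms, which then lie in the image of \<open>k\<close>.\<close>
 have "hd_tw \<Gamma> lines act (%_ _. 1) (target (\<iota> \<circ> a))"
 by (rule s.hd_transport[OF N A.deq_target[OF frame_pt hyp N]])
 then obtain C where C: "orth tw27 (bil lines) C" "card C = card lines" "norms (bil lines) C = target (\<iota> \<circ> a)"
 by (auto simp: hd_tw_def)
 have oC: "obas tw27 (bil lines) C" by (rule s.tw_orth_obas[OF C(1,2)])
 have kT: "kU U \<in> tw27" if "U \<in> carr T27" for U using that by (simp add: T27_iff)
 have bF: "bil lines x y \<in> fixf \<Gamma>" if "x \<in> tw27" "y \<in> tw27" for x y using that by simp
 have inv_add: "inv \<iota> (x + y) = inv \<iota> x + inv \<iota> y" "inv \<iota> (\<iota> c * x) = c * inv \<iota> x" if "x \<in> fixf \<Gamma>" "y \<in> fixf \<Gamma>" for x y c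
 proof -
 have "\<iota> (inv \<iota> x + inv \<iota> y) = x + y" "\<iota> (c * inv \<iota> x) = \<iota> c * x" using that by (simp_all add: \<iota>_hom \<iota>i)
 thus "inv \<iota> (x + y) = inv \<iota> x + inv \<iota> y" "inv \<iota> (\<iota> c * x) = c * inv \<iota> x" by (metis inv_\<iota>)+
 qed
 have T27_add: "U + V \<in> carr T27" if "U \<in> carr T27" "V \<in> carr T27" for U V
 using that by (simp add: T27_iff B3.BC_closed kU_add)
 have T27_sc: "fscale (\<iota> c) U \<in> carr T27" if "U \<in> carr T27" for U c
 using that by (simp add: T27_iff B3.BC_closed kU_scale fx)
 have sc27: "scal T27 = (%c. fscale (\<iota> c))" by (simp add: q27_twist_def twist_def)
 have bsc: "bil lines (fscale a x) y = a * bil lines x y" for a x and y :: "int \<times> 'v => 's"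
 by (simp add: wbil_def fscale_def sum_distrib_left mult_ac)
 have Q27: "qsp UNIV (carr T27) (scal T27) (form T27)"
 proof unfold_locales
 show "0 \<in> carr T27" by (simp add: T27_iff B3.BC_closed kU_0)
 show "form T27 U V = form T27 V U" if "U \<in> carr T27" "V \<in> carr T27" for U V
 using that by (simp add: T27_form wbil_def mult.commute)
 show "form T27 (U + V) Z = form T27 U Z + form T27 V Z" if "U \<in> carr T27" "V \<in> carr T27" "Z \<in> carr T27" for U V Z
 using that kT by (simp add: T27_form T27_add kU_add inv_add bF)
 show "form T27 (scal T27 c U) Z = c * form T27 U Z" if "U \<in> carr T27" "Z \<in> carr T27" for U Z c
 using that inv_add(2)[OF bF[OF kT[OF that(1)] kT[OF that(2)]] bF[OF kT[OF that(1)] kT[OF that(2)]]]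
 by (simp add: T27_form T27_sc sc27 kU_scale bsc)
 qed (use two_k T27_add T27_sc in \<open>auto simp: sc27 \<iota>_hom fscale_def fun_eq_iff algebra_simps\<close>)
 define k where "k d = (SOME U. U \<in> carr T27 & kU U = d)" for d
 have k: "k d \<in> carr T27" "kU (k d) = d" if "d \<in> C" for d
 proof -
 have "d \<in> tw27" using C(1) that by (auto simp: orth_def)
 hence "\<exists>U. U \<in> carr T27 & kU U = d" using T27_surj by metis
 hence "k d \<in> carr T27 & kU (k d) = d" unfolding k_def by (rule someI_ex)
 thus "k d \<in> carr T27" "kU (k d) = d" by simp_all
 qed
 have inv_0: "inv \<iota> x = 0 \<longleftrightarrow> x = 0" if "x \<in> fixf \<Gamma>" for x using \<iota>i[OF that] by (metis \<iota>_0 inv_\<iota>)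
 have CT: "d \<in> tw27" if "d \<in> C" for d using C(1) that by (auto simp: orth_def)
 have of27: "ofam (carr T27) (form T27) C k (%d. inv \<iota> (bil lines d d))"
 unfolding ofam_def
 proof (intro conjI ballI impI)
 show "finite C" using C(1) by (simp add: orth_def)
 show "k d \<in> carr T27" if "d \<in> C" for d by (rule k[OF that])
 show "inv \<iota> (bil lines d d) ~= 0" if "d \<in> C" for d
 using C(1) that inv_0[OF bF[OF CT CT]] by (auto simp: orth_def)
 show "form T27 (k d) (k d') = (if d = d' then inv \<iota> (bil lines d d) else 0)" if "d \<in> C" "d' \<in> C" for d d'
 using C(1) that inv_0[of 0] k by (auto simp: orth_def T27_form)
 show "U = 0" if U: "U \<in> carr T27" and z: "\<forall>d\<in>C. form T27 U (k d) = 0" for U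
 proof -
 have "bil lines (kU U) d = 0" if "d \<in> C" for d
 using bspec[OF z that] T27_form[OF U k(1)[OF that]] k(2)[OF that] inv_0[OF bF[OF kT[OF U] CT[OF that]]] by simp
 hence "kU U = 0" using oC kT[OF U] by (simp add: obas_def)
 thus ?thesis using kU_inj[of U 0] U by (simp add: T27_iff kU_0 B3.BC_closed)
 qed
 qed
 have n27: "norms (form T27) (k ` C) = target a"
 proof -
 have "norms (form T27) (k ` C) = image_mset (inv \<iota>) (norms (bil lines) C)"
 unfolding ofam_obas(2)[OF of27] by (simp add: norms_def multiset.map_comp o_def)
 also have "norms (bil lines) C = image_mset \<iota> (target a)"
 proof -
 have "\<iota> (2 * x) = 2 * \<iota> x" "\<iota> 2 = 2" for x
 using \<iota>_of_int[of 2] \<iota>_hom(2)[of 2 x] by simp_all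
 thus ?thesis unfolding C(3) by (simp add: target_def multiset.map_comp o_def \<iota>_hom)
 qed
 finally show ?thesis by (simp add: multiset.map_comp o_def inv_\<iota>)
 qed
 let ?X1 = "ext_square q5" and ?X2 = "diag [1, 2] \<otimes>\<^sub>q q5" and ?X3 = "diag (replicate 6 1) :: ('k, nat => 'k) form_module"
 and ?X4 = "diag [2] :: ('k, nat => 'k) form_module"
 note o12 = osum_ofam[OF ex(1) ofam_obas(1)[OF ex(2)] t2(1) ofam_obas(1)[OF t2(2)]]
 have l2: "length [1, 2::'k] = 2" by simp
 have nX2: "norms (form ?X2) ((%p. pure_tensor (diag [1, 2]) q5 (udelta (fst p)) (b (snd p))) ` ({..<length [1, 2::'k]} \<times> {1..5}))
 = image_mset a (mset_set {1..5}) + image_mset (%i. 2 * a i) (mset_set {1..5})"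
 unfolding ofam_obas(2)[OF t2(2)] unfolding l2 tensor_norms(2)[OF finite_atLeastAtMost] by simp
 obtain D1 where D1: "obas (carr (?X1 \<oplus>\<^sub>q ?X2)) (form (?X1 \<oplus>\<^sub>q ?X2)) D1" "norms (form (?X1 \<oplus>\<^sub>q ?X2)) D1 =
 image_mset (%p. a (fst p) * a (snd p)) (mset_set pairs5) + (image_mset a (mset_set {1..5}) + image_mset (%i. 2 * a i) (mset_set {1..5}))"
 using o12(2) unfolding ofam_obas(2)[OF ex(2)] nX2 by blast
 note o3 = osum_ofam[OF o12(1) D1(1) dg(1)[OF nz(4)] ofam_obas(1)[OF dg(2)[OF nz(4)]]]
 obtain D2 where D2: "obas (carr (?X1 \<oplus>\<^sub>q ?X2 \<oplus>\<^sub>q ?X3)) (form (?X1 \<oplus>\<^sub>q ?X2 \<oplus>\<^sub>q ?X3)) D2"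
 "norms (form (?X1 \<oplus>\<^sub>q ?X2 \<oplus>\<^sub>q ?X3)) D2 = norms (form (?X1 \<oplus>\<^sub>q ?X2)) D1 + mset (replicate 6 1)"
 using o3(2) unfolding dn[OF nz(4)] by blast
 note o4 = osum_ofam[OF o3(1) D2(1) dg(1)[OF nz(5)] ofam_obas(1)[OF dg(2)[OF nz(5)]]]
 obtain D3 where D3: "obas (carr (?X1 \<oplus>\<^sub>q ?X2 \<oplus>\<^sub>q ?X3 \<oplus>\<^sub>q ?X4)) (form (?X1 \<oplus>\<^sub>q ?X2 \<oplus>\<^sub>q ?X3 \<oplus>\<^sub>q ?X4)) D3"
 "norms (form (?X1 \<oplus>\<^sub>q ?X2 \<oplus>\<^sub>q ?X3 \<oplus>\<^sub>q ?X4)) D3 = norms (form (?X1 \<oplus>\<^sub>q ?X2 \<oplus>\<^sub>q ?X3)) D2 + mset [2]"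
 using o4(2) unfolding dn[OF nz(5)] by blast
 have "norms (form (?X1 \<oplus>\<^sub>q ?X2 \<oplus>\<^sub>q ?X3 \<oplus>\<^sub>q ?X4)) D3 = target a"
 unfolding D3(2) D2(2) D1(2) target_def by (simp add: numeral_eq_Suc)
 thus ?thesis
 by (intro isometric_obas[OF Q27 ofam_obas(1)[OF of27] o4(1) D3(1)]) (simp only: n27)
qed

end

theorem theorem4:
  fixes \<iota> :: "'k::field \<Rightarrow> 's::field"
    and R :: "'v::euclidean_space set"
    and \<alpha> :: "nat \<Rightarrow> 'v"
    and e :: "'v \<Rightarrow> 3"
    and \<phi> :: "('s \<Rightarrow> 's) \<Rightarrow> 'v \<Rightarrow> 'v"
    and q5 :: "('k, 'w::ab_group_add) form_module"
  assumes "CHAR('k) \<noteq> 2"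
    and "separable_closure \<iota>"
    and "E6_root_system R \<alpha>"
    and "weight_class R \<alpha> e"
    and "continuous_hom \<iota> (weyl_group R) \<phi>"
    and "quadratic_space q5" and "form_rank q5 = 5"
    and "q7_twist \<iota> R e \<phi> \<simeq> diag [-2] \<otimes>\<^sub>q q5 \<oplus>\<^sub>q diag [1, -1]"
  shows "q27_twist \<iota> R e \<phi> \<simeq>
           ext_square q5 \<oplus>\<^sub>q diag [1, 2] \<otimes>\<^sub>q q5 \<oplus>\<^sub>q diag (replicate 6 1) \<oplus>\<^sub>q diag [2]"
proof -
  interpret e6 R \<alpha> e by unfold_locales (fact assms)+
  have io: "\<iota> (x + y) = \<iota> x + \<iota> y" "\<iota> (x * y) = \<iota> x * \<iota> y" "\<iota> 1 = 1" for x y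
    using assms(2) by (auto simp: separable_closure_def)
  have two: "(2::'s) \<noteq> 0"
  proof
    assume "(2::'s) = 0"
    have "\<iota> (1 + 1) = 1 + 1" by (simp only: io)
    then have "\<iota> 2 = 0" using \<open>(2::'s) = 0\<close> by simp
    then show False using io(2)[of 2 "inverse 2"] io(3) two_neq_zero[OF assms(1)] by simp
  qed
  have gid: "id \<in> galois_group \<iota>" by (simp add: galois_group_def)
  have wid: "\<phi> \<gamma> \<in> weyl_group R" if "\<gamma> \<in> galois_group \<iota>" for \<gamma>
    using assms(5) that by (auto simp: continuous_hom_def continuous_map_def krull_topology_def)
  \<comment> \<open>\<open>\<phi> id\<close> is idempotent and, as an element of the Weyl group,
    bijective; hence it is the identity.\<close>
  have "\<phi> (id \<circ> id) = \<phi> id \<circ> \<phi> id" using assms(5) gid unfolding continuous_hom_def by blast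
  then have "\<phi> id (\<phi> id x) = \<phi> id x" for x by (metis comp_apply id_comp)
  then have one: "\<phi> id = id" using weyl(5)[OF wid[OF gid]] by (metis bij_is_inj injD eq_id_iff)
  obtain S where S: "gal (galois_group \<iota>) S" "\<And>\<gamma>. \<gamma> \<in> galois_group \<iota> \<Longrightarrow> (\<And>s. s \<in> S \<Longrightarrow> \<gamma> s = s) \<Longrightarrow> \<phi> \<gamma> = id"
    using gal_kernel[OF two assms(2,5) one] by metis
  interpret twisted R \<alpha> e \<iota> \<phi> S
  proof (intro twisted.intro e6_axioms twisted_axioms.intro)
    show "\<phi> \<gamma> = id" if "\<gamma> \<in> galois_group \<iota>" "\<And>s. s \<in> S \<Longrightarrow> \<gamma> s = s" for \<gamma>
      using that by (rule S(2))
  qed (rule two assms(2) assms(5) S(1))+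
  show ?thesis by (rule isometry[OF assms(6-8)])
qed

end
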